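(* Let $\omega$ be a weight function (quasianalytic or non-quasianalytic) and let $K\subset\mathbb{R}^d$ be compact. Then $$\mathcal{B}'_{\{\omega\}}(\mathbb{R}^d)\cap\mathcal{A}'[K]=\mathcal{E}'_{\{\omega\}}[K],$$ where all three spaces are regarded, via restriction of functionals to $\mathcal{D}_{L^1,\{\omega_1\}}(\mathbb{R}^d)$, as vector subspaces of $\mathcal{B}'_{\{\omega_1\}}(\mathbb{R}^d)$.
   Context: $\mathbb{N}=\{0,1,2,\dots\}$ and $\mathbb{Z}_+=\{1,2,\dots\}$. $O$ and $o$ are understood as $t\to\infty$. **Weight functions.** A weight function is a continuous increasing (i.e. non-decreasing) function $\omega:[0,\infty)\to[0,\infty)$ with $\omega\equiv 0$ on $[0,1]$ such that: $(\alpha)$ $\omega(2t)=O(\omega(t))$; $(\beta)$ $\omega(t)=O(t)$; $(\gamma)$ $\log t=o(\omega(t))$; $(\delta)$ $\psi:[0,\infty)\to[0,\infty)$, $\psi(x):=\omega(e^x)$, is convex. It is quasianalytic if $\int_0^\infty \frac{\omega(t)}{1+t^2}\,dt=\infty$ and non-quasianalytic otherwise. The Young conjugate of $\psi$ is $\psi^*(y):=\sup_{x\ge 0}(xy-\psi(x))$, $y\ge0$. The weight function $\omega_1$ is $\omega_1(t):=\max\{t-1,0\}$. **Ultradifferentiable functions.** A compact set $L\subset\mathbb{R}^d$ is regular if $\overline{L^\circ}=L$. For $L$ regular compact, $C^\infty(L)$ is the space of smooth functions on $L^\circ$ all of whose partial derivatives extend continuously to $L$. For $n\in\mathbb{Z}_+$,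 $\mathcal{E}_{\omega,n}(L)$ is the Banach space of all $\varphi\in C^\infty(L)$ with $\|\varphi\|_{\mathcal{E}_{\omega,n}(L)}:=\sup_{\alpha\in\mathbb{N}^d}\max_{x\in L}|\varphi^{(\alpha)}(x)|\exp(-\frac1n\psi^*(n|\alpha|))<\infty$, and $\mathcal{E}_{\{\omega\}}(L):=\varinjlim_n\mathcal{E}_{\omega,n}(L)$. For $\Omega\subseteq\mathbb{R}^d$ open, $\mathcal{E}_{\{\omega\}}(\Omega):=\varprojlim_N\mathcal{E}_{\{\omega\}}(K_N)$, where $(K_N)_{N\in\mathbb N}$ is any sequence of regular compact subsets of $\Omega$ with $K_N\subset K_{N+1}^\circ$ and $\bigcup_NK_N=\Omega$. $\mathcal{A}(\Omega):=\mathcal{E}_{\{\omega_1\}}(\Omega)$ is the space of real analytic functions on $\Omega$. Strong duals are denoted $\mathcal{E}'_{\{\omega\}}(\Omega)$ and $\mathcal{A}'(\Omega)=\mathcal{E}'_{\{\omega_1\}}(\Omega)$. Polynomials are dense in $\mathcal{E}_{\{\omega\}}(\Omega)$, so restriction maps between such duals are injective and are used as identifications. **Carriers.** For $K\subset\mathbb{R}^d$ compact, $\mathcal{E}'_{\{\omega\}}[K]$ is the space of all $f\in\mathcal{E}'_{\{\omega\}}(\mathbb{R}^d)$ such that for every open $\Omega\subseteq\mathbb{R}^d$ with $K\subset\Omega$ there is a (unique) $f_\Omega\in\mathcal{E}'_{\{\omega\}}(\Omega)$ with $f_{\Omega}|_{\mathcal{E}_{\{\omega\}}(\mathbb{R}^d)}=f$.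 Put $\mathcal{A}'[K]:=\mathcal{E}'_{\{\omega_1\}}[K]$. **Bounded infrahyperfunctions/ultradistributions.** For $n\in\mathbb{Z}_+$, $\mathcal{D}_{L^1,\omega,n}(\mathbb{R}^d)$ is the Banach space of all $\varphi\in C^\infty(\mathbb{R}^d)$ with $\varphi^{(\alpha)}\in L^1(\mathbb{R}^d)$ for all $\alpha\in\mathbb{N}^d$ and $\|\varphi\|_{\mathcal{D}_{L^1,\omega,n}}:=\sup_{\alpha\in\mathbb{N}^d}\|\varphi^{(\alpha)}\|_{L^1}\exp(-\frac1n\psi^*(n|\alpha|))<\infty$. Set $\mathcal{D}_{L^1,\{\omega\}}(\mathbb{R}^d):=\varinjlim_n\mathcal{D}_{L^1,\omega,n}(\mathbb{R}^d)$, and let $\mathcal{B}'_{\{\omega\}}(\mathbb{R}^d)$ be its strong dual; the spaces $\mathcal{D}_{L^1,\{\omega_1\}}(\mathbb{R}^d)$ and $\mathcal{B}'_{\{\omega_1\}}(\mathbb{R}^d)$ are defined in the same way with $\omega_1$ in place of $\omega$. There are dense continuous inclusions $\mathcal{D}_{L^1,\{\omega_1\}}(\mathbb{R}^d)\hookrightarrow\mathcal{D}_{L^1,\{\omega\}}(\mathbb{R}^d)\hookrightarrow\mathcal{E}_{\{\omega\}}(\mathbb{R}^d)$, so restriction of functionals gives injections $\mathcal{E}'_{\{\omega\}}(\mathbb{R}^d)\subset\mathcal{B}'_{\{\omega\}}(\mathbb{R}^d)\subset\mathcal{B}'_{\{\omega_1\}}(\mathbb{R}^d)$ and $\mathcal{A}'(\mathbb{R}^d)\subset\mathcal{B}'_{\{\omega_1\}}(\mathbb{R}^d)$.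 *)

theory Defs
  imports "HOL-Analysis.Analysis" "HOL-Library.Landau_Symbols"
begin

text \<open>
  A function (or functional) with domain \<open>S\<close> is represented by the total function that
  vanishes off \<open>S\<close>. In this way equality on \<open>S\<close> is equality of HOL functions, and all
  spaces below are vector spaces under the pointwise operations.
\<close>

definition restrict0 :: "'a set \<Rightarrow> ('a \<Rightarrow> 'b::zero) \<Rightarrow> 'a \<Rightarrow> 'b" where
  "restrict0 S f = (\<lambda>x. if x \<in> S then f x else 0)"


section \<open>Weight functions\<close>

definition weight_function :: "(real \<Rightarrow> real) \<Rightarrow> bool" where
  "weight_function \<omega> \<longleftrightarrow>
     continuous_on {0..} \<omega> \<and> mono_on {0..} \<omega> \<and> (\<forall>t\<ge>0. \<omega> t \<ge> 0) \<and> (\<forall>t\<in>{0..1}. \<omega> t = 0) \<and>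
     (\<lambda>t. \<omega> (2 * t)) \<in> O[at_top](\<omega>) \<and>
     \<omega> \<in> O[at_top](\<lambda>t. t) \<and>
     ln \<in> o[at_top](\<omega>) \<and>
     convex_on {0..} (\<lambda>x. \<omega> (exp x))"

text \<open>
  The Young conjugate of \<open>\<psi>(x) = \<omega>(e\<^sup>x)\<close>. The supremum is finite for weight functions,
  because \<open>log t = o(\<omega>(t))\<close>.
\<close>

definition young_conj :: "(real \<Rightarrow> real) \<Rightarrow> real \<Rightarrow> real" where
  "young_conj \<omega> y = (SUP x\<in>{0..}. x * y - \<omega> (exp x))"

definition omega1 :: "real \<Rightarrow> real" where
  "omega1 t = max (t - 1) 0"


section \<open>Partial derivatives and smooth functions\<close>

definition partial_deriv :: "'d \<Rightarrow> (real^'d \<Rightarrow> complex) \<Rightarrow> real^'d \<Rightarrow> complex" where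
  "partial_deriv i f x = vector_derivative (\<lambda>t. f (x + t *\<^sub>R axis i 1)) (at 0)"

text \<open>All iterated partial derivatives, in any order, exist and are continuous on the open set \<open>U\<close>.\<close>

definition smooth_on :: "(real^'d) set \<Rightarrow> (real^'d \<Rightarrow> complex) \<Rightarrow> bool" where
  "smooth_on U f \<longleftrightarrow>
     (\<forall>js. continuous_on U (foldr partial_deriv js f) \<and>
       (\<forall>x\<in>U. \<forall>i. (\<lambda>t. foldr partial_deriv js f (x + t *\<^sub>R axis i 1)) differentiable (at 0)))"

text \<open>
  \<open>f\<^sup>(\<^sup>\<alpha>\<^sup>)\<close> for a multi-index \<open>\<alpha>\<close>. The index type carries no order, so an enumeration of the
  coordinates is fixed; for smooth functions its choice is irrelevant.
\<close>

definition coords :: "'d::finite list" where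
  "coords = (SOME js. distinct js \<and> set js = UNIV)"

definition mderiv :: "('d::finite \<Rightarrow> nat) \<Rightarrow> (real^'d \<Rightarrow> complex) \<Rightarrow> real^'d \<Rightarrow> complex" where
  "mderiv \<alpha> f = foldr (\<lambda>i. partial_deriv i ^^ \<alpha> i) coords f"

definition mabs :: "('d::finite \<Rightarrow> nat) \<Rightarrow> nat" where
  "mabs \<alpha> = (\<Sum>i\<in>UNIV. \<alpha> i)"


section \<open>Locally convex spaces\<close>

text \<open>
  A locally convex space of functions is given by its underlying vector space \<open>V\<close> and a
  family \<open>P\<close> of seminorms generating its topology.
\<close>

definition seminorm_on :: "('a \<Rightarrow> complex) set \<Rightarrow> (('a \<Rightarrow> complex) \<Rightarrow> real) \<Rightarrow> bool" where
  "seminorm_on V p \<longleftrightarrow>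
     (\<forall>\<phi>\<in>V. 0 \<le> p \<phi>) \<and>
     (\<forall>\<phi>\<in>V. \<forall>\<psi>\<in>V. p (\<lambda>x. \<phi> x + \<psi> x) \<le> p \<phi> + p \<psi>) \<and>
     (\<forall>c. \<forall>\<phi>\<in>V. p (\<lambda>x. c * \<phi> x) = cmod c * p \<phi>)"

definition lc_topology ::
  "('a \<Rightarrow> complex) set \<Rightarrow> (('a \<Rightarrow> complex) \<Rightarrow> real) set \<Rightarrow> ('a \<Rightarrow> complex) topology" where
  "lc_topology V P =
     topology_generated_by
       (insert V {{\<psi>\<in>V. p (\<lambda>x. \<psi> x - \<phi> x) < r} | p \<phi> r. p \<in> P \<and> \<phi> \<in> V \<and> 0 < r})"

text \<open>
  The continuous linear functionals. Only the underlying vector space of the strong dual is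
  defined, not its topology.
\<close>

definition lc_dual ::
  "('a \<Rightarrow> complex) set \<Rightarrow> (('a \<Rightarrow> complex) \<Rightarrow> real) set \<Rightarrow> (('a \<Rightarrow> complex) \<Rightarrow> complex) set" where
  "lc_dual V P =
     {f. (\<forall>\<phi>. \<phi> \<notin> V \<longrightarrow> f \<phi> = 0) \<and>
         (\<forall>\<phi>\<in>V. \<forall>\<psi>\<in>V. f (\<lambda>x. \<phi> x + \<psi> x) = f \<phi> + f \<psi>) \<and>
         (\<forall>c. \<forall>\<phi>\<in>V. f (\<lambda>x. c * \<phi> x) = c * f \<phi>) \<and>
         continuous_map (lc_topology V P) euclidean f}"

text \<open>
  Inductive limit over \<open>n \<ge> 1\<close> of an increasing sequence of normed spaces \<open>(V n, nrm n)\<close>: its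
  topology is the finest locally convex one for which all inclusions are continuous, that is,
  the one generated by all seminorms on the union that are bounded by a multiple of \<open>nrm n\<close> on
  each \<open>V n\<close>. Norms take values in \<open>[0, \<infinity>]\<close> and are finite on \<open>V n\<close>.
\<close>

definition indlim :: "(nat \<Rightarrow> ('a \<Rightarrow> complex) set) \<Rightarrow> ('a \<Rightarrow> complex) set" where
  "indlim V = (\<Union>n\<in>{1..}. V n)"

definition indlim_seminorms ::
  "(nat \<Rightarrow> ('a \<Rightarrow> complex) set) \<Rightarrow> (nat \<Rightarrow> ('a \<Rightarrow> complex) \<Rightarrow> ennreal) \<Rightarrow>
   (('a \<Rightarrow> complex) \<Rightarrow> real) set" where
  "indlim_seminorms V nrm =
     {p. seminorm_on (indlim V) p \<and>
         (\<forall>n\<ge>1. \<exists>C::real. \<forall>\<phi>\<in>V n. ennreal (p \<phi>) \<le> ennreal C * nrm n \<phi>)}"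


section \<open>Ultradifferentiable functions on regular compact sets\<close>

definition regular_compact :: "(real^'d) set \<Rightarrow> bool" where
  "regular_compact L \<longleftrightarrow> compact L \<and> closure (interior L) = L"

text \<open>Elements of \<open>C\<^sup>\<infinity>(L)\<close> are functions on the interior of \<open>L\<close>.\<close>

definition C_infinity :: "(real^'d::finite) set \<Rightarrow> (real^'d \<Rightarrow> complex) set" where
  "C_infinity L =
     {\<phi>. (\<forall>x. x \<notin> interior L \<longrightarrow> \<phi> x = 0) \<and> smooth_on (interior L) \<phi> \<and>
         (\<forall>\<alpha>. \<exists>g. continuous_on L g \<and> (\<forall>x\<in>interior L. g x = mderiv \<alpha> \<phi> x))}"

text \<open>The value of the continuous extension of \<open>\<phi>\<^sup>(\<^sup>\<alpha>\<^sup>)\<close> to \<open>L\<close>.\<close>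

definition mderiv_ext ::
  "(real^'d::finite) set \<Rightarrow> ('d \<Rightarrow> nat) \<Rightarrow> (real^'d \<Rightarrow> complex) \<Rightarrow> real^'d \<Rightarrow> complex" where
  "mderiv_ext L \<alpha> \<phi> x = Lim (at x within interior L) (mderiv \<alpha> \<phi>)"

definition E_norm ::
  "(real \<Rightarrow> real) \<Rightarrow> (real^'d::finite) set \<Rightarrow> nat \<Rightarrow> (real^'d \<Rightarrow> complex) \<Rightarrow> ennreal" where
  "E_norm \<omega> L n \<phi> =
     (SUP \<alpha>. (SUP x\<in>L. ennreal (cmod (mderiv_ext L \<alpha> \<phi> x))) *
        ennreal (exp (- (1 / real n) * young_conj \<omega> (real n * real (mabs \<alpha>)))))"

definition E_step ::
  "(real \<Rightarrow> real) \<Rightarrow> (real^'d::finite) set \<Rightarrow> nat \<Rightarrow> (real^'d \<Rightarrow> complex) set" where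
  "E_step \<omega> L n = {\<phi> \<in> C_infinity L. E_norm \<omega> L n \<phi> < \<infinity>}"

definition E_compact :: "(real \<Rightarrow> real) \<Rightarrow> (real^'d::finite) set \<Rightarrow> (real^'d \<Rightarrow> complex) set" where
  "E_compact \<omega> L = indlim (E_step \<omega> L)"

definition E_compact_seminorms ::
  "(real \<Rightarrow> real) \<Rightarrow> (real^'d::finite) set \<Rightarrow> ((real^'d \<Rightarrow> complex) \<Rightarrow> real) set" where
  "E_compact_seminorms \<omega> L = indlim_seminorms (E_step \<omega> L) (E_norm \<omega> L)"


section \<open>Ultradifferentiable functions on open sets\<close>

definition exhaustion :: "(real^'d) set \<Rightarrow> (nat \<Rightarrow> (real^'d) set) \<Rightarrow> bool" where
  "exhaustion \<Omega> K \<longleftrightarrow>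
     (\<forall>N. regular_compact (K N) \<and> K N \<subseteq> \<Omega> \<and> K N \<subseteq> interior (K (Suc N))) \<and> (\<Union>N. K N) = \<Omega>"

definition some_exhaustion :: "(real^'d) set \<Rightarrow> nat \<Rightarrow> (real^'d) set" where
  "some_exhaustion \<Omega> = (SOME K. exhaustion \<Omega> K)"

text \<open>
  The projective limit along an exhaustion. A compatible sequence of functions on the interiors
  of the \<open>K N\<close> is the same as a function on \<open>\<Omega>\<close>; the projective topology is generated by the
  pullbacks of the continuous seminorms on the factors.
\<close>

definition E_open :: "(real \<Rightarrow> real) \<Rightarrow> (real^'d::finite) set \<Rightarrow> (real^'d \<Rightarrow> complex) set" where
  "E_open \<omega> \<Omega> =
     {\<phi>. (\<forall>x. x \<notin> \<Omega> \<longrightarrow> \<phi> x = 0) \<and>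
         (\<forall>N. restrict0 (interior (some_exhaustion \<Omega> N)) \<phi> \<in> E_compact \<omega> (some_exhaustion \<Omega> N))}"

definition E_open_seminorms ::
  "(real \<Rightarrow> real) \<Rightarrow> (real^'d::finite) set \<Rightarrow> ((real^'d \<Rightarrow> complex) \<Rightarrow> real) set" where
  "E_open_seminorms \<omega> \<Omega> =
     {\<lambda>\<phi>. p (restrict0 (interior (some_exhaustion \<Omega> N)) \<phi>) | N p.
        p \<in> E_compact_seminorms \<omega> (some_exhaustion \<Omega> N)}"

definition E_dual ::
  "(real \<Rightarrow> real) \<Rightarrow> (real^'d::finite) set \<Rightarrow> ((real^'d \<Rightarrow> complex) \<Rightarrow> complex) set" where
  "E_dual \<omega> \<Omega> = lc_dual (E_open \<omega> \<Omega>) (E_open_seminorms \<omega> \<Omega>)"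

text \<open>
  The functionals in \<open>E_dual \<omega> UNIV\<close> carried by the compact set \<open>K\<close>. For \<open>\<omega> = omega1\<close> these
  are the analytic functionals carried by \<open>K\<close>.
\<close>

definition E_dual_carried ::
  "(real \<Rightarrow> real) \<Rightarrow> (real^'d::finite) set \<Rightarrow> ((real^'d \<Rightarrow> complex) \<Rightarrow> complex) set" where
  "E_dual_carried \<omega> K =
     {f \<in> E_dual \<omega> UNIV.
        \<forall>\<Omega>. open \<Omega> \<and> K \<subseteq> \<Omega> \<longrightarrow>
          (\<exists>g \<in> E_dual \<omega> \<Omega>. \<forall>\<phi> \<in> E_open \<omega> UNIV. g (restrict0 \<Omega> \<phi>) = f \<phi>)}"


section \<open>Bounded infrahyperfunctions and ultradistributions\<close>

definition DL1_norm ::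
  "(real \<Rightarrow> real) \<Rightarrow> nat \<Rightarrow> (real^'d::finite \<Rightarrow> complex) \<Rightarrow> ennreal" where
  "DL1_norm \<omega> n \<phi> =
     (SUP \<alpha>. (\<integral>\<^sup>+ x. ennreal (cmod (mderiv \<alpha> \<phi> x)) \<partial>lborel) *
        ennreal (exp (- (1 / real n) * young_conj \<omega> (real n * real (mabs \<alpha>)))))"

definition DL1_step :: "(real \<Rightarrow> real) \<Rightarrow> nat \<Rightarrow> (real^'d::finite \<Rightarrow> complex) set" where
  "DL1_step \<omega> n =
     {\<phi>. smooth_on UNIV \<phi> \<and> (\<forall>\<alpha>. integrable lborel (mderiv \<alpha> \<phi>)) \<and> DL1_norm \<omega> n \<phi> < \<infinity>}"

definition DL1 :: "(real \<Rightarrow> real) \<Rightarrow> (real^'d::finite \<Rightarrow> complex) set" where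
  "DL1 \<omega> = indlim (DL1_step \<omega>)"

definition B_dual :: "(real \<Rightarrow> real) \<Rightarrow> ((real^'d::finite \<Rightarrow> complex) \<Rightarrow> complex) set" where
  "B_dual \<omega> = lc_dual (DL1 \<omega>) (indlim_seminorms (DL1_step \<omega>) (DL1_norm \<omega>))"


section \<open>Well-definedness\<close>

lemma weight_function_omega1: "weight_function omega1"
proof -
  have eq: "eventually (\<lambda>t. omega1 t = t - 1) at_top"
    using eventually_ge_at_top[of 1] by eventually_elim (auto simp: omega1_def)
  have eq2: "eventually (\<lambda>t. omega1 (2 * t) = 2 * t - 1) at_top"
    using eventually_ge_at_top[of 1] by eventually_elim (auto simp: omega1_def)
  have a: "(\<lambda>t. omega1 (2 * t)) \<in> O[at_top](omega1)"
  proof (rule bigoI[of _ 3])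
    show "eventually (\<lambda>t. norm (omega1 (2 * t)) \<le> 3 * norm (omega1 t)) at_top"
      using eventually_ge_at_top[of 2] by eventually_elim (auto simp: omega1_def)
  qed
  have b: "omega1 \<in> O[at_top](\<lambda>t. t)"
  proof (rule bigoI[of _ 1])
    show "eventually (\<lambda>t. norm (omega1 t) \<le> 1 * norm t) at_top"
      using eventually_ge_at_top[of 1] by eventually_elim (auto simp: omega1_def)
  qed
  have c: "ln \<in> o[at_top](omega1)"
  proof -
    have "(ln :: real \<Rightarrow> real) \<in> o[at_top](\<lambda>t. t)"
      using ln_x_over_x_tendsto_0
      by (intro smalloI_tendsto) (auto intro: eventually_mono[OF eventually_gt_at_top[of 0]])
    also have "(\<lambda>t::real. t) \<in> O[at_top](omega1)"
    proof (rule bigoI[of _ 2])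
      show "eventually (\<lambda>t. norm t \<le> 2 * norm (omega1 t)) at_top"
        using eventually_ge_at_top[of 2] by eventually_elim (auto simp: omega1_def)
    qed
    finally show ?thesis .
  qed
  have eq3: "omega1 (exp x) = exp x - 1" if "x \<ge> 0" for x
    using that by (simp add: omega1_def)
  have "convex_on {0..} (\<lambda>x::real. exp x + (-1))"
    using convex_on_subset[OF exp_convex, of "{0..}"] convex_on_const[of "{0..}"]
    by (intro convex_on_add) auto
  then have d: "convex_on {0..} (\<lambda>x. omega1 (exp x))"
    unfolding convex_on_def by (simp add: eq3)
  have e: "continuous_on {0..} omega1"
    unfolding omega1_def by (intro continuous_intros)
  show ?thesis
    unfolding weight_function_def using a b c d e
    by (auto simp: omega1_def intro!: mono_onI)
qed

lemma exhaustion_exists: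
  fixes \<Omega> :: "(real^'d::finite) set"
  assumes "open \<Omega>"
  shows "exhaustion \<Omega> (some_exhaustion \<Omega>)"
proof -
  have step: "\<exists>L. regular_compact L \<and> A \<subseteq> interior L \<and> L \<subseteq> U"
    if A: "compact A" "open U" "A \<subseteq> U" for A U :: "(real^'d) set"
  proof -
    have "\<forall>x\<in>A. \<exists>r>0. cball x r \<subseteq> U"
      using A open_contains_cball by blast
    then obtain r where r: "\<And>x. x \<in> A \<Longrightarrow> r x > 0 \<and> cball x (r x) \<subseteq> U" by metis
    have "A \<subseteq> (\<Union>x\<in>A. ball x (r x))" using r by force
    then obtain D where D: "D \<subseteq> A" "finite D" "A \<subseteq> (\<Union>x\<in>D. ball x (r x))"
      using compactE_image[OF A(1), of A "\<lambda>x. ball x (r x)"] by (metis open_ball)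
    define L where "L = (\<Union>x\<in>D. cball x (r x))"
    have cL: "compact L" unfolding L_def using D by (intro compact_UN) auto
    have bi: "ball x (r x) \<subseteq> interior L" if "x \<in> D" for x
      using that unfolding L_def by (intro interior_maximal) auto
    have "L \<subseteq> closure (interior L)"
    proof
      fix y assume "y \<in> L"
      then obtain x where x: "x \<in> D" "y \<in> cball x (r x)" unfolding L_def by blast
      then have "y \<in> closure (ball x (r x))"
        using r D by (metis closure_ball subsetD)
      then show "y \<in> closure (interior L)" using bi[OF x(1)] closure_mono by blast
    qed
    moreover have "closure (interior L) \<subseteq> L"
      using cL by (simp add: closure_minimal compact_imp_closed interior_subset)
    ultimately have "regular_compact L" using cL unfolding regular_compact_def by blast
    moreover have "A \<subseteq> interior L" using D(3) bi by blast
    moreover have "L \<subseteq> U" unfolding L_def using r D by blast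
    ultimately show ?thesis by blast
  qed
  obtain C where C: "\<And>n. compact (C n)" "\<And>n. C n \<subseteq> \<Omega>" "\<And>n. C n \<subseteq> interior (C (Suc n))"
    "\<Union>(range C) = \<Omega>"
    using open_Union_compact_subsets[OF assms] by metis
  have "\<forall>n. \<exists>L. regular_compact L \<and> C n \<subseteq> interior L \<and> L \<subseteq> interior (C (Suc n))"
    using step C by (meson open_interior)
  then obtain L where L: "\<And>n. regular_compact (L n)" "\<And>n. C n \<subseteq> interior (L n)"
    "\<And>n. L n \<subseteq> interior (C (Suc n))" by metis
  have 1: "L n \<subseteq> \<Omega>" for n using L(3) C(2) interior_subset by blast
  have 2: "L n \<subseteq> interior (L (Suc n))" for n
    using L(2)[of "Suc n"] L(3)[of n] interior_subset by blast
  have "x \<in> (\<Union>n. L n)" if x: "x \<in> \<Omega>" for x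
  proof -
    obtain n where "x \<in> C n" using C(4) x by blast
    then show ?thesis using L(2) interior_subset by blast
  qed
  then have 3: "(\<Union>n. L n) = \<Omega>" using 1 by blast
  have "exhaustion \<Omega> L" unfolding exhaustion_def using L(1) 1 2 3 by simp
  then show ?thesis unfolding some_exhaustion_def by (rule someI[of "exhaustion \<Omega>"])
qed

end

theory Submission
  imports Defs "HOL-Complex_Analysis.Complex_Analysis" "HOL-Probability.Probability" "HOL-Real_Asymp.Real_Asymp"
begin

text \<open>
  A functional on the right is continuous on \<open>\<D>\<^bsub>L\<^sup>1,{\<omega>}\<^esub>\<close> and carried by \<open>K\<close> because
  \<open>\<D>\<^bsub>L\<^sup>1,{\<omega>}\<^esub>\<close> embeds into \<open>\<E>\<^bsub>{\<omega>}\<^esub>\<close> (Sobolev) and every analytic function is of class \<open>{\<omega>}\<close>.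

  Conversely let \<open>f\<close> of class \<open>{\<omega>}\<close> and \<open>g\<close> analytic and carried by \<open>K\<close> agree on
  \<open>\<D>\<^bsub>L\<^sup>1,{\<omega>\<^sub>1}\<^esub>\<close>. Let \<open>T\<^sub>k \<phi>\<close> be the convolution of \<open>\<chi> \<phi>\<close>, where \<open>\<chi>\<close> is a cutoff around \<open>K\<close>, with the
  tensor power of the entire kernel \<open>sin (k t) exp (- k t\<^sup>2) / (\<pi> t)\<close>. The increment
  \<open>T\<^sub>k\<^sub>+\<^sub>1 \<phi> - T\<^sub>k \<phi>\<close> is a finite sum of convolutions with product kernels at least one factor of which
  oscillates like \<open>exp (\<plusminus> i k t)\<close>. Replace \<open>\<chi>\<close> by a cutoff \<open>\<chi>\<^sub>j\<close> that has good derivatives up to an order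
  \<open>j = j(k)\<close> chosen according to \<open>\<omega>\<close>. Integrating by parts \<open>j\<close> times shows that the part with \<open>\<chi>\<^sub>j \<phi>\<close> is
  summable in \<open>\<D>\<^bsub>L\<^sup>1,\<omega>,n\<^esub>\<close>, so that \<open>f\<close> controls it; the part with \<open>(\<chi> - \<chi>\<^sub>j) \<phi>\<close>
  is exponentially small near \<open>K\<close> in the analytic norms, so that \<open>g\<close> controls it. Hence \<open>g (T\<^sub>k \<phi>)\<close>
  converges for every \<open>\<phi>\<close> of class \<open>{\<omega>}\<close> near \<open>K\<close>, and the limit is a continuous functional of \<open>\<phi>\<close> that
  does not depend on the cutoff. For analytic \<open>\<phi>\<close> the same estimate with \<open>\<omega>\<^sub>1\<close> shows that
  \<open>T\<^sub>k \<phi> \<longlonglongrightarrow> \<phi>\<close> near \<open>K\<close> with all derivatives, so the limit functional extends \<open>g\<close>.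
\<close>

section \<open>Weights\<close>

text \<open>A quasianalytic class has no nonzero compactly supported members, so a cutoff times
  \<phi> leaves the class and f cannot be evaluated on it, while g controls functions only through
  analytic norms near K. Neither hypothesis alone bounds g (T_k \<phi>); they meet because every
  smoothed piece is analytic and integrable, so that f and g agree on it.

  The kernel is the sharp frequency cutoff sin (k t) / (pi t) times a Gaussian of width of order 1 /
  sqrt k. At distance d the Gaussian is of size exp (- k d^2), which beats the growth exp (k r) in a
  complex strip of small width r: hence the smallness off the support. Without its phase an
  increment varies at scale 1 / sqrt k, not 1 / k, so j integrations by parts that hit the amplitude
  gain about (j / k)^(j / 2). The order j is the slope of a supporting line of \<omega> (exp x) / m
  at x = ln (k / E), which turns the gain into exp (- \<omega> (k / E) / (2 m)) up to a root of k.
  For large n this beats exp (\<omega> (A k) / n), the cost of the kernel in the class of index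
  n.\<close>

definition Mw :: "(real \<Rightarrow> real) \<Rightarrow> nat \<Rightarrow> nat \<Rightarrow> real" where
  "Mw \<omega> n l = exp (young_conj \<omega> (real n * real l) / real n)"

lemma Mw_pos [simp]: "0 < Mw \<omega> n l" "0 \<le> Mw \<omega> n l" "Mw \<omega> n l \<noteq> 0"
  by (simp_all add: Mw_def)

lemma weight_exp_nonneg: "weight_function \<omega> \<Longrightarrow> 0 \<le> \<omega> (exp x)"
  unfolding weight_function_def by simp

lemma weight_one: "weight_function \<omega> \<Longrightarrow> \<omega> (exp 0) = 0"
  unfolding weight_function_def by simp

text \<open>Condition (\<gamma>) in the variable \<open>x = ln t\<close>. It makes the supremum in
  \<open>young_conj\<close> finite, and later it lets a multiple of \<omega> swallow any fixed power
  of k.\<close>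

lemma weight_dominates_log:
  assumes w: "weight_function \<omega>"
  shows "\<exists>B. \<forall>x\<ge>0. c * x - \<omega> (exp x) \<le> B"
proof -
  define D where "D = \<bar>c\<bar> + 1"
  have "ln \<in> o[at_top](\<omega>)" using w unfolding weight_function_def by blast
  then have "eventually (\<lambda>t. norm (ln t) \<le> (1/D) * norm (\<omega> t)) at_top"
    by (rule landau_o.smallD) (simp add: D_def)
  then obtain T where T: "\<And>t. t \<ge> T \<Longrightarrow> \<bar>ln t\<bar> \<le> (1/D) * \<bar>\<omega> t\<bar>"
    unfolding eventually_at_top_linorder by auto
  define X where "X = ln (max T 1)"
  have "c * x - \<omega> (exp x) \<le> D * X" if x: "x \<ge> 0" for x
  proof (cases "exp x \<ge> T")
    case True
    have "x \<le> (1/D) * \<omega> (exp x)" using T[OF True] x weight_exp_nonneg[OF w, of x] by simp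
    then have "D * x \<le> \<omega> (exp x)" by (simp add: D_def field_simps)
    moreover have "c * x \<le> D * x" using x by (intro mult_right_mono) (auto simp: D_def)
    moreover have "0 \<le> D * X" by (simp add: D_def X_def)
    ultimately show ?thesis by linarith
  next
    case False
    then have "x < ln (max T 1)" by (metis exp_gt_zero le_max_iff_disj less_eq_real_def ln_exp ln_le_cancel_iff
          ln_less_cancel_iff max.strict_coboundedI1 not_le order_less_le_trans)
    then have "c * x \<le> D * X" using x unfolding X_def D_def
      by (intro mult_mono) auto
    then show ?thesis using weight_exp_nonneg[OF w, of x] by linarith
  qed
  then show ?thesis by blast
qed

lemma young_conj_bdd:
  assumes w: "weight_function \<omega>"
  shows "bdd_above ((\<lambda>x. x * y - \<omega> (exp x)) ` {0..})"
  using weight_dominates_log[OF w, of y] by (force simp: bdd_above_def mult.commute)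

lemma young_conj_ge:
  assumes w: "weight_function \<omega>" and "x \<ge> 0"
  shows "x * y - \<omega> (exp x) \<le> young_conj \<omega> y"
  unfolding young_conj_def by (rule cSUP_upper[OF _ young_conj_bdd[OF w]]) (use assms in auto)

lemma young_conj_le:
  assumes "\<And>x. x \<ge> 0 \<Longrightarrow> x * y - \<omega> (exp x) \<le> B"
  shows "young_conj \<omega> y \<le> B"
  unfolding young_conj_def by (rule cSUP_least) (use assms in auto)

text \<open>\<open>Mw \<omega> n l\<close> is the supremum of
  \<open>R ^ l * exp (- \<omega> R / n)\<close> over \<open>R = exp x \<ge> 1\<close>. This lemma
  and \<open>Mw_le\<close> are the two halves of that description; the estimates of the weights go
  through them.\<close>

lemma Mw_ge:
  assumes w: "weight_function \<omega>" and "x \<ge> 0" "n \<ge> 1"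
  shows "exp (x * real l - \<omega> (exp x) / real n) \<le> Mw \<omega> n l"
proof -
  have "(x * (real n * real l) - \<omega> (exp x)) / real n \<le> young_conj \<omega> (real n * real l) / real n"
    by (rule divide_right_mono[OF young_conj_ge[OF w]]) (use assms in auto)
  moreover have "(x * (real n * real l) - \<omega> (exp x)) / real n = x * real l - \<omega> (exp x) / real n"
    using assms by (simp add: field_simps)
  ultimately show ?thesis by (simp add: Mw_def)
qed

lemma Mw_le:
  assumes "n \<ge> 1" and "\<And>x. x \<ge> 0 \<Longrightarrow> x * real l - \<omega> (exp x) / real n \<le> B"
  shows "Mw \<omega> n l \<le> exp B"
proof -
  have "young_conj \<omega> (real n * real l) \<le> real n * B"
  proof (rule young_conj_le)
    fix x :: real assume "x \<ge> 0"
    from assms(2)[OF this] have "real n * (x * real l - \<omega> (exp x) / real n) \<le> real n * B"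
      by (intro mult_left_mono) auto
    moreover have "real n * (x * real l - \<omega> (exp x) / real n) = x * (real n * real l) - \<omega> (exp x)"
      using assms(1) by (simp add: right_diff_distrib)
    ultimately show "x * (real n * real l) - \<omega> (exp x) \<le> real n * B" by simp
  qed
  then show ?thesis using assms(1) by (simp add: Mw_def field_simps)
qed

lemma Mw_ge_1: "weight_function \<omega> \<Longrightarrow> n \<ge> 1 \<Longrightarrow> 1 \<le> Mw \<omega> n l"
  using Mw_ge[of \<omega> 0 n l] weight_one[of \<omega>] by simp

lemma Mw_power_le:
  assumes "weight_function \<omega>" "R \<ge> 1" "n \<ge> 1"
  shows "R ^ l \<le> Mw \<omega> n l * exp (\<omega> R / real n)"
proof -
  have "exp (ln R * real l - \<omega> R / real n) \<le> Mw \<omega> n l"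
    using Mw_ge[of \<omega> "ln R" n l] assms by simp
  moreover have "exp (ln R * real l - \<omega> R / real n) = R ^ l * exp (- (\<omega> R / real n))"
    using assms exp_of_nat_mult[of l "ln R"] by (simp add: exp_diff exp_minus divide_inverse mult.commute)
  ultimately have "R ^ l * exp (- (\<omega> R / real n)) \<le> Mw \<omega> n l" by simp
  then have "R ^ l * exp (- (\<omega> R / real n)) * exp (\<omega> R / real n) \<le> Mw \<omega> n l * exp (\<omega> R / real n)"
    by (rule mult_right_mono) simp
  then show ?thesis by (simp add: mult.assoc flip: exp_add)
qed

lemma Mw_mono_n:
  assumes w: "weight_function \<omega>" and "1 \<le> n" "n \<le> m"
  shows "Mw \<omega> n l \<le> Mw \<omega> m l"
proof -
  have "Mw \<omega> n l \<le> exp (ln (Mw \<omega> m l))"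
  proof (rule Mw_le)
    fix x :: real assume x: "x \<ge> 0"
    have "exp (x * real l - \<omega> (exp x) / real m) \<le> Mw \<omega> m l" using Mw_ge[OF w x] assms by simp
    then have "x * real l - \<omega> (exp x) / real m \<le> ln (Mw \<omega> m l)" by (simp add: ln_ge_iff)
    moreover have "\<omega> (exp x) / real m \<le> \<omega> (exp x) / real n"
      by (rule divide_left_mono) (use assms weight_exp_nonneg[OF w] in auto)
    ultimately show "x * real l - \<omega> (exp x) / real n \<le> ln (Mw \<omega> m l)" by linarith
  qed (use assms in auto)
  then show ?thesis by simp
qed

lemma Mw_superadd:
  assumes w: "weight_function \<omega>" and n: "n \<ge> 1"
  shows "Mw \<omega> n p * Mw \<omega> n q \<le> Mw \<omega> n (p + q)"
proof -
  have "Mw \<omega> n p \<le> exp (ln (Mw \<omega> n (p+q) / Mw \<omega> n q))"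
  proof (rule Mw_le[OF n])
    fix x :: real assume x: "x \<ge> 0"
    have "Mw \<omega> n q \<le> exp (ln (Mw \<omega> n (p+q)) - (x * real p - \<omega> (exp x) / real n))"
    proof (rule Mw_le[OF n])
      fix y :: real assume y: "y \<ge> 0"
      \<comment> \<open>The supremum for \<open>p + q\<close> is tested at the larger point: both
        linear terms only grow, and \<omega> there is one of the two given values, hence at most
        their sum.\<close>
      define z where "z = max x y"
      have "exp (z * real (p+q) - \<omega> (exp z) / real n) \<le> Mw \<omega> n (p+q)"
        by (rule Mw_ge[OF w _ n]) (use x z_def in auto)
      then have "z * real (p+q) - \<omega> (exp z) / real n \<le> ln (Mw \<omega> n (p+q))" by (simp add: ln_ge_iff)
      moreover have "x * real p \<le> z * real p" "y * real q \<le> z * real q"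
        by (auto simp: z_def intro!: mult_right_mono)
      moreover have "\<omega> (exp z) / real n \<le> \<omega> (exp x) / real n + \<omega> (exp y) / real n"
        using weight_exp_nonneg[OF w, of x] weight_exp_nonneg[OF w, of y] by (simp add: z_def max_def)
      ultimately show "y * real q - \<omega> (exp y) / real n
          \<le> ln (Mw \<omega> n (p+q)) - (x * real p - \<omega> (exp x) / real n)"
        by (simp add: distrib_left)
    qed
    then have "ln (Mw \<omega> n q) \<le> ln (Mw \<omega> n (p+q)) - (x * real p - \<omega> (exp x) / real n)"
      by (metis Mw_pos(1) ln_exp ln_le_cancel_iff exp_gt_zero)
    then show "x * real p - \<omega> (exp x) / real n \<le> ln (Mw \<omega> n (p+q) / Mw \<omega> n q)"
      by (simp add: ln_div)
  qed
  then show ?thesis by (simp add: field_simps)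
qed

lemma weight_linear_bound:
  assumes w: "weight_function \<omega>"
  shows "\<exists>C\<ge>1. \<forall>t\<ge>0. \<omega> t \<le> C * (1 + t)"
proof -
  have "\<omega> \<in> O[at_top](\<lambda>t. t)" using w unfolding weight_function_def by blast
  then obtain c where c: "c > 0" "eventually (\<lambda>t. norm (\<omega> t) \<le> c * norm t) at_top"
    by (rule landau_o.bigE)
  then obtain T where T: "\<And>t. t \<ge> T \<Longrightarrow> \<bar>\<omega> t\<bar> \<le> c * \<bar>t\<bar>"
    unfolding eventually_at_top_linorder by auto
  define C where "C = max 1 (max c (\<omega> (max T 0)))"
  have "\<omega> t \<le> C * (1 + t)" if t: "t \<ge> 0" for t
  proof (cases "t \<ge> T")
    case True
    have "\<omega> t \<le> c * t" using T[OF True] t by auto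
    also have "\<dots> \<le> C * (1 + t)" using c t by (intro mult_mono) (auto simp: C_def)
    finally show ?thesis .
  next
    case False
    have m: "mono_on {0..} \<omega>" using w unfolding weight_function_def by blast
    have "\<omega> t \<le> \<omega> (max T 0)" by (rule mono_onD[OF m]) (use False t in auto)
    also have "\<dots> \<le> C * 1" by (simp add: C_def)
    also have "\<dots> \<le> C * (1 + t)" using t by (intro mult_left_mono) (auto simp: C_def)
    finally show ?thesis .
  qed
  then show ?thesis by (intro exI[of _ C]) (auto simp: C_def)
qed

text \<open>Condition (\<alpha>) iterated until \<open>2 ^ k\<close> exceeds A. The summand 1 pays
  for the initial range of t, where \<omega> may vanish.\<close>

lemma weight_scaling:
  assumes w: "weight_function \<omega>" and A: "A \<ge> 1"
  shows "\<exists>C\<ge>1. \<forall>t\<ge>0. \<omega> (A * t) \<le> C * (1 + \<omega> t)"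
proof -
  have m: "mono_on {0..} \<omega>" and nn: "\<And>t. t \<ge> 0 \<Longrightarrow> \<omega> t \<ge> 0"
    using w unfolding weight_function_def by auto
  have "(\<lambda>t. \<omega> (2 * t)) \<in> O[at_top](\<omega>)" using w unfolding weight_function_def by blast
  then obtain c where c: "c > 0" "eventually (\<lambda>t. norm (\<omega> (2*t)) \<le> c * norm (\<omega> t)) at_top"
    by (rule landau_o.bigE)
  then obtain T where T: "\<And>t. t \<ge> T \<Longrightarrow> \<bar>\<omega> (2*t)\<bar> \<le> c * \<bar>\<omega> t\<bar>"
    unfolding eventually_at_top_linorder by auto
  define C where "C = max 1 (max c (\<omega> (2 * max T 0)))"
  have C1: "C \<ge> 1" by (simp add: C_def)
  have two: "\<omega> (2 * t) \<le> C * (1 + \<omega> t)" if t: "t \<ge> 0" for t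
  proof (cases "t \<ge> T")
    case True
    have "\<omega> (2*t) \<le> c * \<omega> t" using T[OF True] nn t by auto
    also have "\<dots> \<le> C * (1 + \<omega> t)" using c nn[OF t] by (intro mult_mono) (auto simp: C_def)
    finally show ?thesis .
  next
    case False
    have "\<omega> (2*t) \<le> \<omega> (2 * max T 0)" by (rule mono_onD[OF m]) (use False t in auto)
    also have "\<dots> \<le> C * 1" by (simp add: C_def)
    also have "\<dots> \<le> C * (1 + \<omega> t)" using nn[OF t] by (intro mult_left_mono) (auto simp: C_def)
    finally show ?thesis .
  qed
  have pow: "\<exists>D\<ge>1. \<forall>t\<ge>0. \<omega> (2 ^ k * t) \<le> D * (1 + \<omega> t)" for k
  proof (induction k)
    case 0
    show ?case by (intro exI[of _ 1]) auto
  next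
    case (Suc k)
    then obtain D where D: "D \<ge> 1" "\<And>t. t \<ge> 0 \<Longrightarrow> \<omega> (2 ^ k * t) \<le> D * (1 + \<omega> t)" by blast
    have "\<omega> (2 ^ Suc k * t) \<le> (2 * C * D) * (1 + \<omega> t)" if t: "t \<ge> 0" for t
    proof -
      have "\<omega> (2 ^ Suc k * t) \<le> C * (1 + \<omega> (2 ^ k * t))" using two[of "2 ^ k * t"] t by (simp add: mult.assoc)
      also have "\<dots> \<le> C * (D * (1 + \<omega> t) + D * (1 + \<omega> t))"
      proof (intro mult_left_mono add_mono)
        have "1 * 1 \<le> D * (1 + \<omega> t)" using D(1) nn[OF t] by (intro mult_mono) auto
        then show "1 \<le> D * (1 + \<omega> t)" by simp
      qed (use D t C1 in auto)
      finally show ?thesis by (simp add: algebra_simps)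
    qed
    moreover have "1 \<le> 2 * C * D" using mult_mono[OF C1 D(1)] C1 by simp
    ultimately show ?case by blast
  qed
  obtain k where k: "A \<le> 2 ^ k" using real_arch_pow[of 2 A] by (auto intro: less_imp_le)
  obtain D where D: "D \<ge> 1" "\<And>t. t \<ge> 0 \<Longrightarrow> \<omega> (2 ^ k * t) \<le> D * (1 + \<omega> t)" using pow[of k] by blast
  have "\<omega> (A * t) \<le> D * (1 + \<omega> t)" if t: "t \<ge> 0" for t
  proof -
    have "\<omega> (A * t) \<le> \<omega> (2 ^ k * t)"
      by (rule mono_onD[OF m]) (use k t A in \<open>auto intro: mult_right_mono\<close>)
    then show ?thesis using D(2)[OF t] by linarith
  qed
  then show ?thesis using D(1) by blast
qed

text \<open>Since \<omega> grows at most linearly, testing the supremum at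
  \<open>R = n * l / C\<close> gives growth at least like factorials. For \<open>R < 1\<close> this
  test point is not allowed, but the left-hand side is then at most 1.\<close>

lemma Mw_analytic_lower:
  assumes w: "weight_function \<omega>"
  shows "\<exists>C\<ge>1. \<forall>n\<ge>1. \<forall>l. (real n * real l / C) ^ l \<le> exp C * Mw \<omega> n l * exp 1 ^ l"
proof -
  obtain C where C: "C \<ge> 1" "\<And>t. t \<ge> 0 \<Longrightarrow> \<omega> t \<le> C * (1 + t)" using weight_linear_bound[OF w] by blast
  have "(real n * real l / C) ^ l \<le> exp C * Mw \<omega> n l * exp 1 ^ l" if n: "n \<ge> 1" for n l :: nat
  proof (cases "real n * real l \<ge> C")
    case True
    define R where "R = real n * real l / C"
    have R: "R \<ge> 1" using True C(1) by (simp add: R_def)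
    have "R ^ l \<le> Mw \<omega> n l * exp (\<omega> R / real n)" by (rule Mw_power_le[OF w R n])
    also have "\<omega> R / real n \<le> C * (1 + R) / real n" by (intro divide_right_mono C(2)) (use R in auto)
    also have "\<dots> = C / real n + real l" using C(1) n by (simp add: R_def field_simps)
    also have "\<dots> \<le> C + real l" using C(1) n by (simp add: field_simps)
    finally have "R ^ l \<le> Mw \<omega> n l * exp (C + real l)" by simp
    also have "\<dots> = exp C * Mw \<omega> n l * exp 1 ^ l" by (simp add: exp_add exp_of_nat_mult[symmetric])
    finally show ?thesis by (simp add: R_def)
  next
    case False
    then have "(real n * real l / C) ^ l \<le> 1" using C(1) by (intro power_le_one) auto
    also have "1 \<le> exp C * Mw \<omega> n l * exp 1 ^ l"
    proof -
      have "1 * 1 * 1 \<le> exp C * Mw \<omega> n l * exp 1 ^ l"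
        by (intro mult_mono Mw_ge_1[OF w n]) (use C(1) in \<open>auto intro: one_le_power\<close>)
      then show ?thesis by simp
    qed
    finally show ?thesis .
  qed
  then show ?thesis using C(1) by blast
qed

text \<open>The factor n in the lower bound absorbs any geometric constant A, at the price of a
  large n.\<close>

lemma Mw_dominates_factorial:
  assumes w: "weight_function \<omega>" and A: "A > 0"
  shows "\<exists>C\<ge>0. \<exists>n0\<ge>1. \<forall>n\<ge>n0. \<forall>l. (A * real l) ^ l \<le> C * Mw \<omega> n l"
proof -
  obtain C where C: "C \<ge> 1" "\<And>n l. n \<ge> 1 \<Longrightarrow> (real n * real l / C) ^ l \<le> exp C * Mw \<omega> n l * exp 1 ^ l"
    using Mw_analytic_lower[OF w] by blast
  obtain n0 where n0: "real n0 \<ge> A * C * exp 1" "n0 \<ge> 1"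
    using real_arch_simple[of "max 1 (A * C * exp 1)"] by auto
  have "(A * real l) ^ l \<le> exp C * Mw \<omega> n l" if n: "n \<ge> n0" for n l :: nat
  proof -
    have "A * real l * exp 1 = (A * C * exp 1) * real l / C" using C(1) by (simp add: field_simps)
    also have "\<dots> \<le> real n * real l / C" using n n0 C(1)
      by (intro divide_right_mono mult_right_mono) auto
    finally have "(A * real l * exp 1) ^ l \<le> (real n * real l / C) ^ l"
      using A by (intro power_mono) auto
    also have "\<dots> \<le> exp C * Mw \<omega> n l * exp 1 ^ l" using C(2)[of n l] n n0 by simp
    finally show ?thesis by (simp add: power_mult_distrib)
  qed
  then show ?thesis using n0(2) by (intro exI[of _ "exp C"]) auto
qed

text \<open>Here n is prescribed, so a geometric factor \<open>D ^ p\<close> remains; the scale E in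
  \<open>order_estimate\<close> absorbs it later.\<close>

lemma Mw_factorial_bound:
  assumes w: "weight_function \<omega>" and n: "n \<ge> 1"
  shows "\<exists>C\<ge>1. \<exists>D\<ge>1. \<forall>p. real p ^ p \<le> C * D ^ p * Mw \<omega> n p"
proof -
  obtain C where C: "C \<ge> 1" "\<And>n l. n \<ge> 1 \<Longrightarrow> (real n * real l / C) ^ l \<le> exp C * Mw \<omega> n l * exp 1 ^ l"
    using Mw_analytic_lower[OF w] by blast
  have "real p ^ p \<le> exp C * (C * exp 1) ^ p * Mw \<omega> n p" for p
  proof -
    have "(real p / C) ^ p \<le> (real n * real p / C) ^ p"
      using n C(1) by (intro power_mono divide_right_mono) (auto simp: mult_le_cancel_right1)
    also have "\<dots> \<le> exp C * Mw \<omega> n p * exp 1 ^ p" by (rule C(2)[OF n])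
    finally show ?thesis using C(1) by (simp add: power_divide power_mult_distrib field_simps)
  qed
  moreover have "1 \<le> C * exp 1" using C(1) by (smt (verit) mult_le_cancel_left1 one_le_exp_iff)
  ultimately show ?thesis using C(1) by (intro exI[of _ "exp C"] exI[of _ "C * exp 1"]) auto
qed

text \<open>One half of \<open>\<omega> (exp x) / n\<close> dominates the linear term
  \<open>d * x\<close> by (\<gamma>); the other half is exactly the weight for \<open>2 * n\<close>.
  This is the price for losing d derivatives.\<close>

lemma Mw_shift:
  assumes w: "weight_function \<omega>" and n: "n \<ge> 1"
  shows "\<exists>C>0. \<forall>l. Mw \<omega> n (l + d) \<le> C * Mw \<omega> (2 * n) l"
proof -
  obtain B where B: "\<And>x. x \<ge> 0 \<Longrightarrow> (2 * real n * real d) * x - \<omega> (exp x) \<le> B"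
    using weight_dominates_log[OF w] by blast
  have "Mw \<omega> n (l + d) \<le> exp (B / (2 * real n)) * Mw \<omega> (2 * n) l" for l
  proof -
    have "Mw \<omega> n (l + d) \<le> exp (B / (2 * real n) + ln (Mw \<omega> (2 * n) l))"
    proof (rule Mw_le[OF n])
      fix x :: real assume x: "x \<ge> 0"
      have "exp (x * real l - \<omega> (exp x) / real (2*n)) \<le> Mw \<omega> (2*n) l" by (rule Mw_ge[OF w x]) (use n in auto)
      then have 1: "x * real l - \<omega> (exp x) / (2 * real n) \<le> ln (Mw \<omega> (2*n) l)" by (simp add: ln_ge_iff)
      have "((2 * real n * real d) * x - \<omega> (exp x)) / (2 * real n) \<le> B / (2 * real n)"
        using B[OF x] n by (intro divide_right_mono) auto
      moreover have "((2 * real n * real d) * x - \<omega> (exp x)) / (2 * real n)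
          = x * real d - \<omega> (exp x) / (2 * real n)" using n by (simp add: field_simps)
      moreover have "\<omega> (exp x) / real n = \<omega> (exp x) / (2 * real n) + \<omega> (exp x) / (2 * real n)"
        using n by (simp add: field_simps)
      ultimately show "x * real (l + d) - \<omega> (exp x) / real n \<le> B / (2 * real n) + ln (Mw \<omega> (2 * n) l)"
        using 1 by (simp add: distrib_left)
    qed
    then show ?thesis by (simp add: exp_add)
  qed
  then show ?thesis by (intro exI[of _ "exp (B / (2 * real n))"]) auto
qed

lemma Mw_mono_l:
  assumes w: "weight_function \<omega>" and n: "n \<ge> 1" and "l \<le> l'"
  shows "Mw \<omega> n l \<le> Mw \<omega> n l'"
proof -
  have "Mw \<omega> n l * 1 \<le> Mw \<omega> n l * Mw \<omega> n (l' - l)" by (intro mult_left_mono Mw_ge_1[OF w n]) auto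
  also have "\<dots> \<le> Mw \<omega> n (l + (l' - l))" by (rule Mw_superadd[OF w n])
  finally show ?thesis using assms by simp
qed

text \<open>By linear growth \<omega> is at most a multiple of \<open>omega1 + 2\<close> on the
  arguments from 1 on; the multiple c goes into the index and the 2 into the constant.\<close>

lemma Mw_omega1_le:
  assumes w: "weight_function \<omega>" and n: "n \<ge> 1"
  shows "\<exists>m\<ge>1. \<exists>C>0. \<forall>l. Mw omega1 n l \<le> C * Mw \<omega> m l"
proof -
  obtain C where C: "C \<ge> 1" "\<And>t. t \<ge> 0 \<Longrightarrow> \<omega> t \<le> C * (1 + t)" using weight_linear_bound[OF w] by blast
  obtain c :: nat where c: "real c \<ge> C" "c \<ge> 1" using real_arch_simple[of C] C(1) by fastforce
  have "Mw omega1 n l \<le> exp 2 * Mw \<omega> (c * n) l" for l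
  proof -
    have "Mw omega1 n l \<le> exp (2 + ln (Mw \<omega> (c * n) l))"
    proof (rule Mw_le[OF n])
      fix x :: real assume x: "x \<ge> 0"
      have "exp (x * real l - \<omega> (exp x) / real (c*n)) \<le> Mw \<omega> (c*n) l" by (rule Mw_ge[OF w x]) (use n c in \<open>simp add: Suc_le_eq\<close>)
      then have 1: "x * real l - \<omega> (exp x) / real (c*n) \<le> ln (Mw \<omega> (c*n) l)" by (simp add: ln_ge_iff)
      have "\<omega> (exp x) \<le> C * (1 + exp x)" by (rule C(2)) simp
      also have "\<dots> = C * (omega1 (exp x) + 2)" using x by (simp add: omega1_def)
      also have "\<dots> \<le> real c * (omega1 (exp x) + 2)" using c by (intro mult_right_mono) (auto simp: omega1_def)
      finally have "\<omega> (exp x) / real (c*n) \<le> real c * (omega1 (exp x) + 2) / real (c * n)"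
        by (intro divide_right_mono) auto
      also have "\<dots> = omega1 (exp x) / real n + 2 / real n" using c n by (simp add: field_simps)
      also have "\<dots> \<le> omega1 (exp x) / real n + 2" using n by (simp add: field_simps)
      finally show "x * real l - omega1 (exp x) / real n \<le> 2 + ln (Mw \<omega> (c * n) l)" using 1 by linarith
    qed
    then show ?thesis by (simp add: exp_add)
  qed
  moreover have "c * n \<ge> 1" using c n by (simp add: Suc_le_eq)
  ultimately show ?thesis by (intro exI[of _ "c * n"] conjI exI[of _ "exp 2"]) auto
qed

text \<open>The slope s is the left derivative at X, the supremum of the difference quotients to the
  left. The quotients to the right bound it from above, in particular the one over a unit step;
  monotonicity makes it nonnegative.\<close>

lemma convex_on_supporting_slope:
  fixes f :: "real \<Rightarrow> real"
  assumes c: "convex_on {0..} f" and X: "X > 0" and mono: "mono_on {0..} f"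
  shows "\<exists>s\<ge>0. s \<le> f (X + 1) - f X \<and> (\<forall>x\<ge>0. f X + s * (x - X) \<le> f x)"
proof -
  define q where "q x = (f x - f X) / (x - X)" for x
  have q_mono: "q x \<le> q y" if "0 \<le> x" "x < X" "X < y" for x y
  proof -
    have 1: "(f x - f X) / (x - X) \<le> (f x - f y) / (x - y)" "(f x - f y) / (x - y) \<le> (f X - f y) / (X - y)"
      using convex_on_slope_le[OF c, of x y X] that by auto
    have "(f X - f y) / (X - y) = q y" unfolding q_def by (metis minus_diff_eq minus_divide_divide)
    then show ?thesis using 1 unfolding q_def by linarith
  qed
  define s where "s = (SUP x\<in>{0..<X}. q x)"
  have bdd: "bdd_above (q ` {0..<X})" using q_mono[of _ "X+1"] X by (force simp: bdd_above_def)
  have up: "q x \<le> s" if "0 \<le> x" "x < X" for x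
    unfolding s_def by (rule cSUP_upper[OF _ bdd]) (use that in auto)
  have lo: "s \<le> q y" if "X < y" for y
    unfolding s_def by (rule cSUP_least) (use that X q_mono in auto)
  have "0 \<le> q 0" using mono_onD[OF mono, of 0 X] X by (simp add: q_def divide_nonpos_pos)
  then have "0 \<le> s" using up[of 0] X by linarith
  moreover have "s \<le> f (X+1) - f X" using lo[of "X+1"] by (simp add: q_def)
  moreover have "f X + s * (x - X) \<le> f x" if x: "x \<ge> 0" for x
  proof (cases x X rule: linorder_cases)
    case less
    have "q x \<le> s" by (rule up[OF x less])
    then show ?thesis using less by (simp add: q_def divide_le_eq)
  next
    case greater
    have "s \<le> q x" by (rule lo[OF greater])
    then show ?thesis using greater by (simp add: q_def le_divide_eq)
  qed simp
  ultimately show ?thesis by blast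
qed

text \<open>The order \<open>j\<close> is the slope of a supporting line of \<open>x \<mapsto> \<omega> (exp x) / m\<close> at \<open>ln R\<close>.\<close>

lemma weight_order_selection:
  assumes w: "weight_function \<omega>" and m: "m \<ge> 1" and R: "R > 1"
  shows "\<exists>j. real j \<le> \<omega> (exp 1 * R) \<and> (\<forall>q\<le>j. Mw \<omega> m q \<le> R ^ q) \<and>
      Mw \<omega> m j \<le> R ^ j * (R * exp (- \<omega> R / real m))"
proof -
  define X where "X = ln R"
  have X: "X > 0" "exp X = R" using R by (auto simp: X_def)
  have mw: "mono_on {0..} \<omega>" using w unfolding weight_function_def by blast
  have "mono_on {0..} (\<lambda>x. \<omega> (exp x))"
    by (rule mono_onI) (auto intro!: mono_onD[OF mw])
  then obtain s where s: "s \<ge> 0" "s \<le> \<omega> (exp (X+1)) - \<omega> (exp X)"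
    "\<And>x. x \<ge> 0 \<Longrightarrow> \<omega> (exp X) + s * (x - X) \<le> \<omega> (exp x)"
    using convex_on_supporting_slope[of "\<lambda>x. \<omega> (exp x)" X] X w unfolding weight_function_def by blast
  define t where "t = s / real m"
  \<comment> \<open>Rounding down keeps \<open>j \<le> t\<close>, so that for
    \<open>q \<le> j\<close> the maximum of \<open>x * q - \<omega> (exp x) / m\<close> is at most
    \<open>q * X\<close>. The lost fraction, less than 1, costs at most \<open>X = ln R\<close> in
    the exponent, which is the factor R in the last bound.\<close>
  define j where "j = nat \<lfloor>t\<rfloor>"
  have t: "0 \<le> t" "t \<le> s" using s(1) m by (auto simp: t_def field_simps mult_le_cancel_left1)
  have j: "real j \<le> t" "t \<le> real j + 1" using t(1) by (auto simp: j_def)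
  have "real j \<le> \<omega> (exp 1 * R)"
    using j t s weight_exp_nonneg[OF w, of X] X by (simp add: exp_add mult.commute)
  moreover have sup: "\<omega> R / real m + t * (x - X) \<le> \<omega> (exp x) / real m" if "x \<ge> 0" for x
  proof -
    have "(\<omega> (exp X) + s * (x - X)) / real m \<le> \<omega> (exp x) / real m"
      by (intro divide_right_mono s(3)) (use that in auto)
    then show ?thesis by (simp add: t_def X add_divide_distrib)
  qed
  moreover have "Mw \<omega> m q \<le> R ^ q" if q: "q \<le> j" for q
  proof -
    have "Mw \<omega> m q \<le> exp (real q * X)"
    proof (rule Mw_le[OF m])
      fix x :: real assume x: "x \<ge> 0"
      show "x * real q - \<omega> (exp x) / real m \<le> real q * X"
      proof (cases "x \<le> X")
        case True
        then have "x * real q \<le> X * real q" by (intro mult_right_mono) auto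
        moreover have "\<omega> (exp x) / real m \<ge> 0" using weight_exp_nonneg[OF w] by simp
        ultimately show ?thesis by (simp add: mult.commute)
      next
        case False
        have "real q * (x - X) \<le> t * (x - X)" using False j q by (intro mult_right_mono) auto
        moreover have "0 \<le> \<omega> R / real m" using weight_exp_nonneg[OF w, of X] X by simp
        ultimately show ?thesis using sup[OF x] by (simp add: algebra_simps)
      qed
    qed
    then show ?thesis using X by (simp add: exp_of_nat_mult)
  qed
  moreover have "Mw \<omega> m j \<le> R ^ j * (R * exp (- \<omega> R / real m))"
  proof -
    have "Mw \<omega> m j \<le> exp (real j * X + X - \<omega> R / real m)"
    proof (rule Mw_le[OF m])
      fix x :: real assume x: "x \<ge> 0"
      have "(real j - t) * (x - X) \<le> X"
      proof (cases "x \<ge> X")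
        case True
        then have "(real j - t) * (x - X) \<le> 0" using j by (intro mult_nonpos_nonneg) auto
        then show ?thesis using X by linarith
      next
        case False
        have "(t - real j) * (X - x) \<le> 1 * X" using False j x by (intro mult_mono) auto
        then show ?thesis by (simp add: algebra_simps)
      qed
      then show "x * real j - \<omega> (exp x) / real m \<le> real j * X + X - \<omega> R / real m"
        using sup[OF x] by (simp add: algebra_simps)
    qed
    also have "\<dots> = R ^ j * (R * exp (- \<omega> R / real m))"
      using X exp_of_nat_mult[of j X] by (simp add: exp_add exp_diff exp_minus divide_inverse)
    finally show ?thesis .
  qed
  ultimately show ?thesis by blast
qed

section \<open>Iterated partial derivatives of smooth functions\<close>

lemma has_vd_partial_shift:
  fixes f :: "real^'d \<Rightarrow> complex"
  assumes "((\<lambda>t. f ((x + t0 *\<^sub>R axis i 1) + t *\<^sub>R axis i 1)) has_vector_derivative D) (at 0)"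
  shows "((\<lambda>t. f (x + t *\<^sub>R axis i 1)) has_vector_derivative D) (at t0)"
proof -
  have "((\<lambda>t. f ((x + t0 *\<^sub>R axis i 1) + t *\<^sub>R axis i 1)) has_vector_derivative D) (at (t0 - t0))"
    using assms by simp
  then have "((\<lambda>t. f ((x + t0 *\<^sub>R axis i 1) + t *\<^sub>R axis i 1)) \<circ> (\<lambda>s. s - t0) has_vector_derivative (1 *\<^sub>R D)) (at t0)"
    by (intro vector_diff_chain_at) (auto intro!: derivative_eq_intros)
  then show ?thesis by (simp add: o_def algebra_simps)
qed

lemma axis_line_in_open:
  fixes U :: "(real^'d) set"
  assumes "open U" "x \<in> U"
  shows "eventually (\<lambda>t. x + t *\<^sub>R axis i 1 \<in> U) (nhds 0)"
proof -
  have "continuous_on UNIV (\<lambda>t::real. x + t *\<^sub>R axis i 1)" by (intro continuous_intros)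
  then have "open ((\<lambda>t::real. x + t *\<^sub>R axis i 1) -` U)" using assms(1) by (simp add: continuous_on_open_vimage)
  then show ?thesis using assms(2) by (auto simp: eventually_nhds)
qed

lemma has_vd_axis_cong:
  fixes f g :: "real^'d \<Rightarrow> complex"
  assumes "open U" "x \<in> U" "\<And>y. y \<in> U \<Longrightarrow> f y = g y"
    and "((\<lambda>t. f (x + t *\<^sub>R axis i 1)) has_vector_derivative D) (at 0)"
  shows "((\<lambda>t. g (x + t *\<^sub>R axis i 1)) has_vector_derivative D) (at 0)"
proof -
  have "eventually (\<lambda>t. f (x + t *\<^sub>R axis i 1) = g (x + t *\<^sub>R axis i 1)) (nhds 0)"
    using axis_line_in_open[OF assms(1,2), of i] by eventually_elim (use assms in auto)
  then have "((\<lambda>t. f (x + t *\<^sub>R axis i 1)) has_vector_derivative D) (at 0) \<longleftrightarrow>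
      ((\<lambda>t. g (x + t *\<^sub>R axis i 1)) has_vector_derivative D) (at 0)"
    by (intro has_vector_derivative_cong_ev) (use assms(2,3) in \<open>auto elim: eventually_mono\<close>)
  then show ?thesis using assms(4) by simp
qed

lemma partial_deriv_eqI:
  "((\<lambda>t. f (x + t *\<^sub>R axis i 1)) has_vector_derivative D) (at 0) \<Longrightarrow> partial_deriv i f x = D"
  unfolding partial_deriv_def by (rule vector_derivative_at)

text \<open>A family indexed by lists that is closed under differentiation along the axes must
  consist of the iterated derivatives of its first member. Sums, multiples and convolutions are
  differentiated below by exhibiting such a family.\<close>

lemma foldr_partial_deriv_family:
  fixes f :: "real^'d \<Rightarrow> complex"
  assumes U: "open U" and F0: "\<And>x. x \<in> U \<Longrightarrow> F [] x = f x"
    and Fd: "\<And>js i x. x \<in> U \<Longrightarrow> ((\<lambda>t. F js (x + t *\<^sub>R axis i 1)) has_vector_derivative F (i # js) x) (at 0)"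
    and x: "x \<in> U"
  shows "foldr partial_deriv js f x = F js x"
  using x
proof (induction js arbitrary: x)
  case Nil
  then show ?case by (simp add: F0)
next
  case (Cons i js)
  have "((\<lambda>t. foldr partial_deriv js f (x + t *\<^sub>R axis i 1)) has_vector_derivative F (i # js) x) (at 0)"
    by (rule has_vd_axis_cong[OF U Cons.prems _ Fd[OF Cons.prems]]) (simp add: Cons.IH)
  then show ?case by (simp add: partial_deriv_eqI)
qed

lemma smooth_on_family:
  fixes f :: "real^'d \<Rightarrow> complex"
  assumes U: "open U" and F0: "\<And>x. x \<in> U \<Longrightarrow> F [] x = f x"
    and Fd: "\<And>js i x. x \<in> U \<Longrightarrow> ((\<lambda>t. F js (x + t *\<^sub>R axis i 1)) has_vector_derivative F (i # js) x) (at 0)"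
    and Fc: "\<And>js. continuous_on U (F js)"
  shows "smooth_on U f"
  unfolding smooth_on_def
proof (intro allI conjI ballI)
  note eq = foldr_partial_deriv_family[OF U F0 Fd]
  show "continuous_on U (foldr partial_deriv js f)" for js
    using Fc[of js] by (rule continuous_on_eq) (use eq in auto)
  fix js x i assume x: "x \<in> U"
  have "((\<lambda>t. foldr partial_deriv js f (x + t *\<^sub>R axis i 1)) has_vector_derivative F (i # js) x) (at 0)"
    by (rule has_vd_axis_cong[OF U x _ Fd[OF x]]) (use eq in auto)
  then show "(\<lambda>t. foldr partial_deriv js f (x + t *\<^sub>R axis i 1)) differentiable (at 0)"
    by (simp add: differentiableI_vector)
qed

lemma smooth_on_foldr_has_vd:
  fixes f :: "real^'d \<Rightarrow> complex"
  assumes "smooth_on U f" "x \<in> U"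
  shows "((\<lambda>t. foldr partial_deriv js f (x + t *\<^sub>R axis i 1)) has_vector_derivative
           foldr partial_deriv (i # js) f x) (at 0)"
  using assms unfolding smooth_on_def
  by (simp add: partial_deriv_def[of i "foldr partial_deriv js f"] vector_derivative_works)

lemma smooth_on_has_vd:
  fixes f :: "real^'d \<Rightarrow> complex"
  assumes "smooth_on U f" "x \<in> U"
  shows "((\<lambda>t. f (x + t *\<^sub>R axis i 1)) has_vector_derivative partial_deriv i f x) (at 0)"
  using smooth_on_foldr_has_vd[OF assms, of "[]"] by simp

lemma smooth_on_has_vd_at:
  fixes f :: "real^'d \<Rightarrow> complex"
  assumes "smooth_on U f" "x + t *\<^sub>R axis i 1 \<in> U"
  shows "((\<lambda>t. f (x + t *\<^sub>R axis i 1)) has_vector_derivative partial_deriv i f (x + t *\<^sub>R axis i 1)) (at t)"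
  by (rule has_vd_partial_shift[OF smooth_on_has_vd[OF assms]])

lemma smooth_on_foldr:
  assumes "smooth_on U f" shows "smooth_on U (foldr partial_deriv ks f)"
proof -
  have "foldr partial_deriv js (foldr partial_deriv ks f) = foldr partial_deriv (js @ ks) f" for js by simp
  then show ?thesis using assms unfolding smooth_on_def by presburger
qed

lemma smooth_on_partial: "smooth_on U f \<Longrightarrow> smooth_on U (partial_deriv i f)"
  using smooth_on_foldr[of U f "[i]"] by simp

lemma smooth_on_continuous: "smooth_on U f \<Longrightarrow> continuous_on U f"
  unfolding smooth_on_def by (metis foldr.simps(1) id_apply)

lemma smooth_on_continuous_foldr: "smooth_on U f \<Longrightarrow> continuous_on U (foldr partial_deriv js f)"
  unfolding smooth_on_def by blast

lemma smooth_on_subset: "smooth_on U f \<Longrightarrow> V \<subseteq> U \<Longrightarrow> smooth_on V f"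
  unfolding smooth_on_def by (meson continuous_on_subset subsetD)

text \<open>\<open>vector_derivative\<close> is a choice among vectors characterised by the germ
  along the line, so equal germs give equal values, differentiable or not.\<close>

lemma foldr_partial_deriv_cong:
  fixes f :: "real^'d \<Rightarrow> complex"
  assumes U: "open U" and eq: "\<And>x. x \<in> U \<Longrightarrow> f x = g x" and x: "x \<in> U"
  shows "foldr partial_deriv js f x = foldr partial_deriv js g x"
  using x
proof (induction js arbitrary: x)
  case (Cons i js)
  have ev: "eventually (\<lambda>t. foldr partial_deriv js f (x + t *\<^sub>R axis i 1) = foldr partial_deriv js g (x + t *\<^sub>R axis i 1)) (nhds 0)"
    using axis_line_in_open[OF U Cons.prems, of i] by eventually_elim (rule Cons.IH)
  have "((\<lambda>t. foldr partial_deriv js f (x + t *\<^sub>R axis i 1)) has_vector_derivative D) (at 0) \<longleftrightarrow>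
      ((\<lambda>t. foldr partial_deriv js g (x + t *\<^sub>R axis i 1)) has_vector_derivative D) (at 0)" for D
    by (rule has_vector_derivative_cong_ev) (use ev eventually_nhds_x_imp_x[OF ev] in \<open>auto elim: eventually_mono\<close>)
  then show ?case
    by (simp add: partial_deriv_def[of i "foldr partial_deriv js f"] partial_deriv_def[of i "foldr partial_deriv js g"] vector_derivative_def)
qed (use eq in simp)

lemma smooth_on_cong:
  fixes f :: "real^'d \<Rightarrow> complex"
  assumes U: "open U" and eq: "\<And>x. x \<in> U \<Longrightarrow> f x = g x" and f: "smooth_on U f"
  shows "smooth_on U g"
proof (rule smooth_on_family[OF U, where F = "\<lambda>js. foldr partial_deriv js f"])
  show "continuous_on U (foldr partial_deriv js f)" for js by (rule smooth_on_continuous_foldr[OF f])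
qed (use eq smooth_on_foldr_has_vd[OF f] in auto)

lemma
  fixes f g :: "real^'d \<Rightarrow> complex"
  assumes U: "open U" and f: "smooth_on U f" and g: "smooth_on U g"
  shows smooth_on_add: "smooth_on U (\<lambda>x. f x + g x)"
    and foldr_partial_deriv_add: "x \<in> U \<Longrightarrow> foldr partial_deriv js (\<lambda>x. f x + g x) x =
       foldr partial_deriv js f x + foldr partial_deriv js g x"
proof -
  let ?F = "\<lambda>js x. foldr partial_deriv js f x + foldr partial_deriv js g x"
  have d: "((\<lambda>t. ?F js (x + t *\<^sub>R axis i 1)) has_vector_derivative ?F (i # js) x) (at 0)" if "x \<in> U" for js i x
    by (intro has_vector_derivative_add smooth_on_foldr_has_vd[OF f that] smooth_on_foldr_has_vd[OF g that])
  show "smooth_on U (\<lambda>x. f x + g x)"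
    by (rule smooth_on_family[OF U, where F = ?F, OF _ d])
      (auto intro!: continuous_intros smooth_on_continuous_foldr f g)
  show "x \<in> U \<Longrightarrow> foldr partial_deriv js (\<lambda>x. f x + g x) x = ?F js x"
    by (rule foldr_partial_deriv_family[OF U _ d]) auto
qed

lemma
  fixes f :: "real^'d \<Rightarrow> complex"
  assumes U: "open U" and f: "smooth_on U f"
  shows smooth_on_cmult: "smooth_on U (\<lambda>x. c * f x)"
    and foldr_partial_deriv_cmult: "x \<in> U \<Longrightarrow> foldr partial_deriv js (\<lambda>x. c * f x) x = c * foldr partial_deriv js f x"
proof -
  let ?F = "\<lambda>js x. c * foldr partial_deriv js f x"
  have d: "((\<lambda>t. ?F js (x + t *\<^sub>R axis i 1)) has_vector_derivative ?F (i # js) x) (at 0)" if "x \<in> U" for js i x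
    by (intro has_vector_derivative_mult_right smooth_on_foldr_has_vd[OF f that])
  show "smooth_on U (\<lambda>x. c * f x)"
    by (rule smooth_on_family[OF U, where F = ?F, OF _ d])
      (auto intro!: continuous_intros smooth_on_continuous_foldr f)
  show "x \<in> U \<Longrightarrow> foldr partial_deriv js (\<lambda>x. c * f x) x = ?F js x"
    by (rule foldr_partial_deriv_family[OF U _ d]) auto
qed

lemma foldr_partial_deriv_zero: "foldr partial_deriv js (\<lambda>x. 0) = (\<lambda>x::real^'d. 0 :: complex)"
  by (rule ext, rule foldr_partial_deriv_family[of UNIV "\<lambda>js x. 0"]) auto

lemma smooth_on_zero: "smooth_on U (\<lambda>x::real^'d. 0 :: complex)"
  unfolding smooth_on_def foldr_partial_deriv_zero by simp

section \<open>Multi-indices\<close>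

lemma coords: "distinct (coords :: 'd::finite list)" "set (coords :: 'd::finite list) = UNIV"
proof -
  have "\<exists>js :: 'd list. distinct js \<and> set js = UNIV" using finite_distinct_list[of "UNIV :: 'd set"] by auto
  then have "distinct (coords :: 'd list) \<and> set (coords :: 'd list) = UNIV"
    unfolding coords_def by (rule someI_ex)
  then show "distinct (coords :: 'd::finite list)" "set (coords :: 'd::finite list) = UNIV" by auto
qed

text \<open>The multi-index written out as a list of coordinates, so that facts on
  \<open>foldr partial_deriv\<close> apply to \<open>mderiv\<close>.\<close>

definition mlist :: "('d::finite \<Rightarrow> nat) \<Rightarrow> 'd list" where
  "mlist \<alpha> = concat (map (\<lambda>i. replicate (\<alpha> i) i) coords)"

lemma mderiv_mlist: "mderiv \<alpha> f = foldr partial_deriv (mlist \<alpha>) f"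
proof -
  have "foldr (\<lambda>i. partial_deriv i ^^ \<alpha> i) cs f = foldr partial_deriv (concat (map (\<lambda>i. replicate (\<alpha> i) i) cs)) f" for cs
    by (induction cs) auto
  then show ?thesis unfolding mderiv_def mlist_def .
qed

lemma count_list_mlist: "count_list (mlist \<alpha>) i = \<alpha> i"
proof -
  have *: "count_list (concat (map (\<lambda>i. replicate (\<alpha> i) i) cs)) i = (if i \<in> set cs then \<alpha> i else 0)" if "distinct cs" for cs
    using that
  proof (induction cs)
    case (Cons c cs)
    have "count_list (replicate n c) i = (if c = i then n else 0)" for n by (induction n) auto
    with Cons show ?case by auto
  qed simp
  show ?thesis unfolding mlist_def using *[OF coords(1)] by (simp add: coords(2))
qed

text \<open>Peeling off the outermost derivative of \<open>mderiv \<alpha>\<close> leaves another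
  \<open>mderiv\<close>: this permits induction over multi-indices along their lists.\<close>

lemma mlist_Cons:
  assumes "mlist \<alpha> = i # js" shows "js = mlist (\<alpha>(i := \<alpha> i - 1))"
proof -
  have "js = concat (map (\<lambda>k. replicate ((\<alpha>(i := \<alpha> i - 1)) k) k) cs)"
    if "distinct cs" "concat (map (\<lambda>k. replicate (\<alpha> k) k) cs) = i # js" for cs
    using that
  proof (induction cs)
    case (Cons c cs)
    show ?case
    proof (cases "\<alpha> c")
      case 0
      then have e: "concat (map (\<lambda>k. replicate (\<alpha> k) k) cs) = i # js" using Cons by simp
      then have "i \<in> set cs" 
      proof -
        have "i \<in> set (concat (map (\<lambda>k. replicate (\<alpha> k) k) cs))" unfolding e by simp
        then show ?thesis by auto
      qed
      then have "i \<noteq> c" using Cons by auto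
      then show ?thesis using Cons e 0 by simp
    next
      case (Suc n)
      then have i: "i = c" and js: "js = replicate n c @ concat (map (\<lambda>k. replicate (\<alpha> k) k) cs)" using Cons by auto
      have "map (\<lambda>k. replicate (\<alpha> k) k) cs = map (\<lambda>k. replicate ((\<alpha>(i := \<alpha> i - 1)) k) k) cs"
        using Cons.prems i by (intro map_cong) auto
      then have "concat (map (\<lambda>k. replicate (\<alpha> k) k) cs) = concat (map (\<lambda>k. replicate ((\<alpha>(i := \<alpha> i - 1)) k) k) cs)"
        by (rule arg_cong)
      then show ?thesis unfolding js using i Suc by simp
    qed
  qed simp
  from this[OF coords(1)] assms show ?thesis unfolding mlist_def by blast
qed

lemma mderiv_single:
  "mderiv (\<lambda>j. if j = i then l else 0) f = (partial_deriv i ^^ l) f"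
proof -
  have *: "foldr (\<lambda>k. partial_deriv k ^^ (if k = i then l else 0)) cs f =
      (if i \<in> set cs then (partial_deriv i ^^ l) f else f)" if "distinct cs" for cs
    using that by (induction cs) auto
  show ?thesis unfolding mderiv_def using *[OF coords(1)] by (simp add: coords(2))
qed

lemma mabs_single [simp]: "mabs (\<lambda>j. if j = i then l else 0) = l"
  by (simp add: mabs_def)

section \<open>Commuting partial derivatives\<close>

lemma continuous_on_axis_line:
  "continuous_on UNIV f \<Longrightarrow> continuous_on A (\<lambda>t. f (x + t *\<^sub>R axis i 1) :: complex)" for x :: "real^'d" and f
  by (rule continuous_on_compose2[of UNIV f]) (auto intro!: continuous_intros)

text \<open>The increment of f in direction j is the integral of \<open>partial_deriv j f\<close>.
  Differentiating it under the integral in direction i, and then in the end point s at 0, produces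
  both mixed derivatives.\<close>

lemma partial_deriv_commute:
  fixes f :: "real^'d \<Rightarrow> complex"
  assumes f: "smooth_on UNIV f"
  shows "partial_deriv i (partial_deriv j f) = partial_deriv j (partial_deriv i f)"
proof
  fix x :: "real^'d"
  define g where "g y s = integral {0..s} (\<lambda>t. partial_deriv j f (y + t *\<^sub>R axis j 1))" for y s
  define G where "G = partial_deriv i (partial_deriv j f)"
  have swap: "(x + t *\<^sub>R axis j 1) + r *\<^sub>R axis i 1 = (x + r *\<^sub>R axis i 1) + t *\<^sub>R axis j 1" for r t :: real
    by (simp only: add.assoc add.commute[of "t *\<^sub>R axis j 1"])
  have cj: "continuous_on UNIV (partial_deriv j f)"
    using smooth_on_continuous smooth_on_partial f by blast
  have cG: "continuous_on UNIV G" unfolding G_def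
    using smooth_on_continuous smooth_on_partial f by blast
  have ftc: "f (y + s *\<^sub>R axis j 1) = f y + g y s" if "s \<ge> 0" for y s
  proof -
    have "((\<lambda>t. f (y + t *\<^sub>R axis j 1)) has_vector_derivative partial_deriv j f (y + t *\<^sub>R axis j 1)) (at t within {0..s})" for t
      by (rule has_vector_derivative_at_within[OF smooth_on_has_vd_at[OF f UNIV_I]])
    then have "((\<lambda>t. partial_deriv j f (y + t *\<^sub>R axis j 1)) has_integral
        f (y + s *\<^sub>R axis j 1) - f (y + 0 *\<^sub>R axis j 1)) {0..s}"
      using fundamental_theorem_of_calculus[OF that, of "\<lambda>t. f (y + t *\<^sub>R axis j 1)"
          "\<lambda>t. partial_deriv j f (y + t *\<^sub>R axis j 1)"] by blast
    from integral_unique[OF this] show ?thesis unfolding g_def by simp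
  qed
  have dg: "((\<lambda>r. g (x + r *\<^sub>R axis i 1) s) has_vector_derivative
      integral {0..s} (\<lambda>t. G (x + t *\<^sub>R axis j 1))) (at 0)" if "s \<ge> 0" for s
  proof -
    have "((\<lambda>r. integral (cbox 0 s) (\<lambda>t. partial_deriv j f ((x + r *\<^sub>R axis i 1) + t *\<^sub>R axis j 1)))
       has_vector_derivative integral (cbox 0 s) (\<lambda>t. G ((x + 0 *\<^sub>R axis i 1) + t *\<^sub>R axis j 1))) (at 0 within UNIV)"
    proof (rule leibniz_rule_vector_derivative[where fx = "\<lambda>r t. G ((x + r *\<^sub>R axis i 1) + t *\<^sub>R axis j 1)"])
      fix r t :: real
      have "((\<lambda>r. partial_deriv j f ((x + t *\<^sub>R axis j 1) + r *\<^sub>R axis i 1)) has_vector_derivative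
         partial_deriv i (partial_deriv j f) ((x + t *\<^sub>R axis j 1) + r *\<^sub>R axis i 1)) (at r)"
        by (rule smooth_on_has_vd_at[OF smooth_on_partial[OF f]]) simp
      then show "((\<lambda>r. partial_deriv j f ((x + r *\<^sub>R axis i 1) + t *\<^sub>R axis j 1)) has_vector_derivative
         G ((x + r *\<^sub>R axis i 1) + t *\<^sub>R axis j 1)) (at r within UNIV)"
        unfolding G_def swap .
    next
      fix r :: real
      show "(\<lambda>t. partial_deriv j f ((x + r *\<^sub>R axis i 1) + t *\<^sub>R axis j 1)) integrable_on cbox 0 s"
        by (intro integrable_continuous continuous_on_axis_line cj)
    next
      show "continuous_on (UNIV \<times> cbox 0 s) (\<lambda>(r, t). G ((x + r *\<^sub>R axis i 1) + t *\<^sub>R axis j 1))"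
        unfolding split_beta by (rule continuous_on_compose2[OF cG]) (auto intro!: continuous_intros)
    qed auto
    then show ?thesis unfolding g_def cbox_interval scaleR_zero_left add_0_right .
  qed
  have h: "partial_deriv i f (x + s *\<^sub>R axis j 1) =
      partial_deriv i f x + integral {0..s} (\<lambda>t. G (x + t *\<^sub>R axis j 1))" if s: "s \<ge> 0" for s
  proof -
    have "((\<lambda>r. f (x + r *\<^sub>R axis i 1) + g (x + r *\<^sub>R axis i 1) s) has_vector_derivative
       partial_deriv i f x + integral {0..s} (\<lambda>t. G (x + t *\<^sub>R axis j 1))) (at 0)"
      by (intro has_vector_derivative_add dg s smooth_on_has_vd[OF f]) simp
    then have "((\<lambda>r. f ((x + s *\<^sub>R axis j 1) + r *\<^sub>R axis i 1)) has_vector_derivative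
       partial_deriv i f x + integral {0..s} (\<lambda>t. G (x + t *\<^sub>R axis j 1))) (at 0)"
      unfolding swap ftc[OF s] .
    then show ?thesis unfolding partial_deriv_def[of i f "x + s *\<^sub>R axis j 1"]
      by (rule vector_derivative_at)
  qed
  \<comment> \<open>The integral formula is available for \<open>s \<ge> 0\<close> only, so the two
    derivatives are compared from one side.\<close>
  have 1: "((\<lambda>s. partial_deriv i f (x + s *\<^sub>R axis j 1)) has_vector_derivative
      partial_deriv j (partial_deriv i f) x) (at 0 within {0..1})"
    by (rule has_vector_derivative_at_within, rule smooth_on_has_vd[OF smooth_on_partial[OF f]]) simp
  have "((\<lambda>s. integral {0..s} (\<lambda>t. G (x + t *\<^sub>R axis j 1))) has_vector_derivative G (x + 0 *\<^sub>R axis j 1)) (at 0 within {0..1})"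
    by (rule integral_has_vector_derivative) (auto intro!: continuous_on_axis_line cG)
  from has_vector_derivative_add[OF has_vector_derivative_const[of "partial_deriv i f x"] this]
  have "((\<lambda>s. partial_deriv i f x + integral {0..s} (\<lambda>t. G (x + t *\<^sub>R axis j 1))) has_vector_derivative G x) (at 0 within {0..1})"
    by simp
  then have 2: "((\<lambda>s. partial_deriv i f (x + s *\<^sub>R axis j 1)) has_vector_derivative G x) (at 0 within {0..1})"
    by (rule has_vector_derivative_transform[rotated 2]) (auto simp: h)
  show "partial_deriv i (partial_deriv j f) x = partial_deriv j (partial_deriv i f) x"
    using vector_derivative_unique_within[OF _ 1 2] by (simp add: G_def trivial_limit_within islimpt_Icc)
qed

text \<open>The head of one list is brought to the front of the other by commuting it past its
  predecessors.\<close>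

lemma foldr_partial_deriv_perm:
  fixes f :: "real^'d \<Rightarrow> complex"
  assumes f: "smooth_on UNIV f" and "mset js = mset ks"
  shows "foldr partial_deriv js f = foldr partial_deriv ks f"
  using assms(2)
proof (induction js arbitrary: ks)
  case (Cons i js)
  have "set (i # js) = set ks" by (rule mset_eq_setD[OF Cons.prems])
  then have "i \<in> set ks" by auto
  then obtain as bs where ks: "ks = as @ i # bs" by (meson split_list)
  have move: "foldr partial_deriv (as @ i # bs) f = foldr partial_deriv (i # as @ bs) f" for as
  proof (induction as)
    case (Cons a as)
    have "foldr partial_deriv ((a # as) @ i # bs) f = partial_deriv a (foldr partial_deriv (as @ i # bs) f)"
      by (simp only: append_Cons foldr.simps o_apply)
    also have "\<dots> = partial_deriv a (partial_deriv i (foldr partial_deriv (as @ bs) f))" unfolding Cons by (simp only: append_Cons foldr.simps o_apply)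
    also have "\<dots> = partial_deriv i (partial_deriv a (foldr partial_deriv (as @ bs) f))"
      by (rule partial_deriv_commute[OF smooth_on_foldr[OF f]])
    finally show ?case unfolding foldr.simps append_Cons o_apply .
  qed simp
  have "mset js = mset (as @ bs)" using Cons.prems ks by simp
  from Cons.IH[OF this] show ?case using ks move[of as] by simp
qed simp

lemma partial_deriv_mderiv:
  fixes f :: "real^'d::finite \<Rightarrow> complex"
  assumes f: "smooth_on UNIV f"
  shows "partial_deriv i (mderiv \<alpha> f) = mderiv (\<alpha>(i := Suc (\<alpha> i))) f"
proof -
  have "mset (i # mlist \<alpha>) = mset (mlist (\<alpha>(i := Suc (\<alpha> i))))"
    by (rule multiset_eqI) (use count_list_mlist[of \<alpha>] count_list_mlist[of "\<alpha>(i := Suc (\<alpha> i))"] in \<open>simp add: count_mset\<close>)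
  from foldr_partial_deriv_perm[OF f this] show ?thesis by (simp add: mderiv_mlist)
qed

abbreviation deriv_bounded :: "(real \<Rightarrow> real) \<Rightarrow> nat \<Rightarrow> (real^'d::finite) set \<Rightarrow> real \<Rightarrow> (real^'d \<Rightarrow> complex) \<Rightarrow> bool" where
  "deriv_bounded \<omega> n S B \<phi> \<equiv> \<forall>\<alpha>. \<forall>x\<in>S. cmod (mderiv \<alpha> \<phi> x) \<le> B * Mw \<omega> n (mabs \<alpha>)"

abbreviation L1_norm :: "(real^'d::finite \<Rightarrow> complex) \<Rightarrow> ennreal" where
  "L1_norm f \<equiv> \<integral>\<^sup>+ x. ennreal (cmod (f x)) \<partial>lborel"

section \<open>Duals of locally convex spaces\<close>

definition function_space :: "('a \<Rightarrow> complex) set \<Rightarrow> bool" where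
  "function_space V \<longleftrightarrow> (\<lambda>x. 0) \<in> V \<and> (\<forall>\<phi>\<in>V. \<forall>\<psi>\<in>V. (\<lambda>x. \<phi> x + \<psi> x) \<in> V) \<and>
     (\<forall>c. \<forall>\<phi>\<in>V. (\<lambda>x. c * \<phi> x) \<in> V)"

lemma function_space_add: "function_space V \<Longrightarrow> \<phi> \<in> V \<Longrightarrow> \<psi> \<in> V \<Longrightarrow> (\<lambda>x. \<phi> x + \<psi> x) \<in> V"
  and function_space_cmult: "function_space V \<Longrightarrow> \<phi> \<in> V \<Longrightarrow> (\<lambda>x. c * \<phi> x) \<in> V"
  unfolding function_space_def by blast+

lemma seminorm_on_add: "seminorm_on V p \<Longrightarrow> \<phi> \<in> V \<Longrightarrow> \<psi> \<in> V \<Longrightarrow> p (\<lambda>x. \<phi> x + \<psi> x) \<le> p \<phi> + p \<psi>"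
  unfolding seminorm_on_def by blast

lemma lc_dual_add: "f \<in> lc_dual V P \<Longrightarrow> \<phi> \<in> V \<Longrightarrow> \<psi> \<in> V \<Longrightarrow> f (\<lambda>x. \<phi> x + \<psi> x) = f \<phi> + f \<psi>"
  and lc_dual_cmult: "f \<in> lc_dual V P \<Longrightarrow> \<phi> \<in> V \<Longrightarrow> f (\<lambda>x. c * \<phi> x) = c * f \<phi>"
  unfolding lc_dual_def by blast+

lemma function_space_diff:
  assumes "function_space V" "\<phi> \<in> V" "\<psi> \<in> V" shows "(\<lambda>x. \<phi> x - \<psi> x) \<in> V"
  using function_space_add[OF assms(1,2) function_space_cmult[OF assms(1,3), of "-1"]] by simp

lemma seminorm_on_zero:
  assumes "function_space V" "seminorm_on V p" shows "p (\<lambda>x. 0) = 0"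
proof -
  have z: "(\<lambda>x. 0) \<in> V" using assms unfolding function_space_def by blast
  have "\<And>c \<phi>. \<phi> \<in> V \<Longrightarrow> p (\<lambda>x. c * \<phi> x) = cmod c * p \<phi>" using assms unfolding seminorm_on_def by blast
  from this[OF z, of 0] show ?thesis by simp
qed

lemma openin_topology_generated_by_finite_Int:
  assumes "openin (topology_generated_by S) W" "x \<in> W"
  shows "\<exists>F. finite F \<and> F \<subseteq> S \<and> x \<in> \<Inter>F \<and> F \<noteq> {} \<and> \<Inter>F \<subseteq> W"
proof -
  have "generate_topology_on S W" using assms(1) by (simp add: openin_topology_generated_by_iff)
  then show ?thesis using assms(2)
  proof (induction arbitrary: x)
    case (Int a b)
    obtain F where "finite F" "F \<subseteq> S" "x \<in> \<Inter>F" "F \<noteq> {}" "\<Inter>F \<subseteq> a" using Int by (metis IntD1)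
    moreover obtain G where "finite G" "G \<subseteq> S" "x \<in> \<Inter>G" "G \<noteq> {}" "\<Inter>G \<subseteq> b" using Int by (metis IntD2)
    ultimately show ?case by (intro exI[of _ "F \<union> G"]) auto
  next
    case (UN K)
    then obtain k where k: "k \<in> K" "x \<in> k" by blast
    from UN.IH[OF this] show ?case using k(1) by blast
  next
    case (Basis s)
    then show ?case by (intro exI[of _ "{s}"]) auto
  qed simp
qed

lemma topspace_lc_topology: "topspace (lc_topology V P) = V"
  unfolding lc_topology_def topology_generated_by_topspace by auto

text \<open>Continuity at 0 made quantitative: the preimage of the unit ball contains a basic
  neighbourhood of 0, this contains a set on which finitely many seminorms are small, and
  homogeneity turns smallness into a bound.\<close>

lemma lc_dual_bound:
  assumes V: "function_space V" and P: "\<And>p. p \<in> P \<Longrightarrow> seminorm_on V p" and f: "f \<in> lc_dual V P"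
  shows "\<exists>F C. finite F \<and> F \<subseteq> P \<and> 0 \<le> C \<and> (\<forall>\<phi>\<in>V. cmod (f \<phi>) \<le> C * (\<Sum>p\<in>F. p \<phi>))"
proof -
  have hom: "\<And>c \<phi>. \<phi> \<in> V \<Longrightarrow> f (\<lambda>x. c * \<phi> x) = c * f \<phi>"
    and cont: "continuous_map (lc_topology V P) euclidean f" using f unfolding lc_dual_def by auto
  have z: "(\<lambda>x. 0) \<in> V" using V unfolding function_space_def by blast
  have f0: "f (\<lambda>x. 0) = 0" using hom[OF z, of 0] by simp
  define W where "W = {\<phi> \<in> V. f \<phi> \<in> ball 0 1}"
  have W1: "openin (lc_topology V P) W"
    using openin_continuous_map_preimage[OF cont, of "ball 0 1"] by (simp add: W_def topspace_lc_topology)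
  have W2: "(\<lambda>x. 0) \<in> W" using z f0 by (simp add: W_def)
  from openin_topology_generated_by_finite_Int[OF W1[unfolded lc_topology_def] W2] obtain F where F: "finite F"
    "F \<subseteq> insert V {{\<psi>\<in>V. p (\<lambda>x. \<psi> x - \<phi> x) < r} | p \<phi> r. p \<in> P \<and> \<phi> \<in> V \<and> 0 < r}"
    "(\<lambda>x. 0) \<in> \<Inter>F" "\<Inter>F \<subseteq> W" "F \<noteq> {}"
    by (elim exE conjE)
  have single: "\<exists>Q e. finite Q \<and> Q \<subseteq> P \<and> e > 0 \<and> (\<forall>\<psi>\<in>V. (\<forall>p\<in>Q. p \<psi> < e) \<longrightarrow> \<psi> \<in> G)" if G: "G \<in> F" for G
  proof (cases "G = V")
    case True
    then show ?thesis by (intro exI[of _ "{}"] exI[of _ 1]) auto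
  next
    case False
    then obtain p \<phi> r where p: "G = {\<psi>\<in>V. p (\<lambda>x. \<psi> x - \<phi> x) < r}" "p \<in> P" "\<phi> \<in> V" "0 < r"
      using F(2) G by blast
    have m: "(\<lambda>x. (-1) * \<phi> x) \<in> V" using V p unfolding function_space_def by blast
    have "(\<lambda>x. 0) \<in> G" using F(3) G by blast
    then have r: "p (\<lambda>x. 0 - \<phi> x) < r" using p(1) by simp
    \<comment> \<open>The generating set is centred at \<phi>, not at 0; e is the radius that
      remains around 0.\<close>
    define e where "e = r - p (\<lambda>x. 0 - \<phi> x)"
    have "\<psi> \<in> G" if "\<psi> \<in> V" "p \<psi> < e" for \<psi>
    proof -
      from seminorm_on_add[OF P[OF p(2)] that(1) m] show ?thesis using that by (simp add: p(1) e_def)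
    qed
    then show ?thesis using p(2) r by (intro exI[of _ "{p}"] exI[of _ e]) (auto simp: e_def)
  qed
  have "\<exists>Q e. finite Q \<and> Q \<subseteq> P \<and> e > 0 \<and> (\<forall>\<psi>\<in>V. (\<forall>p\<in>Q. p \<psi> < e) \<longrightarrow> \<psi> \<in> \<Inter>H)"
    if "finite H" "H \<subseteq> F" for H
    using that
  proof (induction rule: finite_induct)
    case empty
    show ?case by (intro exI[of _ "{}"] exI[of _ 1]) auto
  next
    case (insert G H)
    from insert obtain Q e where Q: "finite Q" "Q \<subseteq> P" "e > 0" "\<And>\<psi>. \<psi>\<in>V \<Longrightarrow> (\<forall>p\<in>Q. p \<psi> < e) \<Longrightarrow> \<psi> \<in> \<Inter>H" by auto
    from single[of G] insert obtain Q' e' where Q': "finite Q'" "Q' \<subseteq> P" "e' > 0" "\<And>\<psi>. \<psi>\<in>V \<Longrightarrow> (\<forall>p\<in>Q'. p \<psi> < e') \<Longrightarrow> \<psi> \<in> G" by auto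
    show ?case using Q Q' by (intro exI[of _ "Q \<union> Q'"] exI[of _ "min e e'"]) auto
  qed
  from this[OF F(1)] obtain Q e where Q: "finite Q" "Q \<subseteq> P" "e > 0" "\<And>\<psi>. \<psi>\<in>V \<Longrightarrow> (\<forall>p\<in>Q. p \<psi> < e) \<Longrightarrow> \<psi> \<in> W"
    using F(4) by blast
  have "cmod (f \<phi>) \<le> (2 / e) * (\<Sum>p\<in>Q. p \<phi>)" if \<phi>: "\<phi> \<in> V" for \<phi>
  proof (rule ccontr)
    assume neg: "\<not> ?thesis"
    define s where "s = (\<Sum>p\<in>Q. p \<phi>)"
    have pn: "p \<phi> \<ge> 0" if "p \<in> Q" for p using P that Q(2) \<phi> unfolding seminorm_on_def by blast
    have s0: "s \<ge> 0" unfolding s_def by (rule sum_nonneg) (use pn in auto)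
    have fs: "(2 / e) * s < cmod (f \<phi>)" using neg by (simp add: s_def)
    moreover have "0 \<le> (2 / e) * s" using s0 Q(3) by simp
    ultimately have fp: "cmod (f \<phi>) > 0" by linarith
    \<comment> \<open>This normalises the value of f to modulus 1. If the bound fails, all seminorms
      of the multiple are below e, so it lies in \<open>W\<close>, where values have modulus below
      1.\<close>
    define c where "c = complex_of_real (1 / cmod (f \<phi>))"
    have cV: "(\<lambda>x. c * \<phi> x) \<in> V" using V \<phi> unfolding function_space_def by blast
    have "p (\<lambda>x. c * \<phi> x) < e" if p: "p \<in> Q" for p
    proof -
      have "p (\<lambda>x. c * \<phi> x) = cmod c * p \<phi>" using P p Q(2) \<phi> unfolding seminorm_on_def by blast
      also have "\<dots> = p \<phi> / cmod (f \<phi>)" using fp by (simp add: c_def norm_divide)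
      also have "p \<phi> \<le> s" unfolding s_def by (rule member_le_sum) (use p pn Q in auto)
      then have "p \<phi> / cmod (f \<phi>) \<le> s / cmod (f \<phi>)" using fp by (intro divide_right_mono) auto
      also have "\<dots> < e" using fs fp Q(3) s0 by (simp add: field_simps)
      finally show ?thesis .
    qed
    then have "(\<lambda>x. c * \<phi> x) \<in> W" using Q(4)[OF cV] by blast
    then have "cmod (c * f \<phi>) < 1" using hom[OF \<phi>] by (simp add: W_def)
    then show False using fp by (simp add: c_def norm_mult norm_divide)
  qed
  then show ?thesis using Q by (intro exI[of _ Q] exI[of _ "2/e"]) auto
qed

text \<open>The converse of \<open>lc_dual_bound\<close>. Apart from restrictions it is applied with
  a single seminorm, the modulus of the functional itself.\<close>

lemma lc_dualI:
  assumes V: "function_space V" and P: "\<And>p. p \<in> P \<Longrightarrow> seminorm_on V p"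
    and off: "\<And>\<phi>. \<phi> \<notin> V \<Longrightarrow> f \<phi> = 0"
    and add: "\<And>\<phi> \<psi>. \<phi> \<in> V \<Longrightarrow> \<psi> \<in> V \<Longrightarrow> f (\<lambda>x. \<phi> x + \<psi> x) = f \<phi> + f \<psi>"
    and hom: "\<And>c \<phi>. \<phi> \<in> V \<Longrightarrow> f (\<lambda>x. c * \<phi> x) = c * f \<phi>"
    and F: "finite F" "F \<subseteq> P" and bd: "\<And>\<phi>. \<phi> \<in> V \<Longrightarrow> cmod (f \<phi>) \<le> C * (\<Sum>p\<in>F. p \<phi>)"
  shows "f \<in> lc_dual V P"
proof -
  have fd: "f (\<lambda>x. \<phi> x - \<psi> x) = f \<phi> - f \<psi>" if "\<phi> \<in> V" "\<psi> \<in> V" for \<phi> \<psi>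
  proof -
    have m: "(\<lambda>x. (-1) * \<psi> x) \<in> V" using V that unfolding function_space_def by blast
    show ?thesis using add[OF that(1) m] hom[OF that(2), of "-1"] by simp
  qed
  have "openin (lc_topology V P) {\<phi> \<in> V. f \<phi> \<in> U}" if U: "open U" for U
  proof (subst openin_subopen, intro ballI)
    fix \<phi> assume "\<phi> \<in> {\<phi> \<in> V. f \<phi> \<in> U}"
    then have \<phi>: "\<phi> \<in> V" "f \<phi> \<in> U" by auto
    obtain e where e: "e > 0" "ball (f \<phi>) e \<subseteq> U" using U \<phi>(2) open_contains_ball by blast
    \<comment> \<open>The added 1 keeps the denominator positive when C or the number of seminorms
      is 0, and the final inequality strict.\<close>
    define r where "r = e / (\<bar>C\<bar> * real (card F) + 1)"
    have den: "\<bar>C\<bar> * real (card F) + 1 > 0" by (simp add: add_nonneg_pos)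
    then have r: "r > 0" using e by (simp add: r_def)
    define T where "T = \<Inter>(insert V ((\<lambda>p. {\<psi>\<in>V. p (\<lambda>x. \<psi> x - \<phi> x) < r}) ` F))"
    have gen: "openin (lc_topology V P) G" if "G \<in> insert V ((\<lambda>p. {\<psi>\<in>V. p (\<lambda>x. \<psi> x - \<phi> x) < r}) ` F)" for G
      unfolding lc_topology_def
      by (rule topology_generated_by_Basis) (use that F(2) \<phi>(1) r in blast)
    have "openin (lc_topology V P) T" unfolding T_def
      by (rule openin_Inter) (use gen F(1) in auto)
    moreover have "\<phi> \<in> T"
    proof -
      have "p (\<lambda>x. \<phi> x - \<phi> x) < r" if "p \<in> F" for p
        using seminorm_on_zero[OF V P, of p] that F(2) r by auto
      then show ?thesis using \<phi>(1) by (simp add: T_def)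
    qed
    moreover have "T \<subseteq> {\<phi> \<in> V. f \<phi> \<in> U}"
    proof
      fix \<psi> assume "\<psi> \<in> T"
      then have \<psi>: "\<psi> \<in> V" "\<And>p. p \<in> F \<Longrightarrow> p (\<lambda>x. \<psi> x - \<phi> x) < r" by (auto simp: T_def)
      have dV: "(\<lambda>x. \<psi> x - \<phi> x) \<in> V" by (rule function_space_diff[OF V \<psi>(1) \<phi>(1)])
      have sn: "0 \<le> (\<Sum>p\<in>F. p (\<lambda>x. \<psi> x - \<phi> x))"
        by (rule sum_nonneg) (use P F(2) dV in \<open>auto simp: seminorm_on_def\<close>)
      have "cmod (f \<psi> - f \<phi>) \<le> C * (\<Sum>p\<in>F. p (\<lambda>x. \<psi> x - \<phi> x))"
        using bd[OF dV] fd[OF \<psi>(1) \<phi>(1)] by simp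
      also have "\<dots> \<le> \<bar>C\<bar> * (\<Sum>p\<in>F. p (\<lambda>x. \<psi> x - \<phi> x))" using sn by (intro mult_right_mono) auto
      also have "\<dots> \<le> \<bar>C\<bar> * (\<Sum>p\<in>F. r)"
        by (intro mult_left_mono sum_mono) (use \<psi>(2) in \<open>auto intro: less_imp_le\<close>)
      also have "\<dots> = \<bar>C\<bar> * real (card F) * r" by simp
      also have "\<dots> < (\<bar>C\<bar> * real (card F) + 1) * r" using r by (simp add: distrib_right)
      also have "\<dots> = e" using den by (simp add: r_def)
      finally have "f \<psi> \<in> ball (f \<phi>) e" by (simp add: dist_norm norm_minus_commute)
      then show "\<psi> \<in> {\<phi> \<in> V. f \<phi> \<in> U}" using e(2) \<psi>(1) by blast
    qed
    ultimately show "\<exists>T. openin (lc_topology V P) T \<and> \<phi> \<in> T \<and> T \<subseteq> {\<phi> \<in> V. f \<phi> \<in> U}" by blast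
  qed
  then have "continuous_map (lc_topology V P) euclidean f"
    by (simp add: continuous_map_def topspace_lc_topology)
  then show ?thesis unfolding lc_dual_def using off add hom by blast
qed

lemma lc_dual_diff:
  assumes V: "function_space V" and f: "f \<in> lc_dual V P" and "\<phi> \<in> V" "\<psi> \<in> V"
  shows "f (\<lambda>x. \<phi> x - \<psi> x) = f \<phi> - f \<psi>"
  using lc_dual_add[OF f assms(3) function_space_cmult[OF V assms(4), of "-1"]] lc_dual_cmult[OF f assms(4), of "-1"]
  by simp

lemma lc_dual_sum:
  assumes V: "function_space V" and f: "f \<in> lc_dual V P" and "finite A" "\<And>a. a \<in> A \<Longrightarrow> \<phi> a \<in> V"
  shows "(\<lambda>x. \<Sum>a\<in>A. \<phi> a x) \<in> V \<and> f (\<lambda>x. \<Sum>a\<in>A. \<phi> a x) = (\<Sum>a\<in>A. f (\<phi> a))"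
  using assms(3,4)
proof (induction rule: finite_induct)
  case empty
  have z: "(\<lambda>x. 0) \<in> V" using V unfolding function_space_def by blast
  from lc_dual_cmult[OF f z, of 0] show ?case using z by simp
next
  case (insert a A)
  have m: "\<phi> a \<in> V" "(\<lambda>x. \<Sum>a\<in>A. \<phi> a x) \<in> V" using insert by auto
  show ?case using function_space_add[OF V m] lc_dual_add[OF f m] insert by simp
qed

lemma lc_dual_restrict:
  assumes V: "function_space V" and P: "\<And>p. p \<in> P \<Longrightarrow> seminorm_on V p"
    and V': "function_space V'" and P': "\<And>p. p \<in> P' \<Longrightarrow> seminorm_on V' p"
    and sub: "V' \<subseteq> V" "P \<subseteq> P'" and f: "f \<in> lc_dual V P"
  shows "restrict0 V' f \<in> lc_dual V' P'"
proof -
  obtain F C where F: "finite F" "F \<subseteq> P" "\<And>\<phi>. \<phi> \<in> V \<Longrightarrow> cmod (f \<phi>) \<le> C * (\<Sum>p\<in>F. p \<phi>)"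
    using lc_dual_bound[OF V P f] by blast
  show ?thesis
  proof (rule lc_dualI[OF V' P' _ _ _ F(1)])
    show "restrict0 V' f \<phi> = 0" if "\<phi> \<notin> V'" for \<phi> using that by (simp add: restrict0_def)
    show "F \<subseteq> P'" using F sub by blast
    show "cmod (restrict0 V' f \<phi>) \<le> C * (\<Sum>p\<in>F. p \<phi>)" if "\<phi> \<in> V'" for \<phi>
      using F(3) that sub by (auto simp: restrict0_def)
    show "restrict0 V' f (\<lambda>x. \<phi> x + \<psi> x) = restrict0 V' f \<phi> + restrict0 V' f \<psi>" if "\<phi> \<in> V'" "\<psi> \<in> V'" for \<phi> \<psi>
    proof -
      have "(\<lambda>x. \<phi> x + \<psi> x) \<in> V'" using V' that unfolding function_space_def by blast
      moreover have "f (\<lambda>x. \<phi> x + \<psi> x) = f \<phi> + f \<psi>" using f that sub unfolding lc_dual_def by blast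
      ultimately show ?thesis using that by (simp add: restrict0_def)
    qed
    show "restrict0 V' f (\<lambda>x. c * \<phi> x) = c * restrict0 V' f \<phi>" if "\<phi> \<in> V'" for c \<phi>
    proof -
      have "(\<lambda>x. c * \<phi> x) \<in> V'" using V' that unfolding function_space_def by blast
      moreover have "f (\<lambda>x. c * \<phi> x) = c * f \<phi>" using f that sub unfolding lc_dual_def by blast
      ultimately show ?thesis using that by (simp add: restrict0_def)
    qed
  qed
qed

section \<open>Ultradifferentiable functions\<close>

lemma SUP_weight_le_iff:
  fixes a :: "('d::finite \<Rightarrow> nat) \<Rightarrow> ennreal"
  assumes "B \<ge> 0"
  shows "(SUP \<alpha>. a \<alpha> * ennreal (exp (- (1 / real n) * young_conj \<omega> (real n * real (mabs \<alpha>))))) \<le> ennreal B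
     \<longleftrightarrow> (\<forall>\<alpha>. a \<alpha> \<le> ennreal (B * Mw \<omega> n (mabs \<alpha>)))"
proof -
  have "a \<alpha> * ennreal (exp (- (1 / real n) * young_conj \<omega> (real n * real (mabs \<alpha>)))) \<le> ennreal B
     \<longleftrightarrow> a \<alpha> \<le> ennreal (B * Mw \<omega> n (mabs \<alpha>))" (is "a \<alpha> * ennreal ?e \<le> _ \<longleftrightarrow> _") for \<alpha>
  proof -
    have e: "?e * Mw \<omega> n (mabs \<alpha>) = 1" by (simp add: Mw_def flip: exp_add)
    show ?thesis
    proof
      assume "a \<alpha> * ennreal ?e \<le> ennreal B"
      then have "a \<alpha> * ennreal ?e * ennreal (Mw \<omega> n (mabs \<alpha>)) \<le> ennreal B * ennreal (Mw \<omega> n (mabs \<alpha>))"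
        by (rule mult_right_mono) simp
      then show "a \<alpha> \<le> ennreal (B * Mw \<omega> n (mabs \<alpha>))"
        unfolding mult.assoc ennreal_mult''[OF Mw_pos(2), symmetric] e by simp
    next
      assume "a \<alpha> \<le> ennreal (B * Mw \<omega> n (mabs \<alpha>))"
      then have "a \<alpha> * ennreal ?e \<le> ennreal (B * Mw \<omega> n (mabs \<alpha>)) * ennreal ?e"
        by (rule mult_right_mono) simp
      also have "\<dots> = ennreal (B * (?e * Mw \<omega> n (mabs \<alpha>)))" using assms
        by (simp add: ac_simps flip: ennreal_mult'')
      finally show "a \<alpha> * ennreal ?e \<le> ennreal B" unfolding e by simp
    qed
  qed
  then show ?thesis by (simp add: SUP_le_iff)
qed

lemma DL1_norm_le_iff:
  assumes "B \<ge> 0"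
  shows "DL1_norm \<omega> n \<phi> \<le> ennreal B \<longleftrightarrow>
     (\<forall>\<alpha>. L1_norm (mderiv \<alpha> \<phi>) \<le> ennreal (B * Mw \<omega> n (mabs \<alpha>)))"
  unfolding DL1_norm_def by (rule SUP_weight_le_iff[OF assms])

lemma E_norm_le_iff:
  assumes "B \<ge> 0"
  shows "E_norm \<omega> L n \<phi> \<le> ennreal B \<longleftrightarrow> (\<forall>\<alpha>. \<forall>x\<in>L. cmod (mderiv_ext L \<alpha> \<phi> x) \<le> B * Mw \<omega> n (mabs \<alpha>))"
  unfolding E_norm_def SUP_weight_le_iff[OF assms] using assms by (simp add: SUP_le_iff)

text \<open>Regularity makes every point of L a limit point of the interior, so that
  \<open>Lim\<close> picks the value of the continuous extension, also on the boundary.\<close>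

lemma mderiv_ext_eq:
  assumes L: "regular_compact L" and g: "continuous_on L g" "\<And>y. y \<in> interior L \<Longrightarrow> g y = mderiv \<alpha> \<phi> y" and x: "x \<in> L"
  shows "mderiv_ext L \<alpha> \<phi> x = g x"
proof -
  have "x \<in> closure (interior L)" using L x unfolding regular_compact_def by simp
  then have "x islimpt interior L"
    by (metis open_interior interior_limit_point closure_def UnE mem_Collect_eq islimpt_subset interior_interior)
  then have nt: "at x within interior L \<noteq> bot" by (simp add: trivial_limit_within)
  have "(g \<longlongrightarrow> g x) (at x within interior L)"
    using g(1) x interior_subset unfolding continuous_on_def by (meson tendsto_within_subset)
  then have "(mderiv \<alpha> \<phi> \<longlongrightarrow> g x) (at x within interior L)"
    by (rule Lim_transform_eventually) (use g(2) in \<open>auto simp: eventually_at_filter\<close>)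
  then show ?thesis unfolding mderiv_ext_def using tendsto_Lim[OF nt] by blast
qed

text \<open>The extension is continuous and the interior is dense in L, so the supremum over L is
  the one over the interior. Later estimates can therefore avoid boundary values.\<close>

lemma E_norm_le_iff_interior:
  assumes L: "regular_compact L" and \<phi>: "\<phi> \<in> C_infinity L" and B: "B \<ge> 0"
  shows "E_norm \<omega> L n \<phi> \<le> ennreal B \<longleftrightarrow> (deriv_bounded \<omega> n (interior L) B \<phi>)"
proof -
  have "(\<forall>x\<in>L. cmod (mderiv_ext L \<alpha> \<phi> x) \<le> c) \<longleftrightarrow> (\<forall>x\<in>interior L. cmod (mderiv \<alpha> \<phi> x) \<le> c)" for \<alpha> c
  proof -
    obtain g where g: "continuous_on L g" "\<And>y. y \<in> interior L \<Longrightarrow> g y = mderiv \<alpha> \<phi> y"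
      using \<phi> unfolding C_infinity_def by blast
    have eq: "mderiv_ext L \<alpha> \<phi> x = g x" if "x \<in> L" for x by (rule mderiv_ext_eq[OF L g that])
    have cl: "closure (interior L) = L" using L unfolding regular_compact_def by simp
    show ?thesis
    proof safe
      fix x assume "\<forall>x\<in>L. cmod (mderiv_ext L \<alpha> \<phi> x) \<le> c" "x \<in> interior L"
      then show "cmod (mderiv \<alpha> \<phi> x) \<le> c" using eq[of x] g(2)[of x] interior_subset by fastforce
    next
      fix x assume a: "\<forall>x\<in>interior L. cmod (mderiv \<alpha> \<phi> x) \<le> c" and x: "x \<in> L"
      have "norm (g x) \<le> c"
        by (rule continuous_on_closure_norm_le[of "interior L" g]) (use g a x in \<open>auto simp: cl\<close>)
      then show "cmod (mderiv_ext L \<alpha> \<phi> x) \<le> c" using eq[OF x] by simp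
    qed
  qed
  then show ?thesis unfolding E_norm_le_iff[OF B] by simp
qed

lemma ennreal_less_top_iff_bound: "(x::ennreal) < \<infinity> \<longleftrightarrow> (\<exists>B\<ge>0. x \<le> ennreal B)"
  by (metis ennreal_cases ennreal_less_top infinity_ennreal_def le_less_trans order_refl less_irrefl)

lemma E_step_iff:
  assumes L: "regular_compact L"
  shows "\<phi> \<in> E_step \<omega> L n \<longleftrightarrow> \<phi> \<in> C_infinity L \<and>
     (\<exists>B\<ge>0. deriv_bounded \<omega> n (interior L) B \<phi>)"
  unfolding E_step_def ennreal_less_top_iff_bound using E_norm_le_iff_interior[OF L, of \<phi> _ \<omega> n] by auto

lemma E_compact_iff:
  assumes L: "regular_compact L"
  shows "\<phi> \<in> E_compact \<omega> L \<longleftrightarrow> \<phi> \<in> C_infinity L \<and>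
     (\<exists>n\<ge>1. \<exists>B\<ge>0. deriv_bounded \<omega> n (interior L) B \<phi>)"
  unfolding E_compact_def indlim_def using E_step_iff[OF L] by auto

lemma mderiv_add:
  fixes f g :: "real^'d::finite \<Rightarrow> complex"
  assumes "open U" "smooth_on U f" "smooth_on U g" "x \<in> U"
  shows "mderiv \<alpha> (\<lambda>x. f x + g x) x = mderiv \<alpha> f x + mderiv \<alpha> g x"
  unfolding mderiv_mlist by (rule foldr_partial_deriv_add[OF assms])

lemma mderiv_cmult:
  fixes f :: "real^'d::finite \<Rightarrow> complex"
  assumes "open U" "smooth_on U f" "x \<in> U"
  shows "mderiv \<alpha> (\<lambda>x. c * f x) x = c * mderiv \<alpha> f x"
  unfolding mderiv_mlist by (rule foldr_partial_deriv_cmult[OF assms])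

lemma mderiv_cong:
  fixes f :: "real^'d::finite \<Rightarrow> complex"
  assumes "open U" "\<And>x. x \<in> U \<Longrightarrow> f x = g x" "x \<in> U"
  shows "mderiv \<alpha> f x = mderiv \<alpha> g x"
  unfolding mderiv_mlist by (rule foldr_partial_deriv_cong[OF assms])

lemma mderiv_zero: "mderiv \<alpha> (\<lambda>x::real^'d::finite. 0 :: complex) = (\<lambda>x. 0)"
  unfolding mderiv_mlist by (rule foldr_partial_deriv_zero)

lemma continuous_on_mderiv: "smooth_on U f \<Longrightarrow> continuous_on U (mderiv \<alpha> f)"
  unfolding mderiv_mlist by (rule smooth_on_continuous_foldr)

lemma function_space_C_infinity: "function_space (C_infinity L)"
  unfolding function_space_def
proof (intro conjI ballI allI)
  show "(\<lambda>x. 0) \<in> C_infinity L"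
    unfolding C_infinity_def by (auto simp: smooth_on_zero mderiv_zero intro!: exI[of _ "\<lambda>x. 0"])
next
  fix \<phi> \<psi> assume a: "\<phi> \<in> C_infinity L" "\<psi> \<in> C_infinity L"
  show "(\<lambda>x. \<phi> x + \<psi> x) \<in> C_infinity L"
    unfolding C_infinity_def
  proof (intro CollectI conjI allI impI)
    show "smooth_on (interior L) (\<lambda>x. \<phi> x + \<psi> x)"
      by (rule smooth_on_add) (use a in \<open>auto simp: C_infinity_def\<close>)
    fix \<alpha>
    obtain g h where "continuous_on L g" "\<forall>x\<in>interior L. g x = mderiv \<alpha> \<phi> x"
      "continuous_on L h" "\<forall>x\<in>interior L. h x = mderiv \<alpha> \<psi> x" using a unfolding C_infinity_def by blast
    then show "\<exists>g. continuous_on L g \<and> (\<forall>x\<in>interior L. g x = mderiv \<alpha> (\<lambda>x. \<phi> x + \<psi> x) x)"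
      using a by (intro exI[of _ "\<lambda>x. g x + h x"])
        (auto intro!: continuous_intros mderiv_add[symmetric, OF open_interior] simp: C_infinity_def
          mderiv_add[OF open_interior])
  qed (use a in \<open>auto simp: C_infinity_def\<close>)
next
  fix c \<phi> assume a: "\<phi> \<in> C_infinity L"
  show "(\<lambda>x. c * \<phi> x) \<in> C_infinity L"
    unfolding C_infinity_def
  proof (intro CollectI conjI allI impI)
    show "smooth_on (interior L) (\<lambda>x. c * \<phi> x)"
      by (rule smooth_on_cmult) (use a in \<open>auto simp: C_infinity_def\<close>)
    fix \<alpha>
    obtain g where "continuous_on L g" "\<forall>x\<in>interior L. g x = mderiv \<alpha> \<phi> x" using a unfolding C_infinity_def by blast
    then show "\<exists>g. continuous_on L g \<and> (\<forall>x\<in>interior L. g x = mderiv \<alpha> (\<lambda>x. c * \<phi> x) x)"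
      using a by (intro exI[of _ "\<lambda>x. c * g x"])
        (auto intro!: continuous_intros simp: C_infinity_def mderiv_cmult[OF open_interior])
  qed (use a in \<open>auto simp: C_infinity_def\<close>)
qed

lemma function_space_E_compact:
  assumes w: "weight_function \<omega>" and L: "regular_compact L"
  shows "function_space (E_compact \<omega> L)"
  unfolding function_space_def
proof (intro conjI ballI allI)
  note C = function_space_C_infinity[of L, unfolded function_space_def]
  show "(\<lambda>x. 0) \<in> E_compact \<omega> L"
    unfolding E_compact_iff[OF L] using C by (intro conjI exI[of _ 1] exI[of _ 0]) (simp_all add: mderiv_zero)
  fix \<phi> assume \<phi>: "\<phi> \<in> E_compact \<omega> L"
  then obtain n B where nB: "n \<ge> 1" "B \<ge> 0" "\<And>\<alpha> x. x\<in>interior L \<Longrightarrow> cmod (mderiv \<alpha> \<phi> x) \<le> B * Mw \<omega> n (mabs \<alpha>)"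
    unfolding E_compact_iff[OF L] by blast
  have \<phi>C: "\<phi> \<in> C_infinity L" "smooth_on (interior L) \<phi>" using \<phi> unfolding E_compact_iff[OF L] C_infinity_def by auto
  { fix \<psi> assume \<psi>: "\<psi> \<in> E_compact \<omega> L"
    then obtain n' B' where nB': "n' \<ge> 1" "B' \<ge> 0" "\<And>\<alpha> x. x\<in>interior L \<Longrightarrow> cmod (mderiv \<alpha> \<psi> x) \<le> B' * Mw \<omega> n' (mabs \<alpha>)"
      unfolding E_compact_iff[OF L] by blast
    have \<psi>C: "\<psi> \<in> C_infinity L" "smooth_on (interior L) \<psi>" using \<psi> unfolding E_compact_iff[OF L] C_infinity_def by auto
    have "cmod (mderiv \<alpha> (\<lambda>x. \<phi> x + \<psi> x) x) \<le> (B + B') * Mw \<omega> (max n n') (mabs \<alpha>)" if x: "x \<in> interior L" for \<alpha> x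
    proof -
      have "cmod (mderiv \<alpha> (\<lambda>x. \<phi> x + \<psi> x) x) \<le> cmod (mderiv \<alpha> \<phi> x) + cmod (mderiv \<alpha> \<psi> x)"
        using mderiv_add[OF open_interior \<phi>C(2) \<psi>C(2) x] norm_triangle_ineq by metis
      also have "\<dots> \<le> B * Mw \<omega> n (mabs \<alpha>) + B' * Mw \<omega> n' (mabs \<alpha>)" using nB(3) nB'(3) x by (intro add_mono) auto
      also have "\<dots> \<le> B * Mw \<omega> (max n n') (mabs \<alpha>) + B' * Mw \<omega> (max n n') (mabs \<alpha>)"
        using nB nB' by (intro add_mono mult_left_mono Mw_mono_n[OF w]) auto
      finally show ?thesis by (simp add: distrib_right)
    qed
    then show "(\<lambda>x. \<phi> x + \<psi> x) \<in> E_compact \<omega> L"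
      unfolding E_compact_iff[OF L] using C \<phi>C(1) \<psi>C(1) nB nB'
      by (intro conjI exI[of _ "max n n'"] exI[of _ "B + B'"]) auto }
  { fix c
    have "cmod (mderiv \<alpha> (\<lambda>x. c * \<phi> x) x) \<le> (cmod c * B) * Mw \<omega> n (mabs \<alpha>)" if x: "x \<in> interior L" for \<alpha> x
      using mderiv_cmult[OF open_interior \<phi>C(2) x, of \<alpha> c] nB(3)[OF x, of \<alpha>]
      by (simp add: norm_mult mult.assoc mult_left_mono)
    then show "(\<lambda>x. c * \<phi> x) \<in> E_compact \<omega> L"
      unfolding E_compact_iff[OF L] using C \<phi>C(1) nB
      by (intro conjI exI[of _ n] exI[of _ "cmod c * B"]) auto }
qed

lemma E_compact_seminorm_bound:
  assumes L: "regular_compact L" and p: "p \<in> E_compact_seminorms \<omega> L" and n: "n \<ge> 1"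
  shows "\<exists>C\<ge>0. \<forall>\<phi>\<in>C_infinity L. \<forall>B\<ge>0. (deriv_bounded \<omega> n (interior L) B \<phi>) \<longrightarrow> p \<phi> \<le> C * B"
proof -
  obtain C :: real where C: "\<And>\<phi>. \<phi> \<in> E_step \<omega> L n \<Longrightarrow> ennreal (p \<phi>) \<le> ennreal C * E_norm \<omega> L n \<phi>"
    using p n unfolding E_compact_seminorms_def indlim_seminorms_def by blast
  \<comment> \<open>The constant in \<open>indlim_seminorms\<close> may be negative, in which case
    \<open>ennreal C\<close> is 0.\<close>
  have "p \<phi> \<le> max C 0 * B" if \<phi>: "\<phi> \<in> C_infinity L" "B \<ge> 0"
    "deriv_bounded \<omega> n (interior L) B \<phi>" for \<phi> B
  proof -
    have "\<phi> \<in> E_step \<omega> L n" using \<phi> unfolding E_step_iff[OF L] by blast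
    then have "ennreal (p \<phi>) \<le> ennreal C * E_norm \<omega> L n \<phi>" by (rule C)
    also have "\<dots> \<le> ennreal (max C 0) * ennreal B"
      using E_norm_le_iff_interior[OF L \<phi>(1,2), of \<omega> n] \<phi>(3) by (intro mult_mono) (auto intro: ennreal_leI)
    also have "\<dots> = ennreal (max C 0 * B)" using \<phi>(2) by (simp add: ennreal_mult)
    finally show ?thesis using \<phi>(2) by (simp add: ennreal_le_iff)
  qed
  then show ?thesis by (intro exI[of _ "max C 0"]) auto
qed

lemma E_compact_seminormI:
  assumes L: "regular_compact L" and s: "seminorm_on (E_compact \<omega> L) p"
    and b: "\<And>n. n \<ge> 1 \<Longrightarrow> \<exists>C\<ge>0. \<forall>\<phi>\<in>C_infinity L. \<forall>B\<ge>0. (deriv_bounded \<omega> n (interior L) B \<phi>) \<longrightarrow> p \<phi> \<le> C * B"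
  shows "p \<in> E_compact_seminorms \<omega> L"
  unfolding E_compact_seminorms_def indlim_seminorms_def
proof (intro CollectI conjI allI impI)
  show "seminorm_on (indlim (E_step \<omega> L)) p" using s by (simp add: E_compact_def)
  fix n :: nat assume n: "1 \<le> n"
  from b[OF n] obtain C where C: "C \<ge> 0" "\<And>\<phi> B. \<phi>\<in>C_infinity L \<Longrightarrow> B\<ge>0 \<Longrightarrow> (deriv_bounded \<omega> n (interior L) B \<phi>) \<Longrightarrow> p \<phi> \<le> C * B"
    by blast
  have "ennreal (p \<phi>) \<le> ennreal C * E_norm \<omega> L n \<phi>" if \<phi>: "\<phi> \<in> E_step \<omega> L n" for \<phi>
  proof -
    have \<phi>C: "\<phi> \<in> C_infinity L" using \<phi> by (simp add: E_step_def)
    obtain B where B: "B \<ge> 0" "E_norm \<omega> L n \<phi> = ennreal B"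
      using \<phi> unfolding E_step_def by (cases "E_norm \<omega> L n \<phi>") auto
    then have "p \<phi> \<le> C * B" using E_norm_le_iff_interior[OF L \<phi>C B(1), of \<omega> n] by (intro C(2)[OF \<phi>C]) auto
    then show ?thesis using B C(1) by (simp add: ennreal_leI flip: ennreal_mult)
  qed
  then show "\<exists>C::real. \<forall>\<phi>\<in>E_step \<omega> L n. ennreal (p \<phi>) \<le> ennreal C * E_norm \<omega> L n \<phi>" by blast
qed

section \<open>Open sets\<close>

lemma exhaustion_interior:
  assumes "open \<Omega>" shows "(\<Union>N. interior (some_exhaustion \<Omega> N)) = \<Omega>"
    and "mono (\<lambda>N. interior (some_exhaustion \<Omega> N))"
    and "regular_compact (some_exhaustion \<Omega> N)" and "some_exhaustion \<Omega> N \<subseteq> \<Omega>"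
proof -
  have e: "exhaustion \<Omega> (some_exhaustion \<Omega>)" by (rule exhaustion_exists[OF assms])
  then show "regular_compact (some_exhaustion \<Omega> N)" "some_exhaustion \<Omega> N \<subseteq> \<Omega>" for N
    unfolding exhaustion_def by auto
  have 1: "some_exhaustion \<Omega> N \<subseteq> interior (some_exhaustion \<Omega> (Suc N))" for N
    using e unfolding exhaustion_def by blast
  then show "mono (\<lambda>N. interior (some_exhaustion \<Omega> N))"
    unfolding mono_iff_le_Suc using interior_subset by blast
  show "(\<Union>N. interior (some_exhaustion \<Omega> N)) = \<Omega>"
  proof
    show "(\<Union>N. interior (some_exhaustion \<Omega> N)) \<subseteq> \<Omega>"
      using e interior_subset unfolding exhaustion_def by blast
    have "\<Omega> = (\<Union>N. some_exhaustion \<Omega> N)" using e unfolding exhaustion_def by blast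
    also have "\<dots> \<subseteq> (\<Union>N. interior (some_exhaustion \<Omega> N))" using 1 by blast
    finally show "\<Omega> \<subseteq> (\<Union>N. interior (some_exhaustion \<Omega> N))" .
  qed
qed

lemma compact_subset_exhaustion:
  assumes "open \<Omega>" "compact D" "D \<subseteq> \<Omega>"
  shows "\<exists>N. D \<subseteq> interior (some_exhaustion \<Omega> N)"
proof -
  obtain C where C: "finite C" "D \<subseteq> (\<Union>N\<in>C. interior (some_exhaustion \<Omega> N))"
    using compactE_image[OF assms(2), of UNIV "\<lambda>N. interior (some_exhaustion \<Omega> N)"] exhaustion_interior(1)[OF assms(1)] assms(3)
    by (metis open_interior)
  have "(\<Union>N\<in>C. interior (some_exhaustion \<Omega> N)) \<subseteq> interior (some_exhaustion \<Omega> (Max (insert 0 C)))"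
  proof (rule UN_least)
    fix N assume "N \<in> C"
    then have "N \<le> Max (insert 0 C)" using C(1) by simp
    from monoD[OF exhaustion_interior(2)[OF assms(1)] this]
    show "interior (some_exhaustion \<Omega> N) \<subseteq> interior (some_exhaustion \<Omega> (Max (insert 0 C)))" .
  qed
  then show ?thesis using C(2) by blast
qed

text \<open>Every compact subset of \<Omega> lies in the interior of some member of the exhaustion,
  so membership does not depend on the exhaustion chosen by \<open>SOME\<close>.\<close>

lemma E_open_iff:
  fixes \<Omega> :: "(real^'d::finite) set"
  assumes \<Omega>: "open \<Omega>"
  shows "\<phi> \<in> E_open \<omega> \<Omega> \<longleftrightarrow> (\<forall>x. x \<notin> \<Omega> \<longrightarrow> \<phi> x = 0) \<and> smooth_on \<Omega> \<phi> \<and>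
     (\<forall>D. compact D \<and> D \<subseteq> \<Omega> \<longrightarrow> (\<exists>n\<ge>1. \<exists>B\<ge>0. deriv_bounded \<omega> n D B \<phi>))"
    (is "_ \<longleftrightarrow> ?z \<and> ?s \<and> ?b")
proof -
  let ?L = "some_exhaustion \<Omega>"
  let ?r = "\<lambda>N. restrict0 (interior (?L N)) \<phi>"
  note ex = exhaustion_interior[OF \<Omega>]
  have cong: "mderiv \<alpha> (?r N) x = mderiv \<alpha> \<phi> x" if "x \<in> interior (?L N)" for \<alpha> N x
    by (rule mderiv_cong[OF open_interior _ that]) (simp add: restrict0_def)
  show ?thesis
  proof
    assume a: "\<phi> \<in> E_open \<omega> \<Omega>"
    have c: "?r N \<in> E_compact \<omega> (?L N)" for N using a unfolding E_open_def by blast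
    have sm: "smooth_on (interior (?L N)) \<phi>" for N
      by (rule smooth_on_cong[of _ "?r N"]) (use c[of N] in \<open>auto simp: E_compact_iff[OF ex(3)] C_infinity_def restrict0_def\<close>)
    have ?s unfolding smooth_on_def
    proof (intro allI conjI ballI)
      fix js
      have "continuous_on (\<Union>N. interior (?L N)) (foldr partial_deriv js \<phi>)"
        by (rule continuous_on_open_UN) (use sm smooth_on_continuous_foldr in auto)
      then show "continuous_on \<Omega> (foldr partial_deriv js \<phi>)" by (simp add: ex(1))
      fix x i assume "x \<in> \<Omega>"
      then obtain N where "x \<in> interior (?L N)" using ex(1) by blast
      then show "(\<lambda>t. foldr partial_deriv js \<phi> (x + t *\<^sub>R axis i 1)) differentiable at 0"
        using sm[of N] unfolding smooth_on_def by blast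
    qed
    moreover have ?b
    proof (intro allI impI)
      fix D assume D: "compact D \<and> D \<subseteq> \<Omega>"
      then obtain N where N: "D \<subseteq> interior (?L N)" using compact_subset_exhaustion[OF \<Omega>] by blast
      obtain n B where "n \<ge> 1" "B \<ge> 0" "\<And>\<alpha> x. x\<in>interior (?L N) \<Longrightarrow> cmod (mderiv \<alpha> (?r N) x) \<le> B * Mw \<omega> n (mabs \<alpha>)"
        using c[of N] unfolding E_compact_iff[OF ex(3)] by blast
      then show "\<exists>n\<ge>1. \<exists>B\<ge>0. deriv_bounded \<omega> n D B \<phi>"
        using N cong by (intro exI[of _ n] exI[of _ B] conjI allI ballI) (auto simp: subset_iff)
    qed
    ultimately show "?z \<and> ?s \<and> ?b" using a unfolding E_open_def by blast
  next
    assume a: "?z \<and> ?s \<and> ?b"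
    have "?r N \<in> E_compact \<omega> (?L N)" for N
      unfolding E_compact_iff[OF ex(3)]
    proof
      show "?r N \<in> C_infinity (?L N)"
        unfolding C_infinity_def
      proof (intro CollectI conjI allI impI)
        show "smooth_on (interior (?L N)) (?r N)"
          by (rule smooth_on_cong[of _ \<phi>]) (use a ex(4)[of N] interior_subset in \<open>auto simp: restrict0_def intro: smooth_on_subset\<close>)
        fix \<alpha>
        show "\<exists>g. continuous_on (?L N) g \<and> (\<forall>x\<in>interior (?L N). g x = mderiv \<alpha> (?r N) x)"
          using a ex(4)[of N] cong by (intro exI[of _ "mderiv \<alpha> \<phi>"]) (auto intro: continuous_on_subset continuous_on_mderiv)
      qed (simp add: restrict0_def)
      have L: "compact (?L N) \<and> ?L N \<subseteq> \<Omega>" using ex(3,4) unfolding regular_compact_def by blast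
      from a have b: ?b by (elim conjE)
      from b[rule_format, OF L] obtain n B where "n \<ge> 1" "B \<ge> 0" "\<forall>\<alpha>. \<forall>x\<in>?L N. cmod (mderiv \<alpha> \<phi> x) \<le> B * Mw \<omega> n (mabs \<alpha>)"
        by (elim exE conjE)
      then show "\<exists>n\<ge>1. \<exists>B\<ge>0. \<forall>\<alpha>. \<forall>x\<in>interior (?L N). cmod (mderiv \<alpha> (?r N) x) \<le> B * Mw \<omega> n (mabs \<alpha>)"
        using cong interior_subset[of "?L N"] by (intro exI[of _ n] exI[of _ B]) (auto simp: subset_iff)
    qed
    then show "\<phi> \<in> E_open \<omega> \<Omega>" using a unfolding E_open_def by blast
  qed
qed

lemma restrict0_add: "restrict0 S (\<lambda>x. \<phi> x + \<psi> x) = (\<lambda>x. restrict0 S \<phi> x + (restrict0 S \<psi> x :: complex))"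
  and restrict0_cmult: "restrict0 S (\<lambda>x. c * \<phi> x) = (\<lambda>x. c * (restrict0 S \<phi> x :: complex))"
  and restrict0_zero: "restrict0 S (\<lambda>x. 0) = (\<lambda>x. 0 :: complex)"
  by (auto simp: restrict0_def)

lemma function_space_E_open:
  assumes w: "weight_function \<omega>" and \<Omega>: "open \<Omega>"
  shows "function_space (E_open \<omega> \<Omega>)"
  using function_space_E_compact[OF w exhaustion_interior(3)[OF \<Omega>]]
  unfolding function_space_def E_open_def by (auto simp: restrict0_add restrict0_cmult restrict0_zero)

lemma seminorm_E_open:
  assumes p: "p \<in> E_open_seminorms \<omega> \<Omega>"
  shows "seminorm_on (E_open \<omega> \<Omega>) p"
proof -
  obtain N q where q: "p = (\<lambda>\<phi>. q (restrict0 (interior (some_exhaustion \<Omega> N)) \<phi>))"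
    "q \<in> E_compact_seminorms \<omega> (some_exhaustion \<Omega> N)" using p unfolding E_open_seminorms_def by blast
  then have "seminorm_on (E_compact \<omega> (some_exhaustion \<Omega> N)) q"
    unfolding E_compact_seminorms_def indlim_seminorms_def E_compact_def by blast
  then show ?thesis unfolding seminorm_on_def q(1) E_open_def
    by (simp add: restrict0_add restrict0_cmult)
qed

lemma E_open_seminorm_bound:
  assumes \<Omega>: "open \<Omega>" and p: "p \<in> E_open_seminorms \<omega> \<Omega>" and n: "n \<ge> 1"
  shows "\<exists>C\<ge>0. \<exists>D. compact D \<and> D \<subseteq> \<Omega> \<and> (\<forall>\<phi>\<in>E_open \<omega> \<Omega>. \<forall>B\<ge>0. (deriv_bounded \<omega> n D B \<phi>) \<longrightarrow> p \<phi> \<le> C * B)"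
proof -
  obtain N q where q: "p = (\<lambda>\<phi>. q (restrict0 (interior (some_exhaustion \<Omega> N)) \<phi>))"
    "q \<in> E_compact_seminorms \<omega> (some_exhaustion \<Omega> N)" using p unfolding E_open_seminorms_def by blast
  let ?L = "some_exhaustion \<Omega> N"
  have L: "regular_compact ?L" by (rule exhaustion_interior(3)[OF \<Omega>])
  obtain C where C: "C \<ge> 0" "\<And>\<phi> B. \<phi>\<in>C_infinity ?L \<Longrightarrow> B\<ge>0 \<Longrightarrow> (deriv_bounded \<omega> n (interior ?L) B \<phi>) \<Longrightarrow> q \<phi> \<le> C * B"
    using E_compact_seminorm_bound[OF L q(2) n] by blast
  have "p \<phi> \<le> C * B" if \<phi>: "\<phi> \<in> E_open \<omega> \<Omega>" "B \<ge> 0" "deriv_bounded \<omega> n ?L B \<phi>" for \<phi> B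
    unfolding q(1)
  proof (rule C(2)[OF _ \<phi>(2)])
    show "restrict0 (interior ?L) \<phi> \<in> C_infinity ?L"
      using \<phi>(1) unfolding E_open_def E_compact_iff[OF exhaustion_interior(3)[OF \<Omega>]] by blast
    have "mderiv \<alpha> (restrict0 (interior ?L) \<phi>) x = mderiv \<alpha> \<phi> x" if "x \<in> interior ?L" for \<alpha> x
      by (rule mderiv_cong[OF open_interior _ that]) (simp add: restrict0_def)
    then show "deriv_bounded \<omega> n (interior ?L) B (restrict0 (interior ?L) \<phi>)"
      using \<phi>(3) interior_subset[of ?L] by (auto simp: subset_iff)
  qed
  then show ?thesis using C(1) L exhaustion_interior(4)[OF \<Omega>, of N] unfolding regular_compact_def by blast
qed

text \<open>Finitely many seminorms control g, and D is the union of the compact sets on which they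
  live. As in any inductive limit the constant depends on the step n.\<close>

lemma E_dual_bound:
  assumes w: "weight_function \<omega>" and \<Omega>: "open \<Omega>" and g: "g \<in> E_dual \<omega> \<Omega>" and n: "n \<ge> 1"
  shows "\<exists>C\<ge>0. \<exists>D. compact D \<and> D \<subseteq> \<Omega> \<and> (\<forall>\<phi>\<in>E_open \<omega> \<Omega>. \<forall>B\<ge>0. (deriv_bounded \<omega> n D B \<phi>) \<longrightarrow> cmod (g \<phi>) \<le> C * B)"
proof -
  obtain F C where F: "finite F" "F \<subseteq> E_open_seminorms \<omega> \<Omega>" "C \<ge> 0" "\<And>\<phi>. \<phi> \<in> E_open \<omega> \<Omega> \<Longrightarrow> cmod (g \<phi>) \<le> C * (\<Sum>p\<in>F. p \<phi>)"
    using lc_dual_bound[OF function_space_E_open[OF w \<Omega>] seminorm_E_open g[unfolded E_dual_def]] by blast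
  define Q where "Q p c D \<longleftrightarrow> c \<ge> 0 \<and> compact D \<and> D \<subseteq> \<Omega> \<and> (\<forall>\<phi>\<in>E_open \<omega> \<Omega>. \<forall>B\<ge>0. (deriv_bounded \<omega> n D B \<phi>) \<longrightarrow> p \<phi> \<le> c * B)" for p c D
  have "\<exists>c D. Q p c D" if "p \<in> F" for p
  proof -
    have "p \<in> E_open_seminorms \<omega> \<Omega>" using that F(2) by blast
    from E_open_seminorm_bound[OF \<Omega> this n] show ?thesis unfolding Q_def by (elim exE conjE) (intro exI conjI)
  qed
  then obtain c D where Q: "\<And>p. p \<in> F \<Longrightarrow> Q p (c p) (D p)" by metis
  have cD: "c p \<ge> 0" "compact (D p)" "D p \<subseteq> \<Omega>" if "p \<in> F" for p
    using Q[OF that] unfolding Q_def by auto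
  have cD': "p \<phi> \<le> c p * B" if "p \<in> F" "\<phi> \<in> E_open \<omega> \<Omega>" "B \<ge> 0"
    "\<forall>\<alpha>. \<forall>x\<in>D p. cmod (mderiv \<alpha> \<phi> x) \<le> B * Mw \<omega> n (mabs \<alpha>)" for p \<phi> B
    using Q[OF that(1)] that(2-) unfolding Q_def by simp
  have "cmod (g \<phi>) \<le> (C * (\<Sum>p\<in>F. c p)) * B" if \<phi>: "\<phi>\<in>E_open \<omega> \<Omega>" "B\<ge>0" "\<forall>\<alpha>. \<forall>x\<in>\<Union>(D ` F). cmod (mderiv \<alpha> \<phi> x) \<le> B * Mw \<omega> n (mabs \<alpha>)" for \<phi> B
  proof -
    have "cmod (g \<phi>) \<le> C * (\<Sum>p\<in>F. p \<phi>)" by (rule F(4)[OF \<phi>(1)])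
    also have "\<dots> \<le> C * (\<Sum>p\<in>F. c p * B)"
      using \<phi> F(3) by (intro mult_left_mono sum_mono cD') auto
    finally show ?thesis by (simp add: sum_distrib_right mult.assoc)
  qed
  moreover have "compact (\<Union>(D ` F))" "\<Union>(D ` F) \<subseteq> \<Omega>" using F(1) cD by (auto intro!: compact_UN)
  moreover have "C * (\<Sum>p\<in>F. c p) \<ge> 0" using F(3) cD by (auto intro!: mult_nonneg_nonneg sum_nonneg)
  ultimately show ?thesis by (intro exI conjI) auto
qed

lemma restrict0_in_E_open:
  assumes "open \<Omega>" "open \<Omega>'" "\<Omega>' \<subseteq> \<Omega>" and \<phi>: "\<phi> \<in> E_open \<omega> \<Omega>"
  shows "restrict0 \<Omega>' \<phi> \<in> E_open \<omega> \<Omega>'"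
  unfolding E_open_iff[OF assms(2)]
proof (intro conjI allI impI)
  note a = \<phi>[unfolded E_open_iff[OF assms(1)]]
  show "smooth_on \<Omega>' (restrict0 \<Omega>' \<phi>)"
    by (rule smooth_on_cong[OF assms(2), of \<phi>]) (use a assms(3) in \<open>auto simp: restrict0_def intro: smooth_on_subset\<close>)
  fix D assume D: "compact D \<and> D \<subseteq> \<Omega>'"
  have D': "compact D \<and> D \<subseteq> \<Omega>" using D assms(3) by blast
  from a have "\<forall>D. compact D \<and> D \<subseteq> \<Omega> \<longrightarrow> (\<exists>n\<ge>1. \<exists>B\<ge>0. deriv_bounded \<omega> n D B \<phi>)"
    by (elim conjE)
  from this[rule_format, OF D'] obtain n B where "n \<ge> 1" "B \<ge> 0" "deriv_bounded \<omega> n D B \<phi>"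
    by (elim exE conjE)
  moreover have "mderiv \<alpha> (restrict0 \<Omega>' \<phi>) x = mderiv \<alpha> \<phi> x" if "x \<in> D" for \<alpha> x
    by (rule mderiv_cong[OF assms(2)]) (use that D in \<open>auto simp: restrict0_def\<close>)
  ultimately show "\<exists>n\<ge>1. \<exists>B\<ge>0. deriv_bounded \<omega> n D B (restrict0 \<Omega>' \<phi>)"
    by (intro exI conjI) auto
qed (simp add: restrict0_def)

section \<open>Comparison of the analytic class with the class of the weight\<close>

lemma E_open_omega1_subset:
  assumes w: "weight_function \<omega>" and \<Omega>: "open \<Omega>"
  shows "E_open omega1 \<Omega> \<subseteq> E_open \<omega> \<Omega>"
proof
  fix \<phi> assume a: "\<phi> \<in> E_open omega1 \<Omega>"
  show "\<phi> \<in> E_open \<omega> \<Omega>"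
    unfolding E_open_iff[OF \<Omega>]
  proof (intro conjI)
    show "\<forall>D. compact D \<and> D \<subseteq> \<Omega> \<longrightarrow> (\<exists>n\<ge>1. \<exists>B\<ge>0. deriv_bounded \<omega> n D B \<phi>)"
    proof (intro allI impI)
      fix D assume D: "compact D \<and> D \<subseteq> \<Omega>"
      from a[unfolded E_open_iff[OF \<Omega>]]
      have "\<forall>D. compact D \<and> D \<subseteq> \<Omega> \<longrightarrow> (\<exists>n\<ge>1. \<exists>B\<ge>0. deriv_bounded omega1 n D B \<phi>)"
        by (elim conjE)
      from this[rule_format, OF D] obtain n B where nB: "n \<ge> 1" "B \<ge> 0" "\<And>\<alpha> x. x\<in>D \<Longrightarrow> cmod (mderiv \<alpha> \<phi> x) \<le> B * Mw omega1 n (mabs \<alpha>)"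
        by blast
      obtain m C where m: "m \<ge> 1" "C > 0" "\<And>l. Mw omega1 n l \<le> C * Mw \<omega> m l"
        using Mw_omega1_le[OF w nB(1)] by blast
      have "cmod (mderiv \<alpha> \<phi> x) \<le> (B * C) * Mw \<omega> m (mabs \<alpha>)" if "x \<in> D" for \<alpha> x
        using nB(3)[OF that, of \<alpha>] mult_left_mono[OF m(3) nB(2), of "mabs \<alpha>"] by (simp add: mult.assoc)
      then show "\<exists>n\<ge>1. \<exists>B\<ge>0. deriv_bounded \<omega> n D B \<phi>"
        using m nB by (intro exI[of _ m] conjI exI[of _ "B * C"]) auto
    qed
  qed (use a[unfolded E_open_iff[OF \<Omega>]] in simp_all)
qed

text \<open>The seminorms of an inductive limit are those bounded on every step. Each analytic step
  embeds into some step for \<omega>, so bounds on the latter pass to the former; hence functionals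
  for \<omega> stay continuous on analytic functions.\<close>

lemma E_open_seminorms_omega1_supset:
  assumes w: "weight_function \<omega>" and \<Omega>: "open \<Omega>"
  shows "E_open_seminorms \<omega> \<Omega> \<subseteq> E_open_seminorms omega1 \<Omega>"
proof -
  have "E_compact_seminorms \<omega> L \<subseteq> E_compact_seminorms omega1 L" if L: "regular_compact L" for L
  proof
    fix p assume p: "p \<in> E_compact_seminorms \<omega> L"
    have sub: "E_compact omega1 L \<subseteq> E_compact \<omega> L"
    proof
      fix \<phi> assume a: "\<phi> \<in> E_compact omega1 L"
      then obtain n B where nB: "n \<ge> 1" "B \<ge> 0" "\<And>\<alpha> x. x\<in>interior L \<Longrightarrow> cmod (mderiv \<alpha> \<phi> x) \<le> B * Mw omega1 n (mabs \<alpha>)"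
        unfolding E_compact_iff[OF L] by blast
      obtain m C where m: "m \<ge> 1" "C > 0" "\<And>l. Mw omega1 n l \<le> C * Mw \<omega> m l"
        using Mw_omega1_le[OF w nB(1)] by blast
      have "cmod (mderiv \<alpha> \<phi> x) \<le> (B * C) * Mw \<omega> m (mabs \<alpha>)" if "x \<in> interior L" for \<alpha> x
        using nB(3)[OF that, of \<alpha>] mult_left_mono[OF m(3) nB(2), of "mabs \<alpha>"] by (simp add: mult.assoc)
      then show "\<phi> \<in> E_compact \<omega> L"
        using m nB a unfolding E_compact_iff[OF L] by (intro conjI exI[of _ m] exI[of _ "B * C"]) auto
    qed
    show "p \<in> E_compact_seminorms omega1 L"
    proof (rule E_compact_seminormI[OF L])
      have "seminorm_on (E_compact \<omega> L) p"
        using p unfolding E_compact_seminorms_def indlim_seminorms_def E_compact_def by blast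
      then show "seminorm_on (E_compact omega1 L) p" using sub unfolding seminorm_on_def by blast
      fix n :: nat assume n: "n \<ge> 1"
      obtain m C where m: "m \<ge> 1" "C > 0" "\<And>l. Mw omega1 n l \<le> C * Mw \<omega> m l"
        using Mw_omega1_le[OF w n] by blast
      obtain c where c: "c \<ge> 0" "\<And>\<phi> B. \<phi>\<in>C_infinity L \<Longrightarrow> B\<ge>0 \<Longrightarrow> (deriv_bounded \<omega> m (interior L) B \<phi>) \<Longrightarrow> p \<phi> \<le> c * B"
        using E_compact_seminorm_bound[OF L p m(1)] by blast
      have "p \<phi> \<le> (c * C) * B" if \<phi>: "\<phi> \<in> C_infinity L" "B \<ge> 0" "deriv_bounded omega1 n (interior L) B \<phi>" for \<phi> B
      proof -
        have "cmod (mderiv \<alpha> \<phi> x) \<le> (B * C) * Mw \<omega> m (mabs \<alpha>)" if "x \<in> interior L" for \<alpha> x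
          using \<phi>(3)[rule_format, OF that, of \<alpha>] mult_left_mono[OF m(3) \<phi>(2), of "mabs \<alpha>"] by (simp add: mult.assoc)
        then have "p \<phi> \<le> c * (B * C)" using \<phi> m by (intro c(2)) auto
        then show ?thesis by (simp add: ac_simps)
      qed
      then show "\<exists>C\<ge>0. \<forall>\<phi>\<in>C_infinity L. \<forall>B\<ge>0. (deriv_bounded omega1 n (interior L) B \<phi>) \<longrightarrow> p \<phi> \<le> C * B"
        using c(1) m(2) by (intro exI[of _ "c * C"]) auto
    qed
  qed
  from this[OF exhaustion_interior(3)[OF \<Omega>]] show ?thesis unfolding E_open_seminorms_def by blast
qed

lemma restrict0_E_dual_omega1:
  assumes w: "weight_function \<omega>" and \<Omega>: "open \<Omega>" and h: "h \<in> E_dual \<omega> \<Omega>"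
  shows "restrict0 (E_open omega1 \<Omega>) h \<in> E_dual omega1 \<Omega>"
  unfolding E_dual_def
  by (rule lc_dual_restrict[OF function_space_E_open[OF w \<Omega>] seminorm_E_open
      function_space_E_open[OF weight_function_omega1 \<Omega>] seminorm_E_open
      E_open_omega1_subset[OF w \<Omega>] E_open_seminorms_omega1_supset[OF w \<Omega>] h[unfolded E_dual_def]])

lemma restrict0_E_dual_carried_omega1:
  assumes w: "weight_function \<omega>" and h: "h \<in> E_dual_carried \<omega> K"
  shows "restrict0 (E_open omega1 UNIV) h \<in> E_dual_carried omega1 K"
  unfolding E_dual_carried_def
proof (intro CollectI conjI allI impI)
  show "restrict0 (E_open omega1 UNIV) h \<in> E_dual omega1 UNIV"
    using h by (intro restrict0_E_dual_omega1[OF w]) (auto simp: E_dual_carried_def)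
  fix \<Omega> assume \<Omega>: "open \<Omega> \<and> K \<subseteq> \<Omega>"
  from h have "\<forall>\<Omega>. open \<Omega> \<and> K \<subseteq> \<Omega> \<longrightarrow> (\<exists>g \<in> E_dual \<omega> \<Omega>. \<forall>\<phi> \<in> E_open \<omega> UNIV. g (restrict0 \<Omega> \<phi>) = h \<phi>)"
    unfolding E_dual_carried_def by (elim CollectE conjE)
  from this[rule_format, OF \<Omega>] obtain g where g: "g \<in> E_dual \<omega> \<Omega>" "\<And>\<phi>. \<phi> \<in> E_open \<omega> UNIV \<Longrightarrow> g (restrict0 \<Omega> \<phi>) = h \<phi>"
    by blast
  have "restrict0 (E_open omega1 \<Omega>) g (restrict0 \<Omega> \<phi>) = restrict0 (E_open omega1 UNIV) h \<phi>" if \<phi>: "\<phi> \<in> E_open omega1 UNIV" for \<phi>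
    using g(2)[of \<phi>] \<phi> restrict0_in_E_open[of UNIV \<Omega> \<phi> omega1] E_open_omega1_subset[OF w, of UNIV] \<Omega>
    by (auto simp: restrict0_def[of "E_open omega1 \<Omega>"] restrict0_def[of "E_open omega1 UNIV"])
  then show "\<exists>g\<in>E_dual omega1 \<Omega>. \<forall>\<phi>\<in>E_open omega1 UNIV. g (restrict0 \<Omega> \<phi>) = restrict0 (E_open omega1 UNIV) h \<phi>"
    using restrict0_E_dual_omega1[OF w _ g(1)] \<Omega> by blast
qed

section \<open>Integrable ultradifferentiable functions\<close>

lemma mderiv_measurable: "smooth_on UNIV \<phi> \<Longrightarrow> mderiv \<alpha> \<phi> \<in> borel_measurable borel"
  by (rule borel_measurable_continuous_onI) (rule continuous_on_mderiv)

lemma DL1_step_iff: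
  "\<phi> \<in> DL1_step \<omega> n \<longleftrightarrow> smooth_on UNIV \<phi> \<and>
     (\<exists>B\<ge>0. \<forall>\<alpha>. L1_norm (mderiv \<alpha> \<phi>) \<le> ennreal (B * Mw \<omega> n (mabs \<alpha>)))"
    (is "_ \<longleftrightarrow> _ \<and> ?b")
proof -
  have eq: "DL1_norm \<omega> n \<phi> < \<infinity> \<longleftrightarrow> ?b"
    unfolding ennreal_less_top_iff_bound using DL1_norm_le_iff[of _ \<omega> n \<phi>] by auto
  have "integrable lborel (mderiv \<alpha> \<phi>)" if s: "smooth_on UNIV \<phi>" and b: ?b for \<alpha>
  proof (rule integrableI_bounded)
    show "mderiv \<alpha> \<phi> \<in> borel_measurable lborel" using mderiv_measurable[OF s] by simp
    from b obtain B where "L1_norm (mderiv \<alpha> \<phi>) \<le> ennreal (B * Mw \<omega> n (mabs \<alpha>))" by blast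
    also have "\<dots> < \<infinity>" by simp
    finally show "(\<integral>\<^sup>+ x. ennreal (norm (mderiv \<alpha> \<phi> x)) \<partial>lborel) < \<infinity>" .
  qed
  then show ?thesis unfolding DL1_step_def using eq by auto
qed

lemma DL1_iff:
  "\<phi> \<in> DL1 \<omega> \<longleftrightarrow> smooth_on UNIV \<phi> \<and>
     (\<exists>n\<ge>1. \<exists>B\<ge>0. \<forall>\<alpha>. L1_norm (mderiv \<alpha> \<phi>) \<le> ennreal (B * Mw \<omega> n (mabs \<alpha>)))"
  unfolding DL1_def indlim_def using DL1_step_iff[of \<phi> \<omega>] by auto

lemma function_space_DL1:
  fixes \<omega> :: "real \<Rightarrow> real"
  assumes w: "weight_function \<omega>"
  shows "function_space (DL1 \<omega> :: (real^'d::finite \<Rightarrow> complex) set)"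
  unfolding function_space_def
proof (intro conjI ballI allI)
  show "(\<lambda>x. 0) \<in> (DL1 \<omega> :: (real^'d::finite \<Rightarrow> complex) set)"
    unfolding DL1_iff by (intro conjI exI[of _ 1] exI[of _ 0]) (simp_all add: smooth_on_zero mderiv_zero)
  fix \<phi> :: "real^'d \<Rightarrow> complex" assume \<phi>: "\<phi> \<in> DL1 \<omega>"
  then obtain n B where nB: "n \<ge> 1" "B \<ge> 0" "\<And>\<alpha>. L1_norm (mderiv \<alpha> \<phi>) \<le> ennreal (B * Mw \<omega> n (mabs \<alpha>))"
    and \<phi>s: "smooth_on UNIV \<phi>" unfolding DL1_iff by blast
  { fix \<psi> :: "real^'d \<Rightarrow> complex" assume \<psi>: "\<psi> \<in> DL1 \<omega>"
    then obtain n' B' where nB': "n' \<ge> 1" "B' \<ge> 0" "\<And>\<alpha>. L1_norm (mderiv \<alpha> \<psi>) \<le> ennreal (B' * Mw \<omega> n' (mabs \<alpha>))"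
      and \<psi>s: "smooth_on UNIV \<psi>" unfolding DL1_iff by blast
    have "L1_norm (mderiv \<alpha> (\<lambda>x. \<phi> x + \<psi> x)) \<le> ennreal ((B + B') * Mw \<omega> (max n n') (mabs \<alpha>))" for \<alpha>
    proof -
      have [measurable]: "mderiv \<alpha> \<phi> \<in> borel_measurable borel" "mderiv \<alpha> \<psi> \<in> borel_measurable borel"
        using mderiv_measurable \<phi>s \<psi>s by auto
      have "L1_norm (mderiv \<alpha> (\<lambda>x. \<phi> x + \<psi> x))
          \<le> (\<integral>\<^sup>+ x. ennreal (cmod (mderiv \<alpha> \<phi> x)) + ennreal (cmod (mderiv \<alpha> \<psi> x)) \<partial>lborel)"
        by (intro nn_integral_mono)
          (simp add: mderiv_add[OF open_UNIV \<phi>s \<psi>s] norm_triangle_ineq ennreal_leI flip: ennreal_plus)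
      also have "\<dots> = L1_norm (mderiv \<alpha> \<phi>) + L1_norm (mderiv \<alpha> \<psi>)"
        by (rule nn_integral_add) auto
      also have "\<dots> \<le> ennreal (B * Mw \<omega> n (mabs \<alpha>)) + ennreal (B' * Mw \<omega> n' (mabs \<alpha>))"
        by (intro add_mono nB nB')
      also have "\<dots> = ennreal (B * Mw \<omega> n (mabs \<alpha>) + B' * Mw \<omega> n' (mabs \<alpha>))" using nB nB' by (simp add: ennreal_plus)
      also have "\<dots> \<le> ennreal (B * Mw \<omega> (max n n') (mabs \<alpha>) + B' * Mw \<omega> (max n n') (mabs \<alpha>))"
        using nB nB' by (intro ennreal_leI add_mono mult_left_mono Mw_mono_n[OF w]) auto
      finally show ?thesis by (simp add: distrib_right)
    qed
    then show "(\<lambda>x. \<phi> x + \<psi> x) \<in> DL1 \<omega>"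
      unfolding DL1_iff using smooth_on_add[OF open_UNIV \<phi>s \<psi>s] nB nB'
      by (intro conjI exI[of _ "max n n'"] exI[of _ "B + B'"]) auto }
  { fix c
    have "L1_norm (mderiv \<alpha> (\<lambda>x. c * \<phi> x)) \<le> ennreal ((cmod c * B) * Mw \<omega> n (mabs \<alpha>))" for \<alpha>
    proof -
      have [measurable]: "mderiv \<alpha> \<phi> \<in> borel_measurable borel" using mderiv_measurable \<phi>s by auto
      have "L1_norm (mderiv \<alpha> (\<lambda>x. c * \<phi> x))
          = (\<integral>\<^sup>+ x. ennreal (cmod c) * ennreal (cmod (mderiv \<alpha> \<phi> x)) \<partial>lborel)"
        by (simp add: mderiv_cmult[OF open_UNIV \<phi>s] norm_mult ennreal_mult)
      also have "\<dots> = ennreal (cmod c) * L1_norm (mderiv \<alpha> \<phi>)"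
        by (rule nn_integral_cmult) auto
      also have "\<dots> \<le> ennreal (cmod c) * ennreal (B * Mw \<omega> n (mabs \<alpha>))" by (intro mult_left_mono nB) auto
      finally show ?thesis using nB(2) by (simp add: mult.assoc flip: ennreal_mult)
    qed
    then show "(\<lambda>x. c * \<phi> x) \<in> DL1 \<omega>"
      unfolding DL1_iff using smooth_on_cmult[OF open_UNIV \<phi>s] nB
      by (intro conjI exI[of _ n] exI[of _ "cmod c * B"]) auto }
qed

lemma DL1_omega1_subset:
  assumes w: "weight_function \<omega>" shows "DL1 omega1 \<subseteq> DL1 \<omega>"
proof
  fix \<phi> :: "real^'d::finite \<Rightarrow> complex" assume a: "\<phi> \<in> DL1 omega1"
  then obtain n B where nB: "n \<ge> 1" "B \<ge> 0" "\<And>\<alpha>. L1_norm (mderiv \<alpha> \<phi>) \<le> ennreal (B * Mw omega1 n (mabs \<alpha>))"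
    unfolding DL1_iff by blast
  obtain m C where m: "m \<ge> 1" "C > 0" "\<And>l. Mw omega1 n l \<le> C * Mw \<omega> m l"
    using Mw_omega1_le[OF w nB(1)] by blast
  have "L1_norm (mderiv \<alpha> \<phi>) \<le> ennreal ((B * C) * Mw \<omega> m (mabs \<alpha>))" for \<alpha>
    by (rule order_trans[OF nB(3) ennreal_leI]) (use mult_left_mono[OF m(3) nB(2)] in \<open>simp add: mult.assoc\<close>)
  then show "\<phi> \<in> DL1 \<omega>"
    unfolding DL1_iff using a m nB by (intro conjI exI[of _ m] exI[of _ "B * C"]) (auto simp: DL1_iff)
qed

lemma B_dual_bound:
  assumes w: "weight_function \<omega>" and f: "f \<in> B_dual \<omega>" and n: "n \<ge> 1"
  shows "\<exists>C\<ge>0. \<forall>\<phi>. \<forall>B\<ge>0. smooth_on UNIV \<phi> \<and>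
    (\<forall>\<alpha>. L1_norm (mderiv \<alpha> \<phi>) \<le> ennreal (B * Mw \<omega> n (mabs \<alpha>))) \<longrightarrow> cmod (f \<phi>) \<le> C * B"
proof -
  let ?P = "indlim_seminorms (DL1_step \<omega>) (DL1_norm \<omega>)"
  have P: "seminorm_on (DL1 \<omega>) p" if "p \<in> ?P" for p using that unfolding indlim_seminorms_def DL1_def by blast
  obtain F C where F: "finite F" "F \<subseteq> ?P" "C \<ge> 0" "\<And>\<phi>. \<phi> \<in> DL1 \<omega> \<Longrightarrow> cmod (f \<phi>) \<le> C * (\<Sum>p\<in>F. p \<phi>)"
    using lc_dual_bound[OF function_space_DL1[OF w] P f[unfolded B_dual_def]] by blast
  have "\<exists>c::real. \<forall>\<phi>\<in>DL1_step \<omega> n. ennreal (p \<phi>) \<le> ennreal c * DL1_norm \<omega> n \<phi>" if "p \<in> F" for p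
    using that F(2) n unfolding indlim_seminorms_def by blast
  then obtain c :: "_ \<Rightarrow> real" where c: "\<And>p \<phi>. p \<in> F \<Longrightarrow> \<phi>\<in>DL1_step \<omega> n \<Longrightarrow> ennreal (p \<phi>) \<le> ennreal (c p) * DL1_norm \<omega> n \<phi>"
    by metis
  have "cmod (f \<phi>) \<le> (C * (\<Sum>p\<in>F. max (c p) 0)) * B"
    if B: "B \<ge> 0" and s: "smooth_on UNIV \<phi>" and b: "\<forall>\<alpha>. L1_norm (mderiv \<alpha> \<phi>) \<le> ennreal (B * Mw \<omega> n (mabs \<alpha>))" for \<phi> B
  proof -
    have st: "\<phi> \<in> DL1_step \<omega> n" using s b B unfolding DL1_step_iff by blast
    then have "\<phi> \<in> DL1 \<omega>" using n unfolding DL1_def indlim_def by auto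
    then have "cmod (f \<phi>) \<le> C * (\<Sum>p\<in>F. p \<phi>)" by (rule F(4))
    also have "\<dots> \<le> C * (\<Sum>p\<in>F. max (c p) 0 * B)"
    proof (intro mult_left_mono sum_mono F(3))
      fix p assume p: "p \<in> F"
      have "ennreal (p \<phi>) \<le> ennreal (c p) * DL1_norm \<omega> n \<phi>" by (rule c[OF p st])
      also have "\<dots> \<le> ennreal (max (c p) 0) * ennreal B"
        using DL1_norm_le_iff[OF B, of \<omega> n \<phi>] b by (intro mult_mono) (auto intro: ennreal_leI)
      also have "\<dots> = ennreal (max (c p) 0 * B)" using B by (simp add: ennreal_mult)
      finally show "p \<phi> \<le> max (c p) 0 * B" using B by (simp add: ennreal_le_iff)
    qed
    finally show ?thesis by (simp add: sum_distrib_right mult.assoc)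
  qed
  moreover have "C * (\<Sum>p\<in>F. max (c p) 0) \<ge> 0" using F(3) by (auto intro!: mult_nonneg_nonneg sum_nonneg)
  ultimately show ?thesis by (intro exI[of _ "C * (\<Sum>p\<in>F. max (c p) 0)"]) auto
qed

section \<open>The Sobolev embedding\<close>

text \<open>\<open>h 0\<close> differs from \<open>h t\<close> by at most the integral of the
  modulus of \<open>h'\<close>; the bound is the average of this over t between 0 and 1.\<close>

lemma norm_le_nn_integral_deriv:
  fixes h h' :: "real \<Rightarrow> complex"
  assumes d: "\<And>t. (h has_vector_derivative h' t) (at t)" and c: "continuous_on UNIV h'"
  shows "ennreal (norm (h 0)) \<le> (\<integral>\<^sup>+ t. ennreal (norm (h t)) + ennreal (norm (h' t)) \<partial>lborel)"
proof -
  have ch: "continuous_on UNIV h"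
    by (rule continuous_on_vector_derivative) (use d in \<open>auto intro: has_vector_derivative_at_within\<close>)
  have [measurable]: "h \<in> borel_measurable borel" "h' \<in> borel_measurable borel"
    using c ch by (auto intro: borel_measurable_continuous_onI)
  let ?I = "\<integral>\<^sup>+ t. ennreal (norm (h' t)) \<partial>lborel"
  have *: "ennreal (norm (h 0)) \<le> ennreal (norm (h t)) + ?I" if t: "t \<ge> 0" for t
  proof -
    have b: "has_bochner_integral lborel (\<lambda>x. indicator {0..t} x *\<^sub>R h' x) (h t - h 0)"
      by (rule has_bochner_integral_FTC_Icc[OF t])
        (use d c in \<open>auto intro: has_vector_derivative_at_within continuous_on_subset\<close>)
    have "ennreal (norm (h t - h 0)) \<le> (\<integral>\<^sup>+ x. ennreal (norm (indicator {0..t} x *\<^sub>R h' x)) \<partial>lborel)"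
      by (rule has_bochner_integral_norm_bound[OF b])
    also have "\<dots> \<le> ?I" by (intro nn_integral_mono) (auto simp: indicator_def)
    finally have 1: "ennreal (norm (h t - h 0)) \<le> ?I" .
    have "norm (h 0) \<le> norm (h t) + norm (h t - h 0)" by (metis norm_minus_commute norm_triangle_sub)
    then have "ennreal (norm (h 0)) \<le> ennreal (norm (h t)) + ennreal (norm (h t - h 0))"
      by (simp add: ennreal_leI flip: ennreal_plus)
    also have "\<dots> \<le> ennreal (norm (h t)) + ?I" using 1 by (rule add_left_mono)
    finally show ?thesis .
  qed
  have "ennreal (norm (h 0)) = (\<integral>\<^sup>+ t. ennreal (norm (h 0)) * indicator {0..1} t \<partial>(lborel :: real measure))"
    by (simp add: nn_integral_cmult)
  also have "\<dots> \<le> (\<integral>\<^sup>+ t. ennreal (norm (h t)) + ?I * indicator {0..1} t \<partial>lborel)"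
    using * by (intro nn_integral_mono) (auto simp: indicator_def)
  also have "\<dots> = (\<integral>\<^sup>+ t. ennreal (norm (h t)) \<partial>lborel) + ?I"
    by (subst nn_integral_add) (auto simp: nn_integral_cmult)
  also have "\<dots> = (\<integral>\<^sup>+ t. ennreal (norm (h t)) + ennreal (norm (h' t)) \<partial>lborel)"
    by (rule nn_integral_add[symmetric]) auto
  finally show ?thesis .
qed

lemma nn_integral_lborel_translate:
  fixes F :: "'a::euclidean_space \<Rightarrow> ennreal"
  assumes [measurable]: "F \<in> borel_measurable borel"
  shows "(\<integral>\<^sup>+ y. F (x + y) \<partial>lborel) = (\<integral>\<^sup>+ y. F y \<partial>lborel)"
proof -
  have "(\<integral>\<^sup>+ y. F y \<partial>lborel) = (\<integral>\<^sup>+ y. F y \<partial>(density (distr lborel borel (\<lambda>y. x + 1 *\<^sub>R y)) (\<lambda>_. \<bar>1::real\<bar> ^ DIM('a))))"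
    using lborel_affine[of 1 x] by simp
  also have "\<dots> = (\<integral>\<^sup>+ y. F (x + y) \<partial>lborel)" by (simp add: nn_integral_density nn_integral_distr)
  finally show ?thesis by simp
qed

text \<open>Induction over the coordinate directions. The one-dimensional inequality in direction b
  replaces each set T of differentiated directions by T and \<open>insert b T\<close>, and adds one
  integration.\<close>

lemma sobolev_iterated:
  fixes u :: "real^'d::finite \<Rightarrow> complex"
  assumes u: "smooth_on UNIV u" and S: "finite S" "S \<subseteq> Basis"
  shows "ennreal (cmod (mderiv \<alpha> u x)) \<le>
    (\<Sum>T\<in>Pow S. \<integral>\<^sup>+ t. ennreal (cmod (mderiv (\<lambda>i. \<alpha> i + (if axis i (1::real) \<in> T then 1 else 0)) u (x + (\<Sum>b\<in>S. t b *\<^sub>R b))))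
        \<partial>(Pi\<^sub>M S (\<lambda>_. lborel)))"
  using S
proof (induction rule: finite_induct)
  case empty
  interpret product_sigma_finite "\<lambda>_::real^'d. lborel :: real measure" by standard
  show ?case by (simp add: nn_integral_empty del: nn_integral_const)
next
  case (insert b S)
  interpret product_sigma_finite "\<lambda>_::real^'d. lborel :: real measure" by standard
  obtain i where i: "b = axis i 1" using insert.prems by (auto simp: Basis_vec_def)
  let ?m = "\<lambda>T. mderiv (\<lambda>i. \<alpha> i + (if axis i (1::real) \<in> T then 1 else 0)) u"
  define A where "A T = (\<integral>\<^sup>+ t. ennreal (cmod (?m T (x + (\<Sum>c\<in>insert b S. t c *\<^sub>R c)))) \<partial>(Pi\<^sub>M (insert b S) (\<lambda>_. lborel)))" for T
  have [measurable]: "?m T \<in> borel_measurable borel" for T by (rule mderiv_measurable[OF u])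
  have A_eq: "A T = (\<integral>\<^sup>+ t. (\<integral>\<^sup>+ s. ennreal (cmod (?m T (x + (\<Sum>c\<in>S. t c *\<^sub>R c) + s *\<^sub>R b))) \<partial>lborel) \<partial>(Pi\<^sub>M S (\<lambda>_. lborel)))" for T
  proof -
    have sm: "(\<Sum>c\<in>insert b S. (t(b := s)) c *\<^sub>R c) = (\<Sum>c\<in>S. t c *\<^sub>R c) + s *\<^sub>R b" for t s
    proof -
      have "(\<Sum>c\<in>S. (t(b := s)) c *\<^sub>R c) = (\<Sum>c\<in>S. t c *\<^sub>R c)" by (rule sum.cong) (use insert in auto)
      then show ?thesis using insert by simp
    qed
    show ?thesis unfolding A_def
      by (subst product_nn_integral_insert[OF insert(1,2)]) (simp_all only: sm add.assoc, measurable)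
  qed
  have step: "(\<integral>\<^sup>+ t. ennreal (cmod (?m T (x + (\<Sum>c\<in>S. t c *\<^sub>R c)))) \<partial>(Pi\<^sub>M S (\<lambda>_. lborel))) \<le> A T + A (insert b T)" if T: "T \<in> Pow S" for T
  proof -
    have nT: "b \<notin> T" using T insert by blast
    have pm: "partial_deriv i (?m T) = ?m (insert b T)"
    proof -
      have "(\<lambda>j. \<alpha> j + (if axis j (1::real) \<in> T then 1 else 0))(i := Suc (\<alpha> i + (if axis i (1::real) \<in> T then 1 else 0)))
        = (\<lambda>j. \<alpha> j + (if axis j (1::real) \<in> insert b T then 1 else 0))"
        using nT by (auto simp: fun_eq_iff i axis_eq_axis)
      then show ?thesis by (simp only: partial_deriv_mderiv[OF u])
    qed
    have sT: "smooth_on UNIV (?m T)" unfolding mderiv_mlist by (rule smooth_on_foldr[OF u])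
    have "ennreal (cmod (?m T y)) \<le> (\<integral>\<^sup>+ s. ennreal (cmod (?m T (y + s *\<^sub>R b))) + ennreal (cmod (?m (insert b T) (y + s *\<^sub>R b))) \<partial>lborel)" for y
    proof -
      have d: "((\<lambda>s. ?m T (y + s *\<^sub>R b)) has_vector_derivative ?m (insert b T) (y + s *\<^sub>R b)) (at s)" for s
        using smooth_on_has_vd_at[OF sT UNIV_I, of y i s] by (simp only: pm i)
      have c: "continuous_on UNIV (\<lambda>s. ?m (insert b T) (y + s *\<^sub>R b))"
        unfolding i by (rule continuous_on_axis_line[OF continuous_on_mderiv[OF u]])
      show ?thesis using norm_le_nn_integral_deriv[OF d c] by simp
    qed
    then have "(\<integral>\<^sup>+ t. ennreal (cmod (?m T (x + (\<Sum>c\<in>S. t c *\<^sub>R c)))) \<partial>(Pi\<^sub>M S (\<lambda>_. lborel))) \<le>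
      (\<integral>\<^sup>+ t. (\<integral>\<^sup>+ s. ennreal (cmod (?m T (x + (\<Sum>c\<in>S. t c *\<^sub>R c) + s *\<^sub>R b))) + ennreal (cmod (?m (insert b T) (x + (\<Sum>c\<in>S. t c *\<^sub>R c) + s *\<^sub>R b))) \<partial>lborel)
        \<partial>(Pi\<^sub>M S (\<lambda>_. lborel)))"
      by (intro nn_integral_mono) blast
    also have "\<dots> = A T + A (insert b T)"
      unfolding A_eq by (subst nn_integral_add[symmetric], measurable) (subst nn_integral_add, measurable)
    finally show ?thesis .
  qed
  have "ennreal (cmod (mderiv \<alpha> u x)) \<le> (\<Sum>T\<in>Pow S. \<integral>\<^sup>+ t. ennreal (cmod (?m T (x + (\<Sum>b\<in>S. t b *\<^sub>R b)))) \<partial>(Pi\<^sub>M S (\<lambda>_. lborel)))"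
    using insert by blast
  also have "\<dots> \<le> (\<Sum>T\<in>Pow S. A T + A (insert b T))" by (rule sum_mono) (rule step)
  also have "\<dots> = (\<Sum>T\<in>Pow S. A T) + (\<Sum>T\<in>insert b ` Pow S. A T)"
  proof -
    have "inj_on (insert b) (Pow S)" using insert(2) by (auto simp: inj_on_def)
    then show ?thesis by (simp add: sum.distrib sum.reindex)
  qed
  also have "\<dots> = (\<Sum>T\<in>Pow (insert b S). A T)"
    unfolding Pow_insert by (rule sum.union_disjoint[symmetric]) (use insert in auto)
  finally show ?case unfolding A_def .
qed

text \<open>Once all directions are used, the iterated integrals are L1 norms of derivatives of
  order at most \<open>mabs \<alpha> + CARD('d)\<close>; \<open>Mw_shift\<close> absorbs the excess
  by doubling n.\<close>

lemma sobolev_embedding: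
  fixes u :: "real^'d::finite \<Rightarrow> complex"
  assumes w: "weight_function \<omega>" and n: "n \<ge> 1"
  shows "\<exists>C\<ge>0. \<forall>u :: real^'d \<Rightarrow> complex. \<forall>B\<ge>0. smooth_on UNIV u \<and> (\<forall>\<alpha>. L1_norm (mderiv \<alpha> u) \<le> ennreal (B * Mw \<omega> n (mabs \<alpha>)))
    \<longrightarrow> (\<forall>\<alpha> x. cmod (mderiv \<alpha> u x) \<le> C * B * Mw \<omega> (2 * n) (mabs \<alpha>))"
proof -
  obtain C where C: "C > 0" "\<And>l. Mw \<omega> n (l + CARD('d)) \<le> C * Mw \<omega> (2 * n) l" using Mw_shift[OF w n] by blast
  define N where "N = real (card (Pow (Basis :: (real^'d) set)))"
  have "cmod (mderiv \<alpha> u x) \<le> (N * C) * B * Mw \<omega> (2 * n) (mabs \<alpha>)"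
    if B: "B \<ge> 0" and u: "smooth_on UNIV u" and b: "\<forall>\<alpha>. L1_norm (mderiv \<alpha> u) \<le> ennreal (B * Mw \<omega> n (mabs \<alpha>))"
    for u :: "real^'d \<Rightarrow> complex" and B \<alpha> x
  proof -
    let ?a = "\<lambda>T i. \<alpha> i + (if axis i (1::real) \<in> T then 1 else 0)"
    have "ennreal (cmod (mderiv \<alpha> u x)) \<le>
      (\<Sum>T\<in>Pow Basis. \<integral>\<^sup>+ t. ennreal (cmod (mderiv (?a T) u (x + (\<Sum>b\<in>Basis. t b *\<^sub>R b)))) \<partial>(Pi\<^sub>M Basis (\<lambda>_. lborel)))"
      by (rule sobolev_iterated[OF u]) auto
    also have "\<dots> = (\<Sum>T\<in>Pow Basis. \<integral>\<^sup>+ y. ennreal (cmod (mderiv (?a T) u y)) \<partial>lborel)"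
    proof (rule sum.cong[OF refl])
      fix T
      have [measurable]: "mderiv (?a T) u \<in> borel_measurable borel" by (rule mderiv_measurable[OF u])
      have "(\<integral>\<^sup>+ t. ennreal (cmod (mderiv (?a T) u (x + (\<Sum>b\<in>Basis. t b *\<^sub>R b)))) \<partial>(Pi\<^sub>M Basis (\<lambda>_. lborel)))
         = (\<integral>\<^sup>+ y. ennreal (cmod (mderiv (?a T) u (x + y))) \<partial>lborel)"
        by (subst lborel_eq) (simp add: nn_integral_distr)
      also have "\<dots> = (\<integral>\<^sup>+ y. ennreal (cmod (mderiv (?a T) u y)) \<partial>lborel)" by (rule nn_integral_lborel_translate) measurable
      finally show "(\<integral>\<^sup>+ t. ennreal (cmod (mderiv (?a T) u (x + (\<Sum>b\<in>Basis. t b *\<^sub>R b)))) \<partial>(Pi\<^sub>M Basis (\<lambda>_. lborel)))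
         = (\<integral>\<^sup>+ y. ennreal (cmod (mderiv (?a T) u y)) \<partial>lborel)" .
    qed
    also have "\<dots> \<le> (\<Sum>T\<in>Pow (Basis :: (real^'d) set). ennreal (B * (C * Mw \<omega> (2*n) (mabs \<alpha>))))"
    proof (rule sum_mono)
      fix T
      have "mabs (?a T) \<le> mabs \<alpha> + CARD('d)"
      proof -
        have "mabs (?a T) = mabs \<alpha> + (\<Sum>i\<in>UNIV. if axis i (1::real) \<in> T then 1 else 0)" by (simp add: mabs_def sum.distrib)
        also have "(\<Sum>i\<in>(UNIV::'d set). if axis i (1::real) \<in> T then 1 else 0) \<le> (\<Sum>i\<in>(UNIV::'d set). 1::nat)" by (rule sum_mono) auto
        finally show ?thesis by simp
      qed
      then have "Mw \<omega> n (mabs (?a T)) \<le> Mw \<omega> n (mabs \<alpha> + CARD('d))" by (rule Mw_mono_l[OF w n])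
      also have "\<dots> \<le> C * Mw \<omega> (2*n) (mabs \<alpha>)" by (rule C(2))
      finally have "B * Mw \<omega> n (mabs (?a T)) \<le> B * (C * Mw \<omega> (2*n) (mabs \<alpha>))" using B by (rule mult_left_mono)
      then show "(\<integral>\<^sup>+ y. ennreal (cmod (mderiv (?a T) u y)) \<partial>lborel) \<le> ennreal (B * (C * Mw \<omega> (2*n) (mabs \<alpha>)))"
        using b by (meson ennreal_leI order_trans)
    qed
    also have "\<dots> = ennreal (N * (B * (C * Mw \<omega> (2*n) (mabs \<alpha>))))"
      using B C(1) by (simp add: N_def ennreal_mult ennreal_of_nat_eq_real_of_nat)
    finally have "cmod (mderiv \<alpha> u x) \<le> N * (B * (C * Mw \<omega> (2*n) (mabs \<alpha>)))"
      using B C(1) by (subst (asm) ennreal_le_iff) (auto simp: N_def)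
    then show ?thesis by (simp add: ac_simps)
  qed
  moreover have "N * C \<ge> 0" using C by (simp add: N_def)
  ultimately show ?thesis by (intro exI[of _ "N * C"]) blast
qed

lemma DL1_subset_E_open:
  assumes w: "weight_function \<omega>" shows "DL1 \<omega> \<subseteq> E_open \<omega> UNIV"
proof
  fix \<phi> :: "real^'d::finite \<Rightarrow> complex" assume "\<phi> \<in> DL1 \<omega>"
  then obtain n B where nB: "n \<ge> 1" "B \<ge> 0" "\<forall>\<alpha>. L1_norm (mderiv \<alpha> \<phi>) \<le> ennreal (B * Mw \<omega> n (mabs \<alpha>))"
    and s: "smooth_on UNIV \<phi>" unfolding DL1_iff by blast
  obtain C where C: "C \<ge> 0" "\<And>\<alpha> x. cmod (mderiv \<alpha> \<phi> x) \<le> C * B * Mw \<omega> (2 * n) (mabs \<alpha>)"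
    using sobolev_embedding[OF w nB(1), where 'd = 'd] s nB by blast
  have "C * B \<ge> 0" "2 * n \<ge> 1" using C nB by auto
  then show "\<phi> \<in> E_open \<omega> UNIV"
    unfolding E_open_iff[OF open_UNIV] using s C(2) by (intro conjI allI impI exI[of _ "2 * n"] exI[of _ "C * B"]) auto
qed

text \<open>The modulus of h is itself a seminorm of the inductive limit: on the n-th step the
  Sobolev embedding gives uniform bounds with index \<open>2 * n\<close>, to which the continuity of
  h applies.\<close>

lemma restrict0_E_dual_B_dual:
  fixes h :: "(real^'d::finite \<Rightarrow> complex) \<Rightarrow> complex"
  assumes w: "weight_function \<omega>" and h: "h \<in> E_dual \<omega> UNIV"
  shows "restrict0 (DL1 \<omega>) h \<in> B_dual \<omega>"
proof -
  let ?D = "DL1 \<omega> :: (real^'d \<Rightarrow> complex) set"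
  let ?P = "indlim_seminorms (DL1_step \<omega>) (DL1_norm \<omega>) :: ((real^'d \<Rightarrow> complex) \<Rightarrow> real) set"
  note D = function_space_DL1[OF w, where 'd = 'd]
  note sub = DL1_subset_E_open[OF w]
  have P: "seminorm_on ?D p" if "p \<in> ?P" for p using that unfolding indlim_seminorms_def DL1_def by blast
  define p where "p \<phi> = cmod (h \<phi>)" for \<phi>
  have hadd: "h (\<lambda>x. \<phi> x + \<psi> x) = h \<phi> + h \<psi>" if "\<phi> \<in> ?D" "\<psi> \<in> ?D" for \<phi> \<psi>
    using lc_dual_add[OF h[unfolded E_dual_def]] that sub by blast
  have hhom: "h (\<lambda>x. c * \<phi> x) = c * h \<phi>" if "\<phi> \<in> ?D" for c \<phi>
    using lc_dual_cmult[OF h[unfolded E_dual_def]] that sub by blast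
  have "p \<in> ?P"
    unfolding indlim_seminorms_def
  proof (intro CollectI conjI allI impI)
    show "seminorm_on (indlim (DL1_step \<omega>)) p"
      unfolding seminorm_on_def DL1_def[symmetric] p_def using hadd hhom by (auto simp: norm_mult norm_triangle_ineq)
    fix n :: nat assume n: "1 \<le> n"
    obtain C where C: "C \<ge> 0" "\<And>(u :: real^'d \<Rightarrow> complex) B \<alpha> x. B \<ge> 0 \<Longrightarrow> smooth_on UNIV u \<Longrightarrow>
      (\<forall>\<alpha>. L1_norm (mderiv \<alpha> u) \<le> ennreal (B * Mw \<omega> n (mabs \<alpha>))) \<Longrightarrow> cmod (mderiv \<alpha> u x) \<le> C * B * Mw \<omega> (2 * n) (mabs \<alpha>)"
      using sobolev_embedding[OF w n, where 'd = 'd] by blast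
    have n2: "1 \<le> 2 * n" using n by simp
    obtain c where c: "c \<ge> 0" "\<And>\<phi> B. \<phi>\<in>E_open \<omega> UNIV \<Longrightarrow> B\<ge>0 \<Longrightarrow> (\<forall>\<alpha> x. cmod (mderiv \<alpha> \<phi> x) \<le> B * Mw \<omega> (2 * n) (mabs \<alpha>)) \<Longrightarrow> cmod (h \<phi>) \<le> c * B"
      using E_dual_bound[OF w open_UNIV h n2] by (elim exE conjE) auto
    have "ennreal (p \<phi>) \<le> ennreal (c * C) * DL1_norm \<omega> n \<phi>" if \<phi>: "\<phi> \<in> DL1_step \<omega> n" for \<phi>
    proof -
      obtain B where B: "B \<ge> 0" "DL1_norm \<omega> n \<phi> = ennreal B"
        using \<phi> unfolding DL1_step_def by (cases "DL1_norm \<omega> n \<phi>") auto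
      have s: "smooth_on UNIV \<phi>" using \<phi> by (simp add: DL1_step_def)
      have b: "\<forall>\<alpha>. L1_norm (mderiv \<alpha> \<phi>) \<le> ennreal (B * Mw \<omega> n (mabs \<alpha>))"
        using DL1_norm_le_iff[OF B(1), of \<omega> n \<phi>] B(2) by simp
      have "\<phi> \<in> ?D" using \<phi> n unfolding DL1_def indlim_def by auto
      then have "p \<phi> \<le> c * (C * B)" unfolding p_def
        using C(1) B(1) by (intro c(2)) (use sub C(2)[OF B(1) s b] in auto)
      then show ?thesis using B C(1) c(1) by (simp add: ennreal_leI mult.assoc flip: ennreal_mult)
    qed
    then show "\<exists>C::real. \<forall>\<phi>\<in>DL1_step \<omega> n. ennreal (p \<phi>) \<le> ennreal C * DL1_norm \<omega> n \<phi>" by blast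
  qed
  then have F: "finite {p}" "{p} \<subseteq> ?P" by auto
  show ?thesis unfolding B_dual_def
  proof (rule lc_dualI[OF D P _ _ _ F])
    show "restrict0 ?D h \<phi> = 0" if "\<phi> \<notin> ?D" for \<phi> using that by (simp add: restrict0_def)
    show "restrict0 ?D h (\<lambda>x. \<phi> x + \<psi> x) = restrict0 ?D h \<phi> + restrict0 ?D h \<psi>" if "\<phi> \<in> ?D" "\<psi> \<in> ?D" for \<phi> \<psi>
      using function_space_add[OF D that] hadd[OF that] that by (simp add: restrict0_def)
    show "restrict0 ?D h (\<lambda>x. c * \<phi> x) = c * restrict0 ?D h \<phi>" if "\<phi> \<in> ?D" for c \<phi>
      using function_space_cmult[OF D that] hhom[OF that] that by (simp add: restrict0_def)
    show "cmod (restrict0 ?D h \<phi>) \<le> 1 * (\<Sum>q\<in>{p}. q \<phi>)" if "\<phi> \<in> ?D" for \<phi>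
      using that by (simp add: restrict0_def p_def)
  qed
qed

lemma E_dual_carried_subset:
  fixes \<omega> :: "real \<Rightarrow> real" and K :: "(real^'d::finite) set"
  assumes w: "weight_function \<omega>"
  shows "restrict0 (DL1 omega1) ` E_dual_carried \<omega> K \<subseteq>
    restrict0 (DL1 omega1) ` B_dual \<omega> \<inter> restrict0 (DL1 omega1) ` E_dual_carried omega1 K"
proof
  fix F assume "F \<in> restrict0 (DL1 omega1) ` E_dual_carried \<omega> K"
  then obtain h where h: "h \<in> E_dual_carried \<omega> K" "F = restrict0 (DL1 omega1) h" by blast
  have hE: "h \<in> E_dual \<omega> UNIV" using h(1) unfolding E_dual_carried_def by simp
  have 1: "F = restrict0 (DL1 omega1) (restrict0 (DL1 \<omega>) h)"
    using DL1_omega1_subset[OF w] h(2) by (auto simp: restrict0_def fun_eq_iff)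
  have 2: "F = restrict0 (DL1 omega1) (restrict0 (E_open omega1 UNIV) h)"
    using DL1_subset_E_open[OF weight_function_omega1] h(2) by (auto simp: restrict0_def fun_eq_iff)
  show "F \<in> restrict0 (DL1 omega1) ` B_dual \<omega> \<inter> restrict0 (DL1 omega1) ` E_dual_carried omega1 K"
    using 1 2 restrict0_E_dual_B_dual[OF w hE] restrict0_E_dual_carried_omega1[OF w h(1)] by blast
qed

section \<open>Convolution with product kernels\<close>

text \<open>Convolution with the tensor product of the one-variable kernels \<open>p i\<close>. In
  the applications v is continuous and supported in a box, where the gauge integral reduces to an
  integral over the box.\<close>

definition pconv :: "('d \<Rightarrow> real \<Rightarrow> complex) \<Rightarrow> (real^'d::finite \<Rightarrow> complex) \<Rightarrow> real^'d \<Rightarrow> complex" where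
  "pconv p v x = integral UNIV (\<lambda>y. (\<Prod>i\<in>UNIV. p i (x $ i - y $ i)) * v y)"

lemma integral_UNIV_eq_cbox:
  fixes F :: "'a::euclidean_space \<Rightarrow> 'b::banach"
  assumes "\<And>y. y \<notin> cbox a b \<Longrightarrow> F y = 0"
  shows "integral UNIV F = integral (cbox a b) F"
proof -
  have "F = (\<lambda>y. if y \<in> cbox a b then F y else 0)" using assms by auto
  then show ?thesis using integral_restrict_UNIV[of "cbox a b" F] by simp
qed

lemma pconv_cbox:
  assumes "\<And>y. y \<notin> cbox a b \<Longrightarrow> v y = 0"
  shows "pconv p v x = integral (cbox a b) (\<lambda>y. (\<Prod>i\<in>UNIV. p i (x $ i - y $ i)) * v y)"
  unfolding pconv_def by (rule integral_UNIV_eq_cbox) (use assms in auto)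

lemma continuous_on_kernel:
  fixes p :: "'d::finite \<Rightarrow> real \<Rightarrow> complex" and v :: "real^'d \<Rightarrow> complex"
  assumes "\<And>i. continuous_on UNIV (p i)" "continuous_on UNIV v"
  shows "continuous_on A (\<lambda>z. (\<Prod>i\<in>UNIV. p i (fst z $ i - snd z $ i)) * v (snd z))"
proof (intro continuous_intros)
  show "continuous_on A (\<lambda>z. p i (fst z $ i - snd z $ i))" for i
    by (rule continuous_on_compose2[OF assms(1)]) (auto intro!: continuous_intros)
  show "continuous_on A (\<lambda>z. v (snd z))"
    by (rule continuous_on_compose2[OF assms(2)]) (auto intro!: continuous_intros)
qed

lemma continuous_on_kernel_snd:
  fixes p :: "'d::finite \<Rightarrow> real \<Rightarrow> complex" and v :: "real^'d \<Rightarrow> complex"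
  assumes "\<And>i. continuous_on UNIV (p i)" "continuous_on UNIV v"
  shows "continuous_on A (\<lambda>y. (\<Prod>i\<in>UNIV. p i (x $ i - y $ i)) * v y)"
proof -
  have "continuous_on A (\<lambda>y. (x, y))" by (intro continuous_intros)
  from continuous_on_compose2[OF continuous_on_kernel[of p v UNIV, OF assms] this] show ?thesis by simp
qed

lemma continuous_on_pconv:
  fixes p :: "'d::finite \<Rightarrow> real \<Rightarrow> complex"
  assumes "\<And>i. continuous_on UNIV (p i)" "continuous_on UNIV v" "\<And>y. y \<notin> cbox a b \<Longrightarrow> v y = 0"
  shows "continuous_on UNIV (pconv p v)"
proof -
  have "continuous_on UNIV (\<lambda>x. integral (cbox a b) (\<lambda>y. (\<Prod>i\<in>UNIV. p i (x $ i - y $ i)) * v y))"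
    by (rule integral_continuous_on_param)
      (use continuous_on_kernel[of p v "UNIV \<times> cbox a b", OF assms(1,2)] in \<open>simp add: split_beta\<close>)
  then show ?thesis using pconv_cbox[of a b v p] assms(3) by (simp add: fun_eq_iff)
qed

text \<open>The derivative falls on the kernel, so a cutoff of low regularity inside v does not
  limit the smoothness of the convolution.\<close>

lemma pconv_has_vd:
  fixes p :: "'d::finite \<Rightarrow> real \<Rightarrow> complex"
  assumes p: "\<And>i. continuous_on UNIV (p i)" and q: "\<And>t. (p j has_vector_derivative q t) (at t)" "continuous_on UNIV q"
    and v: "continuous_on UNIV v" "\<And>y. y \<notin> cbox a b \<Longrightarrow> v y = 0"
  shows "((\<lambda>t. pconv p v (x + t *\<^sub>R axis j 1)) has_vector_derivative pconv (p(j := q)) v x) (at 0)"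
proof -
  let ?P = "\<lambda>p t y. (\<Prod>i\<in>UNIV. p i ((x + t *\<^sub>R axis j 1) $ i - y $ i)) * v y"
  have split: "?P p t y = p j (x $ j - y $ j + t) * ((\<Prod>i\<in>UNIV - {j}. p i (x $ i - y $ i)) * v y)" for p t y
  proof -
    have "(\<Prod>i\<in>UNIV. p i ((x + t *\<^sub>R axis j 1) $ i - y $ i)) =
        p j ((x + t *\<^sub>R axis j 1) $ j - y $ j) * (\<Prod>i\<in>UNIV - {j}. p i ((x + t *\<^sub>R axis j 1) $ i - y $ i))"
      by (rule prod.remove) auto
    also have "(\<Prod>i\<in>UNIV - {j}. p i ((x + t *\<^sub>R axis j 1) $ i - y $ i)) = (\<Prod>i\<in>UNIV - {j}. p i (x $ i - y $ i))"
      by (rule prod.cong) (auto simp: axis_def)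
    finally show ?thesis by (simp add: axis_def algebra_simps)
  qed
  have q': "(\<Prod>i\<in>UNIV - {j}. (p(j := q)) i (x $ i - y $ i)) = (\<Prod>i\<in>UNIV - {j}. p i (x $ i - y $ i))" for y
    by (rule prod.cong) auto
  have cp: "continuous_on UNIV ((p(j := q)) i)" for i using p q(2) by auto
  have "((\<lambda>t. integral (cbox a b) (?P p t)) has_vector_derivative integral (cbox a b) (?P (p(j := q)) 0)) (at 0 within UNIV)"
  proof (rule leibniz_rule_vector_derivative)
    fix t y
    have "((\<lambda>t. p j (x $ j - y $ j + t)) has_vector_derivative q (x $ j - y $ j + t)) (at t)"
    proof -
      have "((\<lambda>s. x $ j - y $ j + s) has_vector_derivative 1) (at t)" by (auto intro!: derivative_eq_intros)
      from vector_diff_chain_at[OF this q(1)[of "x $ j - y $ j + t"]] show ?thesis by (simp add: o_def)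
    qed
    then show "((\<lambda>t. ?P p t y) has_vector_derivative ?P (p(j := q)) t y) (at t within UNIV)"
      unfolding split q' by (simp add: has_vector_derivative_mult_left)
  next
    fix t show "?P p t integrable_on cbox a b"
      by (rule integrable_continuous) (rule continuous_on_kernel_snd[OF p v(1)])
  next
    show "continuous_on (UNIV \<times> cbox a b) (\<lambda>(t, y). ?P (p(j := q)) t y)"
    proof -
      have "continuous_on (UNIV \<times> cbox a b) (\<lambda>z. (x + fst z *\<^sub>R axis j 1, snd z))" by (intro continuous_intros)
      from continuous_on_compose2[OF continuous_on_kernel[of "p(j := q)" v UNIV, OF cp v(1)] this]
      show ?thesis by (simp add: split_beta)
    qed
  qed auto
  then show ?thesis using pconv_cbox[of a b v] v(2) by simp
qed

lemma pconv_bound: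
  fixes p :: "'d::finite \<Rightarrow> real \<Rightarrow> complex"
  assumes p: "\<And>i. continuous_on UNIV (p i)" and v: "continuous_on UNIV v" "\<And>y. y \<notin> cbox a b \<Longrightarrow> v y = 0"
    and B: "B \<ge> 0" "\<And>y. y \<in> cbox a b \<Longrightarrow> cmod ((\<Prod>i\<in>UNIV. p i (x $ i - y $ i)) * v y) \<le> B"
  shows "cmod (pconv p v x) \<le> B * measure lborel (cbox a b)"
proof -
  have "(\<lambda>y. (\<Prod>i\<in>UNIV. p i (x $ i - y $ i)) * v y) integrable_on cbox a b"
    by (rule integrable_continuous) (rule continuous_on_kernel_snd[OF p v(1)])
  then have "((\<lambda>y. (\<Prod>i\<in>UNIV. p i (x $ i - y $ i)) * v y) has_integral pconv p v x) (cbox a b)"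
    using pconv_cbox[of a b v p x] v(2) by (simp add: has_integral_integral)
  from has_integral_bound[OF B(1) this B(2)] show ?thesis by simp
qed

text \<open>The multi-index is part of the kernel: differentiating a convolution only raises
  \<alpha>, see \<open>mderiv_pconv\<close>.\<close>

definition entire_kernel :: "('d \<Rightarrow> complex \<Rightarrow> complex) \<Rightarrow> ('d \<Rightarrow> nat) \<Rightarrow> 'd \<Rightarrow> real \<Rightarrow> complex" where
  "entire_kernel \<tau> \<alpha> i t = (deriv ^^ \<alpha> i) (\<tau> i) (of_real t)"

lemma entire_deriv_of_real_has_vd:
  assumes "f holomorphic_on UNIV"
  shows "((\<lambda>t. (deriv ^^ l) f (of_real t)) has_vector_derivative (deriv ^^ Suc l) f (of_real t)) (at t)"
proof -
  have "(deriv ^^ l) f holomorphic_on UNIV" by (rule holomorphic_higher_deriv[OF assms open_UNIV])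
  then have "((deriv ^^ l) f has_field_derivative deriv ((deriv ^^ l) f) (of_real t)) (at (of_real t))"
    by (rule holomorphic_derivI) auto
  then have "((\<lambda>t. (deriv ^^ l) f (of_real t)) has_vector_derivative deriv ((deriv ^^ l) f) (of_real t)) (at t)"
    by (rule has_vector_derivative_real_field)
  then show ?thesis by simp
qed

lemma continuous_on_entire_kernel:
  assumes "\<And>i. \<tau> i holomorphic_on UNIV"
  shows "continuous_on UNIV (entire_kernel \<tau> \<alpha> i)"
  unfolding entire_kernel_def
  by (rule continuous_on_vector_derivative)
    (use entire_deriv_of_real_has_vd[OF assms] in \<open>auto intro: has_vector_derivative_at_within\<close>)

text \<open>An instance of the list-indexed family: the member for the list js carries
  \<open>count_list js i\<close> derivatives on the i-th factor of the kernel.\<close>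

lemma
  fixes \<tau> :: "'d::finite \<Rightarrow> complex \<Rightarrow> complex"
  assumes \<tau>: "\<And>i. \<tau> i holomorphic_on UNIV" and v: "continuous_on UNIV v" "\<And>y. y \<notin> cbox a b \<Longrightarrow> v y = 0"
  shows smooth_on_pconv: "smooth_on UNIV (pconv (entire_kernel \<tau> (\<lambda>_. 0)) v)"
    and mderiv_pconv: "mderiv \<alpha> (pconv (entire_kernel \<tau> (\<lambda>_. 0)) v) = pconv (entire_kernel \<tau> \<alpha>) v"
proof -
  let ?F = "\<lambda>js. pconv (entire_kernel \<tau> (count_list js)) v"
  have 0: "?F [] x = pconv (entire_kernel \<tau> (\<lambda>_. 0)) v x" for x
    by (simp add: pconv_def entire_kernel_def)
  have d: "((\<lambda>t. ?F js (x + t *\<^sub>R axis j 1)) has_vector_derivative ?F (j # js) x) (at 0)" for js j x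
  proof -
    have eq: "(entire_kernel \<tau> (count_list js))(j := \<lambda>t. (deriv ^^ Suc (count_list js j)) (\<tau> j) (of_real t))
        = entire_kernel \<tau> (count_list (j # js))"
      by (auto simp: fun_eq_iff entire_kernel_def)
    have "((\<lambda>t. ?F js (x + t *\<^sub>R axis j 1)) has_vector_derivative
        pconv ((entire_kernel \<tau> (count_list js))(j := \<lambda>t. (deriv ^^ Suc (count_list js j)) (\<tau> j) (of_real t))) v x) (at 0)"
    proof (rule pconv_has_vd[OF continuous_on_entire_kernel[OF \<tau>] _ _ v])
      show "(entire_kernel \<tau> (count_list js) j has_vector_derivative (deriv ^^ Suc (count_list js j)) (\<tau> j) (of_real t)) (at t)" for t
        using entire_deriv_of_real_has_vd[OF \<tau>[of j], of "count_list js j" t] by (simp add: entire_kernel_def[abs_def])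
      show "continuous_on UNIV (\<lambda>t. (deriv ^^ Suc (count_list js j)) (\<tau> j) (of_real t))"
        using continuous_on_entire_kernel[of \<tau> "\<lambda>_. Suc (count_list js j)" j, OF \<tau>] by (simp add: entire_kernel_def[abs_def])
    qed
    then show ?thesis unfolding eq .
  qed
  have c: "continuous_on UNIV (?F js)" for js
    by (rule continuous_on_pconv[OF continuous_on_entire_kernel[OF \<tau>] v])
  show "smooth_on UNIV (pconv (entire_kernel \<tau> (\<lambda>_. 0)) v)"
    by (rule smooth_on_family[OF open_UNIV 0 d c])
  show "mderiv \<alpha> (pconv (entire_kernel \<tau> (\<lambda>_. 0)) v) = pconv (entire_kernel \<tau> \<alpha>) v"
  proof
    fix x
    have "foldr partial_deriv (mlist \<alpha>) (pconv (entire_kernel \<tau> (\<lambda>_. 0)) v) x = ?F (mlist \<alpha>) x"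
      by (rule foldr_partial_deriv_family[OF open_UNIV 0 d UNIV_I])
    also have "count_list (mlist \<alpha>) = \<alpha>" by (rule ext) (rule count_list_mlist)
    finally show "mderiv \<alpha> (pconv (entire_kernel \<tau> (\<lambda>_. 0)) v) x = pconv (entire_kernel \<tau> \<alpha>) v x"
      by (simp add: mderiv_mlist)
  qed
qed

section \<open>The kernels\<close>

definition expm1_quot :: "complex \<Rightarrow> complex" where
  "expm1_quot z = (if z = 0 then 1 else (exp z - 1) / z)"

lemma expm1_quot_mult: "z * expm1_quot z = exp z - 1"
  by (simp add: expm1_quot_def)

lemma expm1_quot_holomorphic: "expm1_quot holomorphic_on UNIV"
proof -
  have "(\<lambda>z::complex. if z = 0 then deriv exp 0 else (exp z - exp 0) / (z - 0)) holomorphic_on UNIV"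
    by (rule pole_lemma_open) (auto intro!: holomorphic_intros)
  moreover have "deriv exp (0::complex) = exp 0" by (rule DERIV_imp_deriv) (rule DERIV_exp)
  then have "(\<lambda>z::complex. if z = 0 then deriv exp 0 else (exp z - exp 0) / (z - 0)) = expm1_quot"
    by (auto simp: expm1_quot_def fun_eq_iff)
  ultimately show ?thesis by simp
qed

text \<open>Mean value inequality for exp on the segment from 0 to z, on which the real part lies
  between 0 and \<open>Re z\<close>.\<close>

lemma expm1_quot_bound: "cmod (expm1_quot z) \<le> max 1 (exp (Re z))"
proof (cases "z = 0")
  case False
  have "cmod (exp z - exp 0) \<le> max 1 (exp (Re z)) * cmod (z - 0)"
  proof (rule field_differentiable_bound[of "closed_segment 0 z" exp exp])
    fix w assume "w \<in> closed_segment 0 z"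
    then obtain u where u: "0 \<le> u" "u \<le> 1" "w = of_real u * z" by (auto simp: closed_segment_def scaleR_conv_of_real)
    have "u * Re z \<le> max 0 (Re z)" using u by (cases "Re z \<ge> 0") (auto simp: mult_left_le_one_le mult_nonneg_nonpos max_def)
    then have "exp (u * Re z) \<le> exp (max 0 (Re z))" by simp
    also have "\<dots> = max 1 (exp (Re z))" by (simp add: max_def)
    finally show "cmod (exp w) \<le> max 1 (exp (Re z))" using u by simp
  qed (auto intro: DERIV_exp has_field_derivative_at_within)
  then show ?thesis using False by (simp add: expm1_quot_def norm_divide divide_le_eq)
qed (simp add: expm1_quot_def)

text \<open>The kernel \<open>sin (k z) exp (- k z\<^sup>2) / (\<pi> z)\<close>, in a form that is entire.\<close>

definition kap :: "nat \<Rightarrow> complex \<Rightarrow> complex" where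
  "kap k z = of_real (real k / pi) * exp (- \<i> * of_nat k * z - of_nat k * z\<^sup>2) * expm1_quot (2 * \<i> * of_nat k * z)"

text \<open>\<open>osc 1 k\<close> and \<open>osc (-1) k\<close> are the two exponentials in \<open>kap (Suc k) - kap k\<close>, again in entire form.\<close>

definition osc :: "int \<Rightarrow> nat \<Rightarrow> complex \<Rightarrow> complex" where
  "osc s k z = of_real (1 / (2 * pi)) * exp (of_int s * \<i> * of_nat k * z - of_nat k * z\<^sup>2) *
     ((of_int s * \<i> - z) * expm1_quot (of_int s * \<i> * z - z\<^sup>2) / (of_int s * \<i>))"

lemma kap_holomorphic: "kap k holomorphic_on UNIV"
  unfolding kap_def[abs_def]
  by (intro holomorphic_intros holomorphic_on_compose_gen[OF _ expm1_quot_holomorphic, unfolded o_def]) auto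

lemma osc_holomorphic: "osc s k holomorphic_on UNIV"
proof (cases "s = 0")
  case True
  then show ?thesis by (simp add: osc_def[abs_def])
next
  case False
  then show ?thesis unfolding osc_def[abs_def]
    by (intro holomorphic_intros holomorphic_on_compose_gen[OF _ expm1_quot_holomorphic, unfolded o_def]) auto
qed

lemma kap_nonzero: "z \<noteq> 0 \<Longrightarrow> kap k z =
  (exp (\<i> * of_nat k * z - of_nat k * z\<^sup>2) - exp (- \<i> * of_nat k * z - of_nat k * z\<^sup>2)) / (2 * of_real pi * \<i> * z)"
proof (cases "k = 0")
  case False
  assume z: "z \<noteq> 0"
  let ?e = "exp (- \<i> * of_nat k * z - of_nat k * z\<^sup>2)"
  have e: "exp (\<i> * of_nat k * z - of_nat k * z\<^sup>2) = ?e * exp (2 * \<i> * of_nat k * z)"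
    by (simp add: algebra_simps flip: exp_add)
  have "kap k z = of_real (real k / pi) * ?e * ((exp (2 * \<i> * of_nat k * z) - 1) / (2 * \<i> * of_nat k * z))"
    using z False by (simp add: kap_def expm1_quot_def)
  also have "\<dots> = (?e * exp (2 * \<i> * of_nat k * z) - ?e) / (2 * of_real pi * \<i> * z)"
    using z False by (simp add: field_simps)
  finally show ?thesis using e by simp
qed (simp add: kap_def)

text \<open>Away from 0 the kernel is the difference of the exponentials
  \<open>exp (\<plusminus> i k z - k z^2)\<close> over \<open>2 pi i z\<close>. Passing to
  \<open>Suc k\<close> multiplies each by \<open>exp (\<plusminus> i z - z^2)\<close>. This exponent
  is z times \<open>\<plusminus> i - z\<close>, which cancels the z in the denominator and makes
  \<open>osc\<close> entire.\<close>

lemma kap_Suc: "kap (Suc k) z = kap k z + osc 1 k z + osc (-1) k z"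
proof (cases "z = 0")
  case True
  then show ?thesis by (simp add: kap_def osc_def expm1_quot_def field_simps)
next
  case False
  have o: "osc s k z = (exp (of_int s * \<i> * of_nat (Suc k) * z - of_nat (Suc k) * z\<^sup>2) - exp (of_int s * \<i> * of_nat k * z - of_nat k * z\<^sup>2)) /
      (2 * of_real pi * (of_int s * \<i>) * z)" if s: "s \<noteq> 0" for s
  proof -
    let ?\<zeta> = "of_int s * \<i> * z - z\<^sup>2"
    have "z * ((of_int s * \<i> - z) * expm1_quot ?\<zeta>) = ?\<zeta> * expm1_quot ?\<zeta>" by (simp add: algebra_simps power2_eq_square)
    also have "\<dots> = exp ?\<zeta> - 1" by (rule expm1_quot_mult)
    finally have "(of_int s * \<i> - z) * expm1_quot ?\<zeta> = (exp ?\<zeta> - 1) / z" using False by (simp add: field_simps)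
    moreover have "exp (of_int s * \<i> * of_nat (Suc k) * z - of_nat (Suc k) * z\<^sup>2) = exp (of_int s * \<i> * of_nat k * z - of_nat k * z\<^sup>2) * exp ?\<zeta>"
      by (simp add: algebra_simps flip: exp_add)
    moreover have "of_real (1 / (2 * pi)) * a * (((b - 1) / z) / c) = (a * b - a) / (2 * of_real pi * c * z)" for a b c :: complex
    proof -
      have "of_real (1 / (2 * pi)) * a * (((b - 1) / z) / c) = (a * (b - 1)) / (2 * of_real pi * c * z)"
        by (simp add: mult_ac)
      then show ?thesis by (simp only: right_diff_distrib mult_1_right)
    qed
    ultimately show ?thesis unfolding osc_def by (simp only:)
  qed
  have o1: "osc 1 k z = (exp (\<i> * of_nat (Suc k) * z - of_nat (Suc k) * z\<^sup>2) - exp (\<i> * of_nat k * z - of_nat k * z\<^sup>2)) / (2 * of_real pi * \<i> * z)"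
    using o[of 1] by simp
  have o2: "osc (-1) k z = - ((exp (- \<i> * of_nat (Suc k) * z - of_nat (Suc k) * z\<^sup>2) - exp (- \<i> * of_nat k * z - of_nat k * z\<^sup>2)) / (2 * of_real pi * \<i> * z))"
    using o[of "-1"] by simp
  show ?thesis unfolding kap_nonzero[OF False] o1 o2 diff_divide_distrib by simp
qed

lemma exp_real_bound_square: "\<bar>y::real\<bar> \<le> 1 + y\<^sup>2"
proof -
  have "0 \<le> (\<bar>y\<bar> - 1)\<^sup>2" by simp
  then have "2 * \<bar>y\<bar> \<le> 1 + y\<^sup>2" by (simp add: power2_eq_square algebra_simps abs_mult_self_eq)
  then show ?thesis using abs_ge_zero[of y] by linarith
qed

text \<open>Each exponential contributes at most \<open>exp (k |Im z|)\<close>, and the Gaussian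
  \<open>exp (k (Im z)^2 - k (Re z)^2)\<close>. The coefficient 3 leaves room for
  \<open>osc\<close>, so that \<open>ker_bound\<close> has one form for all factors.\<close>

lemma kap_bound:
  assumes k: "k \<ge> 1"
  shows "cmod (kap k z) \<le> exp 1 * real k * exp (real k * \<bar>Im z\<bar> + 3 * real k * (Im z)\<^sup>2 - real k * (Re z)\<^sup>2)"
proof -
  have re: "Re (- \<i> * of_nat k * z - of_nat k * z\<^sup>2) = real k * Im z - real k * ((Re z)\<^sup>2 - (Im z)\<^sup>2)"
    by (simp add: power2_eq_square)
  have "cmod (expm1_quot (2 * \<i> * of_nat k * z)) \<le> max 1 (exp (- 2 * real k * Im z))"
    using expm1_quot_bound[of "2 * \<i> * of_nat k * z"] by simp
  then have "cmod (kap k z) \<le> (real k / pi) * exp (real k * Im z - real k * ((Re z)\<^sup>2 - (Im z)\<^sup>2)) * max 1 (exp (- 2 * real k * Im z))"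
    unfolding kap_def norm_mult norm_exp_eq_Re re by (intro mult_mono) (auto simp: norm_divide)
  also have "\<dots> = (real k / pi) * (exp (real k * Im z) * max 1 (exp (- 2 * real k * Im z))) * exp (- real k * ((Re z)\<^sup>2 - (Im z)\<^sup>2))"
  proof -
    have "exp (real k * Im z - real k * ((Re z)\<^sup>2 - (Im z)\<^sup>2)) = exp (real k * Im z) * exp (- real k * ((Re z)\<^sup>2 - (Im z)\<^sup>2))"
      by (simp flip: exp_add)
    then show ?thesis by (simp only: mult_ac)
  qed
  also have "exp (real k * Im z) * max 1 (exp (- 2 * real k * Im z)) = exp (real k * \<bar>Im z\<bar>)"
  proof (cases "Im z \<ge> 0")
    case True
    then have "- 2 * real k * Im z \<le> 0" by (simp add: zero_le_mult_iff)
    then have "exp (- 2 * real k * Im z) \<le> 1" by (subst exp_le_one_iff)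
    then have "max 1 (exp (- 2 * real k * Im z)) = 1" by (rule max_absorb1)
    then show ?thesis using True by simp
  next
    case False
    then have "- 2 * real k * Im z > 0" using k by (simp add: mult_pos_neg)
    then have "1 \<le> exp (- 2 * real k * Im z)" by (subst one_le_exp_iff) simp
    then have "max 1 (exp (- 2 * real k * Im z)) = exp (- 2 * real k * Im z)" by (rule max_absorb2)
    moreover have "exp (real k * Im z) * exp (- 2 * real k * Im z) = exp (real k * - Im z)"
      unfolding exp_add[symmetric] by simp
    ultimately show ?thesis using False by simp
  qed
  also have "(real k / pi) * exp (real k * \<bar>Im z\<bar>) * exp (- real k * ((Re z)\<^sup>2 - (Im z)\<^sup>2)) \<le>
      (exp 1 * real k) * exp (real k * \<bar>Im z\<bar>) * exp (3 * real k * (Im z)\<^sup>2 - real k * (Re z)\<^sup>2)"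
  proof (intro mult_mono)
    have "real k / pi \<le> real k / 1" using pi_ge_two by (intro divide_left_mono) auto
    also have "\<dots> \<le> exp 1 * real k" using one_le_exp_iff[of 1] by (simp add: mult_le_cancel_right1)
    finally show "real k / pi \<le> exp 1 * real k" .
    show "exp (- real k * ((Re z)\<^sup>2 - (Im z)\<^sup>2)) \<le> exp (3 * real k * (Im z)\<^sup>2 - real k * (Re z)\<^sup>2)"
      by (simp add: algebra_simps)
  qed auto
  also have "\<dots> = exp 1 * real k * exp (real k * \<bar>Im z\<bar> + 3 * real k * (Im z)\<^sup>2 - real k * (Re z)\<^sup>2)"
    unfolding mult.assoc[of "exp 1 * real k"] exp_add[symmetric] by (simp add: add_diff_eq)
  finally show ?thesis .
qed

text \<open>With the phase divided out no factor \<open>exp (k |Im z|)\<close> is left, only a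
  Gaussian; this is why derivatives of the amplitude are cheap. The 3 arises from
  \<open>|y| \<le> 1 + y^2\<close> and \<open>k \<ge> 1\<close>.\<close>

lemma osc_bound:
  assumes k: "k \<ge> 1" and s: "s = 1 \<or> s = -1"
  shows "cmod (exp (- of_int s * \<i> * of_nat k * z) * osc s k z) \<le> exp 1 * exp (3 * real k * (Im z)\<^sup>2 - real k * (Re z)\<^sup>2)"
proof -
  let ?y = "Im z"
  let ?W = "(of_int s * \<i> - z) * expm1_quot (of_int s * \<i> * z - z\<^sup>2)"
  have s1: "cmod (of_int s * \<i>) = 1" using s by auto
  have re: "Re (of_int s * \<i> * z - z\<^sup>2) \<le> \<bar>?y\<bar> + ?y\<^sup>2"
  proof -
    have "Re (of_int s * \<i> * z - z\<^sup>2) = - of_int s * ?y - (Re z * Re z - ?y * ?y)" by (simp add: power2_eq_square)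
    moreover have "- of_int s * ?y \<le> \<bar>?y\<bar>" using s by auto
    moreover have "0 \<le> Re z * Re z" by simp
    ultimately show ?thesis unfolding power2_eq_square by linarith
  qed
  have W: "cmod ?W \<le> 2 * exp (\<bar>?y\<bar> + ?y\<^sup>2)"
  \<comment> \<open>Near 0 the quotient \<open>expm1_quot\<close> is bounded directly; farther out z
    times the expression is a difference of two exponentials, and dividing by z only helps.\<close>
  proof (cases "cmod z \<le> 1")
    case True
    have "cmod (expm1_quot (of_int s * \<i> * z - z\<^sup>2)) \<le> max 1 (exp (\<bar>?y\<bar> + ?y\<^sup>2))"
      using expm1_quot_bound[of "of_int s * \<i> * z - z\<^sup>2"] re by (smt (verit) exp_le_cancel_iff max_def)
    also have "\<dots> = exp (\<bar>?y\<bar> + ?y\<^sup>2)" by (simp add: max_def)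
    finally have "cmod (of_int s * \<i> - z) * cmod (expm1_quot (of_int s * \<i> * z - z\<^sup>2)) \<le> 2 * exp (\<bar>?y\<bar> + ?y\<^sup>2)"
      using norm_triangle_ineq4[of "of_int s * \<i>" z] s1 True by (intro mult_mono) auto
    then show ?thesis by (simp add: norm_mult)
  next
    case False
    have "z * ?W = (of_int s * \<i> * z - z\<^sup>2) * expm1_quot (of_int s * \<i> * z - z\<^sup>2)" by (simp add: algebra_simps power2_eq_square)
    also have "\<dots> = exp (of_int s * \<i> * z - z\<^sup>2) - 1" by (rule expm1_quot_mult)
    finally have "cmod z * cmod ?W = cmod (exp (of_int s * \<i> * z - z\<^sup>2) - 1)" by (metis norm_mult)
    also have "\<dots> \<le> cmod (exp (of_int s * \<i> * z - z\<^sup>2)) + 1" using norm_triangle_ineq4[of "exp (of_int s * \<i> * z - z\<^sup>2)" 1] by simp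
    also have "\<dots> \<le> exp (\<bar>?y\<bar> + ?y\<^sup>2) + exp (\<bar>?y\<bar> + ?y\<^sup>2)"
      unfolding norm_exp_eq_Re using re by (intro add_mono) auto
    finally have "cmod z * cmod ?W \<le> 2 * exp (\<bar>?y\<bar> + ?y\<^sup>2)" by simp
    moreover have "1 * cmod ?W \<le> cmod z * cmod ?W" using False by (intro mult_right_mono) auto
    ultimately show ?thesis by linarith
  qed
  have "exp (- of_int s * \<i> * of_nat k * z) * osc s k z = of_real (1 / (2 * pi)) * exp (- of_nat k * z\<^sup>2) * (?W / (of_int s * \<i>))"
    by (simp add: osc_def mult_ac flip: exp_add) 
  then have "cmod (exp (- of_int s * \<i> * of_nat k * z) * osc s k z) = cmod (of_real (1 / (2 * pi)) * exp (- of_nat k * z\<^sup>2) * (?W / (of_int s * \<i>)))"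
    by (simp only:)
  also have "\<dots> = (1 / (2 * pi)) * exp (- real k * ((Re z)\<^sup>2 - ?y\<^sup>2)) * cmod ?W"
    unfolding norm_mult[of _ "?W / _"] norm_divide[of ?W] s1 by (simp add: norm_mult norm_divide power2_eq_square)
  also have "\<dots> \<le> (1 / 2) * exp (- real k * ((Re z)\<^sup>2 - ?y\<^sup>2)) * (2 * exp (\<bar>?y\<bar> + ?y\<^sup>2))"
    using W pi_ge_two by (intro mult_mono) (auto simp: field_simps)
  also have "\<dots> = exp (\<bar>?y\<bar> + ?y\<^sup>2 + (- real k * ((Re z)\<^sup>2 - ?y\<^sup>2)))"
    by (simp only: exp_add) (simp add: mult_ac)
  also have "\<dots> \<le> exp (1 + (3 * real k * (Im z)\<^sup>2 - real k * (Re z)\<^sup>2))"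
  proof -
    have "?y\<^sup>2 \<le> real k * ?y\<^sup>2" using k by (simp add: mult_le_cancel_right1)
    then show ?thesis using exp_real_bound_square[of ?y] by (simp add: algebra_simps)
  qed
  finally show ?thesis by (simp add: exp_add)
qed

text \<open>One sign per coordinate: 0 selects \<open>kap k\<close>, while 1 and -1 select the two
  oscillating parts of its increment. Expanding the product of the factors
  \<open>kap (Suc k)\<close> gives the sum over all such c.\<close>

definition ker :: "nat \<Rightarrow> ('d \<Rightarrow> int) \<Rightarrow> 'd \<Rightarrow> complex \<Rightarrow> complex" where
  "ker k c i = (if c i = 0 then kap k else osc (c i) k)"

lemma ker_holomorphic: "ker k c i holomorphic_on UNIV"
  by (simp add: ker_def kap_holomorphic osc_holomorphic)

lemma ker_bound:
  assumes k: "k \<ge> 1" and c: "c i \<in> {-1, 0, 1}"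
  shows "cmod (ker k c i z) \<le> exp 1 * real k * exp (real k * \<bar>Im z\<bar> + 3 * real k * (Im z)\<^sup>2 - real k * (Re z)\<^sup>2)"
proof (cases "c i = 0")
  case False
  then have s: "c i = 1 \<or> c i = -1" using c by auto
  let ?s = "c i"
  have "cmod (osc ?s k z) = exp (Re (of_int ?s * \<i> * of_nat k * z)) * cmod (exp (- of_int ?s * \<i> * of_nat k * z) * osc ?s k z)"
    by (simp add: norm_mult norm_exp_eq_Re flip: exp_add)
  also have "\<dots> \<le> exp (real k * \<bar>Im z\<bar>) * (exp 1 * exp (3 * real k * (Im z)\<^sup>2 - real k * (Re z)\<^sup>2))"
  proof (intro mult_mono osc_bound[OF k s])
    show "exp (Re (of_int ?s * \<i> * of_nat k * z)) \<le> exp (real k * \<bar>Im z\<bar>)"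
    proof -
      have "real k * (- of_int ?s * Im z) \<le> real k * \<bar>Im z\<bar>" using s by (intro mult_left_mono) auto
      then show ?thesis by (simp add: algebra_simps)
    qed
  qed auto
  also have "\<dots> \<le> exp (real k * \<bar>Im z\<bar>) * (exp 1 * real k * exp (3 * real k * (Im z)\<^sup>2 - real k * (Re z)\<^sup>2))"
    using k by (intro mult_left_mono) (auto simp: mult_le_cancel_left1)
  finally show ?thesis using False by (simp add: ker_def algebra_simps flip: exp_add)
next
  case True
  then show ?thesis using kap_bound[OF k, of z] by (simp add: ker_def del: of_nat_mult)
qed

section \<open>Cauchy estimates for derivatives of the kernels\<close>

lemma gaussian_displacement:
  fixes x :: real and w :: complex
  shows "3 * (Im (of_real x + w))\<^sup>2 - (Re (of_real x + w))\<^sup>2 \<le> 3 * (cmod w)\<^sup>2 - x\<^sup>2 / 2"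
proof -
  \<comment> \<open>Half of the Gaussian decay survives a displacement:
    \<open>(x + a)^2 \<ge> x^2 / 2 - a^2\<close>.\<close>
  have "0 \<le> (x + 2 * Re w)\<^sup>2" by simp
  then have 1: "x\<^sup>2 / 2 - (Re w)\<^sup>2 \<le> (x + Re w)\<^sup>2" by (simp add: power2_eq_square algebra_simps)
  have lin: "X / 2 - A \<le> S \<Longrightarrow> 0 \<le> A \<Longrightarrow> 3 * B - S \<le> 3 * (A + B) - X / 2" for X A S B :: real by (simp add: field_simps)
  have re: "Re (of_real x + w) = x + Re w" "Im (of_real x + w) = Im w" by simp_all
  show ?thesis unfolding re cmod_power2 by (rule lin[OF 1]) simp
qed

text \<open>Cauchy's inequality on a circle whose radius stays free: \<open>good_radius\<close>
  balances it against the order l, whereas \<open>smoothed_far_bound\<close> fixes it small.\<close>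

lemma ker_deriv_bound:
  assumes k: "k \<ge> 1" and c: "c i \<in> {-1, 0, 1}" and r: "r > 0"
  shows "cmod ((deriv ^^ l) (ker k c i) (of_real x)) \<le>
    exp 1 * real k * (fact l / r ^ l * exp (real k * r + 3 * real k * r\<^sup>2)) * exp (- real k * x\<^sup>2 / 2)"
proof -
  have "cmod ((deriv ^^ l) (ker k c i) (of_real x)) \<le>
      fact l * (exp 1 * real k * exp (real k * r + 3 * real k * r\<^sup>2 - real k * x\<^sup>2 / 2)) / r ^ l"
  proof (rule Cauchy_inequality[OF _ _ r])
    show "ker k c i holomorphic_on ball (of_real x) r" by (rule holomorphic_on_subset[OF ker_holomorphic subset_UNIV])
    show "continuous_on (cball (of_real x) r) (ker k c i)"
      by (rule continuous_on_subset[OF holomorphic_on_imp_continuous_on[OF ker_holomorphic] subset_UNIV])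
    fix z assume z: "norm (complex_of_real x - z) = r"
    define w where "w = z - of_real x"
    have w: "cmod w = r" "z = of_real x + w" using z by (auto simp: w_def norm_minus_commute)
    have "cmod (ker k c i z) \<le> exp 1 * real k * exp (real k * \<bar>Im z\<bar> + 3 * real k * (Im z)\<^sup>2 - real k * (Re z)\<^sup>2)"
      by (rule ker_bound[of k c i z, OF k c])
    also have "\<dots> \<le> exp 1 * real k * exp (real k * r + 3 * real k * r\<^sup>2 - real k * x\<^sup>2 / 2)"
    proof -
      have "\<bar>Im z\<bar> \<le> r" using abs_Im_le_cmod[of w] w by simp
      then have "real k * \<bar>Im z\<bar> \<le> real k * r" by (intro mult_left_mono) auto
      moreover have "real k * (3 * (Im z)\<^sup>2 - (Re z)\<^sup>2) \<le> real k * (3 * r\<^sup>2 - x\<^sup>2 / 2)"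
        using gaussian_displacement[of x w] w by (intro mult_left_mono) auto
      ultimately show ?thesis by (intro mult_left_mono) (auto simp: algebra_simps)
    qed
    finally show "cmod (ker k c i z) \<le> exp 1 * real k * exp (real k * r + 3 * real k * r\<^sup>2 - real k * x\<^sup>2 / 2)" .
  qed
  also have "\<dots> = exp 1 * real k * (fact l / r ^ l * exp (real k * r + 3 * real k * r\<^sup>2)) * exp (- real k * x\<^sup>2 / 2)"
  proof -
    have "exp (real k * r + 3 * real k * r\<^sup>2 - real k * x\<^sup>2 / 2) = exp (real k * r + 3 * real k * r\<^sup>2) * exp (- real k * x\<^sup>2 / 2)"
      by (simp flip: exp_add)
    moreover have "f * (e * (a * b)) / y = e * (f / y * a) * b" for f e a b y :: real by simp
    ultimately show ?thesis by (simp only:)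
  qed
  finally show ?thesis .
qed

text \<open>The l-th derivative of \<open>osc s k\<close> with the phase of its oscillation divided
  out. The l derivatives stem from \<open>mderiv\<close> of the convolution; further derivatives of
  the amplitude stem from integration by parts.\<close>

definition osc_amp :: "int \<Rightarrow> nat \<Rightarrow> nat \<Rightarrow> complex \<Rightarrow> complex" where
  "osc_amp s k l z = exp (- of_int s * \<i> * of_nat k * z) * (deriv ^^ l) (osc s k) z"

lemma osc_amp_holomorphic: "osc_amp s k l holomorphic_on UNIV"
  unfolding osc_amp_def[abs_def] by (intro holomorphic_intros holomorphic_higher_deriv osc_holomorphic open_UNIV)

text \<open>The l derivatives act on the oscillating kernel, so their Cauchy radius costs
  \<open>exp (k r)\<close>; the phase at the centre cancels against its reciprocal in the
  amplitude.\<close>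

lemma osc_amp_bound:
  assumes k: "k \<ge> 1" and s: "s = 1 \<or> s = -1" and r: "r > 0"
  shows "cmod (osc_amp s k l (of_real x + w)) \<le>
    exp 1 * (fact l / r ^ l * exp (real k * r)) * exp (3 * real k * (r + cmod w)\<^sup>2 - real k * x\<^sup>2 / 2)"
proof -
  let ?z = "of_real x + w"
  let ?e = "exp (Re (of_int s * \<i> * of_nat k * ?z))"
  have "cmod ((deriv ^^ l) (osc s k) ?z) \<le>
      fact l * (?e * exp (real k * r) * (exp 1 * exp (3 * real k * (r + cmod w)\<^sup>2 - real k * x\<^sup>2 / 2))) / r ^ l"
  proof (rule Cauchy_inequality[OF _ _ r])
    show "osc s k holomorphic_on ball ?z r" by (rule holomorphic_on_subset[OF osc_holomorphic subset_UNIV])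
    show "continuous_on (cball ?z r) (osc s k)"
      by (rule continuous_on_subset[OF holomorphic_on_imp_continuous_on[OF osc_holomorphic] subset_UNIV])
    fix \<zeta> assume \<zeta>: "norm (?z - \<zeta>) = r"
    define v where "v = \<zeta> - ?z"
    have v: "cmod v = r" "\<zeta> = of_real x + (w + v)" using \<zeta> by (auto simp: v_def norm_minus_commute)
    have "cmod (osc s k \<zeta>) = exp (Re (of_int s * \<i> * of_nat k * \<zeta>)) * cmod (exp (- of_int s * \<i> * of_nat k * \<zeta>) * osc s k \<zeta>)"
      by (simp add: norm_mult norm_exp_eq_Re flip: exp_add)
    also have "\<dots> \<le> (?e * exp (real k * r)) * (exp 1 * exp (3 * real k * (r + cmod w)\<^sup>2 - real k * x\<^sup>2 / 2))"
    proof (intro mult_mono)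
      have "Re (of_int s * \<i> * of_nat k * \<zeta>) = Re (of_int s * \<i> * of_nat k * ?z) + (- of_int s * real k * Im v)"
        by (simp add: v(2) algebra_simps)
      also have "- of_int s * real k * Im v \<le> real k * r"
      proof -
        have "- of_int s * Im v \<le> r" using s abs_Im_le_cmod[of v] v(1) by auto
        then have "real k * (- of_int s * Im v) \<le> real k * r" by (intro mult_left_mono) auto
        then show ?thesis by (simp add: algebra_simps)
      qed
      finally show "exp (Re (of_int s * \<i> * of_nat k * \<zeta>)) \<le> ?e * exp (real k * r)" by (simp flip: exp_add)
      have "cmod (exp (- of_int s * \<i> * of_nat k * \<zeta>) * osc s k \<zeta>) \<le> exp 1 * exp (3 * real k * (Im \<zeta>)\<^sup>2 - real k * (Re \<zeta>)\<^sup>2)"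
        by (rule osc_bound[OF k s])
      also have "\<dots> \<le> exp 1 * exp (3 * real k * (r + cmod w)\<^sup>2 - real k * x\<^sup>2 / 2)"
      proof -
        have "(cmod (w + v))\<^sup>2 \<le> (r + cmod w)\<^sup>2"
          using norm_triangle_ineq[of w v] v(1) by (intro power_mono) auto
        then have "3 * (Im \<zeta>)\<^sup>2 - (Re \<zeta>)\<^sup>2 \<le> 3 * (r + cmod w)\<^sup>2 - x\<^sup>2 / 2"
          using gaussian_displacement[of x "w + v"] unfolding v(2) by linarith
        then have "real k * (3 * (Im \<zeta>)\<^sup>2 - (Re \<zeta>)\<^sup>2) \<le> real k * (3 * (r + cmod w)\<^sup>2 - x\<^sup>2 / 2)"
          by (intro mult_left_mono) auto
        then show ?thesis by (intro mult_left_mono) (auto simp: algebra_simps)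
      qed
      finally show "cmod (exp (- of_int s * \<i> * of_nat k * \<zeta>) * osc s k \<zeta>) \<le> exp 1 * exp (3 * real k * (r + cmod w)\<^sup>2 - real k * x\<^sup>2 / 2)" .
    qed auto
    finally show "cmod (osc s k \<zeta>) \<le> ?e * exp (real k * r) * (exp 1 * exp (3 * real k * (r + cmod w)\<^sup>2 - real k * x\<^sup>2 / 2))" .
  qed
  then have "cmod (osc_amp s k l ?z) \<le> exp (- Re (of_int s * \<i> * of_nat k * ?z)) *
      (fact l * (?e * exp (real k * r) * (exp 1 * exp (3 * real k * (r + cmod w)\<^sup>2 - real k * x\<^sup>2 / 2))) / r ^ l)"
    unfolding osc_amp_def norm_mult norm_exp_eq_Re by (intro mult_mono) auto
  also have "\<dots> = (exp (- Re (of_int s * \<i> * of_nat k * ?z)) * ?e) *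
      (exp 1 * (fact l / r ^ l * exp (real k * r)) * exp (3 * real k * (r + cmod w)\<^sup>2 - real k * x\<^sup>2 / 2))"
    by (simp add: mult_ac)
  also have "exp (- Re (of_int s * \<i> * of_nat k * ?z)) * ?e = 1" by (simp flip: exp_add)
  finally show ?thesis by simp
qed

text \<open>A second Cauchy estimate, of radius \<rho>, for the derivatives produced by integration
  by parts. Its price \<open>exp (6 k \<rho>^2)\<close> has no term linear in
  \<open>k \<rho>\<close>, since the phase is gone.\<close>

lemma osc_amp_deriv_bound:
  assumes k: "k \<ge> 1" and s: "s = 1 \<or> s = -1" and r: "r > 0" and \<rho>: "\<rho> > 0"
  shows "cmod ((deriv ^^ q) (osc_amp s k l) (of_real x)) \<le>
    exp 1 * (fact q / \<rho> ^ q * exp (6 * real k * \<rho>\<^sup>2)) * (fact l / r ^ l * exp (real k * r + 6 * real k * r\<^sup>2)) * exp (- real k * x\<^sup>2 / 2)"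
proof -
  let ?B = "exp 1 * (fact l / r ^ l * exp (real k * r)) * exp (3 * real k * (r + \<rho>)\<^sup>2 - real k * x\<^sup>2 / 2)"
  have "cmod ((deriv ^^ q) (osc_amp s k l) (of_real x)) \<le> fact q * ?B / \<rho> ^ q"
  proof (rule Cauchy_inequality[OF _ _ \<rho>])
    show "osc_amp s k l holomorphic_on ball (of_real x) \<rho>" by (rule holomorphic_on_subset[OF osc_amp_holomorphic subset_UNIV])
    show "continuous_on (cball (of_real x) \<rho>) (osc_amp s k l)"
      by (rule continuous_on_subset[OF holomorphic_on_imp_continuous_on[OF osc_amp_holomorphic] subset_UNIV])
    fix z assume "norm (complex_of_real x - z) = \<rho>"
    then show "cmod (osc_amp s k l z) \<le> ?B"
      using osc_amp_bound[OF k s r, of l x "z - of_real x"] by (simp add: norm_minus_commute)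
  qed
  also have "\<dots> \<le> fact q * (exp 1 * (fact l / r ^ l * exp (real k * r)) * exp (6 * real k * r\<^sup>2 + 6 * real k * \<rho>\<^sup>2 - real k * x\<^sup>2 / 2)) / \<rho> ^ q"
  proof -
    have "0 \<le> (r - \<rho>)\<^sup>2" by simp
    then have "3 * (r + \<rho>)\<^sup>2 \<le> 6 * r\<^sup>2 + 6 * \<rho>\<^sup>2" by (simp add: power2_eq_square algebra_simps)
    then have "real k * (3 * (r + \<rho>)\<^sup>2) \<le> real k * (6 * r\<^sup>2 + 6 * \<rho>\<^sup>2)" by (intro mult_left_mono) auto
    then show ?thesis using r \<rho> by (intro divide_right_mono mult_left_mono) (auto simp: algebra_simps)
  qed
  also have "\<dots> = exp 1 * (fact q / \<rho> ^ q * exp (6 * real k * \<rho>\<^sup>2)) * (fact l / r ^ l * exp (real k * r + 6 * real k * r\<^sup>2)) * exp (- real k * x\<^sup>2 / 2)"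
  proof -
    have e: "exp (6 * real k * r\<^sup>2 + 6 * real k * \<rho>\<^sup>2 - real k * x\<^sup>2 / 2) =
        exp (6 * real k * \<rho>\<^sup>2) * exp (6 * real k * r\<^sup>2) * exp (- real k * x\<^sup>2 / 2)" by (simp flip: exp_add)
    have "x * (d * (f * a) * (p * q * g)) / y = d * (x / y * p) * (f * (a * q)) * g" for x d f a p q g y :: real
      by simp
    then show ?thesis unfolding e exp_add[of "real k * r"] .
  qed
  finally show ?thesis .
qed

lemma fact_le_self_power: "(fact l :: real) \<le> real l ^ l"
  by (metis fact_le_power le_refl of_nat_fact of_nat_le_iff of_nat_power)

text \<open>The product of \<open>fact l / r ^ l\<close> and \<open>exp (k r)\<close> is smallest
  near \<open>r = l / k\<close>. Beyond \<open>l = k\<close> the quadratic term would dominate, so r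
  stays at 1; for \<open>l = 0\<close> a radius of order \<open>1 / k\<close> keeps the exponent
  bounded.\<close>

lemma good_radius:
  assumes k: "k \<ge> 1"
  shows "\<exists>r>0. fact l / r ^ l * exp (real k * r + 6 * real k * r\<^sup>2) \<le> exp 7 * (exp 7 * real (max k l)) ^ l"
proof -
  consider "l = 0" | "1 \<le> l" "l \<le> k" | "l > k" by linarith
  then show ?thesis
  proof cases
    case 1
    have "1 + 6 / real k \<le> 7" using k by (simp add: field_simps)
    moreover have "real k * (1 / real k) + 6 * real k * (1 / real k)\<^sup>2 = 1 + 6 / real k"
      using k by (simp add: power2_eq_square field_simps)
    ultimately show ?thesis using 1 k by (intro exI[of _ "1 / real k"]) simp
  next
    case 2
    define r where "r = real l / real k"
    have r: "r > 0" using 2 k by (simp add: r_def)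
    have "real k * r + 6 * real k * r\<^sup>2 = real l + 6 * real l * (real l / real k)"
      using k by (simp add: r_def power2_eq_square)
    also have "\<dots> \<le> real l + 6 * real l * 1" using 2 k by (intro add_left_mono mult_left_mono) auto
    finally have e: "exp (real k * r + 6 * real k * r\<^sup>2) \<le> exp 7 ^ l" by (simp flip: exp_of_nat_mult)
    have "fact l / r ^ l = fact l / real l ^ l * real k ^ l" using 2 by (simp add: r_def power_divide)
    also have "\<dots> \<le> 1 * real k ^ l" using fact_le_self_power[of l] 2 by (intro mult_right_mono) (auto simp: divide_le_eq)
    finally have "fact l / r ^ l * exp (real k * r + 6 * real k * r\<^sup>2) \<le> real k ^ l * exp 7 ^ l"
      using e by (intro mult_mono) auto
    also have "\<dots> = 1 * (exp 7 * real (max k l)) ^ l" using 2 by (simp add: power_mult_distrib max_def mult.commute)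
    also have "\<dots> \<le> exp 7 * (exp 7 * real (max k l)) ^ l" by (intro mult_right_mono) auto
    finally show ?thesis using r by blast
  next
    case 3
    have e: "exp (real k * 1 + 6 * real k * 1\<^sup>2) \<le> exp 7 ^ l" using 3 by (simp flip: exp_of_nat_mult)
    have "fact l / 1 ^ l * exp (real k * 1 + 6 * real k * 1\<^sup>2) \<le> real l ^ l * exp 7 ^ l"
      using e fact_le_self_power[of l] by (intro mult_mono) auto
    also have "\<dots> = 1 * (exp 7 * real (max k l)) ^ l" using 3 by (simp add: power_mult_distrib max_def mult.commute)
    also have "\<dots> \<le> exp 7 * (exp 7 * real (max k l)) ^ l" by (intro mult_right_mono) auto
    finally show ?thesis by (intro exI[of _ 1]) auto
  qed
qed

lemma ker_deriv_bound_max: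
  assumes k: "k \<ge> 1" and c: "c i \<in> {-1, 0, 1}"
  shows "cmod ((deriv ^^ l) (ker k c i) (of_real x)) \<le>
    (exp 8 * real k) * (exp 7 * real (max k l)) ^ l * exp (- real k * x\<^sup>2 / 2)"
proof -
  obtain r where r: "r > 0" "fact l / r ^ l * exp (real k * r + 6 * real k * r\<^sup>2) \<le> exp 7 * (exp 7 * real (max k l)) ^ l"
    using good_radius[OF k] by blast
  have "fact l / r ^ l * exp (real k * r + 3 * real k * r\<^sup>2) \<le> fact l / r ^ l * exp (real k * r + 6 * real k * r\<^sup>2)"
    using r(1) by (intro mult_left_mono) auto
  then have b: "fact l / r ^ l * exp (real k * r + 3 * real k * r\<^sup>2) \<le> exp 7 * (exp 7 * real (max k l)) ^ l" using r(2) by linarith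
  have "cmod ((deriv ^^ l) (ker k c i) (of_real x)) \<le>
    exp 1 * real k * (fact l / r ^ l * exp (real k * r + 3 * real k * r\<^sup>2)) * exp (- real k * x\<^sup>2 / 2)"
    by (rule ker_deriv_bound) (use k c r(1) in auto)
  also have "\<dots> \<le> exp 1 * real k * (exp 7 * (exp 7 * real (max k l)) ^ l) * exp (- real k * x\<^sup>2 / 2)"
    using b by (intro mult_right_mono mult_left_mono) auto
  also have "\<dots> = (exp (1 + 7) * real k) * (exp 7 * real (max k l)) ^ l * exp (- real k * x\<^sup>2 / 2)"
    unfolding exp_add by (simp add: mult_ac)
  finally show ?thesis by simp
qed

text \<open>The radius \<open>sqrt (j / k)\<close> makes the price \<open>exp (6 k \<rho>^2)\<close>
  geometric in j, while each derivative costs only \<open>sqrt (j k)\<close> instead of k.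
  Integration by parts lives on this gain.\<close>

lemma osc_amp_deriv_bound_max:
  assumes k: "k \<ge> 1" and s: "s = 1 \<or> s = -1" and j: "j \<le> k" "q \<le> j"
  shows "cmod ((deriv ^^ q) (osc_amp s k l) (of_real x)) \<le>
    exp 14 * exp 6 ^ j * sqrt (real j * real k) ^ q * (exp 7 * real (max k l)) ^ l * exp (- real k * x\<^sup>2 / 2)"
proof -
  obtain r where r: "r > 0" "fact l / r ^ l * exp (real k * r + 6 * real k * r\<^sup>2) \<le> exp 7 * (exp 7 * real (max k l)) ^ l"
    using good_radius[OF k] by blast
  \<comment> \<open>For \<open>j = 0\<close> the radius would vanish.\<close>
  define J where "J = max j 1"
  define \<rho> where "\<rho> = sqrt (real J / real k)"
  have \<rho>: "\<rho> > 0" using k by (simp add: \<rho>_def J_def)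
  have sq: "\<rho>\<^sup>2 = real J / real k" by (simp add: \<rho>_def)
  define P where "P = fact q / \<rho> ^ q * exp (6 * real k * \<rho>\<^sup>2)"
  define Q where "Q = fact l / r ^ l * exp (real k * r + 6 * real k * r\<^sup>2)"
  define Q' where "Q' = exp 7 * (exp 7 * real (max k l)) ^ l"
  have nn: "0 \<le> P" "0 \<le> Q" using r(1) \<rho> by (auto simp: P_def Q_def)
  have QQ: "Q \<le> Q'" using r(2) by (simp add: Q_def Q'_def)
  have "P \<le> sqrt (real j * real k) ^ q * (exp 6 * exp 6 ^ j)" unfolding P_def
  proof (rule mult_mono)
    show "fact q / \<rho> ^ q \<le> sqrt (real j * real k) ^ q"
    proof (cases "j = 0")
      case False
      then have J: "J = j" "real j > 0" by (auto simp: J_def)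
      have "(fact q :: real) \<le> real q ^ q" by (rule fact_le_self_power)
      also have "\<dots> \<le> real j ^ q" using j by (intro power_mono) auto
      also have "real j ^ q = (sqrt (real j * real k) * \<rho>) ^ q"
      proof -
        have "sqrt (real j * real k) * \<rho> = sqrt ((real j * real k) * (real j / real k))"
          unfolding \<rho>_def J real_sqrt_mult[symmetric] ..
        also have "(real j * real k) * (real j / real k) = (real j)\<^sup>2" using k by (simp add: power2_eq_square)
        finally show ?thesis by simp
      qed
      finally show ?thesis using \<rho> by (simp add: power_mult_distrib divide_le_eq)
    qed (use j in simp)
    have "6 * real k * \<rho>\<^sup>2 = 6 * real J" using k by (simp add: sq)
    also have "\<dots> \<le> 6 + 6 * real j" by (simp add: J_def max_def)
    finally have "exp (6 * real k * \<rho>\<^sup>2) \<le> exp (6 + 6 * real j)" by simp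
    also have "\<dots> = exp 6 * exp 6 ^ j" by (simp add: exp_add mult.commute flip: exp_of_nat_mult)
    finally show "exp (6 * real k * \<rho>\<^sup>2) \<le> exp 6 * exp 6 ^ j" .
  qed (use \<rho> in auto)
  then have PQ: "P * Q \<le> (sqrt (real j * real k) ^ q * (exp 6 * exp 6 ^ j)) * Q'"
    by (rule mult_mono[OF _ QQ]) (use nn in auto)
  have "cmod ((deriv ^^ q) (osc_amp s k l) (of_real x)) \<le> exp 1 * P * Q * exp (- real k * x\<^sup>2 / 2)"
    unfolding P_def Q_def by (rule osc_amp_deriv_bound[OF k s r(1) \<rho>])
  also have "\<dots> = exp 1 * (P * Q) * exp (- real k * x\<^sup>2 / 2)" by (simp only: mult.assoc)
  also have "\<dots> \<le> exp 1 * ((sqrt (real j * real k) ^ q * (exp 6 * exp 6 ^ j)) * Q') * exp (- real k * x\<^sup>2 / 2)"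
    using PQ by (intro mult_right_mono mult_left_mono) auto
  also have "\<dots> = exp 1 * (sqrt (real j * real k) ^ q * (exp 6 * exp 6 ^ j)) * (exp 7 * (exp 7 * real (max k l)) ^ l) * exp (- real k * x\<^sup>2 / 2)"
    by (simp only: Q'_def mult.assoc)
  also have "\<dots> = exp (1 + 6 + 7) * exp 6 ^ j * sqrt (real j * real k) ^ q * (exp 7 * real (max k l)) ^ l * exp (- real k * x\<^sup>2 / 2)"
    unfolding exp_add by (simp add: mult_ac)
  finally show ?thesis by simp
qed

section \<open>Estimates for the smoothed functions\<close>

text \<open>A fixed integrable majorant, independent of k; pointwise bounds against it become L1
  bounds in \<open>DL1_bound_of_pointwise\<close>.\<close>

definition gauss_weight :: "real^'d::finite \<Rightarrow> real" where
  "gauss_weight x = exp (- (norm x)\<^sup>2 / 4)"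

lemma norm_vec_power2: "(norm (x :: real^'d::finite))\<^sup>2 = (\<Sum>i\<in>UNIV. (x $ i)\<^sup>2)"
  by (simp add: norm_vec_def L2_set_def sum_nonneg)

lemma gauss_weight_finite:
  "\<exists>G\<ge>0. (\<integral>\<^sup>+ x. ennreal (gauss_weight (x :: real^'d::finite)) \<partial>lborel) \<le> ennreal G"
proof -
  have one: "(\<integral>\<^sup>+ t. ennreal (exp (- t\<^sup>2 / 4)) \<partial>(lborel :: real measure)) < \<infinity>"
  proof -
    have eq: "exp (- t\<^sup>2 / 4) = sqrt (4 * pi) * normal_density 0 (sqrt 2) t" for t :: real
      by (simp add: normal_density_def)
    have "integrable lborel (\<lambda>t::real. exp (- t\<^sup>2 / 4))"
      unfolding eq by (intro integrable_mult_right integrable_normal_density) simp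
    then show ?thesis by (simp add: integrable_iff_bounded)
  qed
  have "(\<integral>\<^sup>+ x. ennreal (gauss_weight (x :: real^'d)) \<partial>lborel) = (\<integral>\<^sup>+ x. (\<Prod>b\<in>Basis. ennreal (exp (- ((x :: real^'d) \<bullet> b)\<^sup>2 / 4))) \<partial>lborel)"
  proof (rule nn_integral_cong)
    fix x :: "real^'d"
    have "(norm x)\<^sup>2 = (\<Sum>b\<in>Basis. (x \<bullet> b)\<^sup>2)"
      unfolding power2_norm_eq_inner by (subst euclidean_inner) (simp add: power2_eq_square)
    then have "gauss_weight x = exp (\<Sum>b\<in>Basis. - (x \<bullet> b)\<^sup>2 / 4)"
      by (simp add: gauss_weight_def sum_divide_distrib sum_negf)
    then show "ennreal (gauss_weight x) = (\<Prod>b\<in>Basis. ennreal (exp (- (x \<bullet> b)\<^sup>2 / 4)))"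
      by (simp add: exp_sum prod_ennreal)
  qed
  also have "\<dots> = (\<Prod>b\<in>(Basis :: (real^'d) set). (\<integral>\<^sup>+ t. ennreal (exp (- t\<^sup>2 / 4)) \<partial>lborel))"
    by (rule nn_integral_lborel_prod) auto
  also have "\<dots> < \<infinity>" using one by (simp add: power_less_top_ennreal)
  finally show ?thesis unfolding ennreal_less_top_iff_bound .
qed

lemma DL1_bound_of_pointwise:
  fixes u :: "real^'d::finite \<Rightarrow> complex"
  assumes G: "G \<ge> 0" "(\<integral>\<^sup>+ x. ennreal (gauss_weight (x :: real^'d)) \<partial>lborel) \<le> ennreal G" and B: "B \<ge> 0"
    and b: "\<And>x. cmod (mderiv \<alpha> u x) \<le> B * gauss_weight x"
  shows "L1_norm (mderiv \<alpha> u) \<le> ennreal (B * G)"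
proof -
  have m[measurable]: "(gauss_weight :: real^'d \<Rightarrow> real) \<in> borel_measurable borel"
    unfolding gauss_weight_def by measurable
  have "L1_norm (mderiv \<alpha> u) \<le> (\<integral>\<^sup>+ x. ennreal B * ennreal (gauss_weight (x :: real^'d)) \<partial>lborel)"
    by (intro nn_integral_mono) (use b B in \<open>simp add: ennreal_leI gauss_weight_def flip: ennreal_mult\<close>)
  also have "\<dots> = ennreal B * (\<integral>\<^sup>+ x. ennreal (gauss_weight (x :: real^'d)) \<partial>lborel)"
    by (rule nn_integral_cmult) auto
  also have "\<dots> \<le> ennreal B * ennreal G" using G by (intro mult_left_mono) auto
  finally show ?thesis using G B by (simp add: ennreal_mult)
qed

lemma prod_power_le_power_sum:
  fixes A :: "nat \<Rightarrow> real" and \<alpha> :: "'d::finite \<Rightarrow> nat"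
  assumes "\<And>l. 0 \<le> A l" "mono A"
  shows "(\<Prod>i\<in>UNIV. A (\<alpha> i) ^ \<alpha> i) \<le> A (mabs \<alpha>) ^ mabs \<alpha>"
proof -
  have "(\<Prod>i\<in>UNIV. A (\<alpha> i) ^ \<alpha> i) \<le> (\<Prod>i\<in>UNIV. A (mabs \<alpha>) ^ \<alpha> i)"
  proof (rule prod_mono, intro conjI power_mono)
    fix i
    have "\<alpha> i \<le> mabs \<alpha>" unfolding mabs_def by (rule member_le_sum) auto
    then show "A (\<alpha> i) \<le> A (mabs \<alpha>)" using assms(2) by (simp add: monoD)
  qed (use assms in auto)
  then show ?thesis by (simp add: mabs_def power_sum)
qed

lemma prod_gauss: "(\<Prod>i\<in>UNIV. exp (- c * (x $ i - y $ i)\<^sup>2 / 2)) = exp (- c * (norm (x - y :: real^'d::finite))\<^sup>2 / 2)"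
  unfolding norm_vec_power2 by (simp add: exp_sum[symmetric] sum_negf sum_divide_distrib sum_distrib_left)

lemma ker_factor_prod_bound:
  fixes x y :: "real^'d::finite"
  shows "(\<Prod>i\<in>UNIV. (exp 8 * real k) * (exp 7 * real (max k (\<alpha> i))) ^ \<alpha> i * exp (- real k * (x $ i - y $ i)\<^sup>2 / 2)) \<le>
    (exp 8 * real k) ^ CARD('d) * (exp 7 * real (max k (mabs \<alpha>))) ^ mabs \<alpha> * exp (- real k * (norm (x - y))\<^sup>2 / 2)"
proof -
  have "(\<Prod>i\<in>UNIV. (exp 8 * real k) * (exp 7 * real (max k (\<alpha> i))) ^ \<alpha> i * exp (- real k * (x $ i - y $ i)\<^sup>2 / 2))
     = (exp 8 * real k) ^ CARD('d) * (\<Prod>i\<in>UNIV. (exp 7 * real (max k (\<alpha> i))) ^ \<alpha> i) * exp (- real k * (norm (x - y))\<^sup>2 / 2)"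
    unfolding prod.distrib prod_gauss by (simp add: power_mult_distrib)
  also have "\<dots> \<le> (exp 8 * real k) ^ CARD('d) * (exp 7 * real (max k (mabs \<alpha>))) ^ mabs \<alpha> * exp (- real k * (norm (x - y))\<^sup>2 / 2)"
  proof (intro mult_right_mono mult_left_mono)
    show "(\<Prod>i\<in>UNIV. (exp 7 * real (max k (\<alpha> i))) ^ \<alpha> i) \<le> (exp 7 * real (max k (mabs \<alpha>))) ^ mabs \<alpha>"
      by (rule prod_power_le_power_sum[of "\<lambda>l. exp 7 * real (max k l)"]) (auto simp: mono_def)
  qed auto
  finally show ?thesis .
qed

lemma ker_prod_bound:
  fixes x y :: "real^'d::finite"
  assumes k: "k \<ge> 1" and c: "\<And>i. c i \<in> {-1, 0, 1}"
  shows "cmod (\<Prod>i\<in>UNIV. entire_kernel (ker k c) \<alpha> i (x $ i - y $ i)) \<le>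
    (exp 8 * real k) ^ CARD('d) * (exp 7 * real (max k (mabs \<alpha>))) ^ mabs \<alpha> * exp (- real k * (norm (x - y))\<^sup>2 / 2)"
proof -
  have "cmod (\<Prod>i\<in>UNIV. entire_kernel (ker k c) \<alpha> i (x $ i - y $ i)) \<le>
      (\<Prod>i\<in>UNIV. (exp 8 * real k) * (exp 7 * real (max k (\<alpha> i))) ^ \<alpha> i * exp (- real k * (x $ i - y $ i)\<^sup>2 / 2))"
    unfolding prod_norm[symmetric] entire_kernel_def
  proof (intro prod_mono conjI norm_ge_zero)
    fix i
    show "cmod ((deriv ^^ \<alpha> i) (ker k c i) (of_real (x $ i - y $ i))) \<le>
      (exp 8 * real k) * (exp 7 * real (max k (\<alpha> i))) ^ \<alpha> i * exp (- real k * (x $ i - y $ i)\<^sup>2 / 2)"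
      by (rule ker_deriv_bound_max[of k c i, OF k c])
  qed
  also note ker_factor_prod_bound
  finally show ?thesis .
qed

text \<open>In contrast to \<open>ker_prod_bound\<close>, where the radius is tuned to each order of
  differentiation, one radius serves all orders and the derivatives have plain factorial
  growth.\<close>

lemma ker_prod_bound_radius:
  fixes x y :: "real^'d::finite"
  assumes k: "k \<ge> 1" and c: "\<And>i. c i \<in> {-1, 0, 1}" and r: "r > 0"
  shows "cmod (\<Prod>i\<in>UNIV. entire_kernel (ker k c) \<alpha> i (x $ i - y $ i)) \<le>
    (exp 1 * real k) ^ CARD('d) * exp (real CARD('d) * (real k * r + 3 * real k * r\<^sup>2)) * (real (mabs \<alpha>) / r) ^ mabs \<alpha> * exp (- real k * (norm (x - y))\<^sup>2 / 2)"
proof -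
  let ?e = "exp (real k * r + 3 * real k * r\<^sup>2)"
  have "cmod (\<Prod>i\<in>UNIV. entire_kernel (ker k c) \<alpha> i (x $ i - y $ i)) \<le>
      (\<Prod>i\<in>UNIV. (exp 1 * real k) * ((real (\<alpha> i) / r) ^ \<alpha> i * ?e) * exp (- real k * (x $ i - y $ i)\<^sup>2 / 2))"
    unfolding prod_norm[symmetric] entire_kernel_def
  proof (intro prod_mono conjI norm_ge_zero)
    fix i
    have "cmod ((deriv ^^ \<alpha> i) (ker k c i) (of_real (x $ i - y $ i))) \<le>
      exp 1 * real k * (fact (\<alpha> i) / r ^ \<alpha> i * ?e) * exp (- real k * (x $ i - y $ i)\<^sup>2 / 2)"
      by (rule ker_deriv_bound[of k c i r, OF k c r])
    also have "\<dots> \<le> (exp 1 * real k) * ((real (\<alpha> i) / r) ^ \<alpha> i * ?e) * exp (- real k * (x $ i - y $ i)\<^sup>2 / 2)"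
      using fact_le_self_power[of "\<alpha> i"] r
      by (intro mult_right_mono mult_left_mono) (auto simp: power_divide divide_right_mono)
    finally show "cmod ((deriv ^^ \<alpha> i) (ker k c i) (of_real (x $ i - y $ i))) \<le>
      (exp 1 * real k) * ((real (\<alpha> i) / r) ^ \<alpha> i * ?e) * exp (- real k * (x $ i - y $ i)\<^sup>2 / 2)" .
  qed
  also have "\<dots> = (exp 1 * real k) ^ CARD('d) * exp (real CARD('d) * (real k * r + 3 * real k * r\<^sup>2)) * (\<Prod>i\<in>UNIV. (real (\<alpha> i) / r) ^ \<alpha> i) * exp (- real k * (norm (x - y))\<^sup>2 / 2)"
    unfolding prod.distrib prod_gauss by (simp add: exp_of_nat_mult power_mult_distrib)
  also have "\<dots> \<le> (exp 1 * real k) ^ CARD('d) * exp (real CARD('d) * (real k * r + 3 * real k * r\<^sup>2)) * (real (mabs \<alpha>) / r) ^ mabs \<alpha> * exp (- real k * (norm (x - y))\<^sup>2 / 2)"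
  proof (intro mult_right_mono mult_left_mono)
    show "(\<Prod>i\<in>UNIV. (real (\<alpha> i) / r) ^ \<alpha> i) \<le> (real (mabs \<alpha>) / r) ^ mabs \<alpha>"
      by (rule prod_power_le_power_sum[of "\<lambda>l. real l / r"]) (use r in \<open>auto simp: mono_def divide_right_mono\<close>)
  qed auto
  finally show ?thesis .
qed

text \<open>From \<open>|x|^2 \<le> 2 |x - y|^2 + 2 |y|^2\<close> and \<open>k \<ge> 1\<close>;
  hence the 4 in \<open>gauss_weight\<close>.\<close>

lemma gauss_translate_bound:
  fixes x y :: "real^'d::finite"
  assumes k: "k \<ge> (1::nat)" and y: "norm y \<le> R"
  shows "exp (- real k * (norm (x - y))\<^sup>2 / 2) \<le> exp (R\<^sup>2 / 2) * gauss_weight x"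
proof -
  have "norm x \<le> norm (x - y) + norm y" by (metis diff_add_cancel norm_triangle_ineq)
  then have "(norm x)\<^sup>2 \<le> (norm (x - y) + norm y)\<^sup>2" by (intro power_mono) auto
  moreover have "0 \<le> (norm (x - y) - norm y)\<^sup>2" by simp
  ultimately have "(norm x)\<^sup>2 \<le> 2 * (norm (x - y))\<^sup>2 + 2 * (norm y)\<^sup>2" by (simp add: power2_eq_square algebra_simps)
  moreover have "(norm y)\<^sup>2 \<le> R\<^sup>2" using y by (intro power_mono) auto
  moreover have "1 * (norm (x - y))\<^sup>2 \<le> real k * (norm (x - y))\<^sup>2" using k by (intro mult_right_mono) auto
  ultimately have "- real k * (norm (x - y))\<^sup>2 / 2 \<le> R\<^sup>2 / 2 + - (norm x)\<^sup>2 / 4" by (simp add: field_simps)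
  then have "exp (- real k * (norm (x - y))\<^sup>2 / 2) \<le> exp (R\<^sup>2 / 2 + - (norm x)\<^sup>2 / 4)" by simp
  then show ?thesis unfolding gauss_weight_def exp_add .
qed

text \<open>For \<open>l \<le> k\<close> the power is compared with the weights at the point
  \<open>R = A k\<close>, which costs \<open>exp (\<omega> (A k) / n)\<close>; for
  \<open>l > k\<close> the growth is factorial and a large n absorbs it. The exponential is the cost
  that the decay of the increments must beat.\<close>

lemma max_power_Mw:
  assumes w: "weight_function \<omega>" and A: "A \<ge> 1"
  shows "\<exists>C\<ge>1. \<exists>n0\<ge>1. \<forall>n\<ge>n0. \<forall>k\<ge>1. \<forall>l. (A * real (max k l)) ^ l \<le> C * Mw \<omega> n l * exp (\<omega> (A * real k) / real n)"
proof -
  obtain C n0 where C: "C \<ge> 0" "n0 \<ge> 1" "\<And>n l. n \<ge> n0 \<Longrightarrow> (A * real l) ^ l \<le> C * Mw \<omega> n l"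
    using Mw_dominates_factorial[OF w, of A] A by auto
  have "(A * real (max k l)) ^ l \<le> (C + 1) * Mw \<omega> n l * exp (\<omega> (A * real k) / real n)"
    if n: "n \<ge> n0" and k: "k \<ge> 1" for n k l :: nat
  proof -
    have n1: "n \<ge> 1" using n C(2) by simp
    have Ak: "A * real k \<ge> 1" using mult_mono[of 1 A 1 "real k"] A k by simp
    have "0 \<le> \<omega> (A * real k)" using w Ak unfolding weight_function_def by auto
    then have e: "1 \<le> exp (\<omega> (A * real k) / real n)" by simp
    show ?thesis
    proof (cases "l \<le> k")
      case True
      then have "(A * real (max k l)) ^ l \<le> 1 * (Mw \<omega> n l * exp (\<omega> (A * real k) / real n))"
        using Mw_power_le[OF w Ak n1, of l] by (simp add: max_def)
      also have "\<dots> \<le> (C + 1) * (Mw \<omega> n l * exp (\<omega> (A * real k) / real n))"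
        using C(1) by (intro mult_right_mono) auto
      finally show ?thesis by (simp add: mult.assoc)
    next
      case False
      then have "(A * real (max k l)) ^ l \<le> (C * Mw \<omega> n l) * 1" using C(3)[OF n, of l] by (simp add: max_def)
      also have "\<dots> \<le> ((C + 1) * Mw \<omega> n l) * exp (\<omega> (A * real k) / real n)"
        using C(1) e by (intro mult_mono mult_right_mono) auto
      finally show ?thesis .
    qed
  qed
  then show ?thesis using C by (intro exI[of _ "C + 1"] exI[of _ n0] conjI) auto
qed

abbreviation smoothed :: "nat \<Rightarrow> ('d \<Rightarrow> int) \<Rightarrow> (real^'d::finite \<Rightarrow> complex) \<Rightarrow> real^'d \<Rightarrow> complex" where
  "smoothed k c v \<equiv> pconv (entire_kernel (ker k c) (\<lambda>_. 0)) v"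

lemma cbox_norm_bound: "\<exists>R\<ge>0. \<forall>y\<in>cbox a b. norm (y :: real^'d::finite) \<le> R"
proof -
  obtain R where "\<forall>y\<in>cbox a b. norm (y :: real^'d::finite) \<le> R" using bounded_cbox bounded_iff by metis
  then show ?thesis by (intro exI[of _ "max R 0"]) auto
qed

lemma smoothed_pointwise_bound:
  fixes v :: "real^'d::finite \<Rightarrow> complex"
  assumes k: "k \<ge> 1" and c: "\<And>i. c i \<in> {-1, 0, 1}" and v: "continuous_on UNIV v" "\<And>y. y \<notin> cbox a b \<Longrightarrow> v y = 0"
    and V: "\<And>y. cmod (v y) \<le> V" and R: "\<And>y. y \<in> cbox a b \<Longrightarrow> norm y \<le> R"
  shows "cmod (mderiv \<alpha> (smoothed k c v) x) \<le>
    (V * measure lborel (cbox a b) * exp (R\<^sup>2 / 2) * (exp 8 * real k) ^ CARD('d)) * (exp 7 * real (max k (mabs \<alpha>))) ^ mabs \<alpha> * gauss_weight x"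
proof -
  note h = ker_holomorphic[of k c]
  let ?B = "((exp 8 * real k) ^ CARD('d) * (exp 7 * real (max k (mabs \<alpha>))) ^ mabs \<alpha>) * (exp (R\<^sup>2 / 2) * gauss_weight x) * V"
  have V0: "0 \<le> V" using V[of 0] norm_ge_zero order_trans by blast
  have "cmod (pconv (entire_kernel (ker k c) \<alpha>) v x) \<le> ?B * measure lborel (cbox a b)"
  proof (rule pconv_bound[OF continuous_on_entire_kernel[OF h] v])
    show "0 \<le> ?B" using V0 by (simp add: gauss_weight_def)
    fix y assume y: "y \<in> cbox a b"
    have "cmod (\<Prod>i\<in>UNIV. entire_kernel (ker k c) \<alpha> i (x $ i - y $ i)) \<le>
        ((exp 8 * real k) ^ CARD('d) * (exp 7 * real (max k (mabs \<alpha>))) ^ mabs \<alpha>) * exp (- real k * (norm (x - y))\<^sup>2 / 2)"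
      by (rule ker_prod_bound[OF k c])
    also have "\<dots> \<le> ((exp 8 * real k) ^ CARD('d) * (exp 7 * real (max k (mabs \<alpha>))) ^ mabs \<alpha>) * (exp (R\<^sup>2 / 2) * gauss_weight x)"
      by (intro mult_left_mono gauss_translate_bound[OF k R[OF y]]) auto
    finally show "cmod ((\<Prod>i\<in>UNIV. entire_kernel (ker k c) \<alpha> i (x $ i - y $ i)) * v y) \<le> ?B"
      unfolding norm_mult using V by (intro mult_mono) (auto simp: gauss_weight_def)
  qed
  also have "?B * measure lborel (cbox a b) = (V * measure lborel (cbox a b) * exp (R\<^sup>2 / 2) * (exp 8 * real k) ^ CARD('d)) * (exp 7 * real (max k (mabs \<alpha>))) ^ mabs \<alpha> * gauss_weight x"
    by (simp only: mult_ac)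
  finally show ?thesis using mderiv_pconv[OF h v, where \<alpha> = \<alpha>] by simp
qed

abbreviation gauss_bounded :: "real^'d::finite \<Rightarrow> real^'d \<Rightarrow> nat \<Rightarrow> real \<Rightarrow> nat \<Rightarrow> bool" where
  "gauss_bounded a b n C k \<equiv> \<forall>c v V \<alpha> x. (\<forall>i. c i \<in> {-1, 0, 1}) \<and> continuous_on UNIV v \<and> (\<forall>y. y \<notin> cbox a b \<longrightarrow> v y = 0) \<and> (\<forall>y. cmod (v y) \<le> V)
     \<longrightarrow> cmod (mderiv \<alpha> (smoothed k c v) x) \<le> (C * V) * Mw omega1 n (mabs \<alpha>) * gauss_weight x"

text \<open>The index n serves all k, the constant does not. This is enough for membership and for
  one starting index.\<close>

lemma smoothed_bound_omega1:
  fixes a b :: "real^'d::finite"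
  shows "\<exists>n\<ge>1. \<forall>k\<ge>1. \<exists>C\<ge>0. gauss_bounded a b n C k"
proof -
  obtain R where R: "R \<ge> 0" "\<And>y. y \<in> cbox a b \<Longrightarrow> norm y \<le> R" using cbox_norm_bound by blast
  obtain C0 n where C0: "C0 \<ge> 1" "n \<ge> 1" "\<And>k l. k \<ge> 1 \<Longrightarrow> (exp 7 * real (max k l)) ^ l \<le> C0 * Mw omega1 n l * exp (omega1 (exp 7 * real k) / real n)"
    using max_power_Mw[OF weight_function_omega1, of "exp 7"] by auto
  have "\<exists>C\<ge>0. gauss_bounded a b n C k" if k: "k \<ge> 1" for k
  proof -
    define D where "D = measure lborel (cbox a b) * exp (R\<^sup>2 / 2) * (exp 8 * real k) ^ CARD('d)"
    define C where "C = D * (C0 * exp (omega1 (exp 7 * real k) / real n))"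
    have D: "D \<ge> 0" by (simp add: D_def)
    have "cmod (mderiv \<alpha> (smoothed k c v) x) \<le> (C * V) * Mw omega1 n (mabs \<alpha>) * gauss_weight x"
      if c: "\<forall>i. c i \<in> {-1, 0, 1}" and v: "continuous_on UNIV v" "\<forall>y. y \<notin> cbox a b \<longrightarrow> v y = 0" "\<forall>y. cmod (v y) \<le> V" for c v V \<alpha> x
    proof -
      have V0: "0 \<le> V" using v(3) norm_ge_zero order_trans by blast
      have "cmod (mderiv \<alpha> (smoothed k c v) x) \<le> (V * measure lborel (cbox a b) * exp (R\<^sup>2 / 2) * (exp 8 * real k) ^ CARD('d)) * (exp 7 * real (max k (mabs \<alpha>))) ^ mabs \<alpha> * gauss_weight x"
        by (rule smoothed_pointwise_bound[OF k _ v(1)]) (use c v R in auto)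
      also have "\<dots> = V * D * (exp 7 * real (max k (mabs \<alpha>))) ^ mabs \<alpha> * gauss_weight x" by (simp add: D_def mult_ac)
      also have "\<dots> \<le> V * D * (C0 * Mw omega1 n (mabs \<alpha>) * exp (omega1 (exp 7 * real k) / real n)) * gauss_weight x"
        using V0 D by (intro mult_right_mono mult_left_mono C0(3)[OF k]) (auto simp: gauss_weight_def)
      also have "\<dots> = (C * V) * Mw omega1 n (mabs \<alpha>) * gauss_weight x" by (simp add: C_def mult_ac)
      finally show ?thesis .
    qed
    moreover have "C \<ge> 0" using D C0(1) by (simp add: C_def)
    ultimately show ?thesis by (intro exI[of _ C]) blast
  qed
  then show ?thesis using C0(2) by blast
qed

text \<open>Smoothing brings any continuous function supported in a box into the space on which the
  two functionals of the theorem can be compared.\<close>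

lemma smoothed_in_DL1_omega1:
  fixes v :: "real^'d::finite \<Rightarrow> complex"
  assumes k: "k \<ge> 1" and c: "\<And>i. c i \<in> {-1, 0, 1}" and v: "continuous_on UNIV v" "\<And>y. y \<notin> cbox a b \<Longrightarrow> v y = 0"
  shows "smoothed k c v \<in> DL1 omega1"
proof -
  obtain n where "n \<ge> 1" and *: "\<forall>k\<ge>1. \<exists>C\<ge>0. gauss_bounded a b n C k"
    using smoothed_bound_omega1[of a b] by (elim exE conjE)
  have "bounded (v ` cbox a b)"
    by (intro compact_imp_bounded compact_continuous_image continuous_on_subset[OF v(1)]) auto
  then obtain V where V: "\<And>y. y \<in> cbox a b \<Longrightarrow> cmod (v y) \<le> V" "V > 0" unfolding bounded_pos by auto
  have V': "cmod (v y) \<le> V" for y using V v(2)[of y] by (cases "y \<in> cbox a b") auto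
  from *[rule_format, OF k] obtain C where C: "C \<ge> 0" "\<And>\<alpha> x. cmod (mderiv \<alpha> (smoothed k c v) x) \<le> (C * V) * Mw omega1 n (mabs \<alpha>) * gauss_weight x"
    using c v V' by (elim exE conjE) auto
  obtain G where G: "G \<ge> 0" "(\<integral>\<^sup>+ x. ennreal (gauss_weight (x :: real^'d)) \<partial>lborel) \<le> ennreal G"
    using gauss_weight_finite by blast
  have "L1_norm (mderiv \<alpha> (smoothed k c v)) \<le> ennreal ((C * V * G) * Mw omega1 n (mabs \<alpha>))" for \<alpha>
  proof -
    have "L1_norm (mderiv \<alpha> (smoothed k c v)) \<le> ennreal ((C * V) * Mw omega1 n (mabs \<alpha>) * G)"
      by (rule DL1_bound_of_pointwise[OF G]) (use C V(2) in auto)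
    then show ?thesis by (simp add: mult_ac)
  qed
  moreover have "smooth_on UNIV (smoothed k c v)" by (rule smooth_on_pconv[OF ker_holomorphic v])
  moreover have "C * V * G \<ge> 0" using C(1) V(2) G(1) by simp
  ultimately show ?thesis unfolding DL1_iff using \<open>n \<ge> 1\<close> by (intro conjI exI[of _ n] exI[of _ "C * V * G"]) auto
qed

lemma smoothed_in_E_open_omega1:
  fixes v :: "real^'d::finite \<Rightarrow> complex"
  assumes "k \<ge> 1" "\<And>i. c i \<in> {-1, 0, 1}" "continuous_on UNIV v" "\<And>y. y \<notin> cbox a b \<Longrightarrow> v y = 0"
  shows "smoothed k c v \<in> E_open omega1 UNIV"
  by (rule subsetD[OF DL1_subset_E_open[OF weight_function_omega1] smoothed_in_DL1_omega1[OF assms]])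

text \<open>The form in which the carrier enters: g is controlled by derivatives on an arbitrarily
  small neighbourhood of K, although its arguments are defined everywhere.\<close>

lemma carried_bound:
  assumes g: "g \<in> E_dual_carried omega1 K" and U: "open U" "K \<subseteq> U" and n: "n \<ge> 1"
  shows "\<exists>C\<ge>0. \<forall>\<phi>\<in>E_open omega1 UNIV. \<forall>B\<ge>0. (deriv_bounded omega1 n U B \<phi>) \<longrightarrow> cmod (g \<phi>) \<le> C * B"
proof -
  from g have "\<forall>\<Omega>. open \<Omega> \<and> K \<subseteq> \<Omega> \<longrightarrow> (\<exists>h \<in> E_dual omega1 \<Omega>. \<forall>\<phi> \<in> E_open omega1 UNIV. h (restrict0 \<Omega> \<phi>) = g \<phi>)"
    unfolding E_dual_carried_def by (elim CollectE conjE)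
  from this[rule_format, OF conjI[OF U]] obtain h where h: "h \<in> E_dual omega1 U" "\<And>\<phi>. \<phi> \<in> E_open omega1 UNIV \<Longrightarrow> h (restrict0 U \<phi>) = g \<phi>"
    by (elim bexE) auto
  from E_dual_bound[OF weight_function_omega1 U(1) h(1) n] obtain C D where C: "C \<ge> 0" "compact D" "D \<subseteq> U"
    "\<forall>\<phi>\<in>E_open omega1 U. \<forall>B\<ge>0. (deriv_bounded omega1 n D B \<phi>) \<longrightarrow> cmod (h \<phi>) \<le> C * B"
    by (elim exE conjE)
  have "cmod (g \<phi>) \<le> C * B" if \<phi>: "\<phi> \<in> E_open omega1 UNIV" "B \<ge> 0" "deriv_bounded omega1 n U B \<phi>" for \<phi> B
  proof -
    have r: "restrict0 U \<phi> \<in> E_open omega1 U" by (rule restrict0_in_E_open[OF open_UNIV U(1) subset_UNIV \<phi>(1)])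
    have "mderiv \<alpha> (restrict0 U \<phi>) x = mderiv \<alpha> \<phi> x" if "x \<in> D" for \<alpha> x
      by (rule mderiv_cong[OF U(1)]) (use that C(3) in \<open>auto simp: restrict0_def\<close>)
    then have "deriv_bounded omega1 n D B (restrict0 U \<phi>)"
      using \<phi>(3) C(3) by auto
    then have "cmod (h (restrict0 U \<phi>)) \<le> C * B" using C(4)[rule_format, OF r \<phi>(2)] by blast
    then show ?thesis using h(2)[OF \<phi>(1)] by simp
  qed
  then show ?thesis using C(1) by blast
qed

text \<open>At distance \<eta> from the support the Gaussian is at most
  \<open>exp (- k \<eta>^2 / 2)\<close>. A Cauchy radius that does not depend on k costs
  \<open>exp (d (k r + 3 k r^2))\<close> and leaves derivatives of analytic growth.\<close>

lemma smoothed_far_bound: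
  fixes a b :: "real^'d::finite"
  assumes \<eta>: "\<eta> > 0"
  shows "\<exists>n\<ge>1. \<exists>C\<ge>0. \<exists>\<epsilon>>0. \<forall>k\<ge>1. \<forall>c v V x \<alpha>. (\<forall>i. c i \<in> {-1, 0, 1}) \<and> continuous_on UNIV v \<and> (\<forall>y. y \<notin> cbox a b \<longrightarrow> v y = 0) \<and> (\<forall>y. cmod (v y) \<le> V)
     \<and> (\<forall>y. v y \<noteq> 0 \<longrightarrow> \<eta> \<le> dist x y)
     \<longrightarrow> cmod (mderiv \<alpha> (smoothed k c v) x) \<le> (C * V * real k ^ CARD('d) * exp (- \<epsilon> * real k)) * Mw omega1 n (mabs \<alpha>)"
proof -
  define d where "d = real CARD('d)"
  have d: "d \<ge> 1" unfolding d_def using zero_less_card_finite[where 'a = 'd] by linarith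
  \<comment> \<open>With this radius the Cauchy loss is at most \<open>k \<eta>^2 / 4\<close>, half
    of the Gaussian exponent.\<close>
  define r where "r = min 1 (\<eta>\<^sup>2 / (16 * d))"
  have r: "r > 0" "r \<le> 1" "r \<le> \<eta>\<^sup>2 / (16 * d)" using \<eta> d by (auto simp: r_def)
  have rd: "d * (r + 3 * r\<^sup>2) \<le> \<eta>\<^sup>2 / 4"
  proof -
    have "r\<^sup>2 \<le> r" using r by (simp add: power2_eq_square mult_left_le)
    then have "d * (r + 3 * r\<^sup>2) \<le> d * (4 * (\<eta>\<^sup>2 / (16 * d)))" using r(3) d by (intro mult_left_mono) auto
    then show ?thesis using d by (simp add: field_simps)
  qed
  obtain C0 n where C0: "C0 \<ge> 0" "n \<ge> 1" "\<And>l. ((1 / r) * real l) ^ l \<le> C0 * Mw omega1 n l"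
    using Mw_dominates_factorial[OF weight_function_omega1, of "1 / r"] r(1) by auto
  define C where "C = exp 1 ^ CARD('d) * C0 * measure lborel (cbox a b)"
  have "cmod (mderiv \<alpha> (smoothed k c v) x) \<le> (C * V * real k ^ CARD('d) * exp (- (\<eta>\<^sup>2 / 4) * real k)) * Mw omega1 n (mabs \<alpha>)"
    if k: "k \<ge> 1" and c: "\<forall>i. c i \<in> {-1, 0, 1}" and v: "continuous_on UNIV v" "\<forall>y. y \<notin> cbox a b \<longrightarrow> v y = 0" "\<forall>y. cmod (v y) \<le> V"
      and far: "\<forall>y. v y \<noteq> 0 \<longrightarrow> \<eta> \<le> dist x y" for k c v V x \<alpha>
  proof -
    note h = ker_holomorphic[of k c]
    have V0: "0 \<le> V" using v(3) norm_ge_zero order_trans by blast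
    let ?B = "(exp 1 * real k) ^ CARD('d) * exp (- (\<eta>\<^sup>2 / 4) * real k) * (C0 * Mw omega1 n (mabs \<alpha>)) * V"
    have "cmod (pconv (entire_kernel (ker k c) \<alpha>) v x) \<le> ?B * measure lborel (cbox a b)"
    proof (rule pconv_bound[OF continuous_on_entire_kernel[OF h] v(1)])
      show "0 \<le> ?B" using V0 C0 by simp
      fix y assume y: "y \<in> cbox a b"
      show "cmod ((\<Prod>i\<in>UNIV. entire_kernel (ker k c) \<alpha> i (x $ i - y $ i)) * v y) \<le> ?B"
      proof (cases "v y = 0")
        case True
        then show ?thesis using \<open>0 \<le> ?B\<close> by simp
      next
        case False
        then have dist: "\<eta> \<le> norm (x - y)" using far by (simp add: dist_norm)
        have "cmod (\<Prod>i\<in>UNIV. entire_kernel (ker k c) \<alpha> i (x $ i - y $ i)) \<le>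
          (exp 1 * real k) ^ CARD('d) * exp (real CARD('d) * (real k * r + 3 * real k * r\<^sup>2)) * (real (mabs \<alpha>) / r) ^ mabs \<alpha> * exp (- real k * (norm (x - y))\<^sup>2 / 2)"
          by (rule ker_prod_bound_radius[OF k _ r(1)]) (use c in auto)
        also have "\<dots> = (exp 1 * real k) ^ CARD('d) * (exp (d * (real k * r + 3 * real k * r\<^sup>2)) * exp (- real k * (norm (x - y))\<^sup>2 / 2)) * ((1 / r) * real (mabs \<alpha>)) ^ mabs \<alpha>"
          by (simp add: d_def mult_ac)
        also have "\<dots> \<le> (exp 1 * real k) ^ CARD('d) * exp (- (\<eta>\<^sup>2 / 4) * real k) * (C0 * Mw omega1 n (mabs \<alpha>))"
        proof (intro mult_mono C0(3))
          have "\<eta>\<^sup>2 \<le> (norm (x - y))\<^sup>2" using dist \<eta> by (intro power_mono) auto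
          then have "real k * (d * (r + 3 * r\<^sup>2)) + - (real k * (norm (x - y))\<^sup>2) / 2 \<le> real k * (\<eta>\<^sup>2 / 4) + - (real k * \<eta>\<^sup>2) / 2"
            by (intro add_mono mult_left_mono rd divide_right_mono) (auto intro: mult_left_mono)
          then have "d * (real k * r + 3 * real k * r\<^sup>2) + - real k * (norm (x - y))\<^sup>2 / 2 \<le> - (\<eta>\<^sup>2 / 4) * real k"
            by (simp add: algebra_simps)
          then show "exp (d * (real k * r + 3 * real k * r\<^sup>2)) * exp (- real k * (norm (x - y))\<^sup>2 / 2) \<le> exp (- (\<eta>\<^sup>2 / 4) * real k)"
            unfolding exp_add[symmetric] by (simp only: exp_le_cancel_iff)
        qed (use r C0 in auto)
        finally show ?thesis unfolding norm_mult using v(3) C0 by (intro mult_mono) auto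
      qed
    qed (use v in auto)
    also have "?B * measure lborel (cbox a b) = (C * V * real k ^ CARD('d) * exp (- (\<eta>\<^sup>2 / 4) * real k)) * Mw omega1 n (mabs \<alpha>)"
      by (simp add: C_def power_mult_distrib mult_ac)
    finally show ?thesis using mderiv_pconv[OF h v(1), where a = a and b = b and \<alpha> = \<alpha>] v(2) by simp
  qed
  note * = this
  have "C \<ge> 0" using C0 by (simp add: C_def)
  moreover have "\<eta>\<^sup>2 / 4 > 0" using \<eta> by simp
  ultimately show ?thesis using C0(2) *
    by (intro exI[of _ n] conjI exI[of _ C] exI[of _ "\<eta>\<^sup>2 / 4"] allI impI) auto
qed

section \<open>Leibniz' rule for sequences of derivatives\<close>

text \<open>A formal Leibniz product in which \<open>a s\<close> and \<open>b s\<close> stand for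
  s-th derivatives. Sequences allow products of functions that are differentiable to a finite order
  only.\<close>

definition leib :: "(nat \<Rightarrow> 'x \<Rightarrow> complex) \<Rightarrow> (nat \<Rightarrow> 'x \<Rightarrow> complex) \<Rightarrow> nat \<Rightarrow> 'x \<Rightarrow> complex" where
  "leib a b t y = (\<Sum>s\<le>t. of_nat (t choose s) * (a s y * b (t - s) y))"

text \<open>Pascal's rule, after the term with \<open>s = 0\<close> has been split off.\<close>

lemma leib_Suc_identity:
  fixes X :: "nat \<Rightarrow> nat \<Rightarrow> complex"
  shows "(\<Sum>s\<le>t. of_nat (t choose s) * (X (Suc s) (t - s) + X s (Suc (t - s)))) =
    (\<Sum>s\<le>Suc t. of_nat (Suc t choose s) * X s (Suc t - s))"
proof -
  have "(\<Sum>s\<le>Suc t. of_nat (Suc t choose s) * X s (Suc t - s)) =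
      X 0 (Suc t) + (\<Sum>s\<le>t. of_nat (Suc t choose Suc s) * X (Suc s) (t - s))"
    by (subst sum.atMost_Suc_shift) simp
  also have "(\<Sum>s\<le>t. of_nat (Suc t choose Suc s) * X (Suc s) (t - s)) =
      (\<Sum>s\<le>t. of_nat (t choose s) * X (Suc s) (t - s)) + (\<Sum>s\<le>t. of_nat (t choose Suc s) * X (Suc s) (t - s))"
    by (simp add: distrib_right sum.distrib)
  also have "X 0 (Suc t) + ((\<Sum>s\<le>t. of_nat (t choose s) * X (Suc s) (t - s)) + (\<Sum>s\<le>t. of_nat (t choose Suc s) * X (Suc s) (t - s)))
     = (\<Sum>s\<le>t. of_nat (t choose s) * X (Suc s) (t - s)) + (\<Sum>s\<le>Suc t. of_nat (t choose s) * X s (Suc t - s))"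
  proof -
    have "(\<Sum>s\<le>Suc t. of_nat (t choose s) * X s (Suc t - s)) = X 0 (Suc t) + (\<Sum>s\<le>t. of_nat (t choose Suc s) * X (Suc s) (t - s))"
      by (subst sum.atMost_Suc_shift) simp
    then show ?thesis by (simp only: add_ac)
  qed
  also have "(\<Sum>s\<le>Suc t. of_nat (t choose s) * X s (Suc t - s)) = (\<Sum>s\<le>t. of_nat (t choose s) * X s (Suc (t - s)))"
    by (simp add: Suc_diff_le)
  finally show ?thesis by (simp add: distrib_left sum.distrib)
qed

lemma leib_has_vd:
  fixes a b :: "nat \<Rightarrow> 'x \<Rightarrow> complex" and \<gamma> :: "real \<Rightarrow> 'x"
  assumes "\<And>s. s \<le> t \<Longrightarrow> ((\<lambda>r. a s (\<gamma> r)) has_vector_derivative a (Suc s) (\<gamma> r0)) (at r0)"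
    and "\<And>s. s \<le> t \<Longrightarrow> ((\<lambda>r. b s (\<gamma> r)) has_vector_derivative b (Suc s) (\<gamma> r0)) (at r0)"
  shows "((\<lambda>r. leib a b t (\<gamma> r)) has_vector_derivative leib a b (Suc t) (\<gamma> r0)) (at r0)"
proof -
  have "((\<lambda>r. leib a b t (\<gamma> r)) has_vector_derivative
     (\<Sum>s\<le>t. of_nat (t choose s) * (a s (\<gamma> r0) * b (Suc (t - s)) (\<gamma> r0) + a (Suc s) (\<gamma> r0) * b (t - s) (\<gamma> r0)))) (at r0)"
    unfolding leib_def
    by (intro has_vector_derivative_sum has_vector_derivative_mult_right has_vector_derivative_mult assms) auto
  then show ?thesis
    using leib_Suc_identity[of t "\<lambda>s u. a s (\<gamma> r0) * b u (\<gamma> r0)"] by (simp add: leib_def add.commute)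
qed

lemma leib_bound:
  assumes "\<And>s. s \<le> t \<Longrightarrow> cmod (a s y) \<le> A s" "\<And>s. s \<le> t \<Longrightarrow> cmod (b s y) \<le> B s"
  shows "cmod (leib a b t y) \<le> (\<Sum>s\<le>t. real (t choose s) * (A s * B (t - s)))"
proof -
  have A: "0 \<le> A s" if "s \<le> t" for s using assms(1)[OF that] norm_ge_zero order_trans by blast
  have "cmod (leib a b t y) \<le> (\<Sum>s\<le>t. cmod (of_nat (t choose s) * (a s y * b (t - s) y)))"
    unfolding leib_def by (rule norm_sum)
  also have "\<dots> \<le> (\<Sum>s\<le>t. real (t choose s) * (A s * B (t - s)))"
    by (intro sum_mono) (auto simp: norm_mult intro!: mult_left_mono mult_mono assms A)
  finally show ?thesis .
qed

lemma leib_bound_geometric: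
  assumes "\<And>s. s \<le> t \<Longrightarrow> cmod (a s y) \<le> A * p ^ s" "\<And>s. s \<le> t \<Longrightarrow> cmod (b s y) \<le> B * q ^ s"
  shows "cmod (leib a b t y) \<le> A * B * (p + q) ^ t"
proof -
  have "cmod (leib a b t y) \<le> (\<Sum>s\<le>t. real (t choose s) * ((A * p ^ s) * (B * q ^ (t - s))))"
    by (rule leib_bound) (use assms in auto)
  also have "\<dots> = A * B * (\<Sum>s\<le>t. of_nat (t choose s) * p ^ s * q ^ (t - s))"
    by (simp add: sum_distrib_left mult_ac)
  also have "(\<Sum>s\<le>t. of_nat (t choose s) * p ^ s * q ^ (t - s)) = (p + q) ^ t" by (rule binomial_ring[symmetric])
  finally show ?thesis .
qed

lemma leib_continuous_on:
  fixes a b :: "nat \<Rightarrow> 'x::topological_space \<Rightarrow> complex"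
  assumes "\<And>s. s \<le> t \<Longrightarrow> continuous_on S (a s)" "\<And>s. s \<le> t \<Longrightarrow> continuous_on S (b s)"
  shows "continuous_on S (leib a b t)"
  unfolding leib_def[abs_def] by (intro continuous_intros assms) auto

section \<open>Cutoff functions with controlled derivatives\<close>

text \<open>
  A product of two truncated powers of order \<open>N\<close> has derivatives of order \<open>t \<le> N\<close> bounded by \<open>(C N)\<^sup>t\<close>; no smooth
  compactly supported function of class \<open>{\<omega>}\<close> is needed, which covers quasianalytic weights.
\<close>

definition tpow :: "nat \<Rightarrow> real \<Rightarrow> real" where
  "tpow N y = (max 0 y) ^ N"

text \<open>Near the kink the truncated power is at most \<open>h^2\<close> because
  \<open>N \<ge> 2\<close>, so the derivative there is 0.\<close>

lemma tpow_has_derivative: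
  assumes N: "N \<ge> 2"
  shows "(tpow N has_real_derivative real N * tpow (N - 1) y) (at y)"
proof (cases y "0::real" rule: linorder_cases)
  case less
  have "((\<lambda>y. 0 :: real) has_real_derivative 0) (at y)" by simp
  then have "(tpow N has_real_derivative 0) (at y)"
    by (rule has_field_derivative_transform_within_open[where S = "{..<0}"]) (use less N in \<open>auto simp: tpow_def\<close>)
  then show ?thesis using less N by (simp add: tpow_def power_0_left)
next
  case greater
  have "((\<lambda>y. y ^ N) has_real_derivative real N * y ^ (N - 1)) (at y)"
    using DERIV_pow[of N y UNIV] by simp
  then have "(tpow N has_real_derivative real N * y ^ (N - 1)) (at y)"
    by (rule has_field_derivative_transform_within_open[where S = "{0<..}"]) (use greater in \<open>auto simp: tpow_def\<close>)
  then show ?thesis using greater by (simp add: tpow_def)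
next
  case equal
  have "(tpow N has_real_derivative 0) (at 0)"
    unfolding DERIV_def
  proof (rule Lim_null_comparison[where g = "\<lambda>h. \<bar>h\<bar>"])
    show "((\<lambda>h. \<bar>h\<bar>) \<longlongrightarrow> 0) (at (0::real))" by (rule tendsto_eq_intros refl | simp)+
    have "norm ((tpow N (0 + h) - tpow N 0) / h) \<le> \<bar>h\<bar>" if h: "h \<noteq> 0" "\<bar>h\<bar> < 1" for h
    proof -
      have "\<bar>tpow N h\<bar> \<le> \<bar>h\<bar> ^ N" unfolding tpow_def power_abs by (intro power_mono) auto
      also have "\<dots> \<le> \<bar>h\<bar> ^ 2" using h N by (intro power_decreasing) auto
      finally have "\<bar>tpow N h\<bar> / \<bar>h\<bar> \<le> \<bar>h\<bar>" using h by (simp add: divide_le_eq power2_eq_square)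
      moreover have "tpow N 0 = 0" using N by (simp add: tpow_def)
      ultimately show ?thesis by simp
    qed
    then show "\<forall>\<^sub>F h in at 0. norm ((tpow N (0 + h) - tpow N 0) / h) \<le> \<bar>h\<bar>"
      unfolding eventually_at by (intro exI[of _ 1]) auto
  qed
  then show ?thesis using equal N by (simp add: tpow_def power_0_left)
qed

lemma tpow_continuous: "continuous_on S (tpow N)"
  unfolding tpow_def by (intro continuous_intros)

text \<open>The falling factorial, the coefficient of the t-th derivative of a power of order
  N.\<close>

definition ffall :: "nat \<Rightarrow> nat \<Rightarrow> real" where
  "ffall N t = (\<Prod>i<t. real (N - i))"

lemma ffall: "0 \<le> ffall N t" "ffall N t \<le> real N ^ t" "ffall N (Suc t) = ffall N t * real (N - t)" "ffall N 0 = 1"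
proof -
  have "ffall N t \<le> (\<Prod>i<t. real N)" unfolding ffall_def by (intro prod_mono) auto
  then show "ffall N t \<le> real N ^ t" by simp
qed (auto simp: ffall_def prod_nonneg)

text \<open>For t < N this is the t-th derivative of the power of order N of the positive part of
  \<open>1 + y / \<delta>\<close>; \<open>bump_right\<close> is its mirror image, and
  \<open>bump \<delta> N t\<close> is the t-th derivative of \<open>(1 - y^2 / \<delta>^2)^N\<close>
  extended by 0 beyond \<open>|y| = \<delta>\<close>.\<close>

definition bump_left :: "real \<Rightarrow> nat \<Rightarrow> nat \<Rightarrow> real \<Rightarrow> complex" where
  "bump_left \<delta> N t y = of_real (ffall N t / \<delta> ^ t * tpow (N - t) (1 + y / \<delta>))"

definition bump_right :: "real \<Rightarrow> nat \<Rightarrow> nat \<Rightarrow> real \<Rightarrow> complex" where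
  "bump_right \<delta> N t y = of_real ((-1) ^ t * ffall N t / \<delta> ^ t * tpow (N - t) (1 - y / \<delta>))"

definition bump :: "real \<Rightarrow> nat \<Rightarrow> nat \<Rightarrow> real \<Rightarrow> complex" where
  "bump \<delta> N = leib (bump_left \<delta> N) (bump_right \<delta> N)"

lemma tpow_affine_has_vd:
  assumes "M \<ge> 2"
  shows "((\<lambda>y. tpow M (1 + y / d)) has_vector_derivative real M * tpow (M - 1) (1 + y / d) / d) (at y)"
proof -
  have "((\<lambda>y. 1 + y / d) has_real_derivative 1 / d) (at y)"
    unfolding divide_inverse by (auto intro!: derivative_eq_intros)
  from DERIV_chain2[OF tpow_has_derivative[OF assms] this]
  show ?thesis by (simp add: has_real_derivative_iff_has_vector_derivative)
qed

lemma bump_left_has_vd: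
  assumes "\<delta> > 0" "Suc t < N"
  shows "(bump_left \<delta> N t has_vector_derivative bump_left \<delta> N (Suc t) y) (at y)"
proof -
  have "((\<lambda>y. ffall N t / \<delta> ^ t * tpow (N - t) (1 + y / \<delta>)) has_vector_derivative
     ffall N t / \<delta> ^ t * (real (N - t) * tpow (N - t - 1) (1 + y / \<delta>) / \<delta>)) (at y)"
    by (intro has_vector_derivative_mult_right tpow_affine_has_vd) (use assms in auto)
  then have "((\<lambda>y. complex_of_real (ffall N t / \<delta> ^ t * tpow (N - t) (1 + y / \<delta>))) has_vector_derivative
     complex_of_real (ffall N t / \<delta> ^ t * (real (N - t) * tpow (N - t - 1) (1 + y / \<delta>) / \<delta>))) (at y)"
    unfolding has_real_derivative_iff_has_vector_derivative[symmetric] by (rule has_vector_derivative_of_real)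
  moreover have "ffall N t / \<delta> ^ t * (real (N - t) * tpow (N - t - 1) (1 + y / \<delta>) / \<delta>) = ffall N (Suc t) / \<delta> ^ Suc t * tpow (N - Suc t) (1 + y / \<delta>)"
    by (simp add: ffall(3) mult_ac)
  ultimately show ?thesis unfolding bump_left_def[abs_def] by (simp only:)
qed

lemma bump_right_has_vd:
  assumes "\<delta> > 0" "Suc t < N"
  shows "(bump_right \<delta> N t has_vector_derivative bump_right \<delta> N (Suc t) y) (at y)"
proof -
  have "((\<lambda>y. (-1) ^ t * ffall N t / \<delta> ^ t * tpow (N - t) (1 + y / (- \<delta>))) has_vector_derivative
     (-1) ^ t * ffall N t / \<delta> ^ t * (real (N - t) * tpow (N - t - 1) (1 + y / (- \<delta>)) / (- \<delta>))) (at y)"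
    by (intro has_vector_derivative_mult_right tpow_affine_has_vd) (use assms in auto)
  then have "((\<lambda>y. complex_of_real ((-1) ^ t * ffall N t / \<delta> ^ t * tpow (N - t) (1 + y / (- \<delta>)))) has_vector_derivative
     complex_of_real ((-1) ^ t * ffall N t / \<delta> ^ t * (real (N - t) * tpow (N - t - 1) (1 + y / (- \<delta>)) / (- \<delta>)))) (at y)"
    unfolding has_real_derivative_iff_has_vector_derivative[symmetric] by (rule has_vector_derivative_of_real)
  moreover have "(-1) ^ t * ffall N t / \<delta> ^ t * (real (N - t) * tpow (N - t - 1) (1 + y / (- \<delta>)) / (- \<delta>)) =
      (-1) ^ Suc t * ffall N (Suc t) / \<delta> ^ Suc t * tpow (N - Suc t) (1 - y / \<delta>)"
    by (simp add: ffall(3) mult_ac)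
  moreover have "1 + u / (- \<delta>) = 1 - u / \<delta>" for u by simp
  ultimately show ?thesis unfolding bump_right_def[abs_def] by (simp only:)
qed

lemma bump_has_vd:
  assumes "\<delta> > 0" "Suc t < N"
  shows "(bump \<delta> N t has_vector_derivative bump \<delta> N (Suc t) y) (at y)"
  unfolding bump_def
  using leib_has_vd[of t "bump_left \<delta> N" "\<lambda>r. r" y "bump_right \<delta> N"] bump_left_has_vd[OF assms(1)] bump_right_has_vd[OF assms(1)] assms(2)
  by simp

lemma bump_continuous: "\<delta> > 0 \<Longrightarrow> continuous_on UNIV (bump \<delta> N t)"
  unfolding bump_def bump_left_def bump_right_def
  by (intro leib_continuous_on continuous_intros continuous_on_compose2[OF tpow_continuous[of UNIV]]) auto

lemma bump_eq_0:
  assumes "\<delta> > 0" "t < N" "\<bar>y\<bar> \<ge> \<delta>" shows "bump \<delta> N t y = 0"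
proof -
  have "bump_left \<delta> N s y * bump_right \<delta> N (t - s) y = 0" if "s \<le> t" for s
  proof (cases "y \<ge> \<delta>")
    case True
    then have "1 - y / \<delta> \<le> 0" using assms(1) by (simp add: field_simps)
    then show ?thesis using assms(2) that by (simp add: bump_right_def tpow_def)
  next
    case False
    then have "1 + y / \<delta> \<le> 0" using assms by (simp add: field_simps abs_if split: if_splits)
    then show ?thesis using assms(2) that by (simp add: bump_left_def tpow_def)
  qed
  then show ?thesis unfolding bump_def leib_def by (intro sum.neutral) auto
qed

text \<open>Each factor alone may be nearly as large as \<open>2 ^ N\<close>. But in every Leibniz
  term \<open>N - t\<close> powers of both factors pair up to powers of
  \<open>1 - y^2 / \<delta>^2 \<le> 1\<close>, and only t unpaired factors of size at most 2 remain.
  The binomial sum contributes the other \<open>2 ^ t\<close>.\<close>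

lemma bump_bound:
  assumes \<delta>: "\<delta> > 0" and t: "t < N"
  shows "cmod (bump \<delta> N t y) \<le> (4 * real N / \<delta>) ^ t"
proof (cases "\<bar>y\<bar> \<ge> \<delta>")
  case True
  then show ?thesis using bump_eq_0[OF \<delta> t True] \<delta> by simp
next
  case False
  then have pm: "0 \<le> 1 + y / \<delta>" "0 \<le> 1 - y / \<delta>" "1 + y / \<delta> \<le> 2" "1 - y / \<delta> \<le> 2" using \<delta> by (auto simp: field_simps abs_if split: if_splits)
  have u: "(1 + y / \<delta>) * (1 - y / \<delta>) \<le> 1"
    by (simp add: algebra_simps) 
  have summand: "cmod (bump_left \<delta> N s y * bump_right \<delta> N (t - s) y) \<le> (2 * real N / \<delta>) ^ t" if s: "s \<le> t" for s
  proof -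
    have "tpow (N - s) (1 + y / \<delta>) * tpow (N - (t - s)) (1 - y / \<delta>) = (1 + y / \<delta>) ^ ((N - t) + (t - s)) * (1 - y / \<delta>) ^ ((N - t) + s)"
    proof -
      have e: "N - s = (N - t) + (t - s)" "N - (t - s) = (N - t) + s" using t s by auto
      show ?thesis unfolding tpow_def max_absorb2[OF pm(1)] max_absorb2[OF pm(2)] e ..
    qed
    also have "\<dots> = ((1 + y / \<delta>) * (1 - y / \<delta>)) ^ (N - t) * (1 + y / \<delta>) ^ (t - s) * (1 - y / \<delta>) ^ s"
      by (simp add: power_add power_mult_distrib)
    also have "\<dots> \<le> 1 ^ (N - t) * 2 ^ (t - s) * 2 ^ s"
      using pm u by (intro mult_mono power_mono) auto
    also have "\<dots> = 2 ^ t" using s by (simp flip: power_add)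
    finally have tp: "tpow (N - s) (1 + y / \<delta>) * tpow (N - (t - s)) (1 - y / \<delta>) \<le> 2 ^ t" .
    have tp0: "0 \<le> tpow M z" for M z by (simp add: tpow_def)
    have "cmod (bump_left \<delta> N s y * bump_right \<delta> N (t - s) y) =
       (ffall N s * ffall N (t - s)) / (\<delta> ^ s * \<delta> ^ (t - s)) * (tpow (N - s) (1 + y / \<delta>) * tpow (N - (t - s)) (1 - y / \<delta>))"
      using \<delta> ffall(1) tp0 by (simp add: bump_left_def bump_right_def norm_mult norm_divide norm_power abs_mult)
    also have "\<dots> \<le> (real N ^ s * real N ^ (t - s)) / (\<delta> ^ s * \<delta> ^ (t - s)) * 2 ^ t"
      using tp tp0 ffall \<delta> by (intro mult_mono divide_right_mono) auto
    also have "\<dots> = (2 * real N / \<delta>) ^ t"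
      using s by (simp add: power_mult_distrib power_divide flip: power_add)
    finally show ?thesis .
  qed
  have "cmod (bump \<delta> N t y) \<le> (\<Sum>s\<le>t. real (t choose s) * (2 * real N / \<delta>) ^ t)"
    unfolding bump_def leib_def
  proof (rule order_trans[OF norm_sum], rule sum_mono)
    fix s assume "s \<in> {..t}"
    then show "cmod (of_nat (t choose s) * (bump_left \<delta> N s y * bump_right \<delta> N (t - s) y)) \<le> real (t choose s) * (2 * real N / \<delta>) ^ t"
      unfolding norm_mult[of "of_nat _"] norm_of_nat by (intro mult_left_mono summand) auto
  qed
  also have "\<dots> = 2 ^ t * (2 * real N / \<delta>) ^ t"
    unfolding sum_distrib_right[symmetric] of_nat_sum[symmetric] choose_row_sum by simp
  also have "\<dots> = (4 * real N / \<delta>) ^ t" by (simp flip: power_mult_distrib)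
  finally show ?thesis .
qed

lemma bump_zero: "bump \<delta> N 0 y = of_real (tpow N (1 + y / \<delta>) * tpow N (1 - y / \<delta>))"
  by (simp add: bump_def leib_def bump_left_def bump_right_def ffall(4))

text \<open>Normalising must not spoil the derivative bounds. By Bernoulli's inequality the bump is
  at least 1/2 on an interval of length \<open>\<delta> / (2 N)\<close>, so it costs only one factor
  of order N.\<close>

lemma bump_mass:
  assumes \<delta>: "\<delta> > 0" and N: "N \<ge> 1"
  shows "\<exists>I. \<delta> / (4 * real N) \<le> I \<and> (\<integral>\<^sup>+ y. ennreal (tpow N (1 + y / \<delta>) * tpow N (1 - y / \<delta>)) \<partial>lborel) = ennreal I"
proof -
  let ?q = "\<lambda>y. tpow N (1 + y / \<delta>) * tpow N (1 - y / \<delta>)"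
  have q: "?q y \<le> indicator {-\<delta>..\<delta>} y" for y
  proof (cases "\<bar>y\<bar> \<ge> \<delta>")
    case True
    have e: "?q y = 0" using bump_eq_0[OF \<delta> _ True, of 0 N] N unfolding bump_zero of_real_eq_0_iff by simp
    show ?thesis unfolding e by simp
  next
    case False
    have "cmod (bump \<delta> N 0 y) \<le> 1" using bump_bound[OF \<delta>, of 0 N y] N by simp
    then have "\<bar>?q y\<bar> \<le> 1" unfolding bump_zero norm_of_real .
    then have "?q y \<le> 1" by linarith
    then show ?thesis using False by (auto simp: indicator_def)
  qed
  have low: "1 / 2 * indicator {0..\<delta> / (2 * real N)} y \<le> ?q y" for y
  proof (cases "y \<in> {0..\<delta> / (2 * real N)}")
    case True
    define z where "z = y / \<delta>"
    have z: "0 \<le> z" "z \<le> 1 / (2 * real N)" using True \<delta> N by (auto simp: z_def field_simps)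
    have "1 / (2 * real N) \<le> 1" using N by simp
    then have z1: "z \<le> 1" using z(2) by linarith
    have "real N * z \<le> 1 / 2" using z N by (simp add: field_simps)
    then have "real N * z\<^sup>2 \<le> 1 / 2 * z"
      using z mult_right_mono[of "real N * z" "1 / 2" z] by (auto simp: power2_eq_square mult.assoc)
    then have "1 / 2 \<le> 1 + real N * (- z\<^sup>2)" using z1 by simp
    also have "\<dots> \<le> (1 + (- z\<^sup>2)) ^ N" using z z1 by (intro Bernoulli_inequality) (simp add: power_le_one)
    also have "1 + (- z\<^sup>2) = (1 + z) * (1 - z)" by (simp add: power2_eq_square algebra_simps)
    also have "((1 + z) * (1 - z)) ^ N = ?q y" using z z1 by (simp add: tpow_def z_def power_mult_distrib)
    finally show ?thesis using True by simp
  qed (simp add: tpow_def)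
  have "(\<integral>\<^sup>+ y. ennreal (?q y) \<partial>lborel) \<le> (\<integral>\<^sup>+ y. indicator {-\<delta>..\<delta>} y \<partial>lborel)"
    by (intro nn_integral_mono) (metis ennreal_indicator ennreal_leI q)
  also have "\<dots> < \<infinity>" using \<delta> by simp
  finally obtain I where I: "I \<ge> 0" "(\<integral>\<^sup>+ y. ennreal (?q y) \<partial>lborel) = ennreal I"
    by (cases "\<integral>\<^sup>+ y. ennreal (?q y) \<partial>lborel") auto
  have "ennreal (\<delta> / (4 * real N)) = ennreal (1 / 2 * (\<delta> / (2 * real N)))" by simp
  also have "\<dots> = ennreal (1 / 2) * ennreal (\<delta> / (2 * real N))"
    by (rule ennreal_mult) (use \<delta> in auto)
  also have "\<dots> = (\<integral>\<^sup>+ y. ennreal (1 / 2) * indicator {0..\<delta> / (2 * real N)} y \<partial>lborel)"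
    using \<delta> by (simp add: nn_integral_cmult_indicator)
  also have "\<dots> \<le> (\<integral>\<^sup>+ y. ennreal (?q y) \<partial>lborel)"
  proof (intro nn_integral_mono)
    fix y
    have "ennreal (1 / 2) * indicator {0..\<delta> / (2 * real N)} y = ennreal (1 / 2 * indicator {0..\<delta> / (2 * real N)} y)"
      by (cases "y \<in> {0..\<delta> / (2 * real N)}") auto
    also have "\<dots> \<le> ennreal (?q y)" by (rule ennreal_leI[OF low])
    finally show "ennreal (1 / 2) * indicator {0..\<delta> / (2 * real N)} y \<le> ennreal (?q y)" .
  qed
  finally have "\<delta> / (4 * real N) \<le> I" using I by simp
  then show ?thesis using I(2) by blast
qed

lemma prod_Basis_vec: "(\<Prod>b\<in>(Basis :: (real^'d::finite) set). F b) = (\<Prod>i\<in>UNIV. F (axis i 1))"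
proof -
  have B: "(Basis :: (real^'d) set) = range (\<lambda>i::'d. axis i (1::real))" by (auto simp: Basis_vec_def)
  have inj: "inj (\<lambda>i::'d. axis i (1::real))" by (auto simp: inj_def axis_eq_axis)
  show ?thesis unfolding B by (simp add: prod.reindex[OF inj] o_def)
qed

lemma nn_integral_lborel_vec_prod:
  fixes f :: "'d::finite \<Rightarrow> real \<Rightarrow> ennreal"
  assumes [measurable]: "\<And>i. f i \<in> borel_measurable borel"
  shows "(\<integral>\<^sup>+ y. (\<Prod>i\<in>UNIV. f i (y $ i)) \<partial>(lborel :: (real^'d) measure)) = (\<Prod>i\<in>UNIV. \<integral>\<^sup>+ t. f i t \<partial>lborel)"
proof -
  \<comment> \<open>The product formula is stated over basis vectors; \<open>SOME\<close> inverts
    the injective map \<open>axis\<close>.\<close>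
  define g where "g b = f (SOME i. b = axis i (1::real))" for b :: "real^'d"
  have g: "g (axis i 1) = f i" for i
  proof -
    have "(SOME j. axis i (1::real) = axis j 1) = i" by (rule some_equality) (auto simp: axis_eq_axis)
    then show ?thesis by (simp add: g_def)
  qed
  have "(\<integral>\<^sup>+ y. (\<Prod>b\<in>Basis. g b (y \<bullet> b)) \<partial>(lborel :: (real^'d) measure)) = (\<Prod>b\<in>(Basis :: (real^'d) set). \<integral>\<^sup>+ t. g b t \<partial>lborel)"
    by (rule nn_integral_lborel_prod) (auto simp: g_def)
  then show ?thesis unfolding prod_Basis_vec g by (simp add: inner_axis)
qed

text \<open>A Urysohn function around K is convolved with a product of normalised bumps of order
  \<open>Suc j\<close>. Derivatives in direction i fall on the i-th bump alone. The factor
  \<open>real (Suc j) ^ CARD('d)\<close> comes from normalising one bump per coordinate.\<close>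

lemma cutoff_sequence:
  fixes K :: "(real^'d::finite) set"
  assumes K: "compact K" and \<Omega>: "open \<Omega>" "K \<subseteq> \<Omega>"
  shows "\<exists>\<eta>>0. \<exists>D. \<exists>C\<ge>1. \<exists>X. compact D \<and> D \<subseteq> \<Omega> \<and> (\<forall>j i.
    (\<forall>t\<le>j. continuous_on UNIV (X j i t) \<and> (\<forall>y. y \<notin> D \<longrightarrow> X j i t y = 0) \<and>
        (\<forall>y. cmod (X j i t y) \<le> C * real (Suc j) ^ CARD('d) * (C * real (Suc j)) ^ t)) \<and>
    (\<forall>t<j. \<forall>y. ((\<lambda>r. X j i t (y + r *\<^sub>R axis i 1)) has_vector_derivative X j i (Suc t) y) (at 0)) \<and>
    (\<forall>i'. X j i 0 = X j i' (0::nat)) \<and> (\<forall>x\<in>K. \<forall>y. dist x y < \<eta> \<longrightarrow> X j i 0 y = (1::complex)))"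
proof -
  obtain e where e: "e > 0" "(\<Union>x\<in>K. cball x e) \<subseteq> \<Omega>"
    using compact_subset_open_imp_cball_epsilon_subset[OF K \<Omega>] by blast
  \<comment> \<open>One \<eta> for the region where the cutoff is 1, one for the width of the
    kernel, one for the descent of the Urysohn function, and one for the kernel again: the support
    lies within \<open>4 * \<eta>\<close> of K.\<close>
  define \<eta> where "\<eta> = e / 4"
  have \<eta>: "\<eta> > 0" using e(1) by (simp add: \<eta>_def)
  define NB where "NB r = {x + y | x y. x \<in> K \<and> y \<in> cball (0::real^'d) r}" for r
  have NB: "x \<in> NB r \<longleftrightarrow> (\<exists>z\<in>K. dist z x \<le> r)" for x r
  proof
    assume "\<exists>z\<in>K. dist z x \<le> r"
    then obtain z where "z \<in> K" "dist z x \<le> r" by blast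
    then have "x = z + (x - z) \<and> z \<in> K \<and> x - z \<in> cball 0 r" by (auto simp: dist_norm norm_minus_commute)
    then show "x \<in> NB r" unfolding NB_def by blast
  next
    assume "x \<in> NB r"
    then obtain z y where "x = z + y" "z \<in> K" "norm y \<le> r" unfolding NB_def by auto
    then show "\<exists>z\<in>K. dist z x \<le> r" by (intro bexI[of _ z]) (auto simp: dist_norm)
  qed
  have cNB: "compact (NB r)" for r unfolding NB_def by (rule compact_sums[OF K compact_cball])
  define T where "T = - (\<Union>x\<in>K. ball x (3 * \<eta>))"
  have "closed T" unfolding T_def by (intro closed_Compl open_UN ballI open_ball)
  moreover have "closed (NB (2 * \<eta>))" using cNB compact_imp_closed by blast
  moreover have "NB (2 * \<eta>) \<inter> T = {}" 
  proof -
    have "x \<notin> T" if "x \<in> NB (2 * \<eta>)" for x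
    proof -
      from that obtain z where "z \<in> K" "dist z x \<le> 2 * \<eta>" using NB by blast
      then have "x \<in> ball z (3 * \<eta>)" using \<eta> by simp
      then show ?thesis using \<open>z \<in> K\<close> by (auto simp: T_def)
    qed
    then show ?thesis by blast
  qed
  ultimately obtain A :: "real^'d \<Rightarrow> real" where A: "continuous_on UNIV A" "\<And>x. A x \<in> closed_segment 1 0"
    "\<And>x. x \<in> NB (2 * \<eta>) \<Longrightarrow> A x = 1" "\<And>x. x \<in> T \<Longrightarrow> A x = 0"
    using Urysohn[of "NB (2 * \<eta>)" T "1::real" 0] by metis
  have A01: "\<bar>A x\<bar> \<le> 1" for x using A(2)[of x] by (auto simp: closed_segment_eq_real_ivl)
  define av :: "real^'d \<Rightarrow> complex" where "av x = of_real (A x)" for x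
  have av: "continuous_on UNIV av" unfolding av_def[abs_def] by (intro continuous_intros A(1))
  obtain a b where ab: "NB (3 * \<eta>) \<subseteq> cbox a b" using bounded_subset_cbox_symmetric compact_imp_bounded[OF cNB] by metis
  have av0: "av y = 0" if "y \<notin> cbox a b" for y
  proof -
    have "y \<notin> NB (3 * \<eta>)" using that ab by blast
    then have "y \<in> T" unfolding T_def NB by (auto simp: dist_commute)
    then show ?thesis using A(4) by (simp add: av_def)
  qed
  define dd where "dd = real CARD('d)"
  have dd: "dd \<ge> 1" unfolding dd_def using zero_less_card_finite[where 'a = 'd] by linarith
  \<comment> \<open>The kernel lives in a cube of half-width \<delta>, on which the sum of the
    coordinates in modulus is at most \<eta>.\<close>
  define \<delta> where "\<delta> = \<eta> / dd"
  have \<delta>: "\<delta> > 0" using \<eta> dd by (simp add: \<delta>_def)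
  have near: "dist x y \<le> \<eta>" if "\<And>i. \<bar>x $ i - y $ i\<bar> < \<delta>" for x y :: "real^'d"
  proof -
    have "dist x y \<le> (\<Sum>i\<in>UNIV. \<bar>(x - y) $ i\<bar>)" unfolding dist_norm by (rule norm_le_l1_cart)
    also have "\<dots> \<le> (\<Sum>i\<in>(UNIV::'d set). \<delta>)" by (rule sum_mono) (use that in \<open>auto intro: less_imp_le\<close>)
    also have "\<dots> = \<eta>" using dd by (simp add: \<delta>_def dd_def)
    finally show ?thesis .
  qed
  have "\<exists>I. \<delta> / (4 * real (Suc j)) \<le> I \<and> (\<integral>\<^sup>+ y. ennreal (tpow (Suc j) (1 + y / \<delta>) * tpow (Suc j) (1 - y / \<delta>)) \<partial>lborel) = ennreal I" for j
    by (rule bump_mass[OF \<delta>]) simp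
  then obtain I where I: "\<And>j. \<delta> / (4 * real (Suc j)) \<le> I j"
    "\<And>j. (\<integral>\<^sup>+ y. ennreal (tpow (Suc j) (1 + y / \<delta>) * tpow (Suc j) (1 - y / \<delta>)) \<partial>lborel) = ennreal (I j)" by metis
  have I0: "I j > 0" for j using I(1)[of j] \<delta> by (smt (verit) divide_pos_pos of_nat_0_less_iff zero_less_Suc)
  define cc where "cc j = 1 / I j" for j
  have cc: "0 \<le> cc j" "cc j \<le> 4 / \<delta> * real (Suc j)" for j
  proof -
    show "0 \<le> cc j" using I0[of j] by (simp add: cc_def)
    have "cc j \<le> 1 / (\<delta> / (4 * real (Suc j)))" unfolding cc_def by (rule divide_left_mono[OF I(1)]) (use I0 \<delta> in auto)
    then show "cc j \<le> 4 / \<delta> * real (Suc j)" by simp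
  qed
  define P where "P j t y = of_real (cc j) * bump \<delta> (Suc j) t y" for j t y
  have P_cont: "continuous_on UNIV (P j t)" for j t
    unfolding P_def[abs_def] by (intro continuous_intros bump_continuous \<delta>)
  have P_vd: "(P j t has_vector_derivative P j (Suc t) y) (at y)" if "t < j" for j t y
    unfolding P_def[abs_def] by (intro has_vector_derivative_mult_right bump_has_vd \<delta>) (use that in auto)
  have P_0: "P j t y = 0" if "t \<le> j" "\<bar>y\<bar> \<ge> \<delta>" for j t y
    using bump_eq_0[OF \<delta>, of t "Suc j" y] that by (simp add: P_def)
  have P_bd: "cmod (P j t y) \<le> (4 / \<delta> * real (Suc j)) * (4 / \<delta> * real (Suc j)) ^ t" if "t \<le> j" for j t y
  proof -
    have "cmod (P j t y) = cc j * cmod (bump \<delta> (Suc j) t y)" using cc(1)[of j] by (simp add: P_def norm_mult)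
    also have "\<dots> \<le> (4 / \<delta> * real (Suc j)) * (4 * real (Suc j) / \<delta>) ^ t"
      using cc[of j] bump_bound[OF \<delta>, of t "Suc j" y] that by (intro mult_mono) auto
    finally show ?thesis by simp
  qed
  define X where "X j i t = pconv ((\<lambda>_. P j 0)(i := P j t)) av" for j i t
  have pc: "continuous_on UNIV (((\<lambda>_. P j 0)(i := P j t)) l)" for j i t l using P_cont by simp
  have pk0: "(\<Prod>l\<in>UNIV. ((\<lambda>_. P j 0)(i := P j t)) l (x $ l - y $ l)) = 0" if t: "t \<le> j" and far: "\<eta> < dist x y" for j i t and x y :: "real^'d"
  proof -
    have "\<not> (\<forall>l. \<bar>x $ l - y $ l\<bar> < \<delta>)" using near[of x y] far by auto
    then obtain l where "\<bar>x $ l - y $ l\<bar> \<ge> \<delta>" by (auto simp: not_less)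
    then have z: "((\<lambda>_. P j 0)(i := P j t)) l (x $ l - y $ l) = 0" using P_0 t by auto
    show ?thesis by (rule prod_zero[OF finite bexI[of _ l]]) (use z in auto)
  qed
  define M where "M = max 1 (4 / \<delta>)"
  define C where "C = max M (M ^ CARD('d) * measure lborel (cbox a b))"
  have M: "M \<ge> 1" "4 / \<delta> \<le> M" by (auto simp: M_def)
  have C: "C \<ge> 1" "M \<le> C" "M ^ CARD('d) * measure lborel (cbox a b) \<le> C" using M by (auto simp: C_def)
  have X_cont: "continuous_on UNIV (X j i t)" for j i t
    unfolding X_def by (rule continuous_on_pconv[OF pc av av0])
  have X_vd: "((\<lambda>r. X j i t (y + r *\<^sub>R axis i 1)) has_vector_derivative X j i (Suc t) y) (at 0)" if "t < j" for j i t y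
  proof -
    have "((\<lambda>r. pconv ((\<lambda>_. P j 0)(i := P j t)) av (y + r *\<^sub>R axis i 1)) has_vector_derivative
        pconv (((\<lambda>_. P j 0)(i := P j t))(i := P j (Suc t))) av y) (at 0)"
      by (rule pconv_has_vd[OF pc _ P_cont av av0]) (simp_all add: P_vd[OF that])
    then show ?thesis by (simp add: X_def)
  qed
  have X_0: "X j i t y = 0" if "t \<le> j" "y \<notin> NB (4 * \<eta>)" for j i t y
  proof -
    have "(\<Prod>l\<in>UNIV. ((\<lambda>_. P j 0)(i := P j t)) l (y $ l - z $ l)) * av z = 0" for z
    proof (cases "\<eta> < dist y z")
      case False
      have "z \<in> T"
      proof (rule ccontr)
        assume "z \<notin> T"
        then obtain x where "x \<in> K" "dist x z < 3 * \<eta>" unfolding T_def by auto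
        then have "dist x y \<le> 4 * \<eta>" using dist_triangle[of x y z] False by (simp add: dist_commute)
        then show False using that(2) \<open>x \<in> K\<close> NB by blast
      qed
      then show ?thesis using A(4) by (simp add: av_def)
    next
      case True
      show ?thesis unfolding pk0[OF that(1) True] by simp
    qed
    then show ?thesis unfolding X_def pconv_def by (simp only: integral_0)
  qed
  have X_bd: "cmod (X j i t y) \<le> C * real (Suc j) ^ CARD('d) * (C * real (Suc j)) ^ t" if t: "t \<le> j" for j i t y
  proof -
    let ?m = "M * real (Suc j)"
    have m1: "?m \<ge> 1" using mult_mono[of 1 M 1 "real (Suc j)"] M by simp
    have "cmod (X j i t y) \<le> (?m ^ CARD('d) * ?m ^ t) * measure lborel (cbox a b)"
      unfolding X_def
    proof (rule pconv_bound[OF pc av av0])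
      show "0 \<le> ?m ^ CARD('d) * ?m ^ t" using m1 by simp
      fix z
      have Pm: "cmod (P j u w) \<le> ?m * ?m ^ u" if "u \<le> j" for u w
      proof (rule order_trans[OF P_bd[OF that]])
        have "4 / \<delta> * real (Suc j) \<le> ?m" using M by (intro mult_right_mono) auto
        then show "(4 / \<delta> * real (Suc j)) * (4 / \<delta> * real (Suc j)) ^ u \<le> ?m * ?m ^ u"
          using \<delta> m1 M by (intro mult_mono power_mono) auto
      qed
      have "cmod (\<Prod>l\<in>UNIV. ((\<lambda>_. P j 0)(i := P j t)) l (y $ l - z $ l)) \<le> (\<Prod>l\<in>UNIV. ?m * (if l = i then ?m ^ t else 1))"
        unfolding prod_norm[symmetric] by (intro prod_mono) (use Pm[of t] Pm[of 0] t in auto)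
      also have "\<dots> = ?m ^ CARD('d) * ?m ^ t" by (simp add: prod.distrib prod.delta)
      finally have 1: "cmod (\<Prod>l\<in>UNIV. ((\<lambda>_. P j 0)(i := P j t)) l (y $ l - z $ l)) \<le> ?m ^ CARD('d) * ?m ^ t" .
      show "cmod ((\<Prod>l\<in>UNIV. ((\<lambda>_. P j 0)(i := P j t)) l (y $ l - z $ l)) * av z) \<le> ?m ^ CARD('d) * ?m ^ t"
        using mult_mono[OF 1, of "cmod (av z)" 1] A01[of z] m1 by (simp add: norm_mult av_def)
    qed
    also have "\<dots> = (M ^ CARD('d) * measure lborel (cbox a b)) * real (Suc j) ^ CARD('d) * (M * real (Suc j)) ^ t"
      by (simp add: power_mult_distrib mult_ac)
    also have "\<dots> \<le> C * real (Suc j) ^ CARD('d) * (C * real (Suc j)) ^ t"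
      using C M by (intro mult_mono power_mono mult_right_mono) auto
    finally show ?thesis .
  qed
  \<comment> \<open>From such a point y the kernel reaches only points where the Urysohn function is
    1, so the convolution equals the total mass of the kernel.\<close>
  have X_1: "X j i 0 y = 1" if x: "x \<in> K" "dist x y < \<eta>" for j i x y
  proof -
    define q where "q s = cc j * (tpow (Suc j) (1 + s / \<delta>) * tpow (Suc j) (1 - s / \<delta>))" for s
    have q0: "q s \<ge> 0" for s using cc(1)[of j] by (simp add: q_def tpow_def)
    have qc: "continuous_on UNIV q" unfolding q_def
      by (intro continuous_intros continuous_on_compose2[OF tpow_continuous[of UNIV]]) (use \<delta> in auto)
    have qm[measurable]: "q \<in> borel_measurable borel" by (rule borel_measurable_continuous_onI[OF qc])
    have Pq: "P j 0 s = of_real (q s)" for s by (simp add: P_def q_def bump_zero)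
    have upd: "(\<lambda>_. P j 0)(i := P j 0) = (\<lambda>_::'d. P j 0)" by auto
    have q1: "(\<integral>\<^sup>+ s. ennreal (q s) \<partial>lborel) = 1"
    proof -
      have [measurable]: "tpow N \<in> borel_measurable borel" for N by (rule borel_measurable_continuous_onI[OF tpow_continuous])
      have "(\<integral>\<^sup>+ s. ennreal (q s) \<partial>lborel) = (\<integral>\<^sup>+ s. ennreal (cc j) * ennreal (tpow (Suc j) (1 + s / \<delta>) * tpow (Suc j) (1 - s / \<delta>)) \<partial>lborel)"
        unfolding q_def by (intro nn_integral_cong ennreal_mult cc) (simp add: tpow_def)
      also have "\<dots> = ennreal (cc j) * ennreal (I j)" by (subst nn_integral_cmult) (auto simp: I(2))
      also have "\<dots> = 1" using I0[of j] by (simp add: cc_def flip: ennreal_mult)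
      finally show ?thesis .
    qed
    have q1': "(\<integral>\<^sup>+ s. ennreal (q (u - s)) \<partial>lborel) = 1" for u
      using nn_integral_real_affine[of "\<lambda>s. ennreal (q s)" "-1" u] q1 by simp
    have "((\<lambda>z. \<Prod>l\<in>UNIV. q (y $ l - z $ l)) has_integral 1) UNIV"
    proof (rule nn_integral_has_integral)
      have "continuous_on UNIV (\<lambda>z. \<Prod>l\<in>UNIV. q (y $ l - z $ l))"
        by (intro continuous_on_prod continuous_on_compose2[OF qc] continuous_intros) auto
      then show "(\<lambda>z. \<Prod>l\<in>UNIV. q (y $ l - z $ l)) \<in> borel_measurable borel" by (rule borel_measurable_continuous_onI)
      show "0 \<le> (\<Prod>l\<in>UNIV. q (y $ l - z $ l))" for z by (rule prod_nonneg) (use q0 in auto)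
      have "(\<integral>\<^sup>+ z. ennreal (\<Prod>l\<in>UNIV. q (y $ l - z $ l)) \<partial>lborel) = (\<integral>\<^sup>+ z. (\<Prod>l\<in>UNIV. ennreal (q (y $ l - z $ l))) \<partial>lborel)"
        by (simp add: prod_ennreal q0)
      also have "\<dots> = (\<Prod>l\<in>UNIV. \<integral>\<^sup>+ s. ennreal (q (y $ l - s)) \<partial>lborel)"
        by (rule nn_integral_lborel_vec_prod) measurable
      also have "\<dots> = ennreal 1" by (simp add: q1')
      finally show "(\<integral>\<^sup>+ z. ennreal (\<Prod>l\<in>UNIV. q (y $ l - z $ l)) \<partial>lborel) = ennreal 1" .
    qed simp
    from has_integral_of_real[OF this, where 'b = complex]
    have hi: "((\<lambda>z. \<Prod>l\<in>UNIV. P j 0 (y $ l - z $ l)) has_integral 1) UNIV" by (simp add: Pq)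
    have "(\<Prod>l\<in>UNIV. P j 0 (y $ l - z $ l)) * av z = (\<Prod>l\<in>UNIV. P j 0 (y $ l - z $ l))" for z
    proof (cases "\<eta> < dist y z")
      case True
      then show ?thesis using pk0[of 0 j y z i] upd by simp
    next
      case False
      then have "dist x z \<le> 2 * \<eta>" using dist_triangle[of x z y] x(2) by simp
      then have "z \<in> NB (2 * \<eta>)" using x(1) NB by blast
      then show ?thesis using A(3) by (simp add: av_def)
    qed
    then have "X j i 0 y = integral UNIV (\<lambda>z. \<Prod>l\<in>UNIV. P j 0 (y $ l - z $ l))"
      unfolding X_def upd pconv_def by (simp only:)
    then show ?thesis using integral_unique[OF hi] by simp
  qed
  have X_i: "X j i 0 = X j i' 0" for j i i'
  proof -
    have "(\<lambda>_. P j 0)(i := P j 0) = (\<lambda>_. P j 0)(i' := P j 0)" by auto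
    then show ?thesis by (simp only: X_def)
  qed
  have sub: "NB (4 * \<eta>) \<subseteq> \<Omega>"
  proof
    fix x assume "x \<in> NB (4 * \<eta>)"
    then obtain z where "z \<in> K" "dist z x \<le> 4 * \<eta>" using NB by blast
    then have "x \<in> (\<Union>x\<in>K. cball x e)" by (auto simp: \<eta>_def)
    then show "x \<in> \<Omega>" using e(2) by blast
  qed
  show ?thesis
    by (rule exI[of _ \<eta>], rule conjI[OF \<eta>], rule exI[of _ "NB (4 * \<eta>)"], rule exI[of _ C], rule conjI[OF C(1)], rule exI[of _ X])
      (intro conjI allI impI ballI cNB sub X_cont X_0 X_bd X_vd X_i X_1; assumption)
qed

section \<open>Integration by parts\<close>

lemma integral_UNIV_translate:
  fixes F :: "'a::euclidean_space \<Rightarrow> 'b::banach"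
  assumes F: "continuous_on UNIV F" "\<And>y. y \<notin> cbox a b \<Longrightarrow> F y = 0"
  shows "integral UNIV (\<lambda>y. F (y + c)) = integral UNIV F"
proof -
  let ?S = "(\<lambda>x. (1 / 1) *\<^sub>R x + -((1 / 1) *\<^sub>R c)) ` cbox a b"
  have "(F has_integral integral (cbox a b) F) (cbox a b)"
    by (rule integrable_integral[OF integrable_continuous[OF continuous_on_subset[OF F(1)]]]) simp
  from has_integral_affinity[OF this, of 1 c]
  have "((\<lambda>x. F (x + c)) has_integral integral (cbox a b) F) ?S" by simp
  moreover have "F (x + c) = 0" if "x \<notin> ?S" for x
  proof -
    have "x + c \<notin> cbox a b"
    proof
      assume "x + c \<in> cbox a b"
      then have "x \<in> ?S" by (intro image_eqI[of _ _ "x + c"]) auto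
      then show False using that by blast
    qed
    then show ?thesis by (rule F(2))
  qed
  ultimately have "((\<lambda>x. F (x + c)) has_integral integral (cbox a b) F) UNIV"
    by (rule has_integral_on_superset) auto
  then show ?thesis using integral_UNIV_eq_cbox[of a b F, OF F(2)] by (simp add: integral_unique)
qed

text \<open>The integral of F does not change under translation along the axis, and its derivative
  with respect to the translation is the integral of \<open>F'\<close>. The larger box contains the
  supports of all translates by at most 1.\<close>

lemma integral_partial_zero:
  fixes F F' :: "real^'d::finite \<Rightarrow> complex"
  assumes F: "continuous_on UNIV F" "\<And>y. y \<notin> cbox a b \<Longrightarrow> F y = 0"
    and F': "continuous_on UNIV F'" "\<And>y. y \<notin> cbox a b \<Longrightarrow> F' y = 0"
    and d: "\<And>y. ((\<lambda>r. F (y + r *\<^sub>R axis i 1)) has_vector_derivative F' y) (at 0)"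
  shows "integral UNIV F' = 0"
proof -
  have "bounded ((\<lambda>(y, r). y + r *\<^sub>R axis i (1::real)) ` (cbox a b \<times> {-1..1}))"
    by (intro compact_imp_bounded compact_continuous_image compact_Times)
      (auto simp: split_beta intro!: continuous_intros)
  then obtain a' b' where ab: "(\<lambda>(y, r). y + r *\<^sub>R axis i (1::real)) ` (cbox a b \<times> {-1..1}) \<subseteq> cbox a' b'"
    using bounded_subset_cbox_symmetric by metis
  have out: "F (y + r *\<^sub>R axis i 1) = 0" if "y \<notin> cbox a' b'" "r \<in> {-1..1}" for y r
  proof -
    have "y + r *\<^sub>R axis i 1 \<notin> cbox a b"
    proof
      assume "y + r *\<^sub>R axis i 1 \<in> cbox a b"
      then have "(\<lambda>(y, r). y + r *\<^sub>R axis i (1::real)) (y + r *\<^sub>R axis i 1, - r) \<in> cbox a' b'"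
        by (intro subsetD[OF ab] imageI) (use that(2) in auto)
      then show False using that(1) by simp
    qed
    then show ?thesis by (rule F(2))
  qed
  have d0: "((\<lambda>r. integral (cbox a' b') (\<lambda>y. F (y + r *\<^sub>R axis i 1))) has_vector_derivative
      integral (cbox a' b') (\<lambda>y. F' (y + 0 *\<^sub>R axis i 1))) (at 0 within {-1..1})"
  proof (rule leibniz_rule_vector_derivative[where fx = "\<lambda>r y. F' (y + r *\<^sub>R axis i 1)"])
    fix r y
    show "((\<lambda>r. F (y + r *\<^sub>R axis i 1)) has_vector_derivative F' (y + r *\<^sub>R axis i 1)) (at r within {-1..1})"
      by (rule has_vector_derivative_at_within[OF has_vd_partial_shift[OF d]])
  next
    fix r
    show "(\<lambda>y. F (y + r *\<^sub>R axis i 1)) integrable_on cbox a' b'"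
      by (intro integrable_continuous continuous_on_compose2[OF F(1)] continuous_intros) auto
  next
    show "continuous_on ({-1..1} \<times> cbox a' b') (\<lambda>(r, y). F' (y + r *\<^sub>R axis i 1))"
      unfolding split_beta by (rule continuous_on_compose2[OF F'(1)]) (auto intro!: continuous_intros)
  qed auto
  have const: "integral (cbox a' b') (\<lambda>y. F (y + r *\<^sub>R axis i 1)) = integral UNIV F" if "r \<in> {-1..1}" for r
    using integral_UNIV_eq_cbox[of a' b' "\<lambda>y. F (y + r *\<^sub>R axis i 1)"] out[OF _ that] integral_UNIV_translate[OF F] by simp
  have "((\<lambda>r. integral UNIV F) has_vector_derivative integral (cbox a' b') (\<lambda>y. F' (y + 0 *\<^sub>R axis i 1))) (at 0 within {-1..1})"
    by (rule has_vector_derivative_transform[OF _ _ d0]) (use const in auto)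
  then have "((\<lambda>r. integral UNIV F) has_vector_derivative integral (cbox a' b') F') (at 0 within {-1..1})"
    by simp
  moreover have "((\<lambda>r. integral UNIV F) has_vector_derivative 0) (at 0 within {-1..1})" by simp
  moreover have "at (0::real) within {-1..1} \<noteq> bot" by (simp add: trivial_limit_within islimpt_Icc)
  ultimately have z: "integral (cbox a' b') F' = 0" using vector_derivative_unique_within by blast
  have "F' y = 0" if y: "y \<notin> cbox a' b'" for y
  proof -
    have "y \<notin> cbox a b"
    proof
      assume "y \<in> cbox a b"
      then have "(\<lambda>(y, r). y + r *\<^sub>R axis i (1::real)) (y, 0) \<in> cbox a' b'"
        by (intro subsetD[OF ab] imageI) auto
      then show False using y by simp
    qed
    then show ?thesis by (rule F'(2))
  qed
  then show ?thesis using z integral_UNIV_eq_cbox[of a' b' F'] by simp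
qed

text \<open>\<open>A t\<close> is the t-th derivative of \<open>A 0\<close> in direction i for t up
  to j, the order to which a cutoff of index j is controlled.\<close>

definition dirseq :: "'d::finite \<Rightarrow> nat \<Rightarrow> (nat \<Rightarrow> real^'d \<Rightarrow> complex) \<Rightarrow> bool" where
  "dirseq i j A \<longleftrightarrow> (\<forall>t<j. \<forall>y. ((\<lambda>r. A t (y + r *\<^sub>R axis i 1)) has_vector_derivative A (Suc t) y) (at 0))"

lemma dirseq_leib:
  assumes "dirseq i j A" "dirseq i j B" shows "dirseq i j (leib A B)"
  unfolding dirseq_def
proof (intro allI impI)
  fix t y assume t: "t < j"
  show "((\<lambda>r. leib A B t (y + r *\<^sub>R axis i 1)) has_vector_derivative leib A B (Suc t) y) (at 0)"
    using leib_has_vd[of t A "\<lambda>r. y + r *\<^sub>R axis i 1" 0 B] assms t unfolding dirseq_def by simp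
qed

text \<open>The derivative of the phase in y is \<open>- \<i> * l\<close> times the phase. Hence
  each vanishing integral of a derivative trades one factor \<open>\<i> * l\<close> in front for one
  derivative on U.\<close>

lemma oscillatory_integral_by_parts:
  fixes U :: "nat \<Rightarrow> real^'d::finite \<Rightarrow> complex"
  assumes U: "dirseq i j U" and c: "\<And>t. t \<le> j \<Longrightarrow> continuous_on UNIV (U t)"
    and z: "\<And>t y. t \<le> j \<Longrightarrow> y \<notin> cbox a b \<Longrightarrow> U t y = 0" and l: "l \<noteq> (0::real)" and tj: "t \<le> j"
  shows "(\<i> * of_real l) ^ t * integral UNIV (\<lambda>y. exp (\<i> * of_real (l * (x $ i - y $ i))) * U 0 y) =
     integral UNIV (\<lambda>y. exp (\<i> * of_real (l * (x $ i - y $ i))) * U t y)"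
  using tj
proof (induction t)
  case (Suc t)
  let ?e = "\<lambda>y. exp (\<i> * of_real (l * (x $ i - y $ i)))"
  let ?F' = "\<lambda>y. ?e y * U (Suc t) y - (\<i> * of_real l) * (?e y * U t y)"
  have ce: "continuous_on S ?e" for S by (intro continuous_intros)
  have cont: "continuous_on UNIV (\<lambda>y. ?e y * U s y)" if "s \<le> j" for s by (intro continuous_on_mult ce c that)
  have int: "(\<lambda>y. ?e y * U s y) integrable_on UNIV" if "s \<le> j" for s
  proof -
    have "(\<lambda>y. ?e y * U s y) integrable_on cbox a b"
      by (intro integrable_continuous continuous_on_subset[OF cont[OF that]]) simp
    then show ?thesis
      by (rule integrable_on_superset) (use z that in auto)
  qed
  have "integral UNIV ?F' = 0"
  proof (rule integral_partial_zero[where F = "\<lambda>y. ?e y * U t y" and a = a and b = b and i = i])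
    fix y
    have "((\<lambda>r. exp (\<i> * of_real (l * (x $ i - (y + r *\<^sub>R axis i 1) $ i)))) has_vector_derivative
        - (\<i> * of_real l) * ?e y) (at 0)"
    proof -
      \<comment> \<open>The phase is differentiated as a holomorphic function of r and then
        restricted to the real line.\<close>
      have "((\<lambda>r. exp (\<i> * of_real (l * (x $ i - y $ i - r)))) has_vector_derivative
        - (\<i> * of_real l) * ?e y) (at 0)"
        by (rule has_vector_derivative_real_field[of "\<lambda>r. exp (\<i> * (of_real l * (of_real (x $ i - y $ i) - r)))" _ 0, simplified, unfolded o_def, THEN has_vector_derivative_eq_rhs]
          | auto intro!: derivative_eq_intros)+
      then show ?thesis by (simp add: diff_diff_eq)
    qed
    moreover have "((\<lambda>r. U t (y + r *\<^sub>R axis i 1)) has_vector_derivative U (Suc t) y) (at 0)"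
      using U Suc.prems unfolding dirseq_def by simp
    ultimately have "((\<lambda>r. exp (\<i> * of_real (l * (x $ i - (y + r *\<^sub>R axis i 1) $ i))) * U t (y + r *\<^sub>R axis i 1)) has_vector_derivative
        ?e (y + 0 *\<^sub>R axis i 1) * U (Suc t) y + (- (\<i> * of_real l) * ?e y) * U t (y + 0 *\<^sub>R axis i 1)) (at 0)"
      by (rule has_vector_derivative_mult)
    then show "((\<lambda>r. exp (\<i> * of_real (l * (x $ i - (y + r *\<^sub>R axis i 1) $ i))) * U t (y + r *\<^sub>R axis i 1)) has_vector_derivative ?F' y) (at 0)"
      by (simp add: mult.assoc)
  next
    show "continuous_on UNIV (\<lambda>y. ?e y * U t y)" using cont Suc.prems by simp
    show "continuous_on UNIV ?F'"
      by (intro continuous_on_diff continuous_on_mult[OF continuous_on_const] cont) (use Suc.prems in auto)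
  qed (use z Suc.prems in auto)
  moreover have "integral UNIV ?F' = integral UNIV (\<lambda>y. ?e y * U (Suc t) y) - integral UNIV (\<lambda>y. (\<i> * of_real l) * (?e y * U t y))"
    by (rule integral_diff[OF int integrable_on_mult_right[OF int]]) (use Suc.prems in auto)
  moreover have "integral UNIV (\<lambda>y. (\<i> * of_real l) * (?e y * U t y)) = (\<i> * of_real l) * integral UNIV (\<lambda>y. ?e y * U t y)"
    by (rule integral_mult_right)
  ultimately have "(\<i> * of_real l) * integral UNIV (\<lambda>y. ?e y * U t y) = integral UNIV (\<lambda>y. ?e y * U (Suc t) y)" by simp
  moreover have "(\<i> * of_real l) ^ Suc t * integral UNIV (\<lambda>y. ?e y * U 0 y) = (\<i> * of_real l) * integral UNIV (\<lambda>y. ?e y * U t y)"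
    using Suc.IH Suc.prems by (simp add: mult.assoc)
  ultimately show ?case by (simp only:)
qed simp

section \<open>Choosing the order of differentiation\<close>

text \<open>Squaring turns \<open>sqrt (j k) ^ s\<close> into \<open>(j k) ^ s\<close>. One of the
  two factors \<open>Mw \<omega> m (j - s)\<close> is traded for \<open>k ^ (j - s)\<close>, then
  \<open>j ^ s \<le> exp 1 ^ j * fact s\<close> brings in \<open>Mw \<omega> m s\<close>, and
  superadditivity merges the two weights into a bound independent of s.\<close>

lemma order_estimate_term:
  assumes w: "weight_function \<omega>" and m: "m \<ge> 1" and k: "k \<ge> 1" and j: "j \<le> k" and s: "s \<le> j"
    and C: "C \<ge> 1" "D \<ge> 1" "\<And>p. real p ^ p \<le> C * D ^ p * Mw \<omega> m p"
    and le: "Mw \<omega> m (j - s) \<le> real k ^ (j - s)"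
  shows "(sqrt (real j * real k) ^ s * Mw \<omega> m (j - s) / real k ^ j)\<^sup>2 \<le> C * (exp 1 * D / real k) ^ j * Mw \<omega> m j"
proof -
  let ?q = "j - s"
  let ?M = "Mw \<omega> m ?q"
  have kp: "real k > 0" using k by simp
  have js: "real k ^ j = real k ^ s * real k ^ ?q" using s by (simp flip: power_add)
  have "(sqrt (real j * real k) ^ s * ?M / real k ^ j)\<^sup>2 = (real j * real k) ^ s * ?M\<^sup>2 / (real k ^ j)\<^sup>2"
  proof -
    have "(sqrt (real j * real k) ^ s)\<^sup>2 = ((sqrt (real j * real k))\<^sup>2) ^ s" by (simp only: power_mult[symmetric] mult.commute)
    then have "(sqrt (real j * real k) ^ s)\<^sup>2 = (real j * real k) ^ s" by simp
    then show ?thesis by (simp only: power_mult_distrib[of "sqrt _ ^ s"] power_divide)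
  qed
  also have "\<dots> \<le> (real j * real k) ^ s * (?M * real k ^ ?q) / (real k ^ j)\<^sup>2"
    unfolding power2_eq_square[of ?M] using le by (intro divide_right_mono mult_left_mono) auto
  also have "\<dots> = real j ^ s * ?M / real k ^ j"
    using kp by (simp add: js power_mult_distrib power2_eq_square)
  also have "\<dots> \<le> (exp 1 ^ j * (C * D ^ s * Mw \<omega> m s)) * ?M / real k ^ j"
  proof (intro divide_right_mono mult_right_mono)
    have "real j ^ s / fact s \<le> exp (real j)"
    proof -
      have "(\<Sum>i\<in>{s}. inverse (fact i) *\<^sub>R real j ^ i) \<le> exp (real j)"
        unfolding exp_def by (rule sum_le_suminf[OF summable_exp_generic]) auto
      then show ?thesis by (simp add: divide_inverse mult.commute)
    qed
    then have "real j ^ s \<le> exp (real j) * fact s" by (simp add: divide_le_eq)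
    also have "exp (real j) = exp 1 ^ j" by (simp flip: exp_of_nat_mult)
    also have "exp 1 ^ j * fact s \<le> exp 1 ^ j * (C * D ^ s * Mw \<omega> m s)"
      using fact_le_self_power[of s] C(3)[of s] by (intro mult_left_mono) auto
    finally show "real j ^ s \<le> exp 1 ^ j * (C * D ^ s * Mw \<omega> m s)" .
  qed auto
  also have "\<dots> = C * exp 1 ^ j * D ^ s * (Mw \<omega> m s * ?M) / real k ^ j" by (simp only: mult_ac)
  also have "\<dots> \<le> C * exp 1 ^ j * D ^ j * Mw \<omega> m j / real k ^ j"
  proof (intro divide_right_mono mult_mono)
    show "Mw \<omega> m s * ?M \<le> Mw \<omega> m j" using Mw_superadd[OF w m, of s ?q] s by simp
    show "D ^ s \<le> D ^ j" using C(2) s by (rule power_increasing[rotated])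
  qed (use C in auto)
  also have "\<dots> = C * (exp 1 * D / real k) ^ j * Mw \<omega> m j" by (simp add: power_mult_distrib power_divide)
  finally show ?thesis .
qed

text \<open>The order j is selected at \<open>R = k / E\<close>. The scale E cancels all geometric
  constants against \<open>R ^ j\<close>, and what is left is the root of
  \<open>R * exp (- \<omega> R / m)\<close>; the root is due to the square in
  \<open>order_estimate_term\<close>.\<close>

lemma order_estimate:
  assumes w: "weight_function \<omega>" and m: "m \<ge> 1" and A: "A \<ge> 1"
  shows "\<exists>C\<ge>1. \<exists>E\<ge>1. \<exists>k0\<ge>1. \<forall>k\<ge>k0. real k / E > 1 \<and> (\<exists>j\<le>k.
     A ^ j * (\<Sum>s\<le>j. real (j choose s) * ((A * sqrt (real j * real k)) ^ s * Mw \<omega> m (j - s))) / real k ^ j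
       \<le> C * sqrt (real k / E * exp (- \<omega> (real k / E) / real m)))"
proof -
  obtain C D where CD: "C \<ge> 1" "D \<ge> 1" "\<And>p. real p ^ p \<le> C * D ^ p * Mw \<omega> m p"
    using Mw_factorial_bound[OF w m] by blast
  obtain L where L: "L \<ge> 1" "\<And>t. t \<ge> 0 \<Longrightarrow> \<omega> t \<le> L * (1 + t)" using weight_linear_bound[OF w] by blast
  define E1 where "E1 = (2 * A * A)\<^sup>2 * (exp 1 * D)"
  \<comment> \<open>E1 collects the bases of all powers with exponent j, under the root. The second
    entry ensures \<open>j \<le> k\<close>, through \<open>j \<le> \<omega> (exp 1 * R)\<close> and
    linear growth.\<close>
  define E where "E = max E1 (2 * L * exp 1)"
  have e1: "exp 1 \<ge> (1::real)" by simp
  have E1: "E1 \<ge> 1"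
  proof -
    have "1 * 1 \<le> (2 * A * A)\<^sup>2 * (exp 1 * D)"
    proof (intro mult_mono)
      have "1 \<le> 2 * A * A" using mult_mono[OF A A] A by simp
      then show "1 \<le> (2 * A * A)\<^sup>2" by (simp add: one_le_power)
      show "1 \<le> exp 1 * D" using mult_mono[OF e1 CD(2)] by simp
    qed auto
    then show ?thesis by (simp add: E1_def)
  qed
  have E: "E \<ge> 1" "E1 \<le> E" "2 * L * exp 1 \<le> E" using E1 by (auto simp: E_def)
  obtain k0 :: nat where k0: "real k0 \<ge> max (2 * L) (E + 1)" using real_arch_simple by blast
  have k01: "k0 \<ge> 1" using k0 L(1) by (cases k0) auto
  have "real k / E > 1 \<and> (\<exists>j\<le>k.
     A ^ j * (\<Sum>s\<le>j. real (j choose s) * ((A * sqrt (real j * real k)) ^ s * Mw \<omega> m (j - s))) / real k ^ j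
       \<le> sqrt C * sqrt (real k / E * exp (- \<omega> (real k / E) / real m)))" if k: "k \<ge> k0" for k
  proof -
    define R where "R = real k / E"
    have kk: "real k \<ge> 2 * L" "real k \<ge> E + 1" "k \<ge> 1" using k k0 k01 by auto
    have R: "R > 1" using kk E by (simp add: R_def field_simps)
    obtain j where j: "real j \<le> \<omega> (exp 1 * R)" "\<And>q. q \<le> j \<Longrightarrow> Mw \<omega> m q \<le> R ^ q"
      "Mw \<omega> m j \<le> R ^ j * (R * exp (- \<omega> R / real m))" using weight_order_selection[OF w m R] by blast
    have jk: "j \<le> k"
    proof -
      have "real j \<le> L * (1 + exp 1 * R)" using j(1) L(2)[of "exp 1 * R"] R by (simp add: order_trans)
      also have "\<dots> = L + (2 * L * exp 1) * real k / (2 * E)" by (simp add: R_def field_simps)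
      also have "\<dots> \<le> real k / 2 + E * real k / (2 * E)"
        using kk E by (intro add_mono divide_right_mono mult_right_mono) auto
      also have "\<dots> = real k" using E by simp
      finally show ?thesis by simp
    qed
    have Rk: "R \<le> real k" using E kk by (simp add: R_def divide_le_eq mult_le_cancel_left1)
    define S where "S = sqrt (C * (exp 1 * D / real k) ^ j * Mw \<omega> m j)"
    have S0: "0 \<le> S" using CD(1,2) by (simp add: S_def mult_nonneg_nonneg)
    have t: "sqrt (real j * real k) ^ s * Mw \<omega> m (j - s) / real k ^ j \<le> S" if s: "s \<le> j" for s
    proof -
      have "Mw \<omega> m (j - s) \<le> real k ^ (j - s)"
        by (rule order_trans[OF j(2) power_mono[OF Rk]]) (use R in auto)
      then show ?thesis unfolding S_def
        by (intro real_le_rsqrt order_estimate_term[OF w m kk(3) jk s CD])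
    qed
    have "A ^ j * (\<Sum>s\<le>j. real (j choose s) * ((A * sqrt (real j * real k)) ^ s * Mw \<omega> m (j - s))) / real k ^ j
       = A ^ j * (\<Sum>s\<le>j. real (j choose s) * (A ^ s * (sqrt (real j * real k) ^ s * Mw \<omega> m (j - s) / real k ^ j)))"
      by (simp add: sum_distrib_left sum_divide_distrib power_mult_distrib mult.assoc)
    also have "\<dots> \<le> A ^ j * (\<Sum>s\<le>j. real (j choose s) * (A ^ j * S))"
    proof (intro mult_left_mono sum_mono)
      fix s assume "s \<in> {..j}"
      then have s: "s \<le> j" by simp
      have "0 \<le> sqrt (real j * real k) ^ s * Mw \<omega> m (j - s) / real k ^ j" by simp
      then show "A ^ s * (sqrt (real j * real k) ^ s * Mw \<omega> m (j - s) / real k ^ j) \<le> A ^ j * S"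
        by (intro mult_mono[OF power_increasing[OF s A] t[OF s]]) (use A in auto)
    qed (use A in auto)
    also have "\<dots> = A ^ j * (2 ^ j * (A ^ j * S))"
      unfolding sum_distrib_right[symmetric] of_nat_sum[symmetric] choose_row_sum by simp
    also have "\<dots> = (2 * A * A) ^ j * S" by (simp add: power_mult_distrib mult_ac)
    also have "\<dots> = sqrt (((2 * A * A)\<^sup>2) ^ j) * S"
    proof -
      have "((2 * A * A)\<^sup>2) ^ j = ((2 * A * A) ^ j)\<^sup>2" by (simp only: power_mult[symmetric] mult.commute)
      then show ?thesis using A by simp
    qed
    also have "\<dots> = sqrt (((2 * A * A)\<^sup>2) ^ j * (C * (exp 1 * D / real k) ^ j * Mw \<omega> m j))"
      by (simp only: S_def real_sqrt_mult)
    also have "((2 * A * A)\<^sup>2) ^ j * (C * (exp 1 * D / real k) ^ j * Mw \<omega> m j) = C * ((E1 / real k) ^ j * Mw \<omega> m j)"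
      by (simp add: E1_def power_mult_distrib power_divide mult_ac)
    also have "\<dots> \<le> C * (R * exp (- \<omega> R / real m))"
    proof (rule mult_left_mono)
      have "(E1 / real k) ^ j * Mw \<omega> m j \<le> (1 / R) ^ j * (R ^ j * (R * exp (- \<omega> R / real m)))"
        using j(3) E E1 kk by (intro mult_mono power_mono) (auto simp: R_def divide_right_mono)
      also have "\<dots> = R * exp (- \<omega> R / real m)" using R by (simp add: power_divide)
      finally show "(E1 / real k) ^ j * Mw \<omega> m j \<le> R * exp (- \<omega> R / real m)" .
    qed (use CD in auto)
    finally have "A ^ j * (\<Sum>s\<le>j. real (j choose s) * ((A * sqrt (real j * real k)) ^ s * Mw \<omega> m (j - s))) / real k ^ j
       \<le> sqrt (C * (R * exp (- \<omega> R / real m)))" by (simp add: real_sqrt_le_mono)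
    then show ?thesis using R jk unfolding R_def real_sqrt_mult[of C] by blast
  qed
  moreover have "sqrt C \<ge> 1" using CD(1) by simp
  ultimately show ?thesis using E(1) k01 by blast
qed

text \<open>After the root the decay is \<open>exp (- \<omega> R / (2 m))\<close> with
  \<open>R = k / E\<close>. Half of it pays for \<open>exp (\<omega> (A k) / n)\<close>, by
  (\<alpha>) and \<open>n \<ge> 4 m L\<close>; the other half beats every power of k by
  (\<gamma>).\<close>

lemma decay_estimate:
  assumes w: "weight_function \<omega>" and m: "m \<ge> 1" and E: "E \<ge> 1" and A: "A \<ge> 1"
  shows "\<exists>n0\<ge>1. \<forall>n\<ge>n0. \<exists>C\<ge>0. \<forall>k\<ge>1. real k / E > 1 \<longrightarrow>
     real k ^ p * sqrt (real k / E * exp (- \<omega> (real k / E) / real m)) * exp (\<omega> (A * real k) / real n) \<le> C / (real k)\<^sup>2"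
proof -
  have "1 \<le> A * E" using mult_mono[OF A E] A by simp
  then obtain L where L: "L \<ge> 1" "\<And>t. t \<ge> 0 \<Longrightarrow> \<omega> (A * E * t) \<le> L * (1 + \<omega> t)" using weight_scaling[OF w] by blast
  obtain n0 :: nat where n0: "real n0 \<ge> max 1 (4 * real m * L)" using real_arch_simple by blast
  have n01: "n0 \<ge> 1" using n0 by (cases n0) auto
  \<comment> \<open>The exponent \<open>p + 3\<close> counts powers of R: p from
    \<open>k ^ p\<close>, one from \<open>sqrt R \<le> R\<close>, and two for the denominator on the
    right.\<close>
  obtain B where B: "\<And>x. x \<ge> 0 \<Longrightarrow> (4 * real m * real (p + 3)) * x - \<omega> (exp x) \<le> B" using weight_dominates_log[OF w] by blast
  define C where "C = E ^ (p + 2) * exp 1 * exp (B / (4 * real m))"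
  have "real k ^ p * sqrt (real k / E * exp (- \<omega> (real k / E) / real m)) * exp (\<omega> (A * real k) / real n) \<le> C / (real k)\<^sup>2"
    if n: "n \<ge> n0" and k: "k \<ge> 1" and R1: "real k / E > 1" for n k
  proof -
    define R where "R = real k / E"
    have R: "R > 1" "real k = E * R" using R1 E by (auto simp: R_def)
    have wR: "\<omega> R \<ge> 0" using w R unfolding weight_function_def by auto
    have n': "real n \<ge> 4 * real m * L" "real n \<ge> 1" using n n0 by auto
    have "sqrt (R * exp (- \<omega> R / real m)) = sqrt R * exp (- \<omega> R / real m / 2)"
    proof -
      have "exp (- \<omega> R / real m) = (exp (- \<omega> R / real m / 2))\<^sup>2" by (simp add: power2_eq_square flip: exp_add)
      then show ?thesis by (simp add: real_sqrt_mult)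
    qed
    also have "\<dots> \<le> R * exp (- \<omega> R / real m / 2)"
    proof (intro mult_right_mono)
      have "sqrt R \<le> sqrt (R * R)" using R by (intro real_sqrt_le_mono) (simp add: mult_le_cancel_left1)
      then show "sqrt R \<le> R" using R by simp
    qed auto
    finally have 1: "sqrt (R * exp (- \<omega> R / real m)) \<le> R * exp (- \<omega> R / real m / 2)" .
    have "\<omega> (A * real k) / real n \<le> L * (1 + \<omega> R) / real n"
      using L(2)[of R] R n' by (intro divide_right_mono) (auto simp: mult.assoc)
    also have "\<dots> \<le> L * (1 + \<omega> R) / (4 * real m * L)"
      using n' L(1) wR m by (intro divide_left_mono) auto
    also have "\<dots> = 1 / (4 * real m) + \<omega> R / (4 * real m)" using L(1) m by (simp add: field_simps)
    also have "\<dots> \<le> 1 + \<omega> R / (4 * real m)" using m by (simp add: field_simps)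
    finally have 2: "\<omega> (A * real k) / real n \<le> 1 + \<omega> R / (4 * real m)" .
    have 3: "exp (- \<omega> R / real m / 2) * exp (\<omega> (A * real k) / real n) \<le> exp (1 - \<omega> R / (4 * real m))"
    proof -
      have "- \<omega> R / real m / 2 = - 2 * (\<omega> R / (4 * real m))" by simp
      then show ?thesis unfolding exp_add[symmetric] using 2 by simp
    qed
    have 4: "exp (- \<omega> R / (4 * real m)) * R ^ (p + 3) \<le> exp (B / (4 * real m))"
    proof -
      have "(4 * real m * real (p + 3)) * ln R - \<omega> R \<le> B" using B[of "ln R"] R by simp
      then have "((4 * real m * real (p + 3)) * ln R - \<omega> R) / (4 * real m) \<le> B / (4 * real m)" by (intro divide_right_mono) auto
      then have "- \<omega> R / (4 * real m) + real (p + 3) * ln R \<le> B / (4 * real m)" using m by (simp add: field_simps)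
      then have "exp (- \<omega> R / (4 * real m) + real (p + 3) * ln R) \<le> exp (B / (4 * real m))" by simp
      moreover have "exp (real (p + 3) * ln R) = R ^ (p + 3)" using R unfolding exp_of_nat_mult by simp
      ultimately show ?thesis by (simp only: exp_add)
    qed
    have "real k ^ p * sqrt (R * exp (- \<omega> R / real m)) * exp (\<omega> (A * real k) / real n)
       \<le> real k ^ p * (R * exp (- \<omega> R / real m / 2)) * exp (\<omega> (A * real k) / real n)"
      using 1 by (intro mult_right_mono mult_left_mono) auto
    also have "\<dots> = (real k ^ p * R) * (exp (- \<omega> R / real m / 2) * exp (\<omega> (A * real k) / real n))" by (simp only: mult_ac)
    also have "\<dots> \<le> (real k ^ p * R) * exp (1 - \<omega> R / (4 * real m))" using 3 R by (intro mult_left_mono) auto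
    also have "\<dots> = E ^ p * exp 1 * (exp (- \<omega> R / (4 * real m)) * R ^ (p + 3)) / R\<^sup>2"
      using R(1) by (simp add: R(2) power_mult_distrib exp_diff exp_minus power_add power2_eq_square power3_eq_cube field_simps)
    also have "\<dots> \<le> E ^ p * exp 1 * exp (B / (4 * real m)) / R\<^sup>2"
      using 4 E by (intro divide_right_mono mult_left_mono) auto
    also have "\<dots> = C / (real k)\<^sup>2" using E R(1) by (simp add: C_def R(2) power_mult_distrib power_add power2_eq_square)
    finally show ?thesis by (simp add: R_def)
  qed
  moreover have "C \<ge> 0" using E by (simp add: C_def)
  ultimately show ?thesis using n01 by (intro exI[of _ n0]) blast
qed

section \<open>The decay of the increments\<close>

text \<open>In direction i the kernel is a phase times an amplitude, and its other factors are
  constant along that direction. Integrating by parts j times divides by \<open>k ^ j\<close> and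
  leaves the j-th derivative of amplitude times cutoff times \<phi>.\<close>

lemma smoothed_osc_bound:
  fixes \<phi> :: "real^'d::finite \<Rightarrow> complex" and X :: "nat \<Rightarrow> real^'d \<Rightarrow> complex"
  assumes k: "k \<ge> 1" and c: "\<And>i. c i \<in> {-1, 0, 1}" and ci: "c i \<noteq> 0" and j: "j \<le> k"
    and W: "open W" "D \<subseteq> W" "smooth_on W \<phi>" and D: "compact D" "D \<subseteq> cbox a b"
    and Xc: "\<And>t. t \<le> j \<Longrightarrow> continuous_on UNIV (X t)" and X0: "\<And>t y. t \<le> j \<Longrightarrow> y \<notin> D \<Longrightarrow> X t y = 0"
    and Xb: "\<And>t y. t \<le> j \<Longrightarrow> cmod (X t y) \<le> Q * (C0 * real (Suc j)) ^ t" and C0: "C0 \<ge> 1" and Xd: "dirseq i j X"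
    and \<phi>b: "\<And>t y. y \<in> D \<Longrightarrow> cmod (foldr partial_deriv (replicate t i) \<phi> y) \<le> B * N t" and N: "\<And>t. 0 \<le> N t" and B: "B \<ge> 0"
    and R: "\<And>y. y \<in> cbox a b \<Longrightarrow> norm y \<le> R"
  shows "cmod (mderiv \<alpha> (smoothed k c (\<lambda>y. X 0 y * \<phi> y)) x) \<le>
     measure lborel (cbox a b) * exp (R\<^sup>2 / 2) * exp 14 * (exp 8 * real k) ^ CARD('d) * Q * B *
     (exp 6 ^ j * (\<Sum>s\<le>j. real (j choose s) * ((3 * C0 * sqrt (real j * real k)) ^ s * N (j - s))) / real k ^ j) *
     (exp 7 * real (max k (mabs \<alpha>))) ^ mabs \<alpha> * gauss_weight x"
proof -
  define s where "s = c i"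
  have s: "s = 1 \<or> s = -1" using c[of i] ci by (auto simp: s_def)
  define l where "l = real_of_int s * real k"
  have l: "l \<noteq> 0" "\<bar>l\<bar> = real k" using s k by (auto simp: l_def)
  define \<Phi> where "\<Phi> t = foldr partial_deriv (replicate t i) \<phi>" for t
  define Rest where "Rest y = (\<Prod>m\<in>UNIV - {i}. entire_kernel (ker k c) \<alpha> m (x $ m - y $ m))" for y
  \<comment> \<open>The sign appears because the amplitude is evaluated at
    \<open>x $ i - y $ i\<close> and differentiated in y.\<close>
  define H where "H t y = (-1) ^ t * (deriv ^^ t) (osc_amp s k (\<alpha> i)) (of_real (x $ i - y $ i)) * Rest y" for t y
  define P where "P = leib H X"
  define U where "U = leib P \<Phi>"
  define v where "v y = X 0 y * \<phi> y" for y
  note h = ker_holomorphic[of k c] osc_amp_holomorphic[of s k "\<alpha> i"]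
  have Q: "0 \<le> Q" using Xb[of 0 0] norm_ge_zero[of "X 0 0"] by (simp del: norm_ge_zero)
  have Rest_line: "Rest (y + r *\<^sub>R axis i 1) = Rest y" for y r
    unfolding Rest_def by (rule prod.cong) (auto simp: axis_def)
  have Rest_c: "continuous_on A Rest" for A
    unfolding Rest_def[abs_def]
    by (intro continuous_on_prod continuous_on_compose2[OF continuous_on_entire_kernel[OF h(1)]] continuous_intros) auto
  have amp_vd: "((\<lambda>u. (deriv ^^ t) (osc_amp s k (\<alpha> i)) (of_real u)) has_vector_derivative (deriv ^^ Suc t) (osc_amp s k (\<alpha> i)) (of_real u)) (at u)" for t u
    by (rule entire_deriv_of_real_has_vd[OF h(2)])
  have amp_c: "continuous_on UNIV (\<lambda>u. (deriv ^^ t) (osc_amp s k (\<alpha> i)) (of_real u))" for t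
    by (rule continuous_on_vector_derivative) (use amp_vd in \<open>auto intro: has_vector_derivative_at_within\<close>)
  have H_c: "continuous_on A (H t)" for A t
    unfolding H_def[abs_def]
    by (intro continuous_intros continuous_on_compose2[OF amp_c] Rest_c) auto
  have H_d: "dirseq i j H"
    unfolding dirseq_def
  proof (intro allI impI)
    fix t y
    let ?f = "\<lambda>t u. (deriv ^^ t) (osc_amp s k (\<alpha> i)) (of_real u)"
    have "((\<lambda>r. x $ i - y $ i - r) has_vector_derivative - 1) (at 0)" by (auto intro!: derivative_eq_intros)
    from vector_diff_chain_at[OF this, of "?f t" "?f (Suc t) (x $ i - y $ i)"] amp_vd[of t "x $ i - y $ i"]
    have "((\<lambda>r. ?f t (x $ i - y $ i - r)) has_vector_derivative - ?f (Suc t) (x $ i - y $ i)) (at 0)" by (simp add: o_def)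
    then have "((\<lambda>r. (-1) ^ t * ?f t (x $ i - y $ i - r) * Rest y) has_vector_derivative (-1) ^ t * (- ?f (Suc t) (x $ i - y $ i)) * Rest y) (at 0)"
      by (intro has_vector_derivative_mult_left has_vector_derivative_mult_right)
    then show "((\<lambda>r. H t (y + r *\<^sub>R axis i 1)) has_vector_derivative H (Suc t) y) (at 0)"
      unfolding H_def Rest_line by (simp add: diff_diff_eq)
  qed
  have P_d: "dirseq i j P" unfolding P_def by (rule dirseq_leib[OF H_d Xd])
  have P_c: "continuous_on A (P t)" if "t \<le> j" for A t
    unfolding P_def by (rule leib_continuous_on[OF H_c]) (use that in \<open>auto intro!: continuous_on_subset[OF Xc subset_UNIV]\<close>)
  have P_0: "P t y = 0" if "t \<le> j" "y \<notin> D" for t y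
    using X0[OF _ that(2)] that(1) by (simp add: P_def leib_def)
  have U_0: "U t y = 0" if "t \<le> j" "y \<notin> D" for t y
    using P_0[OF _ that(2)] that(1) by (simp add: U_def leib_def)
  have oD: "open (- D)" using D(1) by (simp add: compact_imp_closed open_Compl)
  \<comment> \<open>\<phi> is smooth on W only; off D the product vanishes, and the open sets W and
    \<open>- D\<close> cover the space.\<close>
  have U_c: "continuous_on UNIV (U t)" if t: "t \<le> j" for t
  proof -
    have "continuous_on W (U t)" unfolding U_def
      by (rule leib_continuous_on) (use t P_c smooth_on_continuous_foldr[OF W(3)] in \<open>auto simp: \<Phi>_def simp del: foldr_replicate\<close>)
    moreover have "continuous_on (- D) (U t)"
      using U_0[OF t] by (subst continuous_on_cong[OF refl, of _ _ "\<lambda>_. 0"]) auto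
    ultimately have "continuous_on (W \<union> - D) (U t)" by (rule continuous_on_open_Un[OF W(1) oD])
    moreover have "W \<union> - D = UNIV" using W(2) by blast
    ultimately show ?thesis by simp
  qed
  have U_d: "dirseq i j U"
    unfolding dirseq_def
  proof (intro allI impI)
    fix t y assume t: "t < j"
    show "((\<lambda>r. U t (y + r *\<^sub>R axis i 1)) has_vector_derivative U (Suc t) y) (at 0)"
    proof (cases "y \<in> W")
      case True
      have "((\<lambda>r. \<Phi> u (y + r *\<^sub>R axis i 1)) has_vector_derivative \<Phi> (Suc u) y) (at 0)" for u
        using smooth_on_foldr_has_vd[OF W(3) True, of "replicate u i" i] by (simp add: \<Phi>_def)
      then show ?thesis
        using leib_has_vd[of t P "\<lambda>r. y + r *\<^sub>R axis i 1" 0 \<Phi>] P_d t unfolding dirseq_def U_def by simp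
    next
      case False
      then have y: "y \<in> - D" using W(2) by blast
      have "((\<lambda>r. U t (y + r *\<^sub>R axis i 1)) has_vector_derivative 0) (at 0)"
        by (rule has_vd_axis_cong[OF oD y, of "\<lambda>_. 0"]) (use U_0 t in auto)
      then show ?thesis using U_0[of "Suc t" y] t y by simp
    qed
  qed
  have U_cb: "U t y = 0" if "t \<le> j" "y \<notin> cbox a b" for t y using U_0 that D(2) by blast
  have vU: "U 0 = (\<lambda>y. osc_amp s k (\<alpha> i) (of_real (x $ i - y $ i)) * Rest y * v y)"
    by (simp add: U_def P_def leib_def H_def \<Phi>_def v_def fun_eq_iff)
  have v_c: "continuous_on UNIV v"
  proof -
    have "continuous_on W v" unfolding v_def[abs_def]
      by (intro continuous_intros smooth_on_continuous[OF W(3)] continuous_on_subset[OF Xc]) auto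
    moreover have "continuous_on (- D) v"
      using X0 by (subst continuous_on_cong[OF refl, of _ _ "\<lambda>_. 0"]) (auto simp: v_def)
    ultimately have "continuous_on (W \<union> - D) v" by (rule continuous_on_open_Un[OF W(1) oD])
    moreover have "W \<union> - D = UNIV" using W(2) by blast
    ultimately show ?thesis by simp
  qed
  have v_0: "v y = 0" if "y \<notin> cbox a b" for y using X0[of 0 y] that D(2) by (auto simp: v_def)
  let ?e = "\<lambda>y. exp (\<i> * of_real (l * (x $ i - y $ i)))"
  have integrand: "(\<Prod>m\<in>UNIV. entire_kernel (ker k c) \<alpha> m (x $ m - y $ m)) * v y = ?e y * U 0 y" for y
  proof -
    have "(\<Prod>m\<in>UNIV. entire_kernel (ker k c) \<alpha> m (x $ m - y $ m)) = entire_kernel (ker k c) \<alpha> i (x $ i - y $ i) * Rest y"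
      unfolding Rest_def by (rule prod.remove) auto
    also have "entire_kernel (ker k c) \<alpha> i (x $ i - y $ i) = ?e y * osc_amp s k (\<alpha> i) (of_real (x $ i - y $ i))"
    proof -
      have "ker k c i = osc s k" using ci by (simp add: ker_def s_def)
      moreover have "?e y * exp (- of_int s * \<i> * of_nat k * of_real (x $ i - y $ i)) = 1"
        unfolding exp_add[symmetric] by (simp add: l_def mult_ac)
      ultimately show ?thesis by (simp add: entire_kernel_def osc_amp_def mult.assoc[symmetric])
    qed
    finally show ?thesis by (simp only: vU mult.assoc)
  qed
  define Iv where "Iv = integral UNIV (\<lambda>y. ?e y * U 0 y)"
  have "pconv (entire_kernel (ker k c) \<alpha>) v x = Iv"
    unfolding pconv_def integrand Iv_def ..
  then have md: "mderiv \<alpha> (smoothed k c v) x = Iv"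
    using mderiv_pconv[where \<tau> = "ker k c" and a = a and b = b and \<alpha> = \<alpha>, OF h(1) v_c v_0] by simp
  let ?T = "exp 14 * exp 6 ^ j * ((exp 8 * real k) ^ CARD('d) * (exp 7 * real (max k (mabs \<alpha>))) ^ mabs \<alpha> * (exp (R\<^sup>2 / 2) * gauss_weight x))"
  let ?S = "\<Sum>s\<le>j. real (j choose s) * ((3 * C0 * sqrt (real j * real k)) ^ s * N (j - s))"
  have T0: "0 \<le> ?T" by (simp add: gauss_weight_def)
  have H_b: "cmod (H t y) \<le> ?T * sqrt (real j * real k) ^ t" if t: "t \<le> j" and y: "y \<in> cbox a b" for t y
  proof -
    let ?g = "\<lambda>m. (exp 8 * real k) * (exp 7 * real (max k (\<alpha> m))) ^ \<alpha> m * exp (- real k * (x $ m - y $ m)\<^sup>2 / 2)"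
    have g0: "0 \<le> ?g m" for m by simp
    have Rest_b: "cmod (Rest y) \<le> (\<Prod>m\<in>UNIV - {i}. ?g m)"
      unfolding Rest_def prod_norm[symmetric] entire_kernel_def
    proof (intro prod_mono conjI norm_ge_zero)
      fix m
      show "cmod ((deriv ^^ \<alpha> m) (ker k c m) (of_real (x $ m - y $ m))) \<le> ?g m"
        by (rule ker_deriv_bound_max[of k c m, OF k c])
    qed
    \<comment> \<open>A factor of at least 1 is inserted for the coordinate i, so that
      \<open>ker_factor_prod_bound\<close> applies to the full product.\<close>
    have kk: "1 \<le> exp 8 * real k" using k mult_mono[of 1 "exp 8" 1 "real k"] by simp
    have "cmod ((deriv ^^ t) (osc_amp s k (\<alpha> i)) (of_real (x $ i - y $ i))) \<le>
       exp 14 * exp 6 ^ j * sqrt (real j * real k) ^ t * (exp 7 * real (max k (\<alpha> i))) ^ \<alpha> i * exp (- real k * (x $ i - y $ i)\<^sup>2 / 2)"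
      by (rule osc_amp_deriv_bound_max[OF k s j t])
    also have "\<dots> = (exp 14 * exp 6 ^ j * sqrt (real j * real k) ^ t) * (1 * (exp 7 * real (max k (\<alpha> i))) ^ \<alpha> i * exp (- real k * (x $ i - y $ i)\<^sup>2 / 2))"
      by (simp add: mult.assoc)
    also have "\<dots> \<le> (exp 14 * exp 6 ^ j * sqrt (real j * real k) ^ t) * ?g i"
      using kk by (intro mult_left_mono mult_right_mono) auto
    finally have amp_b: "cmod ((deriv ^^ t) (osc_amp s k (\<alpha> i)) (of_real (x $ i - y $ i))) \<le> (exp 14 * exp 6 ^ j * sqrt (real j * real k) ^ t) * ?g i" .
    have "cmod (H t y) = cmod ((deriv ^^ t) (osc_amp s k (\<alpha> i)) (of_real (x $ i - y $ i))) * cmod (Rest y)"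
      by (simp add: H_def norm_mult norm_power)
    also have "\<dots> \<le> ((exp 14 * exp 6 ^ j * sqrt (real j * real k) ^ t) * ?g i) * (\<Prod>m\<in>UNIV - {i}. ?g m)"
      by (intro mult_mono amp_b Rest_b) auto
    also have "\<dots> = (exp 14 * exp 6 ^ j * sqrt (real j * real k) ^ t) * (\<Prod>m\<in>UNIV. ?g m)"
      by (subst prod.remove[of UNIV i]) (simp_all only: finite UNIV_I mult.assoc)
    also have "\<dots> \<le> (exp 14 * exp 6 ^ j * sqrt (real j * real k) ^ t) * ((exp 8 * real k) ^ CARD('d) * (exp 7 * real (max k (mabs \<alpha>))) ^ mabs \<alpha> * exp (- real k * (norm (x - y))\<^sup>2 / 2))"
      by (intro mult_left_mono ker_factor_prod_bound) auto
    also have "\<dots> \<le> (exp 14 * exp 6 ^ j * sqrt (real j * real k) ^ t) * ((exp 8 * real k) ^ CARD('d) * (exp 7 * real (max k (mabs \<alpha>))) ^ mabs \<alpha> * (exp (R\<^sup>2 / 2) * gauss_weight x))"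
      by (intro mult_left_mono gauss_translate_bound[OF k R[OF y]]) auto
    finally show ?thesis by (simp only: mult_ac)
  qed
  have P_b: "cmod (P t y) \<le> ?T * Q * (3 * C0 * sqrt (real j * real k)) ^ t" if t: "t \<le> j" and y: "y \<in> cbox a b" for t y
  proof -
    have "cmod (P t y) \<le> ?T * Q * (sqrt (real j * real k) + C0 * real (Suc j)) ^ t"
      unfolding P_def by (rule leib_bound_geometric) (use H_b[OF _ y] Xb t in auto)
    also have "\<dots> \<le> ?T * Q * (3 * C0 * sqrt (real j * real k)) ^ t"
    \<comment> \<open>For \<open>1 \<le> j \<le> k\<close> the base \<open>Suc j\<close> of the
      cutoff bounds is at most \<open>2 * sqrt (j k)\<close>; for \<open>j = 0\<close> only
      \<open>t = 0\<close> occurs.\<close>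
    proof (cases "j = 0")
      case False
      have "real j * real j \<le> real j * real k" using j by (intro mult_left_mono) auto
      then have "real j \<le> sqrt (real j * real k)" by (intro real_le_rsqrt) (simp add: power2_eq_square)
      then have "real (Suc j) \<le> 2 * sqrt (real j * real k)" using False by simp
      then have "C0 * real (Suc j) \<le> C0 * (2 * sqrt (real j * real k))" using C0 by (intro mult_left_mono) auto
      moreover have "1 * sqrt (real j * real k) \<le> C0 * sqrt (real j * real k)" using C0 by (intro mult_right_mono) auto
      ultimately have "sqrt (real j * real k) + C0 * real (Suc j) \<le> 3 * C0 * sqrt (real j * real k)" by simp
      then show ?thesis using T0 Q C0 by (intro mult_left_mono power_mono mult_nonneg_nonneg add_nonneg_nonneg) (auto simp: gauss_weight_def)
    qed (use t in simp)
    finally show ?thesis .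
  qed
  have U_b: "cmod (U j y) \<le> ?T * Q * B * ?S" for y
  proof (cases "y \<in> D")
    case True
    have "cmod (U j y) \<le> (\<Sum>s\<le>j. real (j choose s) * ((?T * Q * (3 * C0 * sqrt (real j * real k)) ^ s) * (B * N (j - s))))"
      unfolding U_def by (rule leib_bound) (use P_b \<phi>b[OF True] True D(2) in \<open>auto simp: \<Phi>_def\<close>)
    also have "\<dots> = ?T * Q * B * ?S" by (simp add: sum_distrib_left mult_ac)
    finally show ?thesis .
  next
    case False
    have "0 \<le> ?S" using N C0 by (intro sum_nonneg) auto
    then have "0 \<le> ?T * Q * B * ?S" using T0 Q B by (intro mult_nonneg_nonneg) (auto simp: gauss_weight_def)
    then show ?thesis using U_0[OF order_refl False] by simp
  qed
  have S0: "0 \<le> ?T * Q * B * ?S" using U_b[of 0] norm_ge_zero order_trans by blast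
  have "(\<i> * of_real l) ^ j * Iv = integral UNIV (\<lambda>y. ?e y * U j y)"
    unfolding Iv_def by (rule oscillatory_integral_by_parts[OF U_d U_c U_cb l(1) order_refl])
  then have "real k ^ j * cmod Iv = cmod (integral UNIV (\<lambda>y. ?e y * U j y))"
    using l(2) by (metis norm_ii norm_mult norm_of_real norm_power mult_1)
  also have "integral UNIV (\<lambda>y. ?e y * U j y) = integral (cbox a b) (\<lambda>y. ?e y * U j y)"
    by (rule integral_UNIV_eq_cbox) (simp add: U_cb)
  also have "cmod (integral (cbox a b) (\<lambda>y. ?e y * U j y)) \<le> (?T * Q * B * ?S) * measure lborel (cbox a b)"
  proof (rule has_integral_bound[OF S0 integrable_integral])
    have "continuous_on (cbox a b) ?e" by (intro continuous_intros)
    then show "(\<lambda>y. ?e y * U j y) integrable_on cbox a b"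
      by (intro integrable_continuous continuous_on_mult continuous_on_subset[OF U_c[OF order_refl]]) auto
    show "cmod (?e y * U j y) \<le> ?T * Q * B * ?S" for y using U_b[of y] by (simp add: norm_mult norm_exp_eq_Re)
  qed
  finally have "cmod Iv \<le> (?T * Q * B * ?S) * measure lborel (cbox a b) / real k ^ j"
    using k by (simp add: pos_le_divide_eq mult.commute)
  also have "\<dots> = measure lborel (cbox a b) * exp (R\<^sup>2 / 2) * exp 14 * (exp 8 * real k) ^ CARD('d) * Q * B *
     (exp 6 ^ j * ?S / real k ^ j) * (exp 7 * real (max k (mabs \<alpha>))) ^ mabs \<alpha> * gauss_weight x"
    by (simp only: divide_inverse mult_ac)
  finally show ?thesis unfolding md[symmetric] v_def .
qed

text \<open>One term of the exponential series, of degree \<open>p + 2\<close>.\<close>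

lemma power_exp_decay:
  assumes \<epsilon>: "\<epsilon> > (0::real)"
  shows "\<exists>C\<ge>0. \<forall>k\<ge>(1::nat). real k ^ p * exp (- \<epsilon> * real k) \<le> C / (real k)\<^sup>2"
proof -
  define q where "q = p + 2"
  define F where "F = (fact q :: real)"
  have F: "F > 0" by (simp add: F_def)
  have \<epsilon>q: "\<epsilon> ^ q > 0" using \<epsilon> by simp
  have "real k ^ p * exp (- \<epsilon> * real k) \<le> (F / \<epsilon> ^ q) / (real k)\<^sup>2" if k: "k \<ge> 1" for k :: nat
  proof -
    have "(\<Sum>i\<in>{q}. inverse (fact i) *\<^sub>R (\<epsilon> * real k) ^ i) \<le> exp (\<epsilon> * real k)"
      unfolding exp_def by (rule sum_le_suminf[OF summable_exp_generic]) (use \<epsilon> in auto)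
    then have "\<epsilon> ^ q * real k ^ q \<le> exp (\<epsilon> * real k) * F"
      using F by (simp add: F_def[symmetric] divide_simps power_mult_distrib mult_ac)
    then have "real k ^ q \<le> exp (\<epsilon> * real k) * (F / \<epsilon> ^ q)" using \<epsilon>q by (simp add: pos_le_divide_eq mult_ac)
    then have "real k ^ q * exp (- \<epsilon> * real k) \<le> exp (\<epsilon> * real k) * (F / \<epsilon> ^ q) * exp (- \<epsilon> * real k)"
      by (rule mult_right_mono) simp
    also have "\<dots> = F / \<epsilon> ^ q" by (simp add: exp_minus)
    finally have "(real k ^ p * exp (- \<epsilon> * real k)) * (real k)\<^sup>2 \<le> F / \<epsilon> ^ q" by (simp add: q_def power_add power2_eq_square mult_ac)
    moreover have "(real k)\<^sup>2 > 0" using k by simp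
    ultimately show ?thesis by (simp only: pos_le_divide_eq)
  qed
  moreover have "F / \<epsilon> ^ q \<ge> 0" using F \<epsilon>q by simp
  ultimately show ?thesis by blast
qed

section \<open>Families of cutoffs and the two bounds for an increment\<close>

type_synonym 'd cutoff_family = "nat \<Rightarrow> 'd \<Rightarrow> nat \<Rightarrow> (real, 'd) vec \<Rightarrow> complex"

text \<open>\<open>X j i t\<close> is the \<open>t\<close>-th derivative in direction \<open>i\<close> of the \<open>j\<close>-th cutoff; only \<open>t \<le> j\<close> is meaningful.\<close>

definition cutoffs :: "(real^'d::finite) set \<Rightarrow> (real^'d) set \<Rightarrow> real \<Rightarrow> real \<Rightarrow> 'd cutoff_family \<Rightarrow> bool" where
  "cutoffs K D \<eta> C X \<longleftrightarrow> \<eta> > 0 \<and> C \<ge> 1 \<and> compact D \<and> (\<forall>j i.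
    (\<forall>t\<le>j. continuous_on UNIV (X j i t) \<and> (\<forall>y. y \<notin> D \<longrightarrow> X j i t y = 0) \<and>
        (\<forall>y. cmod (X j i t y) \<le> C * real (Suc j) ^ CARD('d) * (C * real (Suc j)) ^ t)) \<and>
    dirseq i j (X j i) \<and>
    (\<forall>i'. X j i 0 = X j i' (0::nat)) \<and> (\<forall>x\<in>K. \<forall>y. dist x y < \<eta> \<longrightarrow> X j i 0 y = (1::complex)))"

text \<open>The undifferentiated cutoff does not depend on the direction, by
  \<open>cutoffs_index\<close>, so an arbitrary one is named.\<close>

abbreviation cut :: "('d::finite) cutoff_family \<Rightarrow> nat \<Rightarrow> real^'d \<Rightarrow> complex" where
  "cut X j \<equiv> X j undefined 0"

lemma cutoffs_exist:
  fixes K :: "(real^'d::finite) set"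
  assumes "compact K" "open \<Omega>" "K \<subseteq> \<Omega>"
  shows "\<exists>\<eta> D C X. D \<subseteq> \<Omega> \<and> cutoffs K D \<eta> C X"
proof -
  from cutoff_sequence[OF assms] obtain \<eta> D C and X :: "'d cutoff_family" where
    "\<eta> > 0" "C \<ge> 1" "compact D" "D \<subseteq> \<Omega>" "(\<forall>j i.
    (\<forall>t\<le>j. continuous_on UNIV (X j i t) \<and> (\<forall>y. y \<notin> D \<longrightarrow> X j i t y = 0) \<and>
        (\<forall>y. cmod (X j i t y) \<le> C * real (Suc j) ^ CARD('d) * (C * real (Suc j)) ^ t)) \<and>
    (\<forall>t<j. \<forall>y. ((\<lambda>r. X j i t (y + r *\<^sub>R axis i 1)) has_vector_derivative X j i (Suc t) y) (at 0)) \<and>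
    (\<forall>i'. X j i 0 = X j i' (0::nat)) \<and> (\<forall>x\<in>K. \<forall>y. dist x y < \<eta> \<longrightarrow> X j i 0 y = (1::complex)))"
    by (elim exE conjE)
  then have "cutoffs K D \<eta> C X" unfolding cutoffs_def dirseq_def by (intro conjI)
  then show ?thesis using \<open>D \<subseteq> \<Omega>\<close> by blast
qed

lemma
  fixes X :: "('d::finite) cutoff_family"
  assumes X: "cutoffs K D \<eta> C X"
  shows cutoffs_pos: "\<eta> > 0" "C \<ge> 1" "compact D"
    and cutoffs_continuous: "t \<le> j \<Longrightarrow> continuous_on UNIV (X j i t)"
    and cutoffs_zero: "t \<le> j \<Longrightarrow> y \<notin> D \<Longrightarrow> X j i t y = 0"
    and cutoffs_bound: "t \<le> j \<Longrightarrow> cmod (X j i t y) \<le> C * real (Suc j) ^ CARD('d) * (C * real (Suc j)) ^ t"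
    and cutoffs_dirseq: "dirseq i j (X j i)"
    and cutoffs_index: "X j i 0 = X j i' 0"
    and cutoffs_one: "x \<in> K \<Longrightarrow> dist x y < \<eta> \<Longrightarrow> X j i 0 y = 1"
  using X unfolding cutoffs_def by (elim conjE; simp)+

lemma cut_bound:
  fixes X :: "('d::finite) cutoff_family"
  assumes X: "cutoffs K D \<eta> C X" and j: "j \<le> k" "k \<ge> 1"
  shows "cmod (cut X j y) \<le> C * 2 ^ CARD('d) * real k ^ CARD('d)"
proof -
  have "cmod (cut X j y) \<le> C * real (Suc j) ^ CARD('d)" using cutoffs_bound[OF X, of 0 j undefined y] by simp
  also have "\<dots> \<le> C * (2 * real k) ^ CARD('d)"
    using j cutoffs_pos(2)[OF X] by (intro mult_left_mono power_mono) auto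
  finally show ?thesis by (simp add: power_mult_distrib mult.assoc)
qed

text \<open>\<phi> is controlled on W only, but the product vanishes on the open set
  \<open>- D\<close>, and the two open sets cover the space.\<close>

lemma continuous_on_cutoff_mult:
  fixes \<phi> u :: "real^'d::finite \<Rightarrow> complex"
  assumes "compact D" "open W" "D \<subseteq> W" "continuous_on W \<phi>" "continuous_on UNIV u" "\<And>y. y \<notin> D \<Longrightarrow> u y = 0"
  shows "continuous_on UNIV (\<lambda>y. u y * \<phi> y)"
proof -
  have "continuous_on W (\<lambda>y. u y * \<phi> y)"
    by (intro continuous_intros assms continuous_on_subset[OF assms(5)]) auto
  moreover have "continuous_on (- D) (\<lambda>y. u y * \<phi> y)"
    using assms(6) by (subst continuous_on_cong[OF refl, of _ _ "\<lambda>_. 0"]) auto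
  moreover have "open (- D)" using assms(1) by (simp add: compact_imp_closed open_Compl)
  ultimately have "continuous_on (W \<union> - D) (\<lambda>y. u y * \<phi> y)" using assms(2) by (intro continuous_on_open_Un)
  moreover have "W \<union> - D = UNIV" using assms(3) by blast
  ultimately show ?thesis by simp
qed

lemma compact_subset_cbox: "compact (D :: (real^'d::finite) set) \<Longrightarrow> \<exists>a b. D \<subseteq> cbox a b"
  using bounded_subset_cbox_symmetric[OF compact_imp_bounded] by blast

text \<open>The estimate for the part of an increment with the j-th cutoff: the denominator gives
  summability over k, the Gaussian weight integrability over x.\<close>

abbreviation osc_bounded :: "(real \<Rightarrow> real) \<Rightarrow> nat \<Rightarrow> nat \<Rightarrow> (real^'d::finite) set \<Rightarrow> 'd cutoff_family \<Rightarrow> real \<Rightarrow> nat \<Rightarrow> nat \<Rightarrow> bool" where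
  "osc_bounded \<omega> m n D X C k j \<equiv> \<forall>c \<phi> B W \<alpha> x.
     (\<forall>i. c i \<in> {-1, 0, 1}) \<and> c \<noteq> (\<lambda>_. 0) \<and> open W \<and> D \<subseteq> W \<and> smooth_on W \<phi> \<and> 0 \<le> B \<and> deriv_bounded \<omega> m D B \<phi> \<longrightarrow>
     cmod (mderiv \<alpha> (smoothed k c (\<lambda>y. cut X j y * \<phi> y)) x) \<le> (C * B / (real k)\<^sup>2) * Mw \<omega> n (mabs \<alpha>) * gauss_weight x"

text \<open>The estimate for the part that vanishes near K. Growth like
  \<open>real k ^ CARD('d)\<close> is allowed because cutoffs of order \<open>j \<le> k\<close> are
  bounded only by such a power.\<close>

abbreviation far_bounded :: "real^'d::finite \<Rightarrow> real^'d \<Rightarrow> (real^'d) set \<Rightarrow> real \<Rightarrow> nat \<Rightarrow> real \<Rightarrow> nat \<Rightarrow> bool" where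
  "far_bounded a b K \<eta> n C k \<equiv> \<forall>c v V x \<alpha>. (\<forall>i. c i \<in> {-1, 0, 1}) \<and> continuous_on UNIV v \<and> (\<forall>y. y \<notin> cbox a b \<longrightarrow> v y = 0)
     \<and> (\<forall>y. cmod (v y) \<le> V * real k ^ CARD('d)) \<and> (\<forall>z\<in>K. \<forall>y. dist z y < \<eta> \<longrightarrow> v y = 0) \<and> x \<in> (\<Union>z\<in>K. ball z (\<eta> / 2))
     \<longrightarrow> cmod (mderiv \<alpha> (smoothed k c v) x) \<le> (C * V / (real k)\<^sup>2) * Mw omega1 n (mabs \<alpha>)"

text \<open>The index n is chosen after m: \<open>max_power_Mw\<close> needs it large to absorb the
  derivatives of the kernel, and \<open>decay_estimate\<close> to absorb the exponential that this
  costs. The order j may vary with k.\<close>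

lemma osc_increment_bound:
  fixes X :: "('d::finite) cutoff_family"
  assumes w: "weight_function \<omega>" and m: "m \<ge> 1" and X: "cutoffs K D \<eta> C0 X"
  shows "\<exists>n\<ge>1. \<exists>C\<ge>0. \<exists>k0\<ge>1. \<forall>k\<ge>k0. \<exists>j\<le>k. osc_bounded \<omega> m n D X C k j"
proof -
  let ?d = "CARD('d)"
  note C0 = cutoffs_pos(2)[OF X]
  obtain a b where ab: "D \<subseteq> cbox a b" using compact_subset_cbox[OF cutoffs_pos(3)[OF X]] by blast
  obtain R where R: "\<And>y. y \<in> cbox a b \<Longrightarrow> norm y \<le> R" using cbox_norm_bound[of a b] by blast
  define A where "A = max (exp 6) (3 * C0)"
  have A: "A \<ge> 1" "exp 6 \<le> A" "3 * C0 \<le> A" using C0 by (auto simp: A_def)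
  obtain Co E k0 where o: "Co \<ge> 1" "E \<ge> 1" "k0 \<ge> 1" "\<And>k. k \<ge> k0 \<Longrightarrow> real k / E > 1 \<and> (\<exists>j\<le>k.
     A ^ j * (\<Sum>s\<le>j. real (j choose s) * ((A * sqrt (real j * real k)) ^ s * Mw \<omega> m (j - s))) / real k ^ j
       \<le> Co * sqrt (real k / E * exp (- \<omega> (real k / E) / real m)))"
    using order_estimate[OF w m A(1)] by (elim exE conjE) blast
  obtain C1 n1 where n1: "C1 \<ge> 1" "n1 \<ge> 1" "\<And>n k l. n \<ge> n1 \<Longrightarrow> k \<ge> 1 \<Longrightarrow> (exp 7 * real (max k l)) ^ l \<le> C1 * Mw \<omega> n l * exp (\<omega> (exp 7 * real k) / real n)"
    using max_power_Mw[OF w, of "exp 7"] by auto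
  \<comment> \<open>Of the power \<open>2 * ?d\<close> one half comes from the kernel factors and
    one half from the size of the cutoffs.\<close>
  obtain n2 where n2: "n2 \<ge> 1" "\<And>n. n \<ge> n2 \<Longrightarrow> \<exists>C\<ge>0. \<forall>k\<ge>1. real k / E > 1 \<longrightarrow>
     real k ^ (2 * ?d) * sqrt (real k / E * exp (- \<omega> (real k / E) / real m)) * exp (\<omega> (exp 7 * real k) / real n) \<le> C / (real k)\<^sup>2"
    using decay_estimate[OF w m o(2), of "exp 7" "2 * ?d"] by auto
  define n where "n = max n1 n2"
  have n: "n \<ge> n1" "n \<ge> n2" "n \<ge> 1" using n1 by (auto simp: n_def)
  obtain C2 where C2: "C2 \<ge> 0" "\<And>k. k \<ge> 1 \<Longrightarrow> real k / E > 1 \<Longrightarrow>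
     real k ^ (2 * ?d) * sqrt (real k / E * exp (- \<omega> (real k / E) / real m)) * exp (\<omega> (exp 7 * real k) / real n) \<le> C2 / (real k)\<^sup>2"
    using n2(2)[OF n(2)] by (elim exE conjE) blast
  define P where "P = measure lborel (cbox a b) * exp (R\<^sup>2 / 2) * exp 14 * exp 8 ^ ?d"
  have P: "P \<ge> 0" by (simp add: P_def)
  define P' where "P' = P * (C0 * 2 ^ ?d) * Co * C1"
  have P': "P' \<ge> 0" using P C0 o(1) n1(1) by (simp add: P'_def)
  have "\<exists>j\<le>k. osc_bounded \<omega> m n D X (P' * C2) k j"
    if kk: "k \<ge> k0" for k
  proof -
    have k: "k \<ge> 1" "real k / E > 1" using o(3,4) kk by auto
    define Z where "Z = sqrt (real k / E * exp (- \<omega> (real k / E) / real m))"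
    have Z: "Z \<ge> 0" using o(2) by (simp add: Z_def)
    obtain j where j: "j \<le> k" and jb: "A ^ j * (\<Sum>s\<le>j. real (j choose s) * ((A * sqrt (real j * real k)) ^ s * Mw \<omega> m (j - s))) / real k ^ j \<le> Co * Z"
      using o(4)[OF kk] unfolding Z_def by (elim exE conjE)
    have sb: "exp 6 ^ j * (\<Sum>s\<le>j. real (j choose s) * ((3 * C0 * sqrt (real j * real k)) ^ s * Mw \<omega> m (j - s))) / real k ^ j \<le> Co * Z"
    proof -
      have "exp 6 ^ j * (\<Sum>s\<le>j. real (j choose s) * ((3 * C0 * sqrt (real j * real k)) ^ s * Mw \<omega> m (j - s))) \<le>
         A ^ j * (\<Sum>s\<le>j. real (j choose s) * ((A * sqrt (real j * real k)) ^ s * Mw \<omega> m (j - s)))"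
        using A C0 by (intro mult_mono power_mono sum_mono mult_left_mono mult_right_mono sum_nonneg mult_nonneg_nonneg) auto
      then have "exp 6 ^ j * (\<Sum>s\<le>j. real (j choose s) * ((3 * C0 * sqrt (real j * real k)) ^ s * Mw \<omega> m (j - s))) / real k ^ j \<le>
         A ^ j * (\<Sum>s\<le>j. real (j choose s) * ((A * sqrt (real j * real k)) ^ s * Mw \<omega> m (j - s))) / real k ^ j"
        by (rule divide_right_mono) simp
      then show ?thesis using jb by simp
    qed
    have "cmod (mderiv \<alpha> (smoothed k c (\<lambda>y. cut X j y * \<phi> y)) x) \<le> (P' * C2 * B / (real k)\<^sup>2) * Mw \<omega> n (mabs \<alpha>) * gauss_weight x"
      if c: "\<forall>i. c i \<in> {-1, 0, 1}" "c \<noteq> (\<lambda>_. 0)" and W: "open W" "D \<subseteq> W" "smooth_on W \<phi>" and B: "0 \<le> B"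
        and \<phi>: "deriv_bounded \<omega> m D B \<phi>" for c \<phi> B W \<alpha> x
    proof -
      obtain i where i: "c i \<noteq> 0" using c(2) by (auto simp: fun_eq_iff)
      define Q where "Q = C0 * real (Suc j) ^ ?d"
      have Q: "0 \<le> Q" "Q \<le> C0 * 2 ^ ?d * real k ^ ?d"
      proof -
        show "0 \<le> Q" using C0 by (simp add: Q_def)
        have "Q \<le> C0 * (2 * real k) ^ ?d" unfolding Q_def using j k(1) C0 by (intro mult_left_mono power_mono) auto
        then show "Q \<le> C0 * 2 ^ ?d * real k ^ ?d" by (simp add: power_mult_distrib mult.assoc)
      qed
      have pb: "cmod (foldr partial_deriv (replicate t i) \<phi> y) \<le> B * Mw \<omega> m t" if "y \<in> D" for t y
        using \<phi>[rule_format, OF that, of "\<lambda>l. if l = i then t else 0"] unfolding mderiv_single mabs_single by simp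
      define S where "S = exp 6 ^ j * (\<Sum>s\<le>j. real (j choose s) * ((3 * C0 * sqrt (real j * real k)) ^ s * Mw \<omega> m (j - s))) / real k ^ j"
      define E7 where "E7 = (exp 7 * real (max k (mabs \<alpha>))) ^ mabs \<alpha>"
      define e where "e = exp (\<omega> (exp 7 * real k) / real n)"
      have S: "0 \<le> S" "S \<le> Co * Z" using sb C0 unfolding S_def by (auto intro!: divide_nonneg_nonneg mult_nonneg_nonneg sum_nonneg)
      have E7: "0 \<le> E7" "E7 \<le> C1 * Mw \<omega> n (mabs \<alpha>) * e"
        using n1(3)[OF n(1) k(1), of "mabs \<alpha>"] by (auto simp: E7_def e_def)
      have G: "0 \<le> gauss_weight x" by (simp add: gauss_weight_def)
      have "cmod (mderiv \<alpha> (smoothed k c (\<lambda>y. X j i 0 y * \<phi> y)) x) \<le>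
        measure lborel (cbox a b) * exp (R\<^sup>2 / 2) * exp 14 * (exp 8 * real k) ^ CARD('d) * Q * B * S * E7 * gauss_weight x"
        unfolding S_def E7_def
      proof (rule smoothed_osc_bound[where k = k and c = c and i = i and X = "X j i" and N = "Mw \<omega> m" and W = W and D = D and \<phi> = \<phi> and a = a and b = b and R = R and Q = Q, OF k(1) _ i j W cutoffs_pos(3)[OF X] ab _ _ _ C0 cutoffs_dirseq[OF X] pb _ B R])
        show "cmod (X j i t y) \<le> Q * (C0 * real (Suc j)) ^ t" if "t \<le> j" for t y
          using cutoffs_bound[OF X that, of i y] by (simp add: Q_def)
      qed (use c cutoffs_continuous[OF X] cutoffs_zero[OF X] in auto)
      also have "\<dots> = (P * real k ^ ?d * B * gauss_weight x) * (Q * (S * E7))"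
        by (simp add: P_def power_mult_distrib mult_ac)
      also have "\<dots> \<le> (P * real k ^ ?d * B * gauss_weight x) * ((C0 * 2 ^ ?d * real k ^ ?d) * ((Co * Z) * (C1 * Mw \<omega> n (mabs \<alpha>) * e)))"
        using P B G Q S E7 Z C0 o(1) by (intro mult_left_mono mult_mono mult_nonneg_nonneg) auto
      also have "\<dots> = (P' * B * Mw \<omega> n (mabs \<alpha>) * gauss_weight x) * (real k ^ (2 * ?d) * Z * e)"
        unfolding mult_2 power_add P'_def by (simp only: mult_ac)
      also have "\<dots> \<le> (P' * B * Mw \<omega> n (mabs \<alpha>) * gauss_weight x) * (C2 / (real k)\<^sup>2)"
        using C2(2)[OF k] P' B G by (intro mult_left_mono mult_nonneg_nonneg) (auto simp: Z_def e_def)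
      finally show ?thesis using cutoffs_index[OF X, of j i undefined] by (simp add: mult_ac)
    qed
    then show ?thesis using j by (intro exI[of _ j]) blast
  qed
  moreover have "P' * C2 \<ge> 0" using P' C2(1) by simp
  ultimately show ?thesis using n(3) o(3) by blast
qed

text \<open>Points within \<open>\<eta> / 2\<close> of K keep distance \<open>\<eta> / 2\<close>
  from the support of v, and the exponential decay swallows both powers of k.\<close>

lemma smoothed_far_from_bound:
  fixes a b :: "real^'d::finite"
  assumes \<eta>: "\<eta> > 0"
  shows "\<exists>n\<ge>1. \<exists>C\<ge>0. \<forall>k\<ge>1. far_bounded a b K \<eta> n C k"
proof -
  let ?d = "CARD('d)"
  have "\<eta> / 2 > 0" using \<eta> by simp
  from smoothed_far_bound[OF this, of a b] obtain n C \<epsilon> where *: "n \<ge> 1" "C \<ge> 0" "\<epsilon> > 0"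
    "\<And>k. k\<ge>1 \<Longrightarrow> \<forall>c v V x \<alpha>. (\<forall>i. c i \<in> {-1, 0, 1}) \<and> continuous_on UNIV v \<and> (\<forall>y. y \<notin> cbox a b \<longrightarrow> v y = 0) \<and> (\<forall>y. cmod (v y) \<le> V)
     \<and> (\<forall>y. v y \<noteq> 0 \<longrightarrow> \<eta> / 2 \<le> dist x y)
     \<longrightarrow> cmod (mderiv \<alpha> (smoothed k c v) x) \<le> (C * V * real k ^ ?d * exp (- \<epsilon> * real k)) * Mw omega1 n (mabs \<alpha>)"
    by (elim exE conjE) blast
  obtain C' where C': "C' \<ge> 0" "\<And>k. k \<ge> 1 \<Longrightarrow> real k ^ (2 * ?d) * exp (- \<epsilon> * real k) \<le> C' / (real k)\<^sup>2"
    using power_exp_decay[OF *(3)] by blast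
  have "cmod (mderiv \<alpha> (smoothed k c v) x) \<le> (C * C' * V / (real k)\<^sup>2) * Mw omega1 n (mabs \<alpha>)"
    if k: "k \<ge> 1" and v: "(\<forall>i. c i \<in> {-1, 0, 1})" "continuous_on UNIV v" "(\<forall>y. y \<notin> cbox a b \<longrightarrow> v y = 0)"
      "\<forall>y. cmod (v y) \<le> V * real k ^ ?d" and far: "\<forall>z\<in>K. \<forall>y. dist z y < \<eta> \<longrightarrow> v y = 0" and x: "x \<in> (\<Union>z\<in>K. ball z (\<eta> / 2))" for k c v V x \<alpha>
  proof -
    obtain z where z: "z \<in> K" "dist z x < \<eta> / 2" using x by auto
    have d: "\<forall>y. v y \<noteq> 0 \<longrightarrow> \<eta> / 2 \<le> dist x y"
    proof (intro allI impI)
      fix y assume "v y \<noteq> 0"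
      then have "\<eta> \<le> dist z y" using far z(1) by force
      also have "\<dots> \<le> dist z x + dist x y" by (rule dist_triangle)
      finally show "\<eta> / 2 \<le> dist x y" using z(2) by simp
    qed
    have "0 \<le> V * real k ^ ?d" using v(4) norm_ge_zero order_trans by blast
    moreover have "real k ^ ?d > 0" using k by simp
    ultimately have V: "0 \<le> V" by (simp only: zero_le_mult_iff) linarith
    have "cmod (mderiv \<alpha> (smoothed k c v) x) \<le> (C * (V * real k ^ ?d) * real k ^ ?d * exp (- \<epsilon> * real k)) * Mw omega1 n (mabs \<alpha>)"
      using *(4)[OF k] v d by blast
    also have "\<dots> = (C * V * Mw omega1 n (mabs \<alpha>)) * (real k ^ (2 * ?d) * exp (- \<epsilon> * real k))"
      unfolding mult_2 power_add by (simp only: mult_ac)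
    also have "\<dots> \<le> (C * V * Mw omega1 n (mabs \<alpha>)) * (C' / (real k)\<^sup>2)"
      using C'(2)[OF k] *(2) V by (intro mult_left_mono) auto
    finally show ?thesis by (simp add: mult_ac)
  qed
  moreover have "C * C' \<ge> 0" using *(2) C'(1) by simp
  ultimately show ?thesis using *(1) by (intro exI[of _ n] conjI exI[of _ "C * C'"]) blast+
qed

definition ternary :: "('d::finite \<Rightarrow> int) set" where
  "ternary = PiE UNIV (\<lambda>_. {-1, 0, 1})"

lemma ternary: "finite (ternary :: ('d::finite \<Rightarrow> int) set)" "c \<in> ternary \<longleftrightarrow> (\<forall>i. c i \<in> {-1, 0, 1})" "(\<lambda>_. 0) \<in> ternary"
  unfolding ternary_def by (auto intro!: finite_PiE)

lemma smoothed_integrable: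
  fixes v :: "real^'d::finite \<Rightarrow> complex"
  assumes v: "continuous_on UNIV v"
  shows "(\<lambda>y. (\<Prod>i\<in>UNIV. entire_kernel (ker k c) (\<lambda>_. 0) i (x $ i - y $ i)) * v y) integrable_on cbox a b"
  by (intro integrable_continuous continuous_on_kernel_snd continuous_on_entire_kernel ker_holomorphic v)

lemma smoothed_cbox:
  fixes v :: "real^'d::finite \<Rightarrow> complex"
  assumes "\<forall>y. y \<notin> cbox a b \<longrightarrow> v y = 0"
  shows "smoothed k c v x = integral (cbox a b) (\<lambda>y. (\<Prod>i\<in>UNIV. entire_kernel (ker k c) (\<lambda>_. 0) i (x $ i - y $ i)) * v y)"
  by (rule pconv_cbox) (use assms in blast)

lemma smoothed_add:
  fixes u v :: "real^'d::finite \<Rightarrow> complex"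
  assumes u: "continuous_on UNIV u" "\<forall>y. y \<notin> cbox a b \<longrightarrow> u y = 0" and v: "continuous_on UNIV v" "\<forall>y. y \<notin> cbox a b \<longrightarrow> v y = 0"
  shows "smoothed k c (\<lambda>y. u y + v y) x = smoothed k c u x + smoothed k c v x"
proof -
  have 0: "\<forall>y. y \<notin> cbox a b \<longrightarrow> u y + v y = 0" using u v by simp
  show ?thesis
    unfolding smoothed_cbox[OF u(2)] smoothed_cbox[OF v(2)] smoothed_cbox[OF 0] distrib_left
    by (rule integral_add) (intro smoothed_integrable u v)+
qed

lemma smoothed_cmult: "smoothed k c (\<lambda>y. r * v y) x = r * smoothed k c v x"
  unfolding pconv_def by (simp add: mult.left_commute flip: integral_mult_right)

text \<open>\<open>kap_Suc\<close> in every coordinate, with the product of the three-term sums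
  multiplied out.\<close>

lemma smoothed_Suc:
  fixes v :: "real^'d::finite \<Rightarrow> complex"
  assumes v: "continuous_on UNIV v" "\<forall>y. y \<notin> cbox a b \<longrightarrow> v y = 0"
  shows "smoothed (Suc k) (\<lambda>_. 0) v x = (\<Sum>c\<in>ternary. smoothed k c v x)"
proof -
  have "(\<Prod>i\<in>UNIV. entire_kernel (ker (Suc k) (\<lambda>_. 0)) (\<lambda>_. 0) i (x $ i - y $ i)) =
      (\<Sum>c\<in>ternary. \<Prod>i\<in>UNIV. entire_kernel (ker k c) (\<lambda>_. 0) i (x $ i - y $ i))" for y
  proof -
    let ?f = "\<lambda>i s. (if s = 0 then kap k else osc s k) (of_real (x $ i - y $ i))"
    have "entire_kernel (ker (Suc k) (\<lambda>_. 0)) (\<lambda>_. 0) i (x $ i - y $ i) = (\<Sum>s\<in>{-1, 0, 1}. ?f i s)" for i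
      by (simp add: entire_kernel_def ker_def kap_Suc)
    then have "(\<Prod>i\<in>UNIV. entire_kernel (ker (Suc k) (\<lambda>_. 0)) (\<lambda>_. 0) i (x $ i - y $ i)) = (\<Prod>i\<in>UNIV. \<Sum>s\<in>{-1, 0, 1}. ?f i s)" by simp
    also have "\<dots> = (\<Sum>c\<in>ternary. \<Prod>i\<in>UNIV. ?f i (c i))"
      unfolding ternary_def by (rule prod_sum_PiE) auto
    finally show ?thesis by (simp add: entire_kernel_def ker_def)
  qed
  then have "smoothed (Suc k) (\<lambda>_. 0) v x = integral (cbox a b) (\<lambda>y. \<Sum>c\<in>ternary. (\<Prod>i\<in>UNIV. entire_kernel (ker k c) (\<lambda>_. 0) i (x $ i - y $ i)) * v y)"
    unfolding smoothed_cbox[OF v(2)] by (simp add: sum_distrib_right)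
  also have "\<dots> = (\<Sum>c\<in>ternary. smoothed k c v x)"
    unfolding smoothed_cbox[OF v(2)] by (rule integral_sum) (intro ternary smoothed_integrable v)+
  finally show ?thesis .
qed

section \<open>The limit functional\<close>

text \<open>\<open>1 / l^2 \<le> 2 / l - 2 / (l + 1)\<close> makes the sum of the increments
  telescope.\<close>

lemma telescope_bound:
  fixes a :: "nat \<Rightarrow> 'a::real_normed_vector"
  assumes k: "k \<ge> 1" and a: "\<And>l. l \<ge> k \<Longrightarrow> norm (a (Suc l) - a l) \<le> c / (real l)\<^sup>2" and l: "l \<ge> k"
  shows "norm (a l - a k) \<le> 2 * c / real k"
proof -
  have "0 \<le> c / (real k)\<^sup>2" using a[of k] norm_ge_zero order_trans by blast
  moreover have "(real k)\<^sup>2 > 0" using k by simp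
  ultimately have c: "c \<ge> 0" by (simp only: zero_le_divide_iff) linarith
  have "norm (a l - a k) \<le> c * (2 / real k - 2 / real l)"
    using l
  proof (induction l rule: dec_induct)
    case (step l)
    have l1: "real l \<ge> 1" using k step by simp
    have "1 / (real l)\<^sup>2 \<le> 2 / real l - 2 / real (Suc l)"
    proof -
      have "2 / real l - 2 / real (Suc l) = 2 / (real l * (real l + 1))" using l1 by (simp add: field_simps)
      moreover have "real l * (real l + 1) \<le> 2 * (real l)\<^sup>2" using mult_left_mono[OF l1, of "real l"] l1 by (simp add: power2_eq_square algebra_simps)
      then have "2 / (2 * (real l)\<^sup>2) \<le> 2 / (real l * (real l + 1))" using l1 by (intro divide_left_mono) auto
      ultimately show ?thesis by simp
    qed
    then have "c * (1 / (real l)\<^sup>2) \<le> c * (2 / real l - 2 / real (Suc l))" using c by (rule mult_left_mono)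
    moreover have "norm (a (Suc l) - a k) \<le> norm (a (Suc l) - a l) + norm (a l - a k)"
      using norm_triangle_ineq[of "a (Suc l) - a l" "a l - a k"] by simp
    ultimately show ?case using a[of l] step by (simp add: algebra_simps)
  qed simp
  also have "\<dots> \<le> c * (2 / real k)" using c by (intro mult_left_mono) auto
  finally show ?thesis by (simp add: mult.commute)
qed

lemma telescope_convergent:
  fixes a :: "nat \<Rightarrow> 'a::banach"
  assumes k: "k \<ge> 1" and a: "\<And>l. l \<ge> k \<Longrightarrow> norm (a (Suc l) - a l) \<le> c / (real l)\<^sup>2"
  shows "convergent a" and "norm (lim a - a k) \<le> 2 * c / real k"
proof -
  have b: "norm (a l - a k') \<le> 2 * c / real k'" if "k' \<ge> k" "l \<ge> k'" for k' l
    by (rule telescope_bound[OF _ a that(2)]) (use k that in auto)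
  have "Cauchy a"
  proof (rule metric_CauchyI)
    fix e :: real assume e: "e > 0"
    obtain M :: nat where M: "real M > 4 * \<bar>c\<bar> / e" using reals_Archimedean2 by blast
    define N where "N = max k M"
    have N: "N \<ge> k" "N \<ge> 1" "real N > 4 * \<bar>c\<bar> / e" using k M by (auto simp: N_def)
    then have "4 * \<bar>c\<bar> / real N < e" using e by (simp add: field_simps)
    then have "2 * c / real N < e / 2" using e N(2) by (simp add: field_simps abs_if split: if_splits)
    then have h: "dist (a l) (a N) < e / 2" if "l \<ge> N" for l using b[OF N(1) that] by (simp add: dist_norm)
    have "dist (a l) (a l') < e" if "l \<ge> N" "l' \<ge> N" for l l'
      using dist_triangle_half_r[of "a N" "a l" e "a l'"] h[OF that(1)] h[OF that(2)] by (simp add: dist_commute)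
    then show "\<exists>M. \<forall>m\<ge>M. \<forall>n\<ge>M. dist (a m) (a n) < e" by blast
  qed
  then show conv: "convergent a" by (rule Cauchy_convergent)
  then have "(\<lambda>l. norm (a l - a k)) \<longlonglongrightarrow> norm (lim a - a k)"
    by (intro tendsto_intros) (simp add: convergent_LIMSEQ_iff)
  then show "norm (lim a - a k) \<le> 2 * c / real k"
    by (rule LIMSEQ_le_const2) (use b[of k] in blast)
qed

lemma mderiv_sum:
  fixes F :: "'c \<Rightarrow> real^'d::finite \<Rightarrow> complex"
  assumes "finite S" "\<And>c. c \<in> S \<Longrightarrow> smooth_on UNIV (F c)"
  shows "smooth_on UNIV (\<lambda>x. \<Sum>c\<in>S. F c x) \<and> mderiv \<alpha> (\<lambda>x. \<Sum>c\<in>S. F c x) x = (\<Sum>c\<in>S. mderiv \<alpha> (F c) x)"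
  using assms
proof (induction S rule: finite_induct)
  case empty
  then show ?case by (simp add: smooth_on_zero mderiv_zero)
next
  case (insert c S)
  then show ?case
    using mderiv_add[OF open_UNIV, of "F c" "\<lambda>x. \<Sum>c\<in>S. F c x" x \<alpha>] smooth_on_add[OF open_UNIV, of "F c" "\<lambda>x. \<Sum>c\<in>S. F c x"] by simp
qed

text \<open>The index 0 reproduces the previous approximation as a whole. The remaining kernels,
  each oscillating in some coordinate, are applied to the two parts separately.\<close>

lemma smoothed_Suc_split:
  fixes v u :: "real^'d::finite \<Rightarrow> complex"
  assumes v: "continuous_on UNIV v" "\<forall>y. y \<notin> cbox a b \<longrightarrow> v y = 0" and u: "continuous_on UNIV u" "\<forall>y. y \<notin> cbox a b \<longrightarrow> u y = 0"
  shows "smoothed (Suc k) (\<lambda>_. 0) (\<lambda>y. v y + u y) = (\<lambda>x. smoothed k (\<lambda>_. 0) (\<lambda>y. v y + u y) x +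
    (\<Sum>c\<in>ternary - {\<lambda>_. 0}. smoothed k c v x + smoothed k c u x))"
proof
  fix x
  have "continuous_on UNIV (\<lambda>y. v y + u y)" "\<forall>y. y \<notin> cbox a b \<longrightarrow> v y + u y = 0"
    using v u by (auto intro: continuous_intros)
  from smoothed_Suc[OF this] have "smoothed (Suc k) (\<lambda>_. 0) (\<lambda>y. v y + u y) x = (\<Sum>c\<in>ternary. smoothed k c (\<lambda>y. v y + u y) x)" .
  also have "\<dots> = smoothed k (\<lambda>_. 0) (\<lambda>y. v y + u y) x + (\<Sum>c\<in>ternary - {\<lambda>_. 0}. smoothed k c (\<lambda>y. v y + u y) x)"
    by (rule sum.remove[OF ternary(1) ternary(3)])
  also have "(\<Sum>c\<in>ternary - {\<lambda>_. 0}. smoothed k c (\<lambda>y. v y + u y) x) = (\<Sum>c\<in>ternary - {\<lambda>_. 0}. smoothed k c v x + smoothed k c u x)"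
    by (intro sum.cong refl smoothed_add[OF v u])
  finally show "smoothed (Suc k) (\<lambda>_. 0) (\<lambda>y. v y + u y) x = smoothed k (\<lambda>_. 0) (\<lambda>y. v y + u y) x +
    (\<Sum>c\<in>ternary - {\<lambda>_. 0}. smoothed k c v x + smoothed k c u x)" .
qed

text \<open>The data on a test function that all estimates use: smoothness near the support D of the
  cutoffs and derivative bounds on D. It covers functions on an open set and on the interior of a
  compact set alike.\<close>

definition admissible :: "(real \<Rightarrow> real) \<Rightarrow> nat \<Rightarrow> (real^'d::finite) set \<Rightarrow> (real^'d) set \<Rightarrow> real \<Rightarrow> (real^'d \<Rightarrow> complex) \<Rightarrow> bool" where
  "admissible \<omega> m D W B \<phi> \<longleftrightarrow> open W \<and> D \<subseteq> W \<and> smooth_on W \<phi> \<and> 0 \<le> B \<and> (deriv_bounded \<omega> m D B \<phi>)"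

lemma admissible_bound:
  fixes \<phi> :: "real^'d::finite \<Rightarrow> complex"
  assumes a: "admissible \<omega> m D W B \<phi>" "y \<in> D"
  shows "cmod (\<phi> y) \<le> B * Mw \<omega> m 0"
proof -
  have "mderiv (\<lambda>_. 0) \<phi> y = \<phi> y"
  proof -
    have "foldr (\<lambda>i. id) js \<phi> = \<phi>" for js :: "'d list" by (induction js) auto
    then show ?thesis by (simp add: mderiv_def)
  qed
  then show ?thesis using a unfolding admissible_def by (metis mabs_def sum.neutral_const)
qed

text \<open>The function to be smoothed is always \<open>cut X 0\<close> times \<phi>; only its
  splitting into v and u changes with j, hence with k. Near K all cutoffs are 1, so u vanishes
  there.\<close>

lemma cutoff_pieces:
  fixes X :: "('d::finite) cutoff_family"
  assumes X: "cutoffs K D \<eta> C X" and D: "D \<subseteq> cbox a b" and \<phi>: "admissible \<omega> m D W B \<phi>"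
  defines "v \<equiv> \<lambda>j y. cut X j y * \<phi> y" and "u \<equiv> \<lambda>j y. (cut X 0 y - cut X j y) * \<phi> y"
  shows "continuous_on UNIV (v j)" "\<forall>y. y \<notin> cbox a b \<longrightarrow> v j y = 0" "continuous_on UNIV (u j)" "\<forall>y. y \<notin> cbox a b \<longrightarrow> u j y = 0"
    "(\<lambda>y. v j y + u j y) = (\<lambda>y. cut X 0 y * \<phi> y)"
    "k \<ge> 1 \<Longrightarrow> j \<le> k \<Longrightarrow> cmod (u j y) \<le> (2 * C * 2 ^ CARD('d) * Mw \<omega> m 0 * B) * real k ^ CARD('d)"
    "cmod (v 0 y) \<le> C * 2 ^ CARD('d) * Mw \<omega> m 0 * B"
    "\<forall>z\<in>K. \<forall>y. dist z y < \<eta> \<longrightarrow> u j y = 0"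
proof -
  have W: "open W" "D \<subseteq> W" "smooth_on W \<phi>" "0 \<le> B" using \<phi> by (auto simp: admissible_def)
  have cD: "compact D" by (rule cutoffs_pos(3)[OF X])
  have C: "C \<ge> 1" by (rule cutoffs_pos(2)[OF X])
  have c: "continuous_on UNIV (cut X j)" for j by (rule cutoffs_continuous[OF X]) simp
  have z: "cut X j y = 0" if "y \<notin> D" for j y by (rule cutoffs_zero[OF X _ that]) simp
  show "continuous_on UNIV (v j)" unfolding v_def
    by (rule continuous_on_cutoff_mult[OF cD W(1,2) smooth_on_continuous[OF W(3)] c z])
  show "continuous_on UNIV (u j)" unfolding u_def
    by (rule continuous_on_cutoff_mult[OF cD W(1,2) smooth_on_continuous[OF W(3)]]) (auto intro!: continuous_on_diff c simp: z)
  have zc: "cut X j y = 0" if "y \<notin> cbox a b" for j y using z D that by blast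
  then show "\<forall>y. y \<notin> cbox a b \<longrightarrow> v j y = 0" "\<forall>y. y \<notin> cbox a b \<longrightarrow> u j y = 0" by (simp_all add: v_def u_def zc)
  show "(\<lambda>y. v j y + u j y) = (\<lambda>y. cut X 0 y * \<phi> y)" by (simp add: v_def u_def algebra_simps)
  have P: "0 \<le> C * 2 ^ CARD('d)" using C by simp
  show "cmod (u j y) \<le> (2 * C * 2 ^ CARD('d) * Mw \<omega> m 0 * B) * real k ^ CARD('d)" if k: "k \<ge> 1" "j \<le> k"
  proof (cases "y \<in> D")
    case True
    have "cmod (cut X 0 y - cut X j y) \<le> cmod (cut X 0 y) + cmod (cut X j y)" by (rule norm_triangle_ineq4)
    also have "\<dots> \<le> C * 2 ^ CARD('d) * real k ^ CARD('d) + C * 2 ^ CARD('d) * real k ^ CARD('d)"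
      by (intro add_mono cut_bound[OF X]) (use k in auto)
    also have "\<dots> = 2 * C * 2 ^ CARD('d) * real k ^ CARD('d)" by simp
    finally have "cmod (u j y) \<le> (2 * C * 2 ^ CARD('d) * real k ^ CARD('d)) * (B * Mw \<omega> m 0)"
      unfolding u_def norm_mult using admissible_bound[OF \<phi> True] C by (intro mult_mono) auto
    then show ?thesis by (simp only: mult_ac)
  next
    case False
    then show ?thesis using z[OF False] C W(4) by (simp add: u_def)
  qed
  show "cmod (v 0 y) \<le> C * 2 ^ CARD('d) * Mw \<omega> m 0 * B"
  proof (cases "y \<in> D")
    case True
    have "cmod (v 0 y) \<le> (C * 2 ^ CARD('d)) * (B * Mw \<omega> m 0)"
      unfolding v_def norm_mult using cut_bound[OF X, of 0 1 y] admissible_bound[OF \<phi> True] C by (intro mult_mono) auto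
    then show ?thesis by (simp only: mult_ac)
  next
    case False
    then show ?thesis using z[OF False] C W(4) by (simp add: v_def)
  qed
  show "\<forall>z\<in>K. \<forall>y. dist z y < \<eta> \<longrightarrow> u j y = 0" using cutoffs_one[OF X] by (simp add: u_def)
qed

abbreviation approx :: "('d::finite) cutoff_family \<Rightarrow> nat \<Rightarrow> (real^'d \<Rightarrow> complex) \<Rightarrow> real^'d \<Rightarrow> complex" where
  "approx X k \<phi> \<equiv> smoothed k (\<lambda>_. 0) (\<lambda>y. cut X 0 y * \<phi> y)"

lemma approx_in_E_open:
  fixes X :: "('d::finite) cutoff_family"
  assumes X: "cutoffs K D \<eta> C X" and \<phi>: "admissible \<omega> m D W B \<phi>" and k: "k \<ge> 1"
  shows "approx X k \<phi> \<in> E_open omega1 UNIV"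
proof -
  obtain a b where D: "D \<subseteq> cbox a b" using compact_subset_cbox[OF cutoffs_pos(3)[OF X]] by blast
  note p = cutoff_pieces[OF X D \<phi>]
  show ?thesis by (rule smoothed_in_E_open_omega1[OF k _ p(1)]) (use p(2) in auto)
qed

text \<open>The smoothed v-part lies in \<open>DL1 omega1\<close>, where g may be replaced by f,
  whose continuity is measured by \<omega>; the smoothed u-part is small near K, where g is carried.
  The value at \<open>k0\<close> is bounded as well, so that the limit inherits a bound.\<close>

lemma functional_increment:
  fixes X :: "('d::finite) cutoff_family"
  assumes w: "weight_function \<omega>" and m: "m \<ge> 1" and X: "cutoffs K D \<eta> C0 X"
    and f: "f \<in> B_dual \<omega>" and g: "g \<in> E_dual_carried omega1 K" and fg: "\<forall>\<phi>\<in>DL1 omega1. f \<phi> = g \<phi>"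
  shows "\<exists>C\<ge>0. \<exists>k0\<ge>1. \<forall>W B \<phi>. admissible \<omega> m D W B \<phi> \<longrightarrow>
    (\<forall>k\<ge>k0. cmod (g (approx X (Suc k) \<phi>) - g (approx X k \<phi>)) \<le> C * B / (real k)\<^sup>2) \<and> cmod (g (approx X k0 \<phi>)) \<le> C * B"
proof -
  let ?d = "CARD('d)"
  note C0 = cutoffs_pos(2)[OF X]
  obtain a b where D: "D \<subseteq> cbox a b" using compact_subset_cbox[OF cutoffs_pos(3)[OF X]] by blast
  obtain n1 C1 k0 where 1: "n1 \<ge> 1" "C1 \<ge> 0" "k0 \<ge> 1" "\<And>k. k\<ge>k0 \<Longrightarrow> \<exists>j\<le>k. osc_bounded \<omega> m n1 D X C1 k j"
    using osc_increment_bound[OF w m X] by (elim exE conjE) blast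
  obtain n2 C2 where 2: "n2 \<ge> 1" "C2 \<ge> 0" "\<And>k. k \<ge> 1 \<Longrightarrow> far_bounded a b K \<eta> n2 C2 k"
    using smoothed_far_from_bound[OF cutoffs_pos(1)[OF X], of a b K] by (elim exE conjE) blast
  define U where "U = (\<Union>z\<in>K. ball z (\<eta> / 2))"
  have U: "open U" "K \<subseteq> U" using cutoffs_pos(1)[OF X] by (auto simp: U_def)
  obtain n3 Cs where 3: "n3 \<ge> 1" "Cs \<ge> 0" "gauss_bounded a b n3 Cs k0"
    using smoothed_bound_omega1[of a b] 1(3) by (elim exE conjE) blast
  obtain Cf where Cf: "Cf \<ge> 0" "\<forall>\<phi>. \<forall>B\<ge>0. smooth_on UNIV \<phi> \<and>
    (\<forall>\<alpha>. L1_norm (mderiv \<alpha> \<phi>) \<le> ennreal (B * Mw \<omega> n1 (mabs \<alpha>))) \<longrightarrow> cmod (f \<phi>) \<le> Cf * B"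
    using B_dual_bound[OF w f 1(1)] by (elim exE conjE)
  obtain Cg where Cg: "Cg \<ge> 0" "\<forall>\<phi>\<in>E_open omega1 UNIV. \<forall>B\<ge>0. (deriv_bounded omega1 n2 U B \<phi>) \<longrightarrow> cmod (g \<phi>) \<le> Cg * B"
    using carried_bound[OF g U 2(1)] by (elim exE conjE)
  obtain Ch where Ch: "Ch \<ge> 0" "\<forall>\<phi>\<in>E_open omega1 UNIV. \<forall>B\<ge>0. (deriv_bounded omega1 n3 U B \<phi>) \<longrightarrow> cmod (g \<phi>) \<le> Ch * B"
    using carried_bound[OF g U 3(1)] by (elim exE conjE)
  obtain G where G: "G \<ge> 0" "(\<integral>\<^sup>+ x. ennreal (gauss_weight (x :: real^'d)) \<partial>lborel) \<le> ennreal G"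
    using gauss_weight_finite by blast
  have gl: "g \<in> lc_dual (E_open omega1 UNIV) (E_open_seminorms omega1 UNIV)"
    using g unfolding E_dual_carried_def E_dual_def by blast
  have fs: "function_space (E_open omega1 (UNIV :: (real^'d) set))" by (rule function_space_E_open[OF weight_function_omega1 open_UNIV])
  define T where "T = (ternary - {\<lambda>_. 0} :: ('d \<Rightarrow> int) set)"
  define V where "V = C0 * 2 ^ ?d * Mw \<omega> m 0"
  have V: "V \<ge> 0" using C0 by (simp add: V_def)
  define P where "P = Cf * (C1 * G) + Cg * (C2 * (2 * V))"
  have P: "P \<ge> 0" using Cf(1) 1(2) G(1) Cg(1) 2(2) V by (simp add: P_def)
  define Q where "Q = real (card T) * P + Ch * (Cs * V)"
  have "cmod (g (approx X (Suc k) \<phi>) - g (approx X k \<phi>)) \<le> Q * B / (real k)\<^sup>2"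
    if kk: "k \<ge> k0" and \<phi>: "admissible \<omega> m D W B \<phi>" for k W B \<phi>
  proof -
    have k: "k \<ge> 1" using kk 1(3) by simp
    obtain j where j: "j \<le> k" "osc_bounded \<omega> m n1 D X C1 k j"
      using 1(4)[OF kk] by (elim exE conjE)
    note p = cutoff_pieces[OF X D \<phi>]
    have B: "B \<ge> 0" using \<phi> by (simp add: admissible_def)
    let ?v = "\<lambda>y. cut X j y * \<phi> y" and ?u = "\<lambda>y. (cut X 0 y - cut X j y) * \<phi> y"
    have mem: "smoothed k c ?v \<in> E_open omega1 UNIV" "smoothed k c ?u \<in> E_open omega1 UNIV" "smoothed k c ?v \<in> DL1 omega1"
      if "c \<in> T" for c
      using that p(1-4)[of j] k
      by (auto simp: T_def ternary intro!: smoothed_in_E_open_omega1 smoothed_in_DL1_omega1)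
    have bd: "cmod (g (smoothed k c ?v) + g (smoothed k c ?u)) \<le> P * (B / (real k)\<^sup>2)" if c: "c \<in> T" for c
    proof -
      have c': "\<forall>i. c i \<in> {-1, 0, 1}" "c \<noteq> (\<lambda>_. 0)" using c by (auto simp: T_def ternary)
      have "cmod (mderiv \<alpha> (smoothed k c ?v) x) \<le> (C1 * B / (real k)\<^sup>2) * Mw \<omega> n1 (mabs \<alpha>) * gauss_weight x" for \<alpha> x
        using j(2)[rule_format, of c W \<phi> B] c' \<phi> unfolding admissible_def by blast
      then have "L1_norm (mderiv \<alpha> (smoothed k c ?v)) \<le> ennreal (((C1 * B / (real k)\<^sup>2) * Mw \<omega> n1 (mabs \<alpha>)) * G)" for \<alpha>
        by (intro DL1_bound_of_pointwise[OF G]) (use 1(2) B in auto)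
      then have i: "L1_norm (mderiv \<alpha> (smoothed k c ?v)) \<le> ennreal ((C1 * B / (real k)\<^sup>2 * G) * Mw \<omega> n1 (mabs \<alpha>))" for \<alpha>
        by (simp only: mult_ac)
      have "smooth_on UNIV (smoothed k c ?v)" using mem(3)[OF c] unfolding DL1_iff by blast
      moreover have "0 \<le> C1 * B / (real k)\<^sup>2 * G" using 1(2) B G(1) by simp
      ultimately have "cmod (f (smoothed k c ?v)) \<le> Cf * (C1 * B / (real k)\<^sup>2 * G)"
        using Cf(2) i by blast
      then have gv: "cmod (g (smoothed k c ?v)) \<le> Cf * (C1 * B / (real k)\<^sup>2 * G)" using fg mem(3)[OF c] by simp
      have "\<forall>y. cmod (?u y) \<le> (2 * V * B) * real k ^ ?d"
        using p(6)[OF k j(1)] by (simp add: V_def mult.assoc)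
      then have "cmod (mderiv \<alpha> (smoothed k c ?u) x) \<le> (C2 * (2 * V * B) / (real k)\<^sup>2) * Mw omega1 n2 (mabs \<alpha>)" if "x \<in> U" for \<alpha> x
        using 2(3)[OF k] c'(1) p(3,4,8)[of j] that unfolding U_def by blast
      moreover have "0 \<le> C2 * (2 * V * B) / (real k)\<^sup>2" using 2(2) V B by simp
      ultimately have gu: "cmod (g (smoothed k c ?u)) \<le> Cg * (C2 * (2 * V * B) / (real k)\<^sup>2)"
        using Cg(2) mem(2)[OF c] by blast
      have "cmod (g (smoothed k c ?v) + g (smoothed k c ?u)) \<le> Cf * (C1 * B / (real k)\<^sup>2 * G) + Cg * (C2 * (2 * V * B) / (real k)\<^sup>2)"
        by (rule order_trans[OF norm_triangle_ineq add_mono[OF gv gu]])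
      then show ?thesis by (simp add: P_def algebra_simps)
    qed
    have "approx X (Suc k) \<phi> = (\<lambda>x. approx X k \<phi> x + (\<Sum>c\<in>T. smoothed k c ?v x + smoothed k c ?u x))"
      using smoothed_Suc_split[OF p(1)[of j] p(2)[of j] p(3)[of j] p(4)[of j], of k] unfolding p(5) T_def .
    moreover have "(\<lambda>x. smoothed k c ?v x + smoothed k c ?u x) \<in> E_open omega1 UNIV" if "c \<in> T" for c
      by (rule function_space_add[OF fs mem(1)[OF that] mem(2)[OF that]])
    moreover have "finite T" using ternary(1) by (simp add: T_def)
    ultimately have "g (approx X (Suc k) \<phi>) = g (approx X k \<phi>) + (\<Sum>c\<in>T. g (\<lambda>x. smoothed k c ?v x + smoothed k c ?u x))"
      using lc_dual_sum[OF fs gl, of T "\<lambda>c x. smoothed k c ?v x + smoothed k c ?u x"]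
        lc_dual_add[OF gl approx_in_E_open[OF X \<phi> k], of "\<lambda>x. \<Sum>c\<in>T. smoothed k c ?v x + smoothed k c ?u x"] by simp
    also have "(\<Sum>c\<in>T. g (\<lambda>x. smoothed k c ?v x + smoothed k c ?u x)) = (\<Sum>c\<in>T. g (smoothed k c ?v) + g (smoothed k c ?u))"
      by (intro sum.cong refl lc_dual_add[OF gl] mem)
    finally have "cmod (g (approx X (Suc k) \<phi>) - g (approx X k \<phi>)) \<le> real (card T) * (P * (B / (real k)\<^sup>2))"
      using sum_norm_bound[of T "\<lambda>c. g (smoothed k c ?v) + g (smoothed k c ?u)", OF bd] by simp
    also have "\<dots> = (real (card T) * P) * (B / (real k)\<^sup>2)" by (simp add: mult.assoc)
    also have "\<dots> \<le> Q * (B / (real k)\<^sup>2)" using B Ch(1) 3(2) V by (intro mult_right_mono) (auto simp: Q_def)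
    finally show ?thesis by simp
  qed
  moreover have "cmod (g (approx X k0 \<phi>)) \<le> Q * B" if \<phi>: "admissible \<omega> m D W B \<phi>" for W B \<phi>
  proof -
    note p = cutoff_pieces[OF X D \<phi>]
    have B: "B \<ge> 0" using \<phi> by (simp add: admissible_def)
    have "cmod (mderiv \<alpha> (approx X k0 \<phi>) x) \<le> (Cs * (V * B)) * Mw omega1 n3 (mabs \<alpha>)" for \<alpha> x
    proof -
      have vb: "\<forall>y. cmod (cut X 0 y * \<phi> y) \<le> V * B" using p(7) by (simp add: V_def)
      have "cmod (mderiv \<alpha> (approx X k0 \<phi>) x) \<le> (Cs * (V * B)) * Mw omega1 n3 (mabs \<alpha>) * gauss_weight x"
        by (rule 3(3)[rule_format]) (use p(1,2)[of 0] vb in auto)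
      also have "\<dots> \<le> (Cs * (V * B)) * Mw omega1 n3 (mabs \<alpha>) * 1"
        using 3(2) V B by (intro mult_left_mono mult_nonneg_nonneg) (auto simp: gauss_weight_def)
      finally show ?thesis by simp
    qed
    moreover have "0 \<le> Cs * (V * B)" using 3(2) V B by simp
    ultimately have "cmod (g (approx X k0 \<phi>)) \<le> Ch * (Cs * (V * B))"
      using Ch(2) approx_in_E_open[OF X \<phi> 1(3)] by blast
    also have "\<dots> = (Ch * (Cs * V)) * B" by (simp add: mult.assoc)
    also have "\<dots> \<le> Q * B" using B P by (intro mult_right_mono) (auto simp: Q_def)
    finally show ?thesis .
  qed
  moreover have "Q \<ge> 0" using P Ch(1) 3(2) V by (simp add: Q_def)
  ultimately show ?thesis using 1(3) by blast
qed

definition limit_functional :: "('d::finite) cutoff_family \<Rightarrow> ((real^'d \<Rightarrow> complex) \<Rightarrow> complex) \<Rightarrow> (real^'d \<Rightarrow> complex) \<Rightarrow> complex" where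
  "limit_functional X g \<phi> = lim (\<lambda>k. g (approx X k \<phi>))"

text \<open>The value at \<open>k0\<close> and a telescoping tail of at most twice the constant give
  the factor 3.\<close>

lemma limit_functional_bound:
  fixes X :: "('d::finite) cutoff_family"
  assumes w: "weight_function \<omega>" and m: "m \<ge> 1" and X: "cutoffs K D \<eta> C0 X"
    and f: "f \<in> B_dual \<omega>" and g: "g \<in> E_dual_carried omega1 K" and fg: "\<forall>\<phi>\<in>DL1 omega1. f \<phi> = g \<phi>"
  shows "\<exists>C\<ge>0. \<forall>W B \<phi>. admissible \<omega> m D W B \<phi> \<longrightarrow>
    (\<lambda>k. g (approx X k \<phi>)) \<longlonglongrightarrow> limit_functional X g \<phi> \<and> cmod (limit_functional X g \<phi>) \<le> C * B"
proof -
  obtain C k0 where C: "C \<ge> 0" "k0 \<ge> 1" "\<And>W B \<phi>. admissible \<omega> m D W B \<phi> \<Longrightarrow>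
    (\<forall>k\<ge>k0. cmod (g (approx X (Suc k) \<phi>) - g (approx X k \<phi>)) \<le> C * B / (real k)\<^sup>2) \<and> cmod (g (approx X k0 \<phi>)) \<le> C * B"
    using functional_increment[OF w m X f g fg] by (elim exE conjE) blast
  have "(\<lambda>k. g (approx X k \<phi>)) \<longlonglongrightarrow> limit_functional X g \<phi> \<and> cmod (limit_functional X g \<phi>) \<le> (3 * C) * B"
    if \<phi>: "admissible \<omega> m D W B \<phi>" for W B \<phi>
  proof -
    have B: "B \<ge> 0" using \<phi> by (simp add: admissible_def)
    note * = C(3)[OF \<phi>]
    note t = telescope_convergent[OF C(2), of "\<lambda>k. g (approx X k \<phi>)" "C * B"]
    have conv: "convergent (\<lambda>k. g (approx X k \<phi>))" and le: "cmod (limit_functional X g \<phi> - g (approx X k0 \<phi>)) \<le> 2 * (C * B) / real k0"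
      unfolding limit_functional_def using t * by blast+
    have "2 * (C * B) / real k0 \<le> 2 * (C * B) / 1" using C B by (intro divide_left_mono) auto
    then have "cmod (limit_functional X g \<phi>) \<le> 2 * (C * B) + C * B"
      using le conjunct2[OF *] norm_triangle_sub[of "limit_functional X g \<phi>" "g (approx X k0 \<phi>)"] by linarith
    moreover have "2 * (C * B) + C * B = 3 * C * B" by simp
    ultimately show ?thesis using conv by (simp add: convergent_LIMSEQ_iff limit_functional_def)
  qed
  then show ?thesis using C(1) by (intro exI[of _ "3 * C"]) auto
qed

text \<open>Extending by 0 or restricting a function off the support of the cutoffs does not change
  its approximations.\<close>

lemma approx_cong:
  fixes X :: "('d::finite) cutoff_family"
  assumes X: "cutoffs K D \<eta> C0 X" and eq: "\<And>y. y \<in> D \<Longrightarrow> \<phi> y = \<psi> y"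
  shows "approx X k \<phi> = approx X k \<psi>"
proof -
  have "(\<lambda>y. cut X 0 y * \<phi> y) = (\<lambda>y. cut X 0 y * \<psi> y)"
  proof
    fix y show "cut X 0 y * \<phi> y = cut X 0 y * \<psi> y"
      using eq cutoffs_zero[OF X, of 0 0 y undefined] by (cases "y \<in> D") auto
  qed
  then show ?thesis by simp
qed

lemma functional_approx_add:
  fixes X :: "('d::finite) cutoff_family"
  assumes X: "cutoffs K D \<eta> C0 X" and g: "g \<in> E_dual omega1 UNIV" and k: "k \<ge> 1"
    and \<phi>: "admissible \<omega> m D W B \<phi>" and \<psi>: "admissible \<omega>' m' D W' B' \<psi>"
  shows "g (approx X k (\<lambda>y. \<phi> y + \<psi> y)) = g (approx X k \<phi>) + g (approx X k \<psi>)"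
proof -
  obtain a b where D: "D \<subseteq> cbox a b" using compact_subset_cbox[OF cutoffs_pos(3)[OF X]] by blast
  note p = cutoff_pieces(1,2)[OF X D \<phi>, of 0] and q = cutoff_pieces(1,2)[OF X D \<psi>, of 0]
  have "approx X k (\<lambda>y. \<phi> y + \<psi> y) = (\<lambda>x. approx X k \<phi> x + approx X k \<psi> x)"
    unfolding distrib_left by (rule ext, rule smoothed_add[OF p q])
  then show ?thesis using lc_dual_add[OF g[unfolded E_dual_def] approx_in_E_open[OF X \<phi> k] approx_in_E_open[OF X \<psi> k]] by simp
qed

lemma functional_approx_cmult:
  fixes X :: "('d::finite) cutoff_family"
  assumes X: "cutoffs K D \<eta> C0 X" and g: "g \<in> E_dual omega1 UNIV" and k: "k \<ge> 1" and \<phi>: "admissible \<omega> m D W B \<phi>"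
  shows "g (approx X k (\<lambda>y. c * \<phi> y)) = c * g (approx X k \<phi>)"
proof -
  have "approx X k (\<lambda>y. c * \<phi> y) = (\<lambda>x. c * approx X k \<phi> x)"
    unfolding mult.left_commute[of _ c] by (rule ext, rule smoothed_cmult)
  then show ?thesis using lc_dual_cmult[OF g[unfolded E_dual_def] approx_in_E_open[OF X \<phi> k]] by simp
qed

lemma admissible_add:
  assumes w: "weight_function \<omega>" and \<phi>: "admissible \<omega> m D W B \<phi>" and \<psi>: "admissible \<omega> m' D W B' \<psi>" and m: "1 \<le> m" "1 \<le> m'"
  shows "admissible \<omega> (max m m') D W (B + B') (\<lambda>x. \<phi> x + \<psi> x)"
  unfolding admissible_def
proof (intro conjI allI ballI)
  show "open W" "D \<subseteq> W" "smooth_on W (\<lambda>x. \<phi> x + \<psi> x)" "0 \<le> B + B'"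
    using \<phi> \<psi> by (auto simp: admissible_def intro: smooth_on_add)
  fix \<alpha> y assume y: "y \<in> D"
  have "cmod (mderiv \<alpha> \<phi> y + mderiv \<alpha> \<psi> y) \<le> B * Mw \<omega> m (mabs \<alpha>) + B' * Mw \<omega> m' (mabs \<alpha>)"
    using \<phi> \<psi> y by (intro norm_triangle_le add_mono) (auto simp: admissible_def)
  also have "\<dots> \<le> B * Mw \<omega> (max m m') (mabs \<alpha>) + B' * Mw \<omega> (max m m') (mabs \<alpha>)"
    using \<phi> \<psi> m by (intro add_mono mult_left_mono Mw_mono_n[OF w]) (auto simp: admissible_def)
  also have "mderiv \<alpha> \<phi> y + mderiv \<alpha> \<psi> y = mderiv \<alpha> (\<lambda>x. \<phi> x + \<psi> x) y"
    by (rule mderiv_add[symmetric, of W]) (use \<phi> \<psi> y in \<open>auto simp: admissible_def\<close>)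
  finally show "cmod (mderiv \<alpha> (\<lambda>x. \<phi> x + \<psi> x) y) \<le> (B + B') * Mw \<omega> (max m m') (mabs \<alpha>)" by (simp add: distrib_right)
qed

lemma admissible_cmult:
  assumes \<phi>: "admissible \<omega> m D W B \<phi>"
  shows "admissible \<omega> m D W (cmod c * B) (\<lambda>x. c * \<phi> x)"
  unfolding admissible_def
proof (intro conjI allI ballI)
  show "open W" "D \<subseteq> W" "smooth_on W (\<lambda>x. c * \<phi> x)" "0 \<le> cmod c * B"
    using \<phi> by (auto simp: admissible_def intro: smooth_on_cmult)
  fix \<alpha> y assume y: "y \<in> D"
  have "mderiv \<alpha> (\<lambda>x. c * \<phi> x) y = c * mderiv \<alpha> \<phi> y"
    by (rule mderiv_cmult[of W]) (use \<phi> y in \<open>auto simp: admissible_def\<close>)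
  moreover have "cmod (mderiv \<alpha> \<phi> y) \<le> B * Mw \<omega> m (mabs \<alpha>)" using \<phi> y by (simp add: admissible_def)
  then have "cmod c * cmod (mderiv \<alpha> \<phi> y) \<le> cmod c * (B * Mw \<omega> m (mabs \<alpha>))" by (rule mult_left_mono) simp
  ultimately show "cmod (mderiv \<alpha> (\<lambda>x. c * \<phi> x) y) \<le> cmod c * B * Mw \<omega> m (mabs \<alpha>)"
    by (simp add: norm_mult mult.assoc)
qed

lemma E_open_admissible:
  fixes \<Omega> :: "(real^'d::finite) set"
  assumes \<Omega>: "open \<Omega>" and \<phi>: "\<phi> \<in> E_open \<omega> \<Omega>" and D: "compact D" "D \<subseteq> \<Omega>"
  shows "\<exists>n\<ge>1. \<exists>B. admissible \<omega> n D \<Omega> B \<phi>"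
proof -
  from \<phi> have \<phi>': "smooth_on \<Omega> \<phi> \<and> (\<forall>D. compact D \<and> D \<subseteq> \<Omega> \<longrightarrow> (\<exists>n\<ge>1. \<exists>B\<ge>0. deriv_bounded \<omega> n D B \<phi>))"
    unfolding E_open_iff[OF \<Omega>] by (rule conjunct2)
  note s = conjunct1[OF \<phi>']
  from conjunct2[OF \<phi>', rule_format, OF conjI[OF D]] obtain n B where "n \<ge> 1" "B \<ge> 0" "deriv_bounded \<omega> n D B \<phi>"
    by (elim exE conjE)
  then have "admissible \<omega> n D \<Omega> B \<phi>" using s \<Omega> D by (simp add: admissible_def)
  then show ?thesis using \<open>n \<ge> 1\<close> by blast
qed

text \<open>Linearity passes to the limit. For continuity the modulus of the limit functional is
  itself shown to be a seminorm of the inductive limit over one member L of the exhaustion whose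
  interior contains D; by \<open>approx_cong\<close> it sees only the restriction to that
  interior.\<close>

lemma limit_functional_E_dual:
  fixes X :: "('d::finite) cutoff_family"
  assumes w: "weight_function \<omega>" and X: "cutoffs K D \<eta> C0 X" and \<Omega>: "open \<Omega>" "D \<subseteq> \<Omega>"
    and f: "f \<in> B_dual \<omega>" and g: "g \<in> E_dual_carried omega1 K" and fg: "\<forall>\<phi>\<in>DL1 omega1. f \<phi> = g \<phi>"
  shows "restrict0 (E_open \<omega> \<Omega>) (limit_functional X g) \<in> E_dual \<omega> \<Omega>"
proof -
  let ?h = "limit_functional X g"
  note cD = cutoffs_pos(3)[OF X]
  note b = limit_functional_bound[OF w _ X f g fg]
  have gE: "g \<in> E_dual omega1 UNIV" using g unfolding E_dual_carried_def by blast
  have tend: "(\<lambda>k. g (approx X k \<phi>)) \<longlonglongrightarrow> ?h \<phi>" if "admissible \<omega> m D W B \<phi>" "m \<ge> 1" for m W B \<phi>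
    using b[OF that(2)] that(1) by (elim exE conjE) blast
  have ev: "\<forall>\<^sub>F k in sequentially. (k::nat) \<ge> 1" by (rule eventually_ge_at_top)
  have add: "?h (\<lambda>x. \<phi> x + \<psi> x) = ?h \<phi> + ?h \<psi>"
    if "admissible \<omega> m D W B \<phi>" "m \<ge> 1" "admissible \<omega> m' D W B' \<psi>" "m' \<ge> 1" for m m' W B B' \<phi> \<psi>
  proof (rule LIMSEQ_unique)
    show "(\<lambda>k. g (approx X k (\<lambda>x. \<phi> x + \<psi> x))) \<longlonglongrightarrow> ?h (\<lambda>x. \<phi> x + \<psi> x)"
      by (rule tend[OF admissible_add[OF w that(1,3)]]) (use that in auto)
    have "(\<lambda>k. g (approx X k \<phi>) + g (approx X k \<psi>)) \<longlonglongrightarrow> ?h \<phi> + ?h \<psi>"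
      by (intro tendsto_add tend[OF that(1,2)] tend[OF that(3,4)])
    then show "(\<lambda>k. g (approx X k (\<lambda>x. \<phi> x + \<psi> x))) \<longlonglongrightarrow> ?h \<phi> + ?h \<psi>"
      by (rule Lim_transform_eventually) (use ev in \<open>eventually_elim, simp add: functional_approx_add[OF X gE _ that(1,3)]\<close>)
  qed
  have cmult: "?h (\<lambda>x. c * \<phi> x) = c * ?h \<phi>" if "admissible \<omega> m D W B \<phi>" "m \<ge> 1" for m W B \<phi> c
  proof (rule LIMSEQ_unique)
    show "(\<lambda>k. g (approx X k (\<lambda>x. c * \<phi> x))) \<longlonglongrightarrow> ?h (\<lambda>x. c * \<phi> x)"
      by (rule tend[OF admissible_cmult[OF that(1)] that(2)])
    have "(\<lambda>k. c * g (approx X k \<phi>)) \<longlonglongrightarrow> c * ?h \<phi>" by (intro tendsto_mult_left tend[OF that])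
    then show "(\<lambda>k. g (approx X k (\<lambda>x. c * \<phi> x))) \<longlonglongrightarrow> c * ?h \<phi>"
      by (rule Lim_transform_eventually) (use ev in \<open>eventually_elim, simp add: functional_approx_cmult[OF X gE _ that(1)]\<close>)
  qed
  obtain N where N: "D \<subseteq> interior (some_exhaustion \<Omega> N)" using compact_subset_exhaustion[OF \<Omega>(1) cD \<Omega>(2)] by blast
  define L where "L = some_exhaustion \<Omega> N"
  have L: "regular_compact L" "D \<subseteq> interior L" unfolding L_def using exhaustion_interior(3)[OF \<Omega>(1)] N by auto
  have adC: "admissible \<omega> n D (interior L) B \<phi>"
    if "\<phi> \<in> C_infinity L" "B \<ge> 0" "deriv_bounded \<omega> n (interior L) B \<phi>" for n B \<phi>
    using that L(2) unfolding admissible_def C_infinity_def by auto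
  have adE: "\<exists>n\<ge>1. \<exists>B. admissible \<omega> n D (interior L) B \<phi>" if "\<phi> \<in> E_compact \<omega> L" for \<phi>
    using that adC unfolding E_compact_iff[OF L(1)] by blast
  define p where "p \<psi> = cmod (?h \<psi>)" for \<psi>
  have p: "p \<in> E_compact_seminorms \<omega> L"
  proof (rule E_compact_seminormI[OF L(1)])
    show "seminorm_on (E_compact \<omega> L) p"
      unfolding seminorm_on_def p_def
    proof (intro conjI ballI allI norm_ge_zero)
      fix \<phi> assume "\<phi> \<in> E_compact \<omega> L"
      then obtain n B where a: "n \<ge> 1" "admissible \<omega> n D (interior L) B \<phi>" using adE by blast
      show "cmod (?h (\<lambda>x. c * \<phi> x)) = cmod c * cmod (?h \<phi>)" for c
        using cmult[OF a(2,1)] by (simp add: norm_mult)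
      fix \<psi> assume "\<psi> \<in> E_compact \<omega> L"
      then obtain n' B' where a': "n' \<ge> 1" "admissible \<omega> n' D (interior L) B' \<psi>" using adE by blast
      show "cmod (?h (\<lambda>x. \<phi> x + \<psi> x)) \<le> cmod (?h \<phi>) + cmod (?h \<psi>)"
        using add[OF a(2,1) a'(2,1)] norm_triangle_ineq by simp
    qed
    fix n :: nat assume n: "n \<ge> 1"
    obtain C where C: "C \<ge> 0" "\<And>W B \<phi>. admissible \<omega> n D W B \<phi> \<Longrightarrow> cmod (?h \<phi>) \<le> C * B"
      using b[OF n] by (elim exE conjE) blast
    have "p \<phi> \<le> C * B" if "\<phi> \<in> C_infinity L" "B \<ge> 0" "deriv_bounded \<omega> n (interior L) B \<phi>" for \<phi> B
      unfolding p_def by (rule C(2)[OF adC[OF that]])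
    then show "\<exists>C\<ge>0. \<forall>\<phi>\<in>C_infinity L. \<forall>B\<ge>0. (deriv_bounded \<omega> n (interior L) B \<phi>) \<longrightarrow> p \<phi> \<le> C * B"
      using C(1) by blast
  qed
  define q where "q \<phi> = p (restrict0 (interior L) \<phi>)" for \<phi>
  have q: "q \<in> E_open_seminorms \<omega> \<Omega>" unfolding q_def[abs_def] L_def E_open_seminorms_def using p unfolding L_def by blast
  have qh: "q \<phi> = cmod (?h \<phi>)" for \<phi>
  proof -
    have "approx X k (restrict0 (interior L) \<phi>) = approx X k \<phi>" for k
      by (rule approx_cong[OF X]) (use L(2) in \<open>auto simp: restrict0_def\<close>)
    then show ?thesis by (simp add: q_def p_def limit_functional_def)
  qed
  have fs: "function_space (E_open \<omega> \<Omega>)" by (rule function_space_E_open[OF w \<Omega>(1)])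
  note ad = E_open_admissible[OF \<Omega>(1) _ cD \<Omega>(2)]
  show ?thesis unfolding E_dual_def
  proof (rule lc_dualI[OF fs seminorm_E_open])
    show "finite {q}" "{q} \<subseteq> E_open_seminorms \<omega> \<Omega>" using q by auto
    show "restrict0 (E_open \<omega> \<Omega>) ?h \<phi> = 0" if "\<phi> \<notin> E_open \<omega> \<Omega>" for \<phi> using that by (simp add: restrict0_def)
    show "cmod (restrict0 (E_open \<omega> \<Omega>) ?h \<phi>) \<le> 1 * (\<Sum>p\<in>{q}. p \<phi>)" if "\<phi> \<in> E_open \<omega> \<Omega>" for \<phi>
      using that qh by (simp add: restrict0_def)
    show "restrict0 (E_open \<omega> \<Omega>) ?h (\<lambda>x. c * \<phi> x) = c * restrict0 (E_open \<omega> \<Omega>) ?h \<phi>" if \<phi>: "\<phi> \<in> E_open \<omega> \<Omega>" for c \<phi>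
    proof -
      obtain n B where "n \<ge> 1" "admissible \<omega> n D \<Omega> B \<phi>" using ad[OF \<phi>] by blast
      then have "?h (\<lambda>x. c * \<phi> x) = c * ?h \<phi>" using cmult by blast
      then show ?thesis using \<phi> function_space_cmult[OF fs \<phi>] by (simp add: restrict0_def)
    qed
    show "restrict0 (E_open \<omega> \<Omega>) ?h (\<lambda>x. \<phi> x + \<psi> x) = restrict0 (E_open \<omega> \<Omega>) ?h \<phi> + restrict0 (E_open \<omega> \<Omega>) ?h \<psi>"
      if \<phi>: "\<phi> \<in> E_open \<omega> \<Omega>" and \<psi>: "\<psi> \<in> E_open \<omega> \<Omega>" for \<phi> \<psi>
    proof -
      obtain n B n' B' where "n \<ge> 1" "admissible \<omega> n D \<Omega> B \<phi>" "n' \<ge> 1" "admissible \<omega> n' D \<Omega> B' \<psi>"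
        using ad[OF \<phi>] ad[OF \<psi>] by blast
      then have "?h (\<lambda>x. \<phi> x + \<psi> x) = ?h \<phi> + ?h \<psi>" using add by blast
      then show ?thesis using \<phi> \<psi> function_space_add[OF fs \<phi> \<psi>] by (simp add: restrict0_def)
    qed
  qed
qed

text \<open>The difference of the two cut functions vanishes near K, so by
  \<open>far_bounded\<close> its smoothings tend to 0 near K in an analytic norm, and the carrier
  condition makes g vanish in the limit.\<close>

lemma limit_functional_cutoff_independent:
  fixes X :: "('d::finite) cutoff_family"
  assumes w: "weight_function \<omega>" and X: "cutoffs K D \<eta> C X" and X': "cutoffs K D' \<eta>' C' X'"
    and f: "f \<in> B_dual \<omega>" and g: "g \<in> E_dual_carried omega1 K" and fg: "\<forall>\<phi>\<in>DL1 omega1. f \<phi> = g \<phi>"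
    and \<phi>: "\<phi> \<in> E_open \<omega> UNIV"
  shows "limit_functional X g \<phi> = limit_functional X' g \<phi>"
proof -
  let ?d = "CARD('d)"
  define \<delta> where "\<delta> = min \<eta> \<eta>'"
  have \<delta>: "\<delta> > 0" using cutoffs_pos(1)[OF X] cutoffs_pos(1)[OF X'] by (simp add: \<delta>_def)
  obtain n B where a: "n \<ge> 1" "admissible \<omega> n D UNIV B \<phi>" using E_open_admissible[OF open_UNIV \<phi> cutoffs_pos(3)[OF X]] by blast
  obtain n' B' where a': "n' \<ge> 1" "admissible \<omega> n' D' UNIV B' \<phi>" using E_open_admissible[OF open_UNIV \<phi> cutoffs_pos(3)[OF X']] by blast
  have "compact (D \<union> D')" by (intro compact_Un cutoffs_pos(3)[OF X] cutoffs_pos(3)[OF X'])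
  then obtain a b where "D \<union> D' \<subseteq> cbox a b" using compact_subset_cbox by blast
  then have ab: "D \<subseteq> cbox a b" "D' \<subseteq> cbox a b" by auto
  define v where "v y = cut X 0 y * \<phi> y" for y
  define v' where "v' y = cut X' 0 y * \<phi> y" for y
  define u where "u y = v y - v' y" for y
  note p = cutoff_pieces(1)[OF X ab(1) a(2), of 0] cutoff_pieces(2)[OF X ab(1) a(2), of 0] cutoff_pieces(7)[OF X ab(1) a(2)]
    and p' = cutoff_pieces(1)[OF X' ab(2) a'(2), of 0] cutoff_pieces(2)[OF X' ab(2) a'(2), of 0] cutoff_pieces(7)[OF X' ab(2) a'(2)]
  define V where "V = C * 2 ^ ?d * Mw \<omega> n 0 * B + C' * 2 ^ ?d * Mw \<omega> n' 0 * B'"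
  have ub: "cmod (u y) \<le> V" for y
    unfolding u_def V_def by (rule order_trans[OF norm_triangle_ineq4 add_mono]) (use p(3) p'(3) in \<open>simp_all add: v_def v'_def\<close>)
  then have V: "V \<ge> 0" using norm_ge_zero order_trans by blast
  have u: "continuous_on UNIV u" "\<forall>y. y \<notin> cbox a b \<longrightarrow> u y = 0"
    unfolding u_def[abs_def] v_def[abs_def] v'_def[abs_def]
    by (rule continuous_on_diff[OF p(1) p'(1)]) (use p(2) p'(2) in \<open>metis diff_zero\<close>)
  have uK: "\<forall>z\<in>K. \<forall>y. dist z y < \<delta> \<longrightarrow> u y = 0"
    using cutoffs_one[OF X] cutoffs_one[OF X'] by (auto simp: u_def v_def v'_def \<delta>_def)
  obtain m Cf where m: "m \<ge> 1" "Cf \<ge> 0" "\<And>k. k\<ge>1 \<Longrightarrow> far_bounded a b K \<delta> m Cf k"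
    using smoothed_far_from_bound[OF \<delta>, of a b K] by (elim exE conjE) blast
  define U where "U = (\<Union>z\<in>K. ball z (\<delta> / 2))"
  have U: "open U" "K \<subseteq> U" using \<delta> by (auto simp: U_def)
  obtain Cg where Cg: "Cg \<ge> 0" "\<forall>\<phi>\<in>E_open omega1 UNIV. \<forall>B\<ge>0. (deriv_bounded omega1 m U B \<phi>) \<longrightarrow> cmod (g \<phi>) \<le> Cg * B"
    using carried_bound[OF g U m(1)] by (elim exE conjE)
  have gl: "g \<in> lc_dual (E_open omega1 UNIV) (E_open_seminorms omega1 UNIV)"
    using g unfolding E_dual_carried_def E_dual_def by blast
  have diff: "cmod (g (approx X k \<phi>) - g (approx X' k \<phi>)) \<le> (Cg * (Cf * V)) * (1 / (real k)\<^sup>2)" if k: "k \<ge> 1" for k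
  proof -
    have mem: "smoothed k (\<lambda>_. 0) u \<in> E_open omega1 UNIV"
      by (rule smoothed_in_E_open_omega1[OF k _ u(1)]) (use u(2) in auto)
    have Vk: "V * 1 \<le> V * real k ^ ?d" using V k by (intro mult_left_mono) auto
    have vk: "\<forall>y. cmod (u y) \<le> V * real k ^ ?d" using ub Vk order_trans by fastforce
    have "cmod (mderiv \<alpha> (smoothed k (\<lambda>_. 0) u) x) \<le> (Cf * V / (real k)\<^sup>2) * Mw omega1 m (mabs \<alpha>)" if "x \<in> U" for \<alpha> x
      by (rule m(3)[OF k, rule_format]) (use u uK vk that in \<open>auto simp: U_def\<close>)
    moreover have "0 \<le> Cf * V / (real k)\<^sup>2" using m(2) V by simp
    ultimately have "cmod (g (smoothed k (\<lambda>_. 0) u)) \<le> Cg * (Cf * V / (real k)\<^sup>2)" using Cg(2) mem by blast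
    moreover have "approx X k \<phi> = (\<lambda>x. approx X' k \<phi> x + smoothed k (\<lambda>_. 0) u x)"
    proof
      fix x
      have "smoothed k (\<lambda>_. 0) (\<lambda>y. v' y + u y) x = smoothed k (\<lambda>_. 0) v' x + smoothed k (\<lambda>_. 0) u x"
        by (rule smoothed_add[OF _ _ u]) (use p' in \<open>simp_all add: v'_def\<close>)
      moreover have "(\<lambda>y. v' y + u y) = v" by (simp add: u_def)
      ultimately show "approx X k \<phi> x = approx X' k \<phi> x + smoothed k (\<lambda>_. 0) u x" unfolding v_def[abs_def] v'_def[abs_def] by simp
    qed
    then have "g (approx X k \<phi>) = g (approx X' k \<phi>) + g (smoothed k (\<lambda>_. 0) u)"
      using lc_dual_add[OF gl approx_in_E_open[OF X' a'(2) k] mem] by simp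
    ultimately show ?thesis by simp
  qed
  have "(\<lambda>k. 1 / (real k)\<^sup>2) \<longlonglongrightarrow> 0"
    using tendsto_power[OF lim_1_over_n, of 2] by (simp add: power_divide)
  then have "(\<lambda>k. (Cg * (Cf * V)) * (1 / (real k)\<^sup>2)) \<longlonglongrightarrow> 0" by (rule tendsto_mult_right_zero)
  moreover have "\<forall>\<^sub>F k in sequentially. cmod (g (approx X k \<phi>) - g (approx X' k \<phi>)) \<le> (Cg * (Cf * V)) * (1 / (real k)\<^sup>2)"
    by (rule eventually_mono[OF eventually_ge_at_top[of 1] diff])
  ultimately have "(\<lambda>k. g (approx X k \<phi>) - g (approx X' k \<phi>)) \<longlonglongrightarrow> 0"
    by (rule Lim_null_comparison[rotated])
  moreover have "(\<lambda>k. g (approx X k \<phi>) - g (approx X' k \<phi>)) \<longlonglongrightarrow> limit_functional X g \<phi> - limit_functional X' g \<phi>"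
    using limit_functional_bound[OF w a(1) X f g fg] limit_functional_bound[OF w a'(1) X' f g fg] a(2) a'(2)
    by (elim exE conjE, intro tendsto_diff) blast+
  ultimately show ?thesis using LIMSEQ_unique by fastforce
qed

text \<open>For a neighbourhood \<Omega> of K the cutoffs are chosen anew with support in \<Omega>.
  They give a functional on \<Omega>, which extends the original one by independence of the
  cutoff.\<close>

lemma limit_functional_carried:
  fixes X :: "('d::finite) cutoff_family"
  assumes w: "weight_function \<omega>" and K: "compact K" and X: "cutoffs K D \<eta> C X"
    and f: "f \<in> B_dual \<omega>" and g: "g \<in> E_dual_carried omega1 K" and fg: "\<forall>\<phi>\<in>DL1 omega1. f \<phi> = g \<phi>"
  shows "restrict0 (E_open \<omega> UNIV) (limit_functional X g) \<in> E_dual_carried \<omega> K"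
  unfolding E_dual_carried_def
proof (intro CollectI conjI allI impI)
  show "restrict0 (E_open \<omega> UNIV) (limit_functional X g) \<in> E_dual \<omega> UNIV"
    by (rule limit_functional_E_dual[OF w X open_UNIV subset_UNIV f g fg])
  fix \<Omega> :: "(real^'d) set" assume "open \<Omega> \<and> K \<subseteq> \<Omega>"
  then have \<Omega>: "open \<Omega>" "K \<subseteq> \<Omega>" by auto
  obtain \<eta>' D' C' X' where X': "D' \<subseteq> \<Omega>" "cutoffs K D' \<eta>' C' X'" using cutoffs_exist[OF K \<Omega>] by blast
  show "\<exists>h\<in>E_dual \<omega> \<Omega>. \<forall>\<phi>\<in>E_open \<omega> UNIV. h (restrict0 \<Omega> \<phi>) = restrict0 (E_open \<omega> UNIV) (limit_functional X g) \<phi>"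
  proof (intro bexI ballI)
    show "restrict0 (E_open \<omega> \<Omega>) (limit_functional X' g) \<in> E_dual \<omega> \<Omega>"
      by (rule limit_functional_E_dual[OF w X'(2) \<Omega>(1) X'(1) f g fg])
    fix \<phi> assume \<phi>: "\<phi> \<in> E_open \<omega> (UNIV :: (real^'d) set)"
    have "approx X' k (restrict0 \<Omega> \<phi>) = approx X' k \<phi>" for k
      by (rule approx_cong[OF X'(2)]) (use X'(1) in \<open>auto simp: restrict0_def\<close>)
    then have "limit_functional X' g (restrict0 \<Omega> \<phi>) = limit_functional X' g \<phi>" by (simp add: limit_functional_def)
    also have "\<dots> = limit_functional X g \<phi>" by (rule limit_functional_cutoff_independent[OF w X'(2) X f g fg \<phi>])
    finally show "restrict0 (E_open \<omega> \<Omega>) (limit_functional X' g) (restrict0 \<Omega> \<phi>) = restrict0 (E_open \<omega> UNIV) (limit_functional X g) \<phi>"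
      using \<phi> restrict0_in_E_open[OF open_UNIV \<Omega>(1) subset_UNIV \<phi>] by (simp add: restrict0_def[of "E_open \<omega> \<Omega>"] restrict0_def[of "E_open \<omega> UNIV"])
  qed
qed

section \<open>The approximate identity\<close>

lemma kap_of_real: "t \<noteq> 0 \<Longrightarrow> kap k (of_real t) = of_real (sin (real k * t) * exp (- real k * t\<^sup>2) / (pi * t))"
proof -
  assume t: "t \<noteq> 0"
  have "exp (\<i> * of_nat k * of_real t - of_nat k * (of_real t)\<^sup>2) - exp (- \<i> * of_nat k * of_real t - of_nat k * (of_real t)\<^sup>2) =
      2 * \<i> * of_real (sin (real k * t) * exp (- real k * t\<^sup>2))"
    by (simp add: complex_eq_iff Re_exp Im_exp power2_eq_square)
  then show ?thesis using t by (subst kap_nonzero) (auto simp: field_simps)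
qed

text \<open>From \<open>|sin u| \<le> |u|\<close> and \<open>|sin u| \<le> 1\<close>,
  respectively.\<close>

lemma kap_of_real_bound:
  "cmod (kap k (of_real t)) \<le> real k * exp (- real k * t\<^sup>2)" "cmod (kap k (of_real t)) * \<bar>t\<bar> \<le> exp (- real k * t\<^sup>2)"
proof -
  have pi1: "1 \<le> pi" using pi_gt3 by simp
  have eq: "cmod (kap k (of_real t)) * \<bar>t\<bar> = \<bar>sin (real k * t)\<bar> * exp (- real k * t\<^sup>2) / pi" if "t \<noteq> 0"
    using that by (simp add: kap_of_real norm_mult norm_divide abs_mult)
  show "cmod (kap k (of_real t)) \<le> real k * exp (- real k * t\<^sup>2)"
  proof (cases "t = 0")
    case True
    have "real k / pi \<le> real k / 1" using pi1 by (intro divide_left_mono) auto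
    then show ?thesis using True by (simp add: kap_def expm1_quot_def norm_divide)
  next
    case False
    have "\<bar>sin (real k * t)\<bar> \<le> real k * \<bar>t\<bar>" using abs_sin_x_le_abs_x[of "real k * t"] by (simp add: abs_mult)
    then have "\<bar>sin (real k * t)\<bar> * exp (- real k * t\<^sup>2) / pi \<le> real k * \<bar>t\<bar> * exp (- real k * t\<^sup>2) / 1"
      using pi1 by (intro frac_le mult_right_mono) auto
    then have "cmod (kap k (of_real t)) * \<bar>t\<bar> \<le> (real k * exp (- real k * t\<^sup>2)) * \<bar>t\<bar>" using eq[OF False] by (simp add: mult_ac)
    then show ?thesis using False by (simp only: mult_le_cancel_right)
  qed
  show "cmod (kap k (of_real t)) * \<bar>t\<bar> \<le> exp (- real k * t\<^sup>2)"
  proof (cases "t = 0")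
    case False
    have "\<bar>sin (real k * t)\<bar> * exp (- real k * t\<^sup>2) / pi \<le> 1 * exp (- real k * t\<^sup>2) / 1"
      using pi1 by (intro frac_le mult_right_mono) auto
    then show ?thesis using eq[OF False] by simp
  qed simp
qed

lemma gaussian_has_bochner_integral:
  assumes c: "c > 0"
  shows "has_bochner_integral lborel (\<lambda>t::real. exp (- c * t\<^sup>2)) (sqrt (pi / c))"
proof -
  define \<sigma> where "\<sigma> = sqrt (1 / (2 * c))"
  have \<sigma>: "\<sigma> > 0" "\<sigma>\<^sup>2 = 1 / (2 * c)" using c by (auto simp: \<sigma>_def)
  have "has_bochner_integral lborel (\<lambda>t. sqrt (pi / c) * normal_density 0 \<sigma> t) (sqrt (pi / c) * 1)"
    using integrable_normal_density[OF \<sigma>(1), of 0] integral_normal_density[OF \<sigma>(1), of 0]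
    by (intro has_bochner_integral_mult_right) (auto simp: has_bochner_integral_iff)
  moreover have "sqrt (pi / c) * normal_density 0 \<sigma> t = exp (- c * t\<^sup>2)" for t
    using c unfolding normal_density_def \<sigma>(2) by (simp add: field_simps)
  ultimately show ?thesis by simp
qed

lemma kap_measurable [measurable]: "(\<lambda>t::real. kap k (of_real t)) \<in> borel_measurable borel"
proof (rule borel_measurable_continuous_onI)
  have "continuous_on UNIV (kap k)" using kap_holomorphic holomorphic_on_imp_continuous_on by blast
  then show "continuous_on UNIV (\<lambda>t::real. kap k (of_real t))"
    by (rule continuous_on_compose2) (auto intro!: continuous_intros)
qed

lemma kap_integrable: "integrable lborel (\<lambda>t::real. kap k (of_real t))"
proof (cases "k = 0")
  case False
  have "has_bochner_integral lborel (\<lambda>t::real. real k * exp (- real k * t\<^sup>2)) (real k * sqrt (pi / real k))"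
    using False by (intro has_bochner_integral_mult_right gaussian_has_bochner_integral) simp
  then have "integrable lborel (\<lambda>t::real. real k * exp (- real k * t\<^sup>2))" by (simp add: has_bochner_integral_iff)
  then show ?thesis by (rule Bochner_Integration.integrable_bound) (use kap_of_real_bound(1) in auto)
qed (simp add: kap_def)

text \<open>The factor \<open>|t|\<close> cancels the denominator of the kernel and leaves a
  Gaussian of mass \<open>sqrt (pi / k)\<close>.\<close>

lemma kap_moment_bound:
  assumes k: "k \<ge> 1"
  shows "(\<integral>\<^sup>+ t. ennreal (cmod (kap k (of_real t)) * \<bar>t\<bar>) \<partial>lborel) \<le> ennreal (2 / sqrt (real k))"
proof -
  have h: "has_bochner_integral lborel (\<lambda>t::real. exp (- real k * t\<^sup>2)) (sqrt (pi / real k))"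
    using k by (intro gaussian_has_bochner_integral) simp
  have "(\<integral>\<^sup>+ t. ennreal (cmod (kap k (of_real t)) * \<bar>t\<bar>) \<partial>lborel) \<le> (\<integral>\<^sup>+ t. ennreal (exp (- real k * t\<^sup>2)) \<partial>lborel)"
    by (intro nn_integral_mono ennreal_leI kap_of_real_bound(2))
  also have "\<dots> = ennreal (sqrt (pi / real k))"
    using h by (subst nn_integral_eq_integral) (auto simp: has_bochner_integral_iff)
  also have "sqrt (pi / real k) \<le> 2 / sqrt (real k)"
  proof -
    have "sqrt pi \<le> 2" using pi_less_4 by (intro real_le_lsqrt) auto
    then show ?thesis by (simp add: real_sqrt_divide divide_right_mono)
  qed
  finally show ?thesis by (simp add: ennreal_leI)
qed

text \<open>As for the Dirichlet kernel: for \<open>|t| \<le> 1\<close> the bounds k and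
  \<open>1 / |t|\<close> combine to \<open>2 k / (1 + k |t|)\<close>, whose integral is logarithmic;
  farther out the Gaussian takes over.\<close>

lemma kap_norm_bound:
  assumes k: "k \<ge> 1"
  shows "(\<integral>\<^sup>+ t. ennreal (cmod (kap k (of_real t))) \<partial>lborel) \<le> ennreal (4 * ln (1 + real k) + 2)"
proof -
  let ?f = "\<lambda>t. 2 * real k / (1 + real k * t)" and ?g = "\<lambda>t. 2 * real k / (1 - real k * t)"
  have pw: "ennreal (cmod (kap k (of_real t))) \<le> ennreal (?f t) * indicator {0..1} t + ennreal (?g t) * indicator {-1..0} t + ennreal (exp (- 1 * t\<^sup>2))" for t :: real
  proof (cases "\<bar>t\<bar> \<le> 1")
    case True
    have e: "exp (- real k * t\<^sup>2) \<le> 1" by simp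
    have "cmod (kap k (of_real t)) \<le> real k" using kap_of_real_bound(1)[of k t] mult_left_mono[OF e, of "real k"] by simp
    moreover have "cmod (kap k (of_real t)) * \<bar>t\<bar> \<le> 1" using kap_of_real_bound(2)[of k t] e by linarith
    then have "real k * (cmod (kap k (of_real t)) * \<bar>t\<bar>) \<le> real k * 1" by (rule mult_left_mono) simp
    ultimately have "cmod (kap k (of_real t)) * (1 + real k * \<bar>t\<bar>) \<le> 2 * real k" by (simp add: algebra_simps)
    moreover have "1 + real k * \<bar>t\<bar> > 0" by (intro add_pos_nonneg) auto
    ultimately have b: "cmod (kap k (of_real t)) \<le> 2 * real k / (1 + real k * \<bar>t\<bar>)" by (simp only: pos_le_divide_eq)
    show ?thesis
    proof (cases "t \<ge> 0")
      case t: True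
      then have "ennreal (cmod (kap k (of_real t))) \<le> ennreal (?f t) * indicator {0..1} t" using b True by (simp add: ennreal_leI)
      also have "\<dots> \<le> \<dots> + (ennreal (?g t) * indicator {-1..0} t + ennreal (exp (- 1 * t\<^sup>2)))" by (rule add_increasing2) auto
      finally show ?thesis by (simp only: add.assoc)
    next
      case t: False
      then have "ennreal (cmod (kap k (of_real t))) \<le> ennreal (?g t) * indicator {-1..0} t" using b True by (simp add: ennreal_leI)
      also have "\<dots> \<le> \<dots> + (ennreal (?f t) * indicator {0..1} t + ennreal (exp (- 1 * t\<^sup>2)))" by (rule add_increasing2) auto
      finally show ?thesis by (simp only: add_ac)
    qed
  next
    case False
    have "cmod (kap k (of_real t)) * 1 \<le> cmod (kap k (of_real t)) * \<bar>t\<bar>" using False by (intro mult_left_mono) auto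
    also have "\<dots> \<le> exp (- real k * t\<^sup>2)" by (rule kap_of_real_bound(2))
    also have "\<dots> \<le> exp (- 1 * t\<^sup>2)" using k mult_right_mono[of 1 "real k" "t\<^sup>2"] by simp
    finally have "ennreal (cmod (kap k (of_real t))) \<le> ennreal (exp (- 1 * t\<^sup>2))" by (simp add: ennreal_leI)
    then show ?thesis by (rule add_increasing[OF zero_le])
  qed
  have "(\<integral>\<^sup>+ t. ennreal (cmod (kap k (of_real t))) \<partial>lborel) \<le>
     (\<integral>\<^sup>+ t. ennreal (?f t) * indicator {0..1} t + ennreal (?g t) * indicator {-1..0} t + ennreal (exp (- 1 * t\<^sup>2)) \<partial>lborel)"
    by (rule nn_integral_mono) (rule pw)
  also have "\<dots> = (\<integral>\<^sup>+ t. ennreal (?f t) * indicator {0..1} t \<partial>lborel) + (\<integral>\<^sup>+ t. ennreal (?g t) * indicator {-1..0} t \<partial>lborel) + (\<integral>\<^sup>+ t. ennreal (exp (- 1 * t\<^sup>2)) \<partial>lborel)"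
    by (subst nn_integral_add, simp, simp, subst nn_integral_add) auto
  also have "(\<integral>\<^sup>+ t. ennreal (?f t) * indicator {0..1} t \<partial>lborel) = ennreal (2 * ln (1 + real k * 1) - 2 * ln (1 + real k * 0))"
  proof (rule nn_integral_FTC_Icc)
    fix t :: real assume "t \<in> {0..1}"
    then have t: "0 \<le> t" "t \<le> 1" by auto
    have "1 + real k * t > 0" using t by (intro add_pos_nonneg) auto
    then show "((\<lambda>t. 2 * ln (1 + real k * t)) has_real_derivative ?f t) (at t)" "0 \<le> ?f t"
      by (auto intro!: derivative_eq_intros simp: field_simps)
  qed auto
  also have "(\<integral>\<^sup>+ t. ennreal (?g t) * indicator {-1..0} t \<partial>lborel) = ennreal (- 2 * ln (1 - real k * 0) - (- 2 * ln (1 - real k * (-1))))"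
  proof (rule nn_integral_FTC_Icc)
    fix t :: real assume "t \<in> {-1..0}"
    then have t: "-1 \<le> t" "t \<le> 0" by auto
    have "real k * t \<le> 0" using t by (simp add: mult_nonneg_nonpos)
    then have "1 - real k * t > 0" by simp
    then show "((\<lambda>t. - 2 * ln (1 - real k * t)) has_real_derivative ?g t) (at t)" "0 \<le> ?g t"
      by (auto intro!: derivative_eq_intros simp: field_simps)
  qed auto
  also have "(\<integral>\<^sup>+ t. ennreal (exp (- 1 * t\<^sup>2)) \<partial>lborel) = ennreal (sqrt (pi / 1))"
    using gaussian_has_bochner_integral[of 1] by (subst nn_integral_eq_integral) (auto simp: has_bochner_integral_iff)
  also have "ennreal (2 * ln (1 + real k * 1) - 2 * ln (1 + real k * 0)) + ennreal (- 2 * ln (1 - real k * 0) - (- 2 * ln (1 - real k * (-1)))) + ennreal (sqrt (pi / 1))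
     = ennreal (4 * ln (1 + real k) + sqrt pi)"
    by (simp flip: ennreal_plus)
  also have "\<dots> \<le> ennreal (4 * ln (1 + real k) + 2)"
    using pi_less_4 by (intro ennreal_leI add_left_mono real_le_lsqrt) auto
  finally show ?thesis .
qed

text \<open>
  By Levy's inversion formula the integral is the probability that a standard normal variable
  lies between \<open>- sqrt (k / 2)\<close> and \<open>sqrt (k / 2)\<close>.
\<close>

lemma kap_integral_tendsto: "(\<lambda>k. integral\<^sup>L lborel (\<lambda>t::real. kap k (of_real t))) \<longlonglongrightarrow> 1"
proof -
  interpret N: real_distribution std_normal_distribution by (rule real_dist_normal_dist)
  define A where "A k = {- sqrt (real k / 2) <.. sqrt (real k / 2)}" for k :: nat
  have point: "measure std_normal_distribution {a} = 0" for a :: real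
    by (simp add: measure_def emeasure_density nn_integral_indicator_singleton)
  have eq: "integral\<^sup>L lborel (\<lambda>t::real. kap k (of_real t)) = of_real (measure std_normal_distribution (A k))" if k: "k \<ge> 1" for k
  proof (rule LIMSEQ_unique)
    let ?s = "sqrt (real k / 2)"
    \<comment> \<open>The substitution \<open>u = c * t\<close> turns \<open>exp (- k t^2)\<close>
      into \<open>exp (- u^2 / 2)\<close>, the characteristic function of the standard normal
      distribution, and \<open>k t\<close> into u times the end point of the interval.\<close>
    define c where "c = sqrt (2 * real k)"
    have c: "c > 0" using k by (simp add: c_def)
    have cs: "c * ?s = real k" using k by (simp add: c_def flip: real_sqrt_mult)
    have c2: "c\<^sup>2 = 2 * real k" by (simp add: c_def)
    define H where "H u = of_real (2 * pi / c) * kap k (of_real (u / c))" for u :: real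
    have H_int: "integrable lborel H"
    proof -
      have "integrable lborel (\<lambda>u::real. kap k (of_real (0 + (1 / c) * u)))"
        using kap_integrable c by (intro lborel_integrable_real_affine[where f = "\<lambda>t. kap k (of_real t)"]) auto
      then show ?thesis unfolding H_def[abs_def] by (intro integrable_mult_right) simp
    qed
    have H_total: "integral\<^sup>L lborel H = of_real (2 * pi) * integral\<^sup>L lborel (\<lambda>t::real. kap k (of_real t))"
    proof -
      have "integral\<^sup>L lborel H = \<bar>c\<bar> *\<^sub>R integral\<^sup>L lborel (\<lambda>x. H (0 + c * x))"
        using c by (intro lborel_integral_real_affine) simp
      also have "(\<lambda>x. H (0 + c * x)) = (\<lambda>x. of_real (2 * pi / c) * kap k (of_real x))" using c by (simp add: H_def fun_eq_iff)
      finally show ?thesis using c by (simp add: scaleR_conv_of_real)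
    qed
    have H_eq: "(iexp (- (u * - ?s)) - iexp (- (u * ?s))) / (\<i> * of_real u) * char std_normal_distribution u = H u" if u: "u \<noteq> 0" for u
    proof -
      have arg: "real k * (u / c) = u * ?s"
      proof -
        have "real k * (u / c) = (c * ?s) * (u / c)" by (simp only: cs)
        then show ?thesis using c by simp
      qed
      have sq: "real k * (u / c)\<^sup>2 = u\<^sup>2 / 2" using k by (simp add: power_divide c2)
      have "H u = of_real (2 * pi / c) * of_real (sin (u * ?s) * exp (- (u\<^sup>2 / 2)) / (pi * (u / c)))"
        unfolding H_def using u c by (subst kap_of_real) (simp_all only: mult_minus_left arg sq divide_eq_0_iff, auto)
      also have "\<dots> = of_real (2 * sin (u * ?s) * exp (- (u\<^sup>2 / 2)) / u)"
        using u c by (simp add: field_simps)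
      finally have "H u = of_real (2 * sin (u * ?s) * exp (- (u\<^sup>2 / 2)) / u)" .
      moreover have "iexp (- (u * - ?s)) - iexp (- (u * ?s)) = 2 * \<i> * of_real (sin (u * ?s))"
        by (simp add: complex_eq_iff Re_exp Im_exp)
      ultimately show ?thesis using u by (simp add: char_std_normal_distribution field_simps)
    qed
    have "(\<lambda>T. 1 / (2 * pi) * (CLBINT t=-real T..real T. (iexp (- (t * - ?s)) - iexp (- (t * ?s))) / (\<i> * of_real t) * char std_normal_distribution t))
       \<longlonglongrightarrow> of_real (measure std_normal_distribution {- ?s<..?s})"
      by (rule N.Levy_Inversion[unfolded of_int_minus of_int_of_nat_eq]) (use point k in auto)
    moreover have "(CLBINT t=-real T..real T. (iexp (- (t * - ?s)) - iexp (- (t * ?s))) / (\<i> * of_real t) * char std_normal_distribution t)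
       = integral\<^sup>L lborel (\<lambda>t. indicator {- real T..real T} t *\<^sub>R H t)" for T :: nat
    proof -
      have "(CLBINT t=-real T..real T. (iexp (- (t * - ?s)) - iexp (- (t * ?s))) / (\<i> * of_real t) * char std_normal_distribution t)
        = (CLBINT t:{-real T..real T}. (iexp (- (t * - ?s)) - iexp (- (t * ?s))) / (\<i> * of_real t) * char std_normal_distribution t)"
        by (rule interval_integral_Icc) simp
      also have "\<dots> = integral\<^sup>L lborel (\<lambda>t. indicator {- real T..real T} t *\<^sub>R H t)"
        unfolding set_lebesgue_integral_def
      \<comment> \<open>At 0 the quotient in the inversion formula is 0 by the convention for
        division, unlike \<open>H 0\<close>; a single point does not change the integral.\<close>
      proof (rule integral_discrete_difference[of "{0}"])
        fix t :: real assume "t \<notin> {0}"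
        then have "t \<noteq> 0" by simp
        then show "indicator {- real T..real T} t *\<^sub>R ((iexp (- (t * - ?s)) - iexp (- (t * ?s))) / (\<i> * of_real t) * char std_normal_distribution t)
          = indicator {- real T..real T} t *\<^sub>R H t" using H_eq by metis
      qed auto
      finally show ?thesis .
    qed
    ultimately show "(\<lambda>T. 1 / (2 * pi) * integral\<^sup>L lborel (\<lambda>t. indicator {- real T..real T} t *\<^sub>R H t)) \<longlonglongrightarrow> of_real (measure std_normal_distribution (A k))"
      by (simp add: A_def)
    have "(\<lambda>T. integral\<^sup>L lborel (\<lambda>t. indicator {- real T..real T} t *\<^sub>R H t)) \<longlonglongrightarrow> integral\<^sup>L lborel H"
    proof (rule integral_dominated_convergence[where w = "\<lambda>t. cmod (H t)"])
      show "AE t in lborel. (\<lambda>T. indicator {- real T..real T} t *\<^sub>R H t) \<longlonglongrightarrow> H t"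
      proof (rule always_eventually, rule allI, rule tendsto_eventually)
        fix t :: real
        obtain N :: nat where "\<bar>t\<bar> \<le> real N" using real_arch_simple by blast
        then show "\<forall>\<^sub>F T in sequentially. indicator {- real T..real T} t *\<^sub>R H t = H t"
          by (intro eventually_sequentiallyI[of N]) (auto simp: indicator_def)
      qed
    qed (use H_int in \<open>auto simp: indicator_def\<close>)
    then have "(\<lambda>T. 1 / (2 * pi) * integral\<^sup>L lborel (\<lambda>t. indicator {- real T..real T} t *\<^sub>R H t)) \<longlonglongrightarrow> 1 / (2 * pi) * integral\<^sup>L lborel H"
      by (rule tendsto_mult_left)
    then show "(\<lambda>T. 1 / (2 * pi) * integral\<^sup>L lborel (\<lambda>t. indicator {- real T..real T} t *\<^sub>R H t)) \<longlonglongrightarrow> integral\<^sup>L lborel (\<lambda>t::real. kap k (of_real t))"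
      unfolding H_total by simp
  qed
  have "(\<Union>k. A k) = UNIV"
  proof -
    have "x \<in> (\<Union>k. A k)" for x
    proof -
      obtain k :: nat where "2 * x\<^sup>2 < real k" using reals_Archimedean2 by blast
      then have "sqrt (x\<^sup>2) < sqrt (real k / 2)" by (intro real_sqrt_less_mono) simp
      then have "x \<in> A k" by (auto simp: A_def)
      then show ?thesis by blast
    qed
    then show ?thesis by blast
  qed
  moreover have "incseq A"
  proof (rule incseq_SucI)
    fix k
    have "{- r<..r} \<subseteq> {- r'<..r'}" if "r \<le> r'" for r r' :: real using that by auto
    moreover have "sqrt (real k / 2) \<le> sqrt (real (Suc k) / 2)" by simp
    ultimately show "A k \<le> A (Suc k)" unfolding A_def by blast
  qed
  moreover have "range A \<subseteq> sets std_normal_distribution" by (auto simp: A_def)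
  ultimately have "(\<lambda>k. measure std_normal_distribution (A k)) \<longlonglongrightarrow> measure std_normal_distribution UNIV"
    using N.finite_Lim_measure_incseq[of A] by simp
  moreover have "measure std_normal_distribution UNIV = 1" using N.prob_space by simp
  ultimately have "(\<lambda>k. complex_of_real (measure std_normal_distribution (A k))) \<longlonglongrightarrow> of_real 1"
    by (intro tendsto_of_real) simp
  then have "(\<lambda>k. integral\<^sup>L lborel (\<lambda>t::real. kap k (of_real t))) \<longlonglongrightarrow> of_real 1"
    by (rule Lim_transform_eventually) (use eventually_ge_at_top[of 1] in eventually_elim, simp add: eq)
  then show ?thesis by simp
qed

lemma integral_lborel_vec_prod:
  fixes f :: "'d::finite \<Rightarrow> real \<Rightarrow> complex"
  assumes f: "\<And>i. integrable lborel (f i)"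
  shows "integral\<^sup>L (lborel :: (real^'d) measure) (\<lambda>y. \<Prod>i\<in>UNIV. f i (y $ i)) = (\<Prod>i\<in>UNIV. integral\<^sup>L lborel (f i))"
proof -
  interpret product_sigma_finite "\<lambda>_. lborel :: real measure" ..
  define g where "g b = f (SOME i. b = axis i (1::real))" for b :: "real^'d"
  have g: "g (axis i 1) = f i" for i
  proof -
    have "(SOME j. axis i (1::real) = axis j 1) = i" by (rule some_equality) (auto simp: axis_eq_axis)
    then show ?thesis by (simp add: g_def)
  qed
  have g_int: "integrable lborel (g b)" for b by (simp add: g_def f)
  have [measurable]: "g b \<in> borel_measurable borel" for b using borel_measurable_integrable[OF g_int] by simp
  have "integral\<^sup>L (lborel :: (real^'d) measure) (\<lambda>y. \<Prod>b\<in>Basis. g b (y \<bullet> b)) =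
      integral\<^sup>L (\<Pi>\<^sub>M b\<in>(Basis :: (real^'d) set). lborel) (\<lambda>h. \<Prod>b\<in>Basis. g b ((\<Sum>b\<in>Basis. h b *\<^sub>R b) \<bullet> b))"
    unfolding lborel_def[where 'a = "real^'d"] lborel_eq_real[symmetric] by (rule integral_distr) measurable
  also have "\<dots> = integral\<^sup>L (\<Pi>\<^sub>M b\<in>(Basis :: (real^'d) set). lborel) (\<lambda>h. \<Prod>b\<in>Basis. g b (h b))"
    by (intro Bochner_Integration.integral_cong refl prod.cong) (simp add: inner_sum_left inner_Basis if_distrib sum.delta cong: if_cong)
  also have "\<dots> = (\<Prod>b\<in>(Basis :: (real^'d) set). integral\<^sup>L lborel (g b))"
    by (rule product_integral_prod) (auto simp: g_int)
  finally show ?thesis unfolding prod_Basis_vec g by (simp add: inner_axis)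
qed

lemma kap_norm_moment_tendsto: "(\<lambda>k. C * (2 / sqrt (real k) * (4 * ln (1 + real k) + 2) ^ m)) \<longlonglongrightarrow> 0"
  by real_asymp

section \<open>Convergence of the approximations with all derivatives\<close>

lemma vd_norm_le:
  fixes h :: "real \<Rightarrow> complex"
  assumes h: "(h has_vector_derivative D) (at 0)" and b: "eventually (\<lambda>t. norm (h t - h 0) \<le> c * \<bar>t\<bar>) (at 0)"
  shows "norm D \<le> c"
proof -
  have "((\<lambda>t. norm ((h t - h 0) - (t - 0) *\<^sub>R D) / norm (t - 0)) \<longlongrightarrow> 0) (at 0)"
    using h unfolding has_vector_derivative_def has_derivative_iff_norm by blast
  moreover have "eventually (\<lambda>t::real. t \<noteq> 0) (at 0)" by (simp add: eventually_at_filter)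
  then have "eventually (\<lambda>t. norm D - c \<le> norm ((h t - h 0) - (t - 0) *\<^sub>R D) / norm (t - 0)) (at 0)"
    using b
  proof eventually_elim
    case (elim t)
    have "norm (t *\<^sub>R D) \<le> norm (h t - h 0) + norm ((h t - h 0) - t *\<^sub>R D)"
      using norm_triangle_ineq4[of "h t - h 0" "(h t - h 0) - t *\<^sub>R D"] by simp
    then have "(norm D - c) * \<bar>t\<bar> \<le> norm ((h t - h 0) - t *\<^sub>R D)" using elim by (simp add: algebra_simps)
    then show ?case using elim by (simp add: pos_le_divide_eq)
  qed
  ultimately have "norm D - c \<le> 0" by (rule tendsto_lowerbound) simp
  then show ?thesis by simp
qed

lemma vd_increment_bound:
  fixes g :: "real \<Rightarrow> complex"
  assumes g: "\<And>r. \<bar>r\<bar> \<le> \<bar>s\<bar> \<Longrightarrow> (g has_vector_derivative g' r) (at r)" and b: "\<And>r. \<bar>r\<bar> \<le> \<bar>s\<bar> \<Longrightarrow> norm (g' r) \<le> c"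
  shows "norm (g s - g 0) \<le> c * \<bar>s\<bar>"
proof -
  let ?S = "{- \<bar>s\<bar>..\<bar>s\<bar>}"
  have "norm (g s - g 0) \<le> c * norm (s - 0)"
  proof (rule differentiable_bound[of ?S])
    fix r assume "r \<in> ?S"
    then have r: "\<bar>r\<bar> \<le> \<bar>s\<bar>" by auto
    show "(g has_derivative (\<lambda>h. h *\<^sub>R g' r)) (at r within ?S)"
      using g[OF r] unfolding has_vector_derivative_def by (rule has_derivative_at_withinI)
    show "onorm (\<lambda>h. h *\<^sub>R g' r) \<le> c"
    proof (rule onorm_le)
      fix h :: real
      show "norm (h *\<^sub>R g' r) \<le> c * norm h" using mult_right_mono[OF b[OF r], of "\<bar>h\<bar>"] by (simp add: mult.commute)
    qed
  qed (auto simp: abs_if)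
  then show ?thesis by simp
qed

text \<open>Induction along the list of \<alpha>. The mean value inequality for
  \<open>F l - F k\<close> along an axis survives the limit in l and bounds the difference quotients
  of \<open>\<phi> - F k\<close>, one derivative lower, by the constant for \<alpha>. As \<phi> is
  smooth, this bounds the derivative itself.\<close>

lemma mderiv_limit_bound:
  fixes F :: "nat \<Rightarrow> real^'d::finite \<Rightarrow> complex"
  assumes U: "open U" and F: "\<And>k. smooth_on U (F k)" and \<phi>: "smooth_on U \<phi>" and k0: "k0 \<ge> 1"
    and inc: "\<And>\<alpha> k x. k \<ge> k0 \<Longrightarrow> x \<in> U \<Longrightarrow> cmod (mderiv \<alpha> (F (Suc k)) x - mderiv \<alpha> (F k) x) \<le> c \<alpha> / (real k)\<^sup>2"
    and lim: "\<And>x. x \<in> U \<Longrightarrow> (\<lambda>k. F k x) \<longlonglongrightarrow> \<phi> x"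
    and k: "k \<ge> k0" and x: "x \<in> U"
  shows "cmod (mderiv \<alpha> \<phi> x - mderiv \<alpha> (F k) x) \<le> 2 * c \<alpha> / real k"
proof -
  have tele: "cmod (mderiv \<alpha> (F l) x - mderiv \<alpha> (F k) x) \<le> 2 * c \<alpha> / real k" if "k \<ge> k0" "l \<ge> k" "x \<in> U" for \<alpha> k l x
    by (rule telescope_bound[of k "\<lambda>l. mderiv \<alpha> (F l) x"]) (use that k0 inc in auto)
  have step: "\<forall>k\<ge>k0. \<forall>x\<in>U. cmod (mderiv \<alpha> \<phi> x - mderiv \<alpha> (F k) x) \<le> 2 * c \<alpha> / real k" if "mlist \<alpha> = js" for js \<alpha>
    using that
  proof (induction js arbitrary: \<alpha>)
    case Nil
    have e: "mderiv \<alpha> f = f" for f :: "real^'d \<Rightarrow> complex" unfolding mderiv_mlist Nil by simp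
    show ?case
    proof (intro allI impI ballI)
      fix k x assume k: "k \<ge> k0" and x: "x \<in> U"
      have "(\<lambda>l. cmod (F l x - F k x)) \<longlonglongrightarrow> cmod (\<phi> x - F k x)" by (intro tendsto_intros lim x)
      then have "cmod (\<phi> x - F k x) \<le> 2 * c \<alpha> / real k"
        by (rule LIMSEQ_le_const2) (use tele[OF k _ x, of _ \<alpha>] in \<open>auto simp: e\<close>)
      then show "cmod (mderiv \<alpha> \<phi> x - mderiv \<alpha> (F k) x) \<le> 2 * c \<alpha> / real k" by (simp add: e)
    qed
  next
    case (Cons i js)
    define \<beta> where "\<beta> = \<alpha>(i := \<alpha> i - 1)"
    have js: "mlist \<beta> = js" using mlist_Cons[OF Cons.prems] by (simp add: \<beta>_def)
    have lim': "(\<lambda>k. mderiv \<beta> (F k) x) \<longlonglongrightarrow> mderiv \<beta> \<phi> x" if x: "x \<in> U" for x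
    proof -
      have "(\<lambda>k. 2 * c \<beta> / real k) \<longlonglongrightarrow> 0" by (rule lim_const_over_n)
      moreover have "eventually (\<lambda>k. cmod (mderiv \<beta> (F k) x - mderiv \<beta> \<phi> x) \<le> 2 * c \<beta> / real k) sequentially"
        using eventually_ge_at_top[of k0] by eventually_elim (use Cons.IH[OF js] x in \<open>simp add: norm_minus_commute\<close>)
      ultimately have "(\<lambda>k. mderiv \<beta> (F k) x - mderiv \<beta> \<phi> x) \<longlonglongrightarrow> 0" by (rule Lim_null_comparison[rotated])
      then show ?thesis by (simp add: LIM_zero_iff)
    qed
    have vd: "((\<lambda>t. mderiv \<beta> f (x + t *\<^sub>R axis i 1)) has_vector_derivative mderiv \<alpha> f (x + t *\<^sub>R axis i 1)) (at t)"
      if "smooth_on U f" "x + t *\<^sub>R axis i 1 \<in> U" for f x t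
      unfolding mderiv_mlist js Cons.prems
      by (rule has_vd_partial_shift) (rule smooth_on_foldr_has_vd[OF that])
    show ?case
    proof (intro allI impI ballI)
      fix k x assume k: "k \<ge> k0" and x: "x \<in> U"
      let ?e = "\<lambda>t. x + t *\<^sub>R axis i (1::real)"
      obtain \<delta> where \<delta>: "\<delta> > 0" "ball x \<delta> \<subseteq> U" using U x openE by blast
      have eU: "?e t \<in> U" if "\<bar>t\<bar> < \<delta>" for t
        using that \<delta>(2) by (auto simp: dist_norm)
      let ?h = "\<lambda>t. mderiv \<beta> \<phi> (?e t) - mderiv \<beta> (F k) (?e t)"
      have "cmod (?h t - ?h 0) \<le> (2 * c \<alpha> / real k) * \<bar>t\<bar>" if t: "\<bar>t\<bar> < \<delta>" for t
      proof -
        let ?q = "\<lambda>l t. mderiv \<beta> (F l) (?e t) - mderiv \<beta> (F k) (?e t)"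
        have "cmod (?q l t - ?q l 0) \<le> (2 * c \<alpha> / real k) * \<bar>t\<bar>" if l: "l \<ge> k" for l
        proof (rule vd_increment_bound)
          fix r assume "\<bar>r\<bar> \<le> \<bar>t\<bar>"
          then have r: "?e r \<in> U" using t by (intro eU) simp
          show "(?q l has_vector_derivative mderiv \<alpha> (F l) (?e r) - mderiv \<alpha> (F k) (?e r)) (at r)"
            by (intro has_vector_derivative_diff vd F r)
          show "cmod (mderiv \<alpha> (F l) (?e r) - mderiv \<alpha> (F k) (?e r)) \<le> 2 * c \<alpha> / real k" by (rule tele[OF k l r])
        qed
        moreover have "(\<lambda>l. cmod (?q l t - ?q l 0)) \<longlonglongrightarrow> cmod (?h t - ?h 0)"
          by (intro tendsto_intros lim' eU) (use t \<delta>(1) in auto)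
        ultimately show ?thesis by (intro LIMSEQ_le_const2) auto
      qed
      then have "eventually (\<lambda>t. cmod (?h t - ?h 0) \<le> (2 * c \<alpha> / real k) * \<bar>t\<bar>) (at 0)"
        unfolding eventually_at using \<delta>(1) by (intro exI[of _ \<delta>]) (auto simp: dist_real_def)
      moreover have "(?h has_vector_derivative mderiv \<alpha> \<phi> (?e 0) - mderiv \<alpha> (F k) (?e 0)) (at 0)"
        by (intro has_vector_derivative_diff vd \<phi> F) (use x in auto)
      ultimately have "cmod (mderiv \<alpha> \<phi> (?e 0) - mderiv \<alpha> (F k) (?e 0)) \<le> 2 * c \<alpha> / real k"
        by (intro vd_norm_le[where h = ?h])
      then show "cmod (mderiv \<alpha> \<phi> x - mderiv \<alpha> (F k) x) \<le> 2 * c \<alpha> / real k" by simp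
    qed
  qed
  then show ?thesis using k x by blast
qed

text \<open>From x to y the coordinates are changed one at a time. The intermediate points are in
  each coordinate no farther from x than y is, so they stay in the ball.\<close>

lemma smooth_lipschitz_at:
  fixes \<phi> :: "real^'d::finite \<Rightarrow> complex"
  assumes \<phi>: "smooth_on (ball x r) \<phi>" and r: "r > 0"
  shows "\<exists>M\<ge>0. \<forall>y\<in>cball x (r / 2). cmod (\<phi> y - \<phi> x) \<le> M * (\<Sum>i\<in>UNIV. \<bar>y $ i - x $ i\<bar>)"
proof -
  let ?B = "cball x (r / 2)"
  have sub: "?B \<subseteq> ball x r" using r by auto
  have "\<exists>M. \<forall>y\<in>?B. cmod (partial_deriv i \<phi> y) \<le> M" for i
  proof -
    have "compact (partial_deriv i \<phi> ` ?B)"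
      by (intro compact_continuous_image continuous_on_subset[OF smooth_on_continuous[OF smooth_on_partial[OF \<phi>]] sub] compact_cball)
    then have "bounded (partial_deriv i \<phi> ` ?B)" by (rule compact_imp_bounded)
    then show ?thesis by (auto simp: bounded_iff)
  qed
  then obtain m where m: "\<And>i y. y \<in> ?B \<Longrightarrow> cmod (partial_deriv i \<phi> y) \<le> m i" by metis
  define M where "M = (\<Sum>i\<in>UNIV. \<bar>m i\<bar>)"
  have M: "M \<ge> 0" by (simp add: M_def sum_nonneg)
  have mM: "m i \<le> M" for i
  proof -
    have "\<bar>m i\<bar> \<le> M" unfolding M_def by (rule member_le_sum) auto
    then show ?thesis by simp
  qed
  have "cmod (\<phi> y - \<phi> x) \<le> M * (\<Sum>i\<in>UNIV. \<bar>y $ i - x $ i\<bar>)" if y: "y \<in> ?B" for y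
  proof -
    define z where "z S = (\<chi> i. if i \<in> S then y $ i else x $ i)" for S
    have near: "w \<in> ?B" if "\<And>i. \<bar>w $ i - x $ i\<bar> \<le> \<bar>y $ i - x $ i\<bar>" for w
    proof -
      have "norm (w - x) \<le> norm (y - x)" by (rule norm_le_componentwise_cart) (use that in simp)
      then show ?thesis using y by (simp add: dist_norm norm_minus_commute)
    qed
    have "cmod (\<phi> (z S) - \<phi> x) \<le> M * (\<Sum>i\<in>S. \<bar>y $ i - x $ i\<bar>)" if "finite S" for S
      using that
    proof (induction S rule: finite_induct)
      case empty
      have "z {} = x" by (simp add: z_def vec_eq_iff)
      then show ?case by simp
    next
      case (insert i S)
      let ?s = "y $ i - x $ i"
      let ?e = "\<lambda>r. z S + r *\<^sub>R axis i (1::real)"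
      have zi: "?e ?s = z (insert i S)" using insert.hyps by (auto simp: z_def vec_eq_iff axis_def)
      have eB: "?e r \<in> ?B" if "\<bar>r\<bar> \<le> \<bar>?s\<bar>" for r
        by (rule near) (use that insert.hyps in \<open>auto simp: z_def axis_def\<close>)
      have "cmod (\<phi> (?e ?s) - \<phi> (?e 0)) \<le> M * \<bar>?s\<bar>"
      proof (rule vd_increment_bound)
        fix r assume r: "\<bar>r\<bar> \<le> \<bar>?s\<bar>"
        show "((\<lambda>r. \<phi> (?e r)) has_vector_derivative partial_deriv i \<phi> (?e r)) (at r)"
          by (rule smooth_on_has_vd_at[OF \<phi>]) (use eB[OF r] sub in blast)
        show "cmod (partial_deriv i \<phi> (?e r)) \<le> M" using m[OF eB[OF r], of i] mM[of i] by simp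
      qed
      then have "cmod (\<phi> (z (insert i S)) - \<phi> (z S)) \<le> M * \<bar>?s\<bar>" by (simp add: zi)
      then show ?case using insert norm_triangle_ineq[of "\<phi> (z (insert i S)) - \<phi> (z S)" "\<phi> (z S) - \<phi> x"]
        by (simp add: distrib_left)
    qed
    from this[of UNIV] show ?thesis by (simp add: z_def)
  qed
  then show ?thesis using M by blast
qed

text \<open>Beyond distance \<open>r / 2\<close> the bound \<open>2 * V\<close> is itself at most
  \<open>4 * V / r\<close> times the distance.\<close>

lemma bounded_lipschitz_at:
  fixes v :: "real^'d::finite \<Rightarrow> complex"
  assumes \<phi>: "smooth_on (ball x r) \<phi>" and r: "r > 0" and eq: "\<And>y. dist x y < r \<Longrightarrow> v y = \<phi> y" and V: "\<And>y. cmod (v y) \<le> V"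
  shows "\<exists>M\<ge>0. \<forall>y. cmod (v y - v x) \<le> M * (\<Sum>i\<in>UNIV. \<bar>y $ i - x $ i\<bar>)"
proof -
  obtain M where M: "M \<ge> 0" "\<And>y. y \<in> cball x (r / 2) \<Longrightarrow> cmod (\<phi> y - \<phi> x) \<le> M * (\<Sum>i\<in>UNIV. \<bar>y $ i - x $ i\<bar>)"
    using smooth_lipschitz_at[OF \<phi> r] by blast
  have V0: "V \<ge> 0" using V[of x] norm_ge_zero order_trans by blast
  have "cmod (v y - v x) \<le> (M + 4 * V / r) * (\<Sum>i\<in>UNIV. \<bar>y $ i - x $ i\<bar>)" for y
  proof (cases "y \<in> cball x (r / 2)")
    case True
    then have "cmod (v y - v x) \<le> M * (\<Sum>i\<in>UNIV. \<bar>y $ i - x $ i\<bar>)" using M(2)[OF True] eq[of y] eq[of x] r by simp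
    also have "\<dots> \<le> (M + 4 * V / r) * (\<Sum>i\<in>UNIV. \<bar>y $ i - x $ i\<bar>)" using V0 r by (intro mult_right_mono sum_nonneg) auto
    finally show ?thesis .
  next
    case False
    then have "r / 2 \<le> norm (y - x)" by (simp add: dist_norm norm_minus_commute)
    also have "\<dots> \<le> (\<Sum>i\<in>UNIV. \<bar>(y - x) $ i\<bar>)" by (rule norm_le_l1_cart)
    finally have s: "r / 2 \<le> (\<Sum>i\<in>UNIV. \<bar>y $ i - x $ i\<bar>)" by simp
    have "cmod (v y - v x) \<le> V + V" by (intro order_trans[OF norm_triangle_ineq4] add_mono V)
    also have "\<dots> = (4 * V / r) * (r / 2)" using r by simp
    also have "\<dots> \<le> (M + 4 * V / r) * (\<Sum>i\<in>UNIV. \<bar>y $ i - x $ i\<bar>)" using V0 r M(1) s by (intro mult_mono) auto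
    finally show ?thesis .
  qed
  moreover have "M + 4 * V / r \<ge> 0" using M(1) V0 r by simp
  ultimately show ?thesis by blast
qed

text \<open>The L1 norms of the kernels are bounded only by a power of a logarithm, so the usual
  argument for approximate identities is not enough. The Lipschitz bound at x brings in one first
  moment, of order \<open>1 / sqrt k\<close>, which beats the logarithms from the other
  coordinates.\<close>

lemma smoothed_pointwise_tendsto:
  fixes v :: "real^'d::finite \<Rightarrow> complex"
  assumes v: "continuous_on UNIV v" "\<forall>y. y \<notin> cbox a b \<longrightarrow> v y = 0" and V: "\<And>y. cmod (v y) \<le> V"
    and M: "M \<ge> 0" "\<And>y. cmod (v y - v x) \<le> M * (\<Sum>i\<in>UNIV. \<bar>y $ i - x $ i\<bar>)"
  shows "(\<lambda>k. smoothed k (\<lambda>_. 0) v x) \<longlonglongrightarrow> v x"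
proof -
  let ?d = "CARD('d)"
  define f where "f k i t = kap k (of_real (x $ i - t))" for k i t
  define F where "F k y = (\<Prod>i\<in>UNIV. f k i (y $ i))" for k and y :: "real^'d"
  define I where "I k = integral\<^sup>L lborel (\<lambda>t::real. kap k (of_real t))" for k
  have [measurable]: "f k i \<in> borel_measurable borel" for k i unfolding f_def[abs_def] by measurable
  have [measurable]: "v \<in> borel_measurable borel" by (rule borel_measurable_continuous_onI[OF v(1)])
  have [measurable]: "F k \<in> borel_measurable borel" for k unfolding F_def[abs_def] by measurable
  have f_int: "integrable lborel (f k i)" for k i
    using lborel_integrable_real_affine[OF kap_integrable, where c = "-1" and t = "x $ i", of k] by (simp add: f_def[abs_def])
  have f_I: "integral\<^sup>L lborel (f k i) = I k" for k i
    using lborel_integral_real_affine[where c = "-1" and f = "\<lambda>t::real. kap k (of_real t)" and t = "x $ i"] by (simp add: I_def f_def[abs_def])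
  have f_nn: "(\<integral>\<^sup>+ t. ennreal (cmod (f k i t)) \<partial>lborel) \<le> ennreal (4 * ln (1 + real k) + 2)" if "k \<ge> 1" for k i
    using kap_norm_bound[OF that] nn_integral_real_affine[where f = "\<lambda>t. ennreal (cmod (kap k (of_real t)))" and c = "-1" and t = "x $ i"] by (simp add: f_def)
  have f_mom: "(\<integral>\<^sup>+ t. ennreal (cmod (f k i t) * \<bar>t - x $ i\<bar>) \<partial>lborel) \<le> ennreal (2 / sqrt (real k))" if "k \<ge> 1" for k i
    using kap_moment_bound[OF that] nn_integral_real_affine[where f = "\<lambda>t. ennreal (cmod (kap k (of_real t)) * \<bar>t\<bar>)" and c = "-1" and t = "x $ i"]
    by (simp add: f_def abs_minus_commute)
  have F_int: "integrable lborel (F k)" if "k \<ge> 1" for k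
    unfolding integrable_iff_bounded
  proof
    have "(\<integral>\<^sup>+ y. ennreal (norm (F k y)) \<partial>lborel) = (\<integral>\<^sup>+ y. (\<Prod>i\<in>UNIV. ennreal (cmod (f k i (y $ i)))) \<partial>lborel)"
      by (simp add: F_def prod_norm[symmetric] prod_ennreal)
    also have "\<dots> = (\<Prod>i\<in>UNIV. \<integral>\<^sup>+ t. ennreal (cmod (f k i t)) \<partial>lborel)" by (rule nn_integral_lborel_vec_prod) simp
    also have "\<dots> \<le> (\<Prod>i\<in>(UNIV :: 'd set). ennreal (4 * ln (1 + real k) + 2))" by (intro prod_mono_ennreal f_nn[OF that])
    also have "\<dots> < \<infinity>" by (simp add: power_less_top_ennreal)
    finally show "(\<integral>\<^sup>+ y. ennreal (norm (F k y)) \<partial>lborel) < \<infinity>" .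
  qed simp
  have V0: "V \<ge> 0" using V[of x] norm_ge_zero order_trans by blast
  have Fv_int: "integrable lborel (\<lambda>y. F k y * v y)" if "k \<ge> 1" for k
  proof (rule Bochner_Integration.integrable_bound[of _ "\<lambda>y. of_real V * F k y"])
    show "AE y in lborel. norm (F k y * v y) \<le> norm (of_real V * F k y)"
    proof (rule AE_I2)
      fix y show "norm (F k y * v y) \<le> norm (of_real V * F k y)"
        using mult_right_mono[OF V[of y], of "cmod (F k y)"] V0 by (simp add: norm_mult mult.commute)
    qed
  qed (use F_int[OF that] in auto)
  have S: "smoothed k (\<lambda>_. 0) v x = integral\<^sup>L lborel (\<lambda>y. F k y * v y)" if "k \<ge> 1" for k
    unfolding pconv_def using integral_lborel[OF Fv_int[OF that]] by (simp add: F_def f_def entire_kernel_def ker_def)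
  have diff: "cmod (smoothed k (\<lambda>_. 0) v x - v x * I k ^ ?d) \<le> (M * real ?d) * (2 / sqrt (real k) * (4 * ln (1 + real k) + 2) ^ (?d - 1))" if k: "k \<ge> 1" for k
  proof -
    let ?L = "4 * ln (1 + real k) + 2"
    have L: "?L \<ge> 0" by simp
    have "integral\<^sup>L lborel (F k) = I k ^ ?d" unfolding F_def[abs_def] by (subst integral_lborel_vec_prod) (auto simp: f_int f_I)
    then have "smoothed k (\<lambda>_. 0) v x - v x * I k ^ ?d = integral\<^sup>L lborel (\<lambda>y. F k y * v y) - integral\<^sup>L lborel (\<lambda>y. F k y * v x)"
      using S[OF k] by (simp add: mult.commute)
    also have "\<dots> = integral\<^sup>L lborel (\<lambda>y. F k y * (v y - v x))"
      using Fv_int[OF k] F_int[OF k] by (simp add: right_diff_distrib)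
    finally have "ennreal (cmod (smoothed k (\<lambda>_. 0) v x - v x * I k ^ ?d)) \<le> (\<integral>\<^sup>+ y. ennreal (norm (F k y * (v y - v x))) \<partial>lborel)"
      using integral_norm_bound_ennreal[of lborel "\<lambda>y. F k y * (v y - v x)"] Fv_int[OF k] F_int[OF k]
      by (simp add: right_diff_distrib)
    \<comment> \<open>In the i-th summand the factor \<open>|y $ i - x $ i|\<close> is attached to
      the i-th kernel, so that the integral again splits into one-dimensional ones.\<close>
    also have "\<dots> \<le> (\<integral>\<^sup>+ y. (\<Sum>i\<in>UNIV. ennreal M * (\<Prod>l\<in>UNIV. ennreal (cmod (f k l (y $ l)) * (if l = i then \<bar>y $ l - x $ l\<bar> else 1)))) \<partial>lborel)"
    proof (rule nn_integral_mono)
      fix y :: "real^'d"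
      have "norm (F k y * (v y - v x)) \<le> cmod (F k y) * (M * (\<Sum>i\<in>UNIV. \<bar>y $ i - x $ i\<bar>))"
        unfolding norm_mult by (intro mult_left_mono M(2)) simp
      also have "\<dots> = (\<Sum>i\<in>UNIV. M * (cmod (F k y) * \<bar>y $ i - x $ i\<bar>))" by (simp add: sum_distrib_left mult_ac)
      also have "\<dots> = (\<Sum>i\<in>UNIV. M * (\<Prod>l\<in>UNIV. cmod (f k l (y $ l)) * (if l = i then \<bar>y $ l - x $ l\<bar> else 1)))"
        unfolding prod.distrib F_def prod_norm by (simp add: prod.delta)
      finally have "ennreal (norm (F k y * (v y - v x))) \<le> ennreal (\<Sum>i\<in>UNIV. M * (\<Prod>l\<in>UNIV. cmod (f k l (y $ l)) * (if l = i then \<bar>y $ l - x $ l\<bar> else 1)))"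
        by (rule ennreal_leI)
      also have "\<dots> = (\<Sum>i\<in>UNIV. ennreal M * (\<Prod>l\<in>UNIV. ennreal (cmod (f k l (y $ l)) * (if l = i then \<bar>y $ l - x $ l\<bar> else 1))))"
      proof -
        have "ennreal (M * (\<Prod>l\<in>UNIV. cmod (f k l (y $ l)) * (if l = i then \<bar>y $ l - x $ l\<bar> else 1))) =
          ennreal M * (\<Prod>l\<in>UNIV. ennreal (cmod (f k l (y $ l)) * (if l = i then \<bar>y $ l - x $ l\<bar> else 1)))" for i
          using M(1) by (subst prod_ennreal) (auto intro!: ennreal_mult prod_nonneg)
        then show ?thesis using M(1) by (subst sum_ennreal[symmetric]) (auto intro!: mult_nonneg_nonneg prod_nonneg)
      qed
      finally show "ennreal (norm (F k y * (v y - v x))) \<le> (\<Sum>i\<in>UNIV. ennreal M * (\<Prod>l\<in>UNIV. ennreal (cmod (f k l (y $ l)) * (if l = i then \<bar>y $ l - x $ l\<bar> else 1))))" .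
    qed
    also have "\<dots> = (\<Sum>i\<in>UNIV. ennreal M * (\<Prod>l\<in>UNIV. \<integral>\<^sup>+ t. ennreal (cmod (f k l t) * (if l = i then \<bar>t - x $ l\<bar> else 1)) \<partial>lborel))"
    proof -
      have "(\<integral>\<^sup>+ y. (\<Prod>l\<in>UNIV. ennreal (cmod (f k l (y $ l)) * (if l = i then \<bar>y $ l - x $ l\<bar> else 1))) \<partial>lborel) =
         (\<Prod>l\<in>UNIV. \<integral>\<^sup>+ t. ennreal (cmod (f k l t) * (if l = i then \<bar>t - x $ l\<bar> else 1)) \<partial>lborel)" for i
        by (rule nn_integral_lborel_vec_prod[where f = "\<lambda>l t. ennreal (cmod (f k l t) * (if l = i then \<bar>t - x $ l\<bar> else 1))"]) simp
      then show ?thesis by (simp add: nn_integral_sum nn_integral_cmult)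
    qed
    also have "\<dots> \<le> (\<Sum>i\<in>(UNIV :: 'd set). ennreal (M * (2 / sqrt (real k) * ?L ^ (?d - 1))))"
    proof (rule sum_mono)
      fix i :: 'd
      have "(\<Prod>l\<in>UNIV. \<integral>\<^sup>+ t. ennreal (cmod (f k l t) * (if l = i then \<bar>t - x $ l\<bar> else 1)) \<partial>lborel)
         \<le> (\<Prod>l\<in>UNIV. ennreal (if l = i then 2 / sqrt (real k) else ?L))"
        by (rule prod_mono_ennreal) (use f_nn[OF k] f_mom[OF k] in auto)
      also have "\<dots> = ennreal (\<Prod>l\<in>UNIV. if l = i then 2 / sqrt (real k) else ?L)" using L by (subst prod_ennreal) auto
      also have "(\<Prod>l\<in>UNIV. if l = i then 2 / sqrt (real k) else ?L) = 2 / sqrt (real k) * ?L ^ (?d - 1)"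
        by (subst prod.remove[of UNIV i]) (auto simp: card_Diff_singleton)
      finally show "ennreal M * (\<Prod>l\<in>UNIV. \<integral>\<^sup>+ t. ennreal (cmod (f k l t) * (if l = i then \<bar>t - x $ l\<bar> else 1)) \<partial>lborel) \<le> ennreal (M * (2 / sqrt (real k) * ?L ^ (?d - 1)))"
        using M(1) L by (subst ennreal_mult) (auto intro: mult_left_mono)
    qed
    also have "\<dots> = ennreal ((M * real ?d) * (2 / sqrt (real k) * ?L ^ (?d - 1)))"
    proof -
      have "(\<Sum>i\<in>(UNIV :: 'd set). ennreal z) = ennreal (real ?d * z)" if "z \<ge> 0" for z
        using that by (simp add: ennreal_of_nat_eq_real_of_nat ennreal_mult)
      then show ?thesis using M(1) L by (simp only: mult.assoc mult.left_commute[of "real ?d"] mult_nonneg_nonneg divide_nonneg_nonneg real_sqrt_ge_zero of_nat_0_le_iff zero_le_power zero_le_numeral)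
    qed
    finally show ?thesis using M(1) L by (subst (asm) ennreal_le_iff) auto
  qed
  have "\<forall>\<^sub>F k in sequentially. cmod (smoothed k (\<lambda>_. 0) v x - v x * I k ^ ?d) \<le> (M * real ?d) * (2 / sqrt (real k) * (4 * ln (1 + real k) + 2) ^ (?d - 1))"
    by (rule eventually_mono[OF eventually_ge_at_top[of 1] diff])
  then have "(\<lambda>k. smoothed k (\<lambda>_. 0) v x - v x * I k ^ ?d) \<longlonglongrightarrow> 0"
    by (rule Lim_null_comparison) (rule kap_norm_moment_tendsto)
  moreover have "(\<lambda>k. v x * I k ^ ?d) \<longlonglongrightarrow> v x * 1 ^ ?d" unfolding I_def by (intro tendsto_intros kap_integral_tendsto)
  ultimately have "(\<lambda>k. (smoothed k (\<lambda>_. 0) v x - v x * I k ^ ?d) + v x * I k ^ ?d) \<longlonglongrightarrow> 0 + v x * 1 ^ ?d" by (rule tendsto_add)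
  then show ?thesis by simp
qed

text \<open>For analytic \<phi> both parts of an increment are estimated near K in the derivatives
  themselves, with weight \<open>omega1\<close>. Pointwise convergence identifies the sum,
  \<open>mderiv_limit_bound\<close> upgrades it to a rate \<open>1 / k\<close> in an analytic norm
  near K, and only then is g applied.\<close>

lemma approx_tendsto:
  fixes X :: "('d::finite) cutoff_family"
  assumes X: "cutoffs K D \<eta> C0 X" and g: "g \<in> E_dual_carried omega1 K" and \<phi>: "\<phi> \<in> E_open omega1 UNIV"
  shows "(\<lambda>k. g (approx X k \<phi>)) \<longlonglongrightarrow> g \<phi>"
proof -
  let ?d = "CARD('d)"
  note w = weight_function_omega1
  note C0 = cutoffs_pos(2)[OF X] and \<eta> = cutoffs_pos(1)[OF X] and cD = cutoffs_pos(3)[OF X]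
  obtain a b where D: "D \<subseteq> cbox a b" using compact_subset_cbox[OF cD] by blast
  obtain m B where m: "m \<ge> 1" and ad: "admissible omega1 m D UNIV B \<phi>" using E_open_admissible[OF open_UNIV \<phi> cD] by blast
  have B: "B \<ge> 0" and \<phi>s: "smooth_on UNIV \<phi>" using ad by (auto simp: admissible_def)
  obtain n1 C1 k0 where 1: "n1 \<ge> 1" "C1 \<ge> 0" "k0 \<ge> 1" "\<And>k. k\<ge>k0 \<Longrightarrow> \<exists>j\<le>k. osc_bounded omega1 m n1 D X C1 k j"
    using osc_increment_bound[OF w m X] by (elim exE conjE) blast
  obtain n2 C2 where 2: "n2 \<ge> 1" "C2 \<ge> 0" "\<And>k. k \<ge> 1 \<Longrightarrow> far_bounded a b K \<eta> n2 C2 k"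
    using smoothed_far_from_bound[OF \<eta>, of a b K] by (elim exE conjE) blast
  define U where "U = (\<Union>z\<in>K. ball z (\<eta> / 2))"
  have U: "open U" "K \<subseteq> U" using \<eta> by (auto simp: U_def)
  \<comment> \<open>The two parts come with different indices; the continuity of g is used at the
    larger one.\<close>
  define n where "n = max n1 n2"
  have n: "n \<ge> 1" "Mw omega1 n1 l \<le> Mw omega1 n l" "Mw omega1 n2 l \<le> Mw omega1 n l" for l
    using 1(1) 2(1) by (auto simp: n_def intro!: Mw_mono_n[OF w])
  obtain Cg where Cg: "Cg \<ge> 0" "\<forall>\<phi>\<in>E_open omega1 UNIV. \<forall>B\<ge>0. (deriv_bounded omega1 n U B \<phi>) \<longrightarrow> cmod (g \<phi>) \<le> Cg * B"
    using carried_bound[OF g U n(1)] by (elim exE conjE)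
  have gl: "g \<in> lc_dual (E_open omega1 UNIV) (E_open_seminorms omega1 UNIV)"
    using g unfolding E_dual_carried_def E_dual_def by blast
  have fs: "function_space (E_open omega1 (UNIV :: (real^'d) set))" by (rule function_space_E_open[OF w open_UNIV])
  define T where "T = (ternary - {\<lambda>_. 0} :: ('d \<Rightarrow> int) set)"
  have T: "finite T" using ternary(1) by (simp add: T_def)
  define V where "V = 2 * C0 * 2 ^ ?d * Mw omega1 m 0 * B"
  have V: "V \<ge> 0" using C0 B by (simp add: V_def)
  define P where "P = C1 * B + C2 * V"
  define c where "c \<alpha> = real (card T) * P * Mw omega1 n (mabs \<alpha>)" for \<alpha> :: "'d \<Rightarrow> nat"
  note p = cutoff_pieces[OF X D ad]
  have smooth: "smooth_on UNIV (smoothed k c v)" if "continuous_on UNIV v" "\<forall>y. y \<notin> cbox a b \<longrightarrow> v y = 0" for k c v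
    by (rule smooth_on_pconv[OF ker_holomorphic that(1)]) (use that(2) in blast)
  have smooth_approx: "smooth_on UNIV (approx X k \<phi>)" for k by (rule smooth[OF p(1,2)])
  have inc: "cmod (mderiv \<alpha> (approx X (Suc k) \<phi>) x - mderiv \<alpha> (approx X k \<phi>) x) \<le> c \<alpha> / (real k)\<^sup>2"
    if kk: "k \<ge> k0" and x: "x \<in> U" for \<alpha> k x
  proof -
    have k: "k \<ge> 1" using kk 1(3) by simp
    obtain j where j: "j \<le> k" "osc_bounded omega1 m n1 D X C1 k j"
      using 1(4)[OF kk] by (elim exE conjE)
    let ?v = "\<lambda>y. cut X j y * \<phi> y" and ?u = "\<lambda>y. (cut X 0 y - cut X j y) * \<phi> y"
    note sv = smooth[OF p(1)[of j] p(2)[of j]] and su = smooth[OF p(3)[of j] p(4)[of j]]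
    have bd: "cmod (mderiv \<alpha> (\<lambda>x. smoothed k c ?v x + smoothed k c ?u x) x) \<le> (P / (real k)\<^sup>2) * Mw omega1 n (mabs \<alpha>)" if c: "c \<in> T" for c
    proof -
      have c': "\<forall>i. c i \<in> {-1, 0, 1}" "c \<noteq> (\<lambda>_. 0)" using c by (auto simp: T_def ternary)
      have "cmod (mderiv \<alpha> (smoothed k c ?v) x) \<le> (C1 * B / (real k)\<^sup>2) * Mw omega1 n1 (mabs \<alpha>) * gauss_weight x"
        using j(2)[rule_format, of c UNIV \<phi> B] c' ad unfolding admissible_def by blast
      also have "\<dots> \<le> (C1 * B / (real k)\<^sup>2) * Mw omega1 n (mabs \<alpha>) * 1"
        using 1(2) B n(2) by (intro mult_mono mult_left_mono mult_nonneg_nonneg) (auto simp: gauss_weight_def)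
      finally have v: "cmod (mderiv \<alpha> (smoothed k c ?v) x) \<le> (C1 * B / (real k)\<^sup>2) * Mw omega1 n (mabs \<alpha>)" by simp
      have "\<forall>y. cmod (?u y) \<le> V * real k ^ ?d"
        using p(6)[OF k j(1)] by (simp add: V_def)
      then have "cmod (mderiv \<alpha> (smoothed k c ?u) x) \<le> (C2 * V / (real k)\<^sup>2) * Mw omega1 n2 (mabs \<alpha>)"
        using 2(3)[OF k] c'(1) p(3,4,8)[of j] x unfolding U_def by blast
      also have "\<dots> \<le> (C2 * V / (real k)\<^sup>2) * Mw omega1 n (mabs \<alpha>)"
        using 2(2) V n(3) by (intro mult_left_mono) auto
      finally have "cmod (mderiv \<alpha> (smoothed k c ?v) x + mderiv \<alpha> (smoothed k c ?u) x) \<le>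
          (C1 * B / (real k)\<^sup>2) * Mw omega1 n (mabs \<alpha>) + (C2 * V / (real k)\<^sup>2) * Mw omega1 n (mabs \<alpha>)"
        by (intro order_trans[OF norm_triangle_ineq] add_mono v)
      then show ?thesis using mderiv_add[OF open_UNIV sv su UNIV_I] by (simp add: P_def distrib_right add_divide_distrib)
    qed
    have sum: "smooth_on UNIV (\<lambda>x. \<Sum>c\<in>T. smoothed k c ?v x + smoothed k c ?u x) \<and>
        mderiv \<alpha> (\<lambda>x. \<Sum>c\<in>T. smoothed k c ?v x + smoothed k c ?u x) x = (\<Sum>c\<in>T. mderiv \<alpha> (\<lambda>x. smoothed k c ?v x + smoothed k c ?u x) x)"
      by (rule mderiv_sum[OF T]) (rule smooth_on_add[OF open_UNIV sv su])
    have "approx X (Suc k) \<phi> = (\<lambda>x. approx X k \<phi> x + (\<Sum>c\<in>T. smoothed k c ?v x + smoothed k c ?u x))"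
      using smoothed_Suc_split[OF p(1)[of j] p(2)[of j] p(3)[of j] p(4)[of j], of k] unfolding p(5) T_def .
    then have "mderiv \<alpha> (approx X (Suc k) \<phi>) x = mderiv \<alpha> (approx X k \<phi>) x + (\<Sum>c\<in>T. mderiv \<alpha> (\<lambda>x. smoothed k c ?v x + smoothed k c ?u x) x)"
      using mderiv_add[OF open_UNIV smooth_approx conjunct1[OF sum] UNIV_I] conjunct2[OF sum] by simp
    then have "cmod (mderiv \<alpha> (approx X (Suc k) \<phi>) x - mderiv \<alpha> (approx X k \<phi>) x) \<le> real (card T) * ((P / (real k)\<^sup>2) * Mw omega1 n (mabs \<alpha>))"
      using sum_norm_bound[of T "\<lambda>c. mderiv \<alpha> (\<lambda>x. smoothed k c ?v x + smoothed k c ?u x) x", OF bd] by simp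
    then show ?thesis by (simp add: c_def mult_ac)
  qed
  have lim: "(\<lambda>k. approx X k \<phi> x) \<longlonglongrightarrow> \<phi> x" if x: "x \<in> U" for x
  proof -
    obtain z where z: "z \<in> K" "dist z x < \<eta> / 2" using x by (auto simp: U_def)
    have eq: "cut X 0 y * \<phi> y = \<phi> y" if "dist x y < \<eta> / 2" for y
    proof -
      have "dist z y < \<eta>" using dist_triangle[of z y x] z(2) that by simp
      then show ?thesis using cutoffs_one[OF X z(1)] by simp
    qed
    have "smooth_on (ball x (\<eta> / 2)) \<phi>" by (rule smooth_on_subset[OF \<phi>s]) simp
    from bounded_lipschitz_at[OF this _ eq p(7)] obtain M where
      "M \<ge> 0" "\<And>y. cmod (cut X 0 y * \<phi> y - cut X 0 x * \<phi> x) \<le> M * (\<Sum>i\<in>UNIV. \<bar>y $ i - x $ i\<bar>)" using \<eta> by auto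
    from smoothed_pointwise_tendsto[OF p(1)[of 0] p(2)[of 0] p(7) this]
    show ?thesis using eq[of x] \<eta> by simp
  qed
  have bound: "cmod (g \<phi> - g (approx X k \<phi>)) \<le> (Cg * (2 * (real (card T) * P))) / real k" if kk: "k \<ge> k0" for k
  proof -
    have k: "k \<ge> 1" using kk 1(3) by simp
    note mem = approx_in_E_open[OF X ad k]
    have "cmod (mderiv \<alpha> (\<lambda>x. \<phi> x - approx X k \<phi> x) x) \<le> (2 * (real (card T) * P) / real k) * Mw omega1 n (mabs \<alpha>)" if x: "x \<in> U" for \<alpha> x
    proof -
      have "mderiv \<alpha> (\<lambda>x. \<phi> x + (-1) * approx X k \<phi> x) x = mderiv \<alpha> \<phi> x + (-1) * mderiv \<alpha> (approx X k \<phi>) x"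
        using mderiv_add[OF open_UNIV \<phi>s smooth_on_cmult[OF open_UNIV smooth_approx, of "-1"] UNIV_I]
          mderiv_cmult[OF open_UNIV smooth_approx UNIV_I, of \<alpha> "-1"] by simp
      moreover have "cmod (mderiv \<alpha> \<phi> x - mderiv \<alpha> (approx X k \<phi>) x) \<le> 2 * c \<alpha> / real k"
        by (rule mderiv_limit_bound[OF U(1) _ _ 1(3) inc lim kk x]) (auto intro: smooth_on_subset[OF smooth_approx] smooth_on_subset[OF \<phi>s])
      ultimately show ?thesis by (simp add: c_def mult_ac)
    qed
    moreover have "0 \<le> 2 * (real (card T) * P) / real k" using 1(2) B 2(2) V by (simp add: P_def)
    ultimately have "cmod (g (\<lambda>x. \<phi> x - approx X k \<phi> x)) \<le> Cg * (2 * (real (card T) * P) / real k)"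
      using Cg(2) function_space_diff[OF fs \<phi> mem] by blast
    then show ?thesis using lc_dual_diff[OF fs gl \<phi> mem] by simp
  qed
  have "eventually (\<lambda>k. cmod (g (approx X k \<phi>) - g \<phi>) \<le> (Cg * (2 * (real (card T) * P))) / real k) sequentially"
    by (rule eventually_mono[OF eventually_ge_at_top[of k0]]) (use bound in \<open>simp add: norm_minus_commute\<close>)
  moreover have "(\<lambda>k. (Cg * (2 * (real (card T) * P))) / real k) \<longlonglongrightarrow> 0" by (rule lim_const_over_n)
  ultimately have "(\<lambda>k. g (approx X k \<phi>) - g \<phi>) \<longlonglongrightarrow> 0" by (rule Lim_null_comparison)
  then show ?thesis by (simp add: LIM_zero_iff)
qed

theorem theorem5p1:
  fixes \<omega> :: "real \<Rightarrow> real" and K :: "(real^'d::finite) set"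
  assumes "weight_function \<omega>" and "compact K"
  shows "restrict0 (DL1 omega1) ` B_dual \<omega> \<inter> restrict0 (DL1 omega1) ` E_dual_carried omega1 K
       = restrict0 (DL1 omega1) ` E_dual_carried \<omega> K"
proof
  show "restrict0 (DL1 omega1) ` E_dual_carried \<omega> K
     \<subseteq> restrict0 (DL1 omega1) ` B_dual \<omega> \<inter> restrict0 (DL1 omega1) ` E_dual_carried omega1 K"
    by (rule E_dual_carried_subset[OF assms(1)])
  show "restrict0 (DL1 omega1) ` B_dual \<omega> \<inter> restrict0 (DL1 omega1) ` E_dual_carried omega1 K
     \<subseteq> restrict0 (DL1 omega1) ` E_dual_carried \<omega> K"
  proof
    fix F assume "F \<in> restrict0 (DL1 omega1) ` B_dual \<omega> \<inter> restrict0 (DL1 omega1) ` E_dual_carried omega1 K"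
    then obtain f g where f: "f \<in> B_dual \<omega>" "F = restrict0 (DL1 omega1) f"
      and g: "g \<in> E_dual_carried omega1 K" "F = restrict0 (DL1 omega1) g" by blast
    have fg: "\<forall>\<phi>\<in>DL1 omega1. f \<phi> = g \<phi>"
    proof
      fix \<phi> :: "real^'d \<Rightarrow> complex" assume "\<phi> \<in> DL1 omega1"
      then have "restrict0 (DL1 omega1) f \<phi> = f \<phi>" "restrict0 (DL1 omega1) g \<phi> = g \<phi>" by (auto simp: restrict0_def)
      then show "f \<phi> = g \<phi>" using f(2) g(2) by simp
    qed
    obtain \<eta> D C X where X: "cutoffs K D \<eta> C X" using cutoffs_exist[OF assms(2) open_UNIV subset_UNIV] by blast
    let ?h = "restrict0 (E_open \<omega> UNIV) (limit_functional X g)"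
    have h: "?h \<in> E_dual_carried \<omega> K" by (rule limit_functional_carried[OF assms X f(1) g(1) fg])
    \<comment> \<open>Equality inside the ambient space only concerns \<open>DL1 omega1\<close>,
      whose members are analytic, so that the approximations recover g there.\<close>
    have "?h \<phi> = g \<phi>" if \<phi>: "\<phi> \<in> DL1 omega1" for \<phi>
    proof -
      have \<phi>1: "\<phi> \<in> E_open omega1 UNIV" using DL1_subset_E_open[OF weight_function_omega1] \<phi> by blast
      then have "\<phi> \<in> E_open \<omega> UNIV" using E_open_omega1_subset[OF assms(1) open_UNIV] by blast
      moreover have "limit_functional X g \<phi> = g \<phi>"
        unfolding limit_functional_def by (rule limI[OF approx_tendsto[OF X g(1) \<phi>1]])
      ultimately show ?thesis by (simp add: restrict0_def)
    qed
    then have "F = restrict0 (DL1 omega1) ?h"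
      unfolding g(2) by (auto simp: restrict0_def[of "DL1 omega1"])
    then show "F \<in> restrict0 (DL1 omega1) ` E_dual_carried \<omega> K" using h by blast
  qed
qed

end
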